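(* Let $\Omega\subset\mathbb{R}^m$ be a bounded domain with infinitely smooth boundary and let $\widehat{L}$ be the maximal operator generated by the Laplace operator $-\Delta$ in $L_2(\Omega)$. Let $L$ be a well-defined restriction of $\widehat{L}$ such that $L^{-1}$ is a non-negative compact operator, let $K$ be a bounded linear operator in $L_2(\Omega)$ with $R(K)\subset\mathrm{Ker}\,\widehat{L}$, and let $L_K$ be the well-defined restriction of $\widehat{L}$ with inverse $L_K^{-1}=L^{-1}+K$. Suppose that one of the following two conditions holds: (i) $\lim_{n\to\infty}n^2s_n(L^{-1})=\infty$ and, for some $0<\alpha<2$ and $0<a<\infty$, $\lim_{n\to\infty}n^{\alpha}s_n(L^{-1})=a$, and $K\in\mathfrak{S}_q(L_2(\Omega))$ for all $q$ with $0<q\le\frac1\alpha$; (ii) for some slowly varying function $\ell$ and some $0<a<\infty$, $\lim_{n\to\infty}\frac{1}{\ell(n)}s_n(L^{-1})=a$, and $K\in\mathfrak{S}_q(L_2(\Omega))$ for some $q$ with $0<q<\infty$. Then $L_K^*$ is not Volterra, i.e. the operator $(L_K^* )^{-1}=(L_K^{-1})^*=L^{-1}+K^*$ is not a Volterra operator.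
   Context: $L_2(\Omega)$ is the complex Hilbert space of square-integrable functions. $R(\cdot)$ and $\mathrm{Ker}$ denote range and kernel, $D(\cdot)$ domain. The minimal operator $L_0$ is the closure in $L_2(\Omega)$ of $-\Delta$ with domain $C_0^\infty(\Omega)$; the maximal operator $\widehat{L}$ is the adjoint of $L_0$, i.e. $\widehat{L}u=-\Delta u$ with $D(\widehat{L})=\{u\in L_2(\Omega):\ \Delta u\in L_2(\Omega)\}$. A closed linear operator $L$ in a Hilbert space is called well defined if it has a bounded inverse $L^{-1}$ defined on the whole space; a well-defined restriction of $\widehat{L}$ is a well-defined operator $L$ with $L\subset\widehat{L}$ (i.e. $D(L)\subset D(\widehat{L})$ and $Lf=\widehat{L}f$ on $D(L)$). The domain of $L_K$ is $D(L_K)=\{u\in D(\widehat{L}):\ (I-K\widehat{L})u\in D(L)\}$. The symbol $(L_K^* )^{-1}$ is understood as the bounded operator $(L_K^{-1})^*=L^{-1}+K^*$ (which is the inverse of the adjoint $L_K^*$ when $D(L_K)$ is dense). For a compact operator $T$, the $s$-numbers $s_n(T)$, $n=1,2,\dots$, are the eigenvalues of $(T^*T)^{1/2}$, counted with multiplicity, in non-increasing order; for $0<p<\infty$, $\mathfrak{S}_p(H)$ is the set of compact operators $T$ in $H$ with $\sum_j s_j^p(T)<\infty$. A non-negative operator is a self-adjoint operator $C$ with $(Cf,f)\ge0$ for all $f$. A function $\ell(x)$, $b\le x<\infty$ (with some $b>0$), is called slowly varying if it is positive and continuously differentiable and $\lim_{x\to\infty}\frac{x\,\ell'(x)}{\ell(x)}=0$.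 A Volterra operator is a compact operator whose spectrum is $\{0\}$; a well-defined operator is called Volterra if its inverse is a Volterra operator. *)

theory Defs
  imports "HOL-Analysis.Analysis"
begin

section \<open>Complex inner product spaces\<close>

(* The inherited real inner product is the real part of cinner, so norm, topology and
   completeness are those of the complex inner product, linear in the first argument. *)

class complex_inner = real_inner +
  fixes scaleC :: "complex \<Rightarrow> 'a \<Rightarrow> 'a"
    and cinner :: "'a \<Rightarrow> 'a \<Rightarrow> complex"
  assumes scaleC_add_right: "scaleC c (x + y) = scaleC c x + scaleC c y"
    and scaleC_add_left: "scaleC (c + d) x = scaleC c x + scaleC d x"
    and scaleC_scaleC: "scaleC c (scaleC d x) = scaleC (c * d) x"
    and scaleC_of_real: "scaleC (complex_of_real r) x = scaleR r x"
    and cinner_add_left: "cinner (x + y) z = cinner x z + cinner y z"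
    and cinner_scaleC_left: "cinner (scaleC c x) y = c * cinner x y"
    and cinner_commute: "cinner x y = cnj (cinner y x)"
    and inner_eq_Re_cinner: "inner x y = Re (cinner x y)"

global_interpretation complex_space: vector_space "scaleC :: complex \<Rightarrow> 'a \<Rightarrow> 'a::complex_inner"
  defines cdim = complex_space.dim
proof (unfold_locales)
  fix x :: 'a
  show "scaleC 1 x = x"
    using scaleC_of_real[of 1 x] by simp
qed (simp_all add: scaleC_add_right scaleC_add_left scaleC_scaleC)


section \<open>Operators in a closed subspace\<close>

(* The Hilbert space is a closed complex subspace H of the ambient type.  Everywhere defined
   operators are functions of which only the values on H matter; operators with smaller
   domains are given by their graphs. *)

subsection \<open>Bounded operators\<close>

definition bounded_op :: "'a::complex_inner set \<Rightarrow> ('a \<Rightarrow> 'a) \<Rightarrow> bool" where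
  "bounded_op H T \<longleftrightarrow>
     T ` H \<subseteq> H \<and>
     (\<forall>f\<in>H. \<forall>g\<in>H. T (f + g) = T f + T g) \<and>
     (\<forall>c. \<forall>f\<in>H. T (scaleC c f) = scaleC c (T f)) \<and>
     (\<exists>M. \<forall>f\<in>H. norm (T f) \<le> M * norm f)"

definition compact_op :: "'a::complex_inner set \<Rightarrow> ('a \<Rightarrow> 'a) \<Rightarrow> bool" where
  "compact_op H T \<longleftrightarrow> bounded_op H T \<and> compact (closure (T ` {f \<in> H. norm f \<le> 1}))"

definition adjoint_op :: "'a::complex_inner set \<Rightarrow> ('a \<Rightarrow> 'a) \<Rightarrow> 'a \<Rightarrow> 'a" where
  "adjoint_op H T g =
     (if g \<in> H then (THE h. h \<in> H \<and> (\<forall>f\<in>H. cinner (T f) g = cinner f h)) else 0)"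

(* By symmetry of C the number cinner (C f) f is real. *)

definition nonneg_op :: "'a::complex_inner set \<Rightarrow> ('a \<Rightarrow> 'a) \<Rightarrow> bool" where
  "nonneg_op H C \<longleftrightarrow>
     bounded_op H C \<and>
     (\<forall>f\<in>H. \<forall>g\<in>H. cinner (C f) g = cinner f (C g)) \<and>
     (\<forall>f\<in>H. 0 \<le> Re (cinner (C f) f))"

definition nonneg_sqrt :: "'a::complex_inner set \<Rightarrow> ('a \<Rightarrow> 'a) \<Rightarrow> 'a \<Rightarrow> 'a" where
  "nonneg_sqrt H B =
     (THE A. nonneg_op H A \<and> (\<forall>f\<in>H. A (A f) = B f) \<and> (\<forall>f. f \<notin> H \<longrightarrow> A f = 0))"

definition abs_op :: "'a::complex_inner set \<Rightarrow> ('a \<Rightarrow> 'a) \<Rightarrow> 'a \<Rightarrow> 'a" where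
  "abs_op H T = nonneg_sqrt H (\<lambda>f. adjoint_op H T (T f))"

definition eigenspace :: "'a::complex_inner set \<Rightarrow> ('a \<Rightarrow> 'a) \<Rightarrow> complex \<Rightarrow> 'a set" where
  "eigenspace H A z = {f \<in> H. A f = scaleC z f}"

(* The 0-based non-increasing enumeration, with multiplicities, of the eigenvalues of a
   non-negative compact operator on an infinite-dimensional space.  The last clause counts only
   positive values: if there are finitely many of them the sequence continues with zeros. *)

definition eigenvalue_sequence :: "'a::complex_inner set \<Rightarrow> ('a \<Rightarrow> 'a) \<Rightarrow> nat \<Rightarrow> real" where
  "eigenvalue_sequence H A =
     (THE s. antimono s \<and> (\<forall>n. 0 \<le> s n) \<and>
        (\<forall>t>0. finite {n. s n = t} \<and>
               card {n. s n = t} = cdim (eigenspace H A (complex_of_real t))))"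

(* s_number H T n is s_n(T) for n = 1, 2, ...; the value at n = 0 is irrelevant. *)

definition s_number :: "'a::complex_inner set \<Rightarrow> ('a \<Rightarrow> 'a) \<Rightarrow> nat \<Rightarrow> real" where
  "s_number H T n = eigenvalue_sequence H (abs_op H T) (n - 1)"

definition schatten_class :: "real \<Rightarrow> 'a::complex_inner set \<Rightarrow> ('a \<Rightarrow> 'a) set" where
  "schatten_class p H = {T. compact_op H T \<and> summable (\<lambda>j. s_number H T (Suc j) powr p)}"

definition op_spectrum :: "'a::complex_inner set \<Rightarrow> ('a \<Rightarrow> 'a) \<Rightarrow> complex set" where
  "op_spectrum H T =
     {z. \<not> (\<exists>S. bounded_op H S \<and>
               (\<forall>f\<in>H. S (T f - scaleC z f) = f \<and> T (S f) - scaleC z (S f) = f))}"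

definition volterra_op :: "'a::complex_inner set \<Rightarrow> ('a \<Rightarrow> 'a) \<Rightarrow> bool" where
  "volterra_op H T \<longleftrightarrow> compact_op H T \<and> op_spectrum H T = {0}"

subsection \<open>Operators given by graphs\<close>

definition adjoint_graph :: "'a::complex_inner set \<Rightarrow> ('a \<times> 'a) set \<Rightarrow> ('a \<times> 'a) set" where
  "adjoint_graph H A =
     {(u, v). u \<in> H \<and> v \<in> H \<and> (\<forall>(f, g)\<in>A. cinner g u = cinner f v)}"

definition op_kernel :: "('a::complex_inner \<times> 'a) set \<Rightarrow> 'a set" where
  "op_kernel A = {u. (u, 0) \<in> A}"

definition closed_linear_op :: "'a::complex_inner set \<Rightarrow> ('a \<times> 'a) set \<Rightarrow> bool" where
  "closed_linear_op H L \<longleftrightarrow>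
     L \<subseteq> H \<times> H \<and> single_valued L \<and> closed L \<and> (0, 0) \<in> L \<and>
     (\<forall>(u, f)\<in>L. \<forall>(v, g)\<in>L. (u + v, f + g) \<in> L) \<and>
     (\<forall>c. \<forall>(u, f)\<in>L. (scaleC c u, scaleC c f) \<in> L)"

definition inverse_op :: "('a::complex_inner \<times> 'a) set \<Rightarrow> 'a \<Rightarrow> 'a" where
  "inverse_op L f = (THE u. (u, f) \<in> L)"

definition well_defined_op :: "'a::complex_inner set \<Rightarrow> ('a \<times> 'a) set \<Rightarrow> bool" where
  "well_defined_op H L \<longleftrightarrow>
     closed_linear_op H L \<and> (\<exists>B. bounded_op H B \<and> L\<inverse> = {(f, B f) | f. f \<in> H})"

definition well_defined_restriction ::
    "'a::complex_inner set \<Rightarrow> ('a \<times> 'a) set \<Rightarrow> ('a \<times> 'a) set \<Rightarrow> bool" where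
  "well_defined_restriction H A L \<longleftrightarrow> well_defined_op H L \<and> L \<subseteq> A"


section \<open>Square-integrable functions\<close>

definition square_integrable :: "('a::euclidean_space \<Rightarrow> complex) \<Rightarrow> bool" where
  "square_integrable f \<longleftrightarrow>
     f \<in> borel_measurable lebesgue \<and> integrable lebesgue (\<lambda>x. (norm (f x))\<^sup>2)"

lemma square_integrable_mult:
  fixes f g :: "'a::euclidean_space \<Rightarrow> complex"
  assumes "square_integrable f" "square_integrable g"
  shows "integrable lebesgue (\<lambda>x. f x * cnj (g x))"
proof (rule Bochner_Integration.integrable_bound)
  show "integrable lebesgue (\<lambda>x. (norm (f x))\<^sup>2 + (norm (g x))\<^sup>2)"
    using assms by (auto simp: square_integrable_def)
  have [measurable]: "f \<in> borel_measurable lebesgue" "g \<in> borel_measurable lebesgue"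
    using assms by (auto simp: square_integrable_def)
  have "cnj \<in> borel_measurable borel"
    by (intro borel_measurable_continuous_onI continuous_intros)
  then have [measurable]: "(\<lambda>x. cnj (g x)) \<in> borel_measurable lebesgue"
    by (rule measurable_compose[rotated]) measurable
  show "(\<lambda>x. f x * cnj (g x)) \<in> borel_measurable lebesgue"
    by measurable
  have "norm (f x * cnj (g x)) \<le> norm ((norm (f x))\<^sup>2 + (norm (g x))\<^sup>2)" for x
  proof -
    have "2 * (norm (f x) * norm (g x)) \<le> (norm (f x))\<^sup>2 + (norm (g x))\<^sup>2"
      using sum_squares_bound[of "norm (f x)" "norm (g x)"] by simp
    moreover have "0 \<le> norm (f x) * norm (g x)"
      by simp
    ultimately have "norm (f x) * norm (g x) \<le> (norm (f x))\<^sup>2 + (norm (g x))\<^sup>2"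
      by linarith
    then show ?thesis
      by (simp add: norm_mult)
  qed
  then show "AE x in lebesgue.
      norm (f x * cnj (g x)) \<le> norm ((norm (f x))\<^sup>2 + (norm (g x))\<^sup>2)"
    by simp
qed

lemma square_integrable_add:
  assumes "square_integrable f" "square_integrable g"
  shows "square_integrable (\<lambda>x. f x + g x)"
proof -
  have [measurable]: "f \<in> borel_measurable lebesgue" "g \<in> borel_measurable lebesgue"
    using assms by (auto simp: square_integrable_def)
  have "integrable lebesgue (\<lambda>x. (norm (f x + g x))\<^sup>2)"
  proof (rule Bochner_Integration.integrable_bound)
    show "integrable lebesgue (\<lambda>x. 2 * (norm (f x))\<^sup>2 + 2 * (norm (g x))\<^sup>2)"
      using assms by (auto simp: square_integrable_def)
    have "norm ((norm (f x + g x))\<^sup>2) \<le> norm (2 * (norm (f x))\<^sup>2 + 2 * (norm (g x))\<^sup>2)" for x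
    proof -
      have "(norm (f x + g x))\<^sup>2 \<le> (norm (f x) + norm (g x))\<^sup>2"
        by (intro power_mono norm_triangle_ineq) auto
      also have "\<dots> \<le> 2 * (norm (f x))\<^sup>2 + 2 * (norm (g x))\<^sup>2"
        using sum_squares_bound[of "norm (f x)" "norm (g x)"]
        by (simp add: power2_sum)
      finally show ?thesis
        by simp
    qed
    then show "AE x in lebesgue.
        norm ((norm (f x + g x))\<^sup>2) \<le> norm (2 * (norm (f x))\<^sup>2 + 2 * (norm (g x))\<^sup>2)"
      by simp
  qed measurable
  then show ?thesis
    by (simp add: square_integrable_def)
qed

lemma square_integrable_cmult:
  assumes "square_integrable f"
  shows "square_integrable (\<lambda>x. c * f x)"
  using assms by (auto simp: square_integrable_def norm_mult power_mult_distrib)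

lemma square_integrable_zero: "square_integrable (\<lambda>x. 0)"
  by (simp add: square_integrable_def)

definition l2_eq :: "('a::euclidean_space \<Rightarrow> complex) \<Rightarrow> ('a \<Rightarrow> complex) \<Rightarrow> bool" where
  "l2_eq f g \<longleftrightarrow>
     square_integrable f \<and> square_integrable g \<and> (AE x in lebesgue. f x = g x)"

quotient_type (overloaded) 'a l2 = "'a::euclidean_space \<Rightarrow> complex" / partial: l2_eq
  morphisms rep_l2 to_l2
proof (rule part_equivpI)
  show "\<exists>f :: 'a \<Rightarrow> complex. l2_eq f f"
    using square_integrable_zero by (auto simp: l2_eq_def)
  show "symp (l2_eq :: ('a \<Rightarrow> complex) \<Rightarrow> _)"
    by (rule sympI) (simp add: l2_eq_def eq_commute)
  show "transp (l2_eq :: ('a \<Rightarrow> complex) \<Rightarrow> _)"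
  proof (rule transpI)
    fix f g h :: "'a \<Rightarrow> complex"
    assume *: "l2_eq f g" "l2_eq g h"
    then have "AE x in lebesgue. f x = g x" "AE x in lebesgue. g x = h x"
      by (auto simp: l2_eq_def)
    then have "AE x in lebesgue. f x = h x"
      by eventually_elim simp
    with * show "l2_eq f h"
      by (simp add: l2_eq_def)
  qed
qed

instantiation l2 :: (euclidean_space) complex_inner
begin

lift_definition zero_l2 :: "'a l2" is "\<lambda>x. 0"
  by (simp add: l2_eq_def square_integrable_zero)

lift_definition plus_l2 :: "'a l2 \<Rightarrow> 'a l2 \<Rightarrow> 'a l2" is "\<lambda>f g x. f x + g x"
proof -
  fix f f' g g' :: "'a \<Rightarrow> complex"
  assume *: "l2_eq f f'" "l2_eq g g'"
  then have "AE x in lebesgue. f x = f' x" "AE x in lebesgue. g x = g' x"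
    by (simp_all add: l2_eq_def)
  then have "AE x in lebesgue. f x + g x = f' x + g' x"
    by eventually_elim simp
  with * show "l2_eq (\<lambda>x. f x + g x) (\<lambda>x. f' x + g' x)"
    by (simp add: l2_eq_def square_integrable_add)
qed

lift_definition scaleC_l2 :: "complex \<Rightarrow> 'a l2 \<Rightarrow> 'a l2" is "\<lambda>c f x. c * f x"
proof -
  fix c and f f' :: "'a \<Rightarrow> complex"
  assume *: "l2_eq f f'"
  then have "AE x in lebesgue. f x = f' x"
    by (simp add: l2_eq_def)
  then have "AE x in lebesgue. c * f x = c * f' x"
    by eventually_elim simp
  with * show "l2_eq (\<lambda>x. c * f x) (\<lambda>x. c * f' x)"
    by (simp add: l2_eq_def square_integrable_cmult)
qed

lift_definition cinner_l2 :: "'a l2 \<Rightarrow> 'a l2 \<Rightarrow> complex" is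
  "\<lambda>f g. LINT x|lebesgue. f x * cnj (g x)"
proof -
  fix f f' g g' :: "'a \<Rightarrow> complex"
  assume "l2_eq f f'" "l2_eq g g'"
  then have sq: "square_integrable f" "square_integrable f'"
      "square_integrable g" "square_integrable g'"
    and ae: "AE x in lebesgue. f x = f' x" "AE x in lebesgue. g x = g' x"
    by (auto simp: l2_eq_def)
  show "(LINT x|lebesgue. f x * cnj (g x)) = (LINT x|lebesgue. f' x * cnj (g' x))"
  proof (rule integral_cong_AE)
    show "AE x in lebesgue. f x * cnj (g x) = f' x * cnj (g' x)"
      using ae by eventually_elim simp
    show "(\<lambda>x. f x * cnj (g x)) \<in> borel_measurable lebesgue"
      using square_integrable_mult[OF sq(1) sq(3)] by simp
    show "(\<lambda>x. f' x * cnj (g' x)) \<in> borel_measurable lebesgue"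
      using square_integrable_mult[OF sq(2) sq(4)] by simp
  qed
qed

definition uminus_l2 :: "'a l2 \<Rightarrow> 'a l2" where
  "uminus_l2 u = scaleC (-1) u"

definition minus_l2 :: "'a l2 \<Rightarrow> 'a l2 \<Rightarrow> 'a l2" where
  "minus_l2 u v = u + scaleC (-1) v"

definition scaleR_l2 :: "real \<Rightarrow> 'a l2 \<Rightarrow> 'a l2" where
  "scaleR_l2 r u = scaleC (complex_of_real r) u"

definition inner_l2 :: "'a l2 \<Rightarrow> 'a l2 \<Rightarrow> real" where
  "inner_l2 u v = Re (cinner u v)"

definition norm_l2 :: "'a l2 \<Rightarrow> real" where
  "norm_l2 u = sqrt (inner u u)"

definition sgn_l2 :: "'a l2 \<Rightarrow> 'a l2" where
  "sgn_l2 u = scaleR (inverse (norm u)) u"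

definition dist_l2 :: "'a l2 \<Rightarrow> 'a l2 \<Rightarrow> real" where
  "dist_l2 u v = norm (u - v)"

definition uniformity_l2 :: "('a l2 \<times> 'a l2) filter" where
  [code del]: "uniformity_l2 = (INF e\<in>{0 <..}. principal {(u, v). dist u v < e})"

definition open_l2 :: "'a l2 set \<Rightarrow> bool" where
  [code del]: "open_l2 U \<longleftrightarrow> (\<forall>u\<in>U. eventually (\<lambda>(u', v). u' = u \<longrightarrow> v \<in> U) uniformity)"

instance
proof
  fix u v w :: "'a l2" and r s :: real and c d :: complex
  show "u + v + w = u + (v + w)"
    by transfer (simp add: l2_eq_def square_integrable_add add.assoc)
  show "u + v = v + u"
    by transfer (simp add: l2_eq_def square_integrable_add add.commute)
  show zero: "0 + u = u"
    by transfer (simp add: l2_eq_def)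
  have cancel: "scaleC (-1) u + u = 0" for u :: "'a l2"
    by transfer (simp add: l2_eq_def square_integrable_zero)
  show "- u + u = 0"
    by (simp add: uminus_l2_def cancel)
  show "u - v = u + - v"
    by (simp add: uminus_l2_def minus_l2_def)
  show cadd_right: "scaleC c (u + v) = scaleC c u + scaleC c v" for c and u v :: "'a l2"
    by transfer (simp add: l2_eq_def distrib_left square_integrable_add square_integrable_cmult)
  show cadd_left: "scaleC (c + d) u = scaleC c u + scaleC d u" for c d and u :: "'a l2"
    by transfer (simp add: l2_eq_def distrib_right square_integrable_add square_integrable_cmult)
  show cc: "scaleC c (scaleC d u) = scaleC (c * d) u" for c d and u :: "'a l2"
    by transfer (simp add: l2_eq_def mult.assoc square_integrable_cmult)
  have one: "scaleC 1 u = u" for u :: "'a l2"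
    by transfer (simp add: l2_eq_def)
  show "scaleC (complex_of_real r) u = scaleR r u"
    by (simp add: scaleR_l2_def)
  show "scaleR r (u + v) = scaleR r u + scaleR r v"
    by (simp add: scaleR_l2_def cadd_right)
  show "scaleR (r + s) u = scaleR r u + scaleR s u"
    by (simp add: scaleR_l2_def cadd_left)
  show "scaleR r (scaleR s u) = scaleR (r * s) u"
    by (simp add: scaleR_l2_def cc)
  show "scaleR 1 u = u"
    by (simp add: scaleR_l2_def one)
  show clin_add: "cinner (u + v) w = cinner u w + cinner v w" for u v w :: "'a l2"
    by transfer (simp add: l2_eq_def distrib_right square_integrable_mult)
  show clin_scale: "cinner (scaleC c u) v = c * cinner u v" for c and u v :: "'a l2"
    by transfer (simp add: mult.assoc)
  show ccomm: "cinner u v = cnj (cinner v u)" for u v :: "'a l2"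
  proof transfer
    fix f g :: "'a \<Rightarrow> complex"
    assume "l2_eq f f" "l2_eq g g"
    then have "integrable lebesgue (\<lambda>x. g x * cnj (f x))"
      by (auto simp: l2_eq_def intro: square_integrable_mult)
    note cnj = integral_bounded_linear[OF bounded_linear_cnj this]
    have "(LINT x|lebesgue. f x * cnj (g x)) = (LINT x|lebesgue. cnj (g x * cnj (f x)))"
      by (simp add: mult.commute)
    then show "(LINT x|lebesgue. f x * cnj (g x)) = cnj (LINT x|lebesgue. g x * cnj (f x))"
      by (simp only: cnj)
  qed
  show "inner u v = Re (cinner u v)"
    by (simp add: inner_l2_def)
  show "inner u v = inner v u"
    by (subst inner_l2_def, subst ccomm) (simp add: inner_l2_def)
  show "inner (u + v) w = inner u w + inner v w"
    by (simp add: inner_l2_def clin_add)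
  show "inner (scaleR r u) v = r * inner u v"
    by (simp add: inner_l2_def scaleR_l2_def clin_scale)
  have Re_self: "Re (LINT x|lebesgue. f x * cnj (f x)) = (LINT x|lebesgue. (norm (f x))\<^sup>2)"
    for f :: "'a \<Rightarrow> complex"
  proof -
    have "(\<lambda>x. f x * cnj (f x)) = (\<lambda>x. complex_of_real ((norm (f x))\<^sup>2))"
      by (simp only: complex_norm_square)
    then show ?thesis
      by (simp only: integral_complex_of_real Re_complex_of_real)
  qed
  show "0 \<le> inner u u"
    unfolding inner_l2_def by transfer (simp add: Re_self)
  show "inner u u = 0 \<longleftrightarrow> u = 0"
    unfolding inner_l2_def
  proof transfer
    fix f :: "'a \<Rightarrow> complex"
    assume "l2_eq f f"
    then have "square_integrable f"
      by (simp add: l2_eq_def)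
    then have "integrable lebesgue (\<lambda>x. (norm (f x))\<^sup>2)"
      by (simp add: square_integrable_def)
    then have "(LINT x|lebesgue. (norm (f x))\<^sup>2) = 0 \<longleftrightarrow> (AE x in lebesgue. (norm (f x))\<^sup>2 = 0)"
      by (rule integral_nonneg_eq_0_iff_AE) simp
    with \<open>square_integrable f\<close>
    show "Re (LINT x|lebesgue. f x * cnj (f x)) = 0 \<longleftrightarrow> l2_eq f (\<lambda>x. 0)"
      by (simp add: Re_self l2_eq_def square_integrable_zero)
  qed
  show "norm u = sqrt (inner u u)"
    by (simp add: norm_l2_def)
qed (simp_all add: sgn_l2_def dist_l2_def uniformity_l2_def open_l2_def)

end

(* Functions on W are identified with their extensions by zero. *)

definition L2_on :: "'a::euclidean_space set \<Rightarrow> 'a l2 set" where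
  "L2_on W = {to_l2 f | f. square_integrable f \<and> (\<forall>x. x \<notin> W \<longrightarrow> f x = 0)}"


section \<open>Smooth functions and domains\<close>

(* iterated_derivative [v1, ..., vk] f is the iterated directional derivative D_v1 ... D_vk f. *)

fun iterated_derivative ::
    "'a list \<Rightarrow> ('a::euclidean_space \<Rightarrow> 'b::real_normed_vector) \<Rightarrow> 'a \<Rightarrow> 'b" where
  "iterated_derivative [] f = f"
| "iterated_derivative (v # vs) f =
     (\<lambda>x. frechet_derivative (iterated_derivative vs f) (at x) v)"

(* Differentiability of all iterated partial derivatives also gives their continuity. *)

definition smooth :: "('a::euclidean_space \<Rightarrow> 'b::real_normed_vector) \<Rightarrow> bool" where
  "smooth f \<longleftrightarrow>
     (\<forall>vs. set vs \<subseteq> Basis \<longrightarrow> (\<forall>x. iterated_derivative vs f differentiable (at x)))"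

definition laplacian :: "('a::euclidean_space \<Rightarrow> complex) \<Rightarrow> 'a \<Rightarrow> complex" where
  "laplacian f x = (\<Sum>i\<in>Basis. iterated_derivative [i, i] f x)"

definition test_function :: "'a::euclidean_space set \<Rightarrow> ('a \<Rightarrow> complex) \<Rightarrow> bool" where
  "test_function W f \<longleftrightarrow>
     smooth f \<and> compact (closure {x. f x \<noteq> 0}) \<and> closure {x. f x \<noteq> 0} \<subseteq> W"

(* Near every boundary point, W is the part above the graph of a smooth function over the
   hyperplane orthogonal to some unit vector e. *)

definition smooth_boundary :: "'a::euclidean_space set \<Rightarrow> bool" where
  "smooth_boundary W \<longleftrightarrow>
     (\<forall>p\<in>frontier W. \<exists>r>0. \<exists>e. \<exists>\<gamma> :: 'a \<Rightarrow> real.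
        norm e = 1 \<and> smooth \<gamma> \<and>
        W \<inter> ball p r = {x \<in> ball p r. \<gamma> (x - (x \<bullet> e) *\<^sub>R e) < x \<bullet> e})"

definition bounded_smooth_domain :: "'a::euclidean_space set \<Rightarrow> bool" where
  "bounded_smooth_domain W \<longleftrightarrow>
     open W \<and> connected W \<and> W \<noteq> {} \<and> bounded W \<and> smooth_boundary W"

definition minimal_laplace :: "'a::euclidean_space set \<Rightarrow> ('a l2 \<times> 'a l2) set" where
  "minimal_laplace W =
     closure {(to_l2 f, to_l2 (\<lambda>x. - laplacian f x)) | f. test_function W f}"

definition maximal_laplace :: "'a::euclidean_space set \<Rightarrow> ('a l2 \<times> 'a l2) set" where
  "maximal_laplace W = adjoint_graph (L2_on W) (minimal_laplace W)"


section \<open>Slowly varying functions\<close>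

definition slowly_varying :: "(real \<Rightarrow> real) \<Rightarrow> bool" where
  "slowly_varying l \<longleftrightarrow>
     (\<exists>b>0. \<exists>l'.
        (\<forall>x\<ge>b. 0 < l x) \<and>
        (\<forall>x\<ge>b. (l has_real_derivative l' x) (at x within {b..})) \<and>
        continuous_on {b..} l' \<and>
        ((\<lambda>x. x * l' x / l x) \<longlongrightarrow> 0) at_top)"

end

theory Submission
  imports Defs "Jordan_Normal_Form.Spectral_Radius" "HOL-Real_Asymp.Real_Asymp"
begin

text \<open>Let \<open>H\<close> be the inverse of \<open>L\<close> and \<open>A = H + K\<close>. If the adjoint of \<open>A\<close> is Volterra, then \<open>A\<close> is compact
  without nonzero eigenvalues, so its compressions to the spans of the leading eigenvectors of \<open>H\<close> and
  right singular vectors of \<open>K\<close> have arbitrarily small spectrum. In finite dimension a small spectrum of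
  \<open>H + K\<close> with \<open>H \<ge> 0\<close> forces \<open>H\<close> to be dominated by \<open>K\<close>, in two ways.

  If \<open>p\<close> is a power of two, the \<open>p\<close>-th Schatten sum of \<open>H\<close> is at most a constant times that of \<open>K\<close>,
  because a nilpotent matrix has its real part controlled by its imaginary part.

  If \<open>1/2 < q < 1\<close>, the number of eigenvalues of \<open>H\<close> above \<open>t\<close> is at most a constant times \<open>t powr (-q)\<close>
  times the \<open>q\<close>-th Schatten sum of \<open>K\<close>. Here \<open>ln \<bar>det (1 - z A)\<bar>\<close>, which exceeds \<open>ln \<bar>det (1 - z H)\<bar>\<close> by an
  amount controlled by \<open>K\<close> off the positive axis, is integrated against a positive measure whose moments
  of positive order vanish: the zeros of \<open>det (1 - z A)\<close> are outside the disc and contribute nothing, while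
  each positive zero of \<open>det (1 - z H)\<close> inside it contributes a negative amount.

  Hence \<open>s_n(H)\<close> is at most a negative power of \<open>n\<close>, with exponent \<open>1/p\<close> for large \<open>p\<close> or \<open>1/q\<close>. The former
  contradicts slow variation; the latter contradicts the power law with exponent \<open>\<alpha>\<close> if \<open>\<alpha> q < 1\<close>, and
  \<open>\<alpha> < 2\<close> leaves room for such a \<open>q > 1/2\<close>.\<close>

section \<open>Complex inner products and finite orthonormal families\<close>

text \<open>Only one direction of comparison is available: the resolvent of the Hermitian
  \<open>H\<close> is bounded off the positive axis, that of \<open>A\<close> is not controlled.
  With an upper bound for ln |det (1 - z A)| the uniform measure on the circle is useless, because
  by Jensen's formula zeros in the disc contribute with a positive sign. The measure has to give
  points of the positive axis a negative potential; mass near the origin on a ray in the right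
  half-plane, where |1 - z h| < 1, does this. Two integrability demands then meet. At modulus x and
  argument s the comparison loses a quantity of order (x / sin (s / 2)) powr q. The singularity at s
  = 0 is absorbed by a density on the circle that vanishes there to second order, and the ray
  density, of order x powr (-\<kappa> - 1) at the origin, integrates x powr q only for q > \<kappa>.
  Traces of even powers reach only Schatten orders p \<ge> 2. This suffices for slow variation,
  where any power bound gives a contradiction, and it needs no complex analysis.\<close>

lemma scaleC_simps [simp]:
  fixes x :: "'a::complex_inner"
  shows "scaleC 0 x = 0" "scaleC c (0::'a) = 0" "scaleC 1 x = x" "scaleC (-c) x = - scaleC c x"
    "scaleC c (- x) = - scaleC c x"
  by (rule complex_space.scale_zero_left complex_space.scale_zero_right complex_space.scale_one
      complex_space.scale_minus_left complex_space.scale_minus_right)+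

lemma scaleC_diff_right: "scaleC c (x - y) = scaleC c x - scaleC c (y::'a::complex_inner)"
  by (rule complex_space.scale_right_diff_distrib)

lemma scaleC_diff_left: "scaleC (c - d) x = scaleC c x - scaleC d (x::'a::complex_inner)"
  by (rule complex_space.scale_left_diff_distrib)

lemma scaleC_sum_right: "scaleC c (sum f A) = (\<Sum>x\<in>A. scaleC c (f x :: 'a::complex_inner))"
  by (rule complex_space.scale_sum_right)

lemma cinner_add_right: "cinner x (y + z) = cinner x y + cinner x (z::'a::complex_inner)"
  by (metis cinner_add_left cinner_commute complex_cnj_add)

lemma cinner_scaleC_right: "cinner x (scaleC c y) = cnj c * cinner x (y::'a::complex_inner)"
  by (metis cinner_scaleC_left cinner_commute complex_cnj_mult)

lemma cinner_zero_left [simp]: "cinner 0 (x::'a::complex_inner) = 0"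
  using cinner_scaleC_left[of 0 0 x] by simp

lemma cinner_zero_right [simp]: "cinner (x::'a::complex_inner) 0 = 0"
  by (metis cinner_zero_left cinner_commute complex_cnj_zero)

lemma cinner_minus_left [simp]: "cinner (- x) y = - cinner x (y::'a::complex_inner)"
  using cinner_scaleC_left[of "-1" x y] by simp

lemma cinner_minus_right [simp]: "cinner x (- y) = - cinner x (y::'a::complex_inner)"
  using cinner_scaleC_right[of x "-1" y] by simp

lemma cinner_diff_left: "cinner (x - y) z = cinner x z - cinner y (z::'a::complex_inner)"
  using cinner_add_left[of x "- y" z] by simp

lemma cinner_diff_right: "cinner x (y - z) = cinner x y - cinner x (z::'a::complex_inner)"
  using cinner_add_right[of x y "- z"] by simp

lemma cinner_sum_left: "cinner (sum f A) y = (\<Sum>x\<in>A. cinner (f x) (y::'a::complex_inner))"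
  by (induction A rule: infinite_finite_induct) (auto simp: cinner_add_left)

lemma cinner_sum_right: "cinner y (sum f A) = (\<Sum>x\<in>A. cinner (y::'a::complex_inner) (f x))"
  by (induction A rule: infinite_finite_induct) (auto simp: cinner_add_right)

lemma cinner_self: "cinner x x = of_real ((norm (x::'a::complex_inner))\<^sup>2)"
proof (rule complex_eqI)
  show "Re (cinner x x) = Re (of_real ((norm x)\<^sup>2))"
    by (simp add: inner_eq_Re_cinner[symmetric] power2_norm_eq_inner)
  have "Im (cinner x x) = - Im (cinner x x)" by (subst cinner_commute) simp
  then show "Im (cinner x x) = Im (of_real ((norm x)\<^sup>2))" by simp
qed

lemma Re_cinner_self: "Re (cinner x x) = (norm (x::'a::complex_inner))\<^sup>2"
  by (simp add: cinner_self del: of_real_power)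

lemma norm_sq_add:
  "(norm (x + y :: 'a::complex_inner))\<^sup>2 = (norm x)\<^sup>2 + 2 * Re (cinner x y) + (norm y)\<^sup>2"
proof -
  have "Re (cinner y x) = Re (cinner x y)" by (subst cinner_commute) simp
  then show ?thesis
    by (simp add: Re_cinner_self[symmetric] cinner_add_left cinner_add_right)
qed

lemma norm_sq_diff:
  "(norm (x - y :: 'a::complex_inner))\<^sup>2 = (norm x)\<^sup>2 - 2 * Re (cinner x y) + (norm y)\<^sup>2"
  using norm_sq_add[of x "- y"] by simp

lemma norm_scaleC: "norm (scaleC c x) = cmod c * norm (x::'a::complex_inner)"
proof -
  have "cinner (scaleC c x) (scaleC c x) = (c * cnj c) * cinner x x"
    by (simp only: cinner_scaleC_left cinner_scaleC_right mult.assoc mult.left_commute)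
  also have "\<dots> = of_real ((cmod c * norm x)\<^sup>2)"
    by (simp add: cinner_self power_mult_distrib flip: complex_norm_square)
  finally have "cinner (scaleC c x) (scaleC c x) = of_real ((cmod c * norm x)\<^sup>2)" .
  then have "(norm (scaleC c x))\<^sup>2 = (cmod c * norm x)\<^sup>2"
    using cinner_self of_real_eq_iff by metis
  then show ?thesis by (simp add: power2_eq_iff_nonneg)
qed

lemma cauchy_schwarz: "cmod (cinner x y) \<le> norm x * norm (y::'a::complex_inner)"
proof (cases "cinner x y = 0")
  case False
  define c where "c = cnj (cinner x y) / of_real (cmod (cinner x y))"
  have c: "cmod c = 1" using False by (simp add: c_def norm_divide)
  have "c * cinner x y = of_real (cmod (cinner x y))"
    using False complex_norm_square[of "cinner x y"]
    by (simp add: c_def divide_simps mult.commute power2_eq_square)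
  then have "Re (cinner (scaleC c x) y) = cmod (cinner x y)"
    by (simp add: cinner_scaleC_left)
  then have "cmod (cinner x y) = inner (scaleC c x) y" by (simp add: inner_eq_Re_cinner)
  also have "\<dots> \<le> norm (scaleC c x) * norm y" by (rule norm_cauchy_schwarz)
  finally show ?thesis by (simp add: norm_scaleC c)
qed auto

lemma bounded_bilinear_cinner: "bounded_bilinear (cinner :: 'a::complex_inner \<Rightarrow> 'a \<Rightarrow> complex)"
proof
  fix r :: real and x y :: 'a
  show "cinner (r *\<^sub>R x) y = r *\<^sub>R cinner x y"
    by (simp flip: scaleC_of_real add: cinner_scaleC_left scaleR_conv_of_real)
  show "cinner x (r *\<^sub>R y) = r *\<^sub>R cinner x y"
    by (simp flip: scaleC_of_real add: cinner_scaleC_right scaleR_conv_of_real)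
  show "\<exists>K. \<forall>x y::'a. cmod (cinner x y) \<le> norm x * norm y * K"
    using cauchy_schwarz by (intro exI[of _ 1]) auto
qed (auto simp: cinner_add_left cinner_add_right)

lemmas tendsto_cinner = bounded_bilinear.tendsto[OF bounded_bilinear_cinner]

lemma bounded_bilinear_scaleC: "bounded_bilinear (scaleC :: complex \<Rightarrow> 'a \<Rightarrow> 'a::complex_inner)"
proof
  fix r :: real and c :: complex and x :: 'a
  show "scaleC (r *\<^sub>R c) x = r *\<^sub>R scaleC c x"
    by (simp flip: scaleC_of_real add: scaleC_scaleC scaleR_conv_of_real)
  show "scaleC c (r *\<^sub>R x) = r *\<^sub>R scaleC c x"
    by (simp flip: scaleC_of_real add: scaleC_scaleC mult.commute)
  show "\<exists>K. \<forall>c (x::'a). norm (scaleC c x) \<le> norm c * norm x * K"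
    by (intro exI[of _ 1]) (auto simp: norm_scaleC)
qed (auto simp: scaleC_add_left scaleC_add_right)

lemmas tendsto_scaleC = bounded_bilinear.tendsto[OF bounded_bilinear_scaleC]

abbreviation csubspace :: "'a::complex_inner set \<Rightarrow> bool" where
  "csubspace \<equiv> complex_space.subspace"

lemmas csubspace_def = complex_space.subspace_def

lemma csubspace_simps:
  assumes "csubspace (S :: 'a::complex_inner set)"
  shows "0 \<in> S" "x \<in> S \<Longrightarrow> y \<in> S \<Longrightarrow> x + y \<in> S" "x \<in> S \<Longrightarrow> scaleC c x \<in> S"
    "x \<in> S \<Longrightarrow> y \<in> S \<Longrightarrow> x - y \<in> S" "(\<And>i. i \<in> A \<Longrightarrow> f i \<in> S) \<Longrightarrow> sum f A \<in> S"
  using assms complex_space.subspace_diff[OF assms] complex_space.subspace_sum[OF assms]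
  unfolding csubspace_def by blast+

definition clin_on :: "'a::complex_inner set \<Rightarrow> ('a \<Rightarrow> 'a) \<Rightarrow> bool" where
  "clin_on S T \<longleftrightarrow> (\<forall>x\<in>S. \<forall>y\<in>S. T (x + y) = T x + T y) \<and> (\<forall>c. \<forall>x\<in>S. T (scaleC c x) = scaleC c (T x))"

lemma clin_onD:
  assumes "clin_on S T"
  shows "x \<in> S \<Longrightarrow> y \<in> S \<Longrightarrow> T (x + y) = T x + T y" "x \<in> S \<Longrightarrow> T (scaleC c x) = scaleC c (T x)"
  using assms by (auto simp: clin_on_def)

lemma clin_on_simps:
  assumes "csubspace S" "clin_on S T"
  shows "T 0 = 0" "x \<in> S \<Longrightarrow> y \<in> S \<Longrightarrow> T (x - y) = T x - T y"
    "finite A \<Longrightarrow> (\<And>i. i \<in> A \<Longrightarrow> f i \<in> S) \<Longrightarrow> T (sum f A) = (\<Sum>i\<in>A. T (f i))"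
proof -
  show 0: "T 0 = 0"
    using clin_onD(2)[OF assms(2), of 0 0] csubspace_simps(1)[OF assms(1)] by simp
  show "T (x - y) = T x - T y" if "x \<in> S" "y \<in> S"
  proof -
    have "T (x + scaleC (-1) y) = T x + scaleC (-1) (T y)"
      using clin_onD[OF assms(2)] csubspace_simps(3)[OF assms(1)] that by metis
    then show ?thesis by simp
  qed
  show "T (sum f A) = (\<Sum>i\<in>A. T (f i))" if "finite A" "\<And>i. i \<in> A \<Longrightarrow> f i \<in> S"
    using that
  proof (induction A rule: finite_induct)
    case (insert a A)
    then have "sum f A \<in> S" by (intro csubspace_simps(5)[OF assms(1)]) auto
    then show ?case using insert clin_onD(1)[OF assms(2)] by simp
  qed (use 0 in simp)
qed

text \<open>The finite-dimensional estimates are stated for maps linear on the whole type, which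
  removes membership conditions. An operator on a subspace enters them after composition with a
  projection.\<close>

abbreviation "clin \<equiv> clin_on UNIV"

lemma csubspace_UNIV [simp]: "csubspace UNIV" by (simp add: csubspace_def)

lemma clinI:
  "(\<And>x y. T (x + y) = T x + T y) \<Longrightarrow> (\<And>c x. T (scaleC c x) = scaleC c (T x)) \<Longrightarrow> clin T"
  by (auto simp: clin_on_def)

lemma clin_simps:
  assumes "clin T"
  shows "T (x + y) = T x + T y" "T (scaleC c x) = scaleC c (T x)" "T 0 = 0" "T (x - y) = T x - T y"
    "T (sum f A) = (\<Sum>i\<in>A. T (f i))"
proof -
  show "T (sum f A) = (\<Sum>i\<in>A. T (f i))"
    using clin_on_simps(1,3)[OF csubspace_UNIV assms]
    by (cases "finite A") auto
qed (use clin_onD[OF assms] clin_on_simps(1,2)[OF csubspace_UNIV assms] in auto)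

section \<open>Finite orthonormal families, their projections and Gram-Schmidt\<close>

definition orthonormal :: "nat \<Rightarrow> (nat \<Rightarrow> 'a::complex_inner) \<Rightarrow> bool" where
  "orthonormal d b \<longleftrightarrow> (\<forall>i<d. \<forall>j<d. cinner (b i) (b j) = (if i = j then 1 else 0))"

text \<open>A finite-dimensional subspace is represented by an orthonormal family and its
  projection: \<open>proj d b x = x\<close> says that \<open>x\<close> lies in the span, and
  \<open>proj d f = proj d b\<close> that two families of length \<open>d\<close> span the same
  space.\<close>

definition proj :: "nat \<Rightarrow> (nat \<Rightarrow> 'a::complex_inner) \<Rightarrow> 'a \<Rightarrow> 'a" where
  "proj d b x = (\<Sum>i<d. scaleC (cinner x (b i)) (b i))"

lemma clin_proj: "clin (proj d b)"
  by (rule clinI) (simp_all add: proj_def cinner_add_left cinner_scaleC_left scaleC_add_left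
      sum.distrib scaleC_sum_right scaleC_scaleC)

lemmas proj_simps = clin_simps[OF clin_proj]

lemma orthonormalD:
  "orthonormal d b \<Longrightarrow> i < d \<Longrightarrow> j < d \<Longrightarrow> cinner (b i) (b j) = (if i = j then 1 else 0)"
  by (auto simp: orthonormal_def)

lemma orthonormal_norm: "orthonormal d b \<Longrightarrow> i < d \<Longrightarrow> norm (b i) = 1"
  using orthonormalD[of d b i i] Re_cinner_self[of "b i"] norm_ge_zero[of "b i"]
  by (auto simp: power2_eq_1_iff simp del: norm_ge_zero)

lemma orthonormal_mono: "orthonormal d b \<Longrightarrow> m \<le> d \<Longrightarrow> orthonormal m b"
  by (auto simp: orthonormal_def)

lemma cinner_comb_basis:
  assumes "orthonormal d b" "i < d"
  shows "cinner (\<Sum>j<d. scaleC (c j) (b j)) (b i) = c i"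
proof -
  have "cinner (\<Sum>j<d. scaleC (c j) (b j)) (b i) = (\<Sum>j<d. if j = i then c j else 0)"
    unfolding cinner_sum_left
    by (rule sum.cong) (auto simp: cinner_scaleC_left orthonormalD[OF assms(1) _ assms(2)])
  then show ?thesis using assms by simp
qed

lemma cinner_proj_basis:
  "orthonormal d b \<Longrightarrow> i < d \<Longrightarrow> cinner (proj d b x) (b i) = cinner x (b i)"
  unfolding proj_def by (rule cinner_comb_basis)

lemma proj_comb:
  "orthonormal d b \<Longrightarrow> proj d b (\<Sum>j<d. scaleC (c j) (b j)) = (\<Sum>j<d. scaleC (c j) (b j))"
  unfolding proj_def by (rule sum.cong) (auto simp: cinner_comb_basis)

lemma proj_idem: "orthonormal d b \<Longrightarrow> proj d b (proj d b x) = proj d b x"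
  using proj_comb[of d b] by (simp add: proj_def)

lemma proj_basis: "orthonormal d b \<Longrightarrow> i < d \<Longrightarrow> proj d b (b i) = b i"
proof -
  assume *: "orthonormal d b" "i < d"
  have "b i = (\<Sum>j<d. scaleC (if j = i then 1 else 0) (b j))"
    using * by (simp add: if_distrib[of "\<lambda>c. scaleC c _"] cong: if_cong)
  then show ?thesis using proj_comb[OF *(1)] by metis
qed

lemma cinner_proj_left: "cinner (proj d b x) y = (\<Sum>i<d. cinner x (b i) * cinner (b i) y)"
  by (simp add: proj_def cinner_sum_left cinner_scaleC_left)

lemma cinner_proj_right: "cinner x (proj d b y) = (\<Sum>i<d. cinner x (b i) * cinner (b i) y)"
proof -
  have "cnj (cinner y z) = cinner z y" for y z :: 'a by (metis cinner_commute)
  then show ?thesis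
    by (simp add: proj_def cinner_sum_right cinner_scaleC_right mult.commute)
qed

lemma proj_selfadjoint: "cinner (proj d b x) y = cinner x (proj d b y)"
  by (simp add: cinner_proj_left cinner_proj_right)

lemma cinner_swap_mult: "cinner x y * cinner y x = of_real ((cmod (cinner x (y::'a::complex_inner)))\<^sup>2)"
  by (metis cinner_commute complex_norm_square)

lemma parseval_proj: "(\<Sum>i<d. (cmod (cinner x (b i)))\<^sup>2) = Re (cinner (proj d b x) x)"
  by (simp add: cinner_proj_left cinner_swap_mult)

lemma norm_proj_sq:
  assumes "orthonormal d b"
  shows "(norm (proj d b x))\<^sup>2 = (\<Sum>i<d. (cmod (cinner x (b i)))\<^sup>2)"
proof -
  have "cinner (proj d b x) x = cinner (proj d b (proj d b x)) x"
    using assms by (simp add: proj_idem)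
  also have "\<dots> = cinner (proj d b x) (proj d b x)" by (rule proj_selfadjoint)
  finally show ?thesis by (simp add: parseval_proj cinner_self del: of_real_power)
qed

lemma proj_residual_orth:
  "orthonormal d b \<Longrightarrow> i < d \<Longrightarrow> cinner (x - proj d b x) (b i) = 0"
  by (simp add: cinner_diff_left cinner_proj_basis)

lemma proj_pythagoras:
  assumes "orthonormal d b"
  shows "(norm x)\<^sup>2 = (norm (proj d b x))\<^sup>2 + (norm (x - proj d b x))\<^sup>2"
proof -
  have "cinner (proj d b x) x = cinner (proj d b x) (proj d b x)"
    using assms by (metis proj_idem proj_selfadjoint)
  then have "Re (cinner x (proj d b x)) = (norm (proj d b x))\<^sup>2"
    by (subst cinner_commute) (simp add: Re_cinner_self)
  then show ?thesis by (simp add: norm_sq_diff)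
qed

lemma norm_proj_le: "orthonormal d b \<Longrightarrow> norm (proj d b x) \<le> norm x"
  using proj_pythagoras[of d b x] by (simp add: power2_le_imp_le)

lemma bessel: "orthonormal d b \<Longrightarrow> (\<Sum>i<d. (cmod (cinner x (b i)))\<^sup>2) \<le> (norm x)\<^sup>2"
  using norm_proj_le[of d b x] by (simp flip: norm_proj_sq add: power_mono)

lemma proj_fix_iff: "orthonormal d b \<Longrightarrow> proj d b x = x \<longleftrightarrow> norm (proj d b x) = norm x"
  using proj_pythagoras[of d b x] by auto

lemma proj_in_csubspace:
  "csubspace S \<Longrightarrow> (\<And>i. i < d \<Longrightarrow> b i \<in> S) \<Longrightarrow> proj d b x \<in> S"
  unfolding proj_def by (intro csubspace_simps(5) csubspace_simps(3)) auto

text \<open>Dimensions are compared through the trace of a product of two projections.\<close>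

lemma trace_proj_swap:
  assumes "orthonormal n b" "orthonormal m c"
  shows "(\<Sum>i<n. (norm (proj m c (b i)))\<^sup>2) = (\<Sum>j<m. (norm (proj n b (c j)))\<^sup>2)"
proof -
  have "cmod (cinner x y) = cmod (cinner y x)" for x y :: 'a
    by (metis cinner_commute complex_mod_cnj)
  then show ?thesis
    using assms by (simp add: norm_proj_sq) (subst sum.swap, simp)
qed

text \<open>Since every \<open>c j\<close> lies in the span of \<open>b\<close>, the common trace
  equals \<open>m\<close>, while each of the \<open>n\<close> summands for \<open>b\<close> is at
  most 1. If \<open>m = n\<close>, each summand is 1, so each \<open>b i\<close> is fixed by the
  projection onto \<open>c\<close>, and the two projections agree.\<close>

lemma orthonormal_count_le:
  assumes "orthonormal n b" "orthonormal m c" "\<And>j. j < m \<Longrightarrow> proj n b (c j) = c j"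
  shows "m \<le> n" "m = n \<Longrightarrow> proj m c = proj n b"
proof -
  have "(\<Sum>j<m. (norm (proj n b (c j)))\<^sup>2) = real m"
    using assms by (simp add: orthonormal_norm)
  then have *: "(\<Sum>i<n. (norm (proj m c (b i)))\<^sup>2) = real m"
    using trace_proj_swap[OF assms(1,2)] by simp
  have le: "(norm (proj m c (b i)))\<^sup>2 \<le> 1" if "i < n" for i
    using norm_proj_le[OF assms(2), of "b i"] orthonormal_norm[OF assms(1) that]
    by (simp add: power_le_one)
  have "(\<Sum>i<n. (norm (proj m c (b i)))\<^sup>2) \<le> (\<Sum>i<n. 1)"
    using le by (intro sum_mono) auto
  then show "m \<le> n" using * by simp
  show "proj m c = proj n b" if "m = n"
  proof
    fix x
    have "(\<Sum>i<n. 1 - (norm (proj m c (b i)))\<^sup>2) = 0" using * that by (simp add: sum_subtractf)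
    then have "(norm (proj m c (b i)))\<^sup>2 = 1" if "i < n" for i
      using le that by (subst (asm) sum_nonneg_eq_0_iff) auto
    then have "norm (proj m c (b i)) = 1" if "i < n" for i
      using that by (metis norm_ge_zero one_power2 power2_eq_iff_nonneg zero_le_one)
    then have fx: "proj m c (b i) = b i" if "i < n" for i
      using that by (simp add: proj_fix_iff[OF assms(2)] orthonormal_norm[OF assms(1)])
    have 1: "proj m c (proj n b x) = proj n b x"
      unfolding proj_def[of n b] by (simp add: proj_simps fx)
    have 2: "proj n b (proj m c x) = proj m c x"
      unfolding proj_def[of m c] by (simp add: proj_simps assms(3))
    have "cinner (proj m c x) y = cinner (proj n b x) y" for y
    proof -
      have "cinner (proj m c x) y = cinner (proj n b (proj m c x)) y" by (simp add: 2)
      also have "\<dots> = cinner x (proj m c (proj n b y))" by (simp add: proj_selfadjoint)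
      also have "proj m c (proj n b y) = proj n b y"
        unfolding proj_def[of n b] by (simp add: proj_simps fx)
      finally show ?thesis by (simp add: proj_selfadjoint)
    qed
    then have "cinner (proj m c x - proj n b x) (proj m c x - proj n b x) = 0"
      by (simp add: cinner_diff_left)
    then show "proj m c x = proj n b x" by (simp add: cinner_self)
  qed
qed

lemma orthonormal_snoc:
  assumes "orthonormal m c" "norm u = 1" "\<And>i. i < m \<Longrightarrow> cinner u (c i) = 0"
  shows "orthonormal (Suc m) (c(m := u))"
proof -
  have "cinner (c i) u = 0" if "i < m" for i
    using assms(3)[OF that] by (metis cinner_commute complex_cnj_zero)
  then show ?thesis
    using assms by (auto simp: orthonormal_def less_Suc_eq cinner_self)
qed

text \<open>One Gram-Schmidt step. The last clause, that \<open>u\<close> is a multiple of the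
  residual, is what later shows that vectors already captured by the projection stay
  captured.\<close>

lemma orthonormal_add_vector:
  assumes "orthonormal m c" "csubspace S" "\<And>i. i < m \<Longrightarrow> c i \<in> S" "x \<in> S" "proj m c x \<noteq> x"
  obtains u where "u \<in> S" "orthonormal (Suc m) (c(m := u))" "proj (Suc m) (c(m := u)) x = x"
    "\<exists>a. u = scaleC a (x - proj m c x)"
proof -
  define y where "y = x - proj m c x"
  have y: "y \<noteq> 0" "y \<in> S"
    using assms proj_in_csubspace[OF assms(2,3)] by (auto simp: y_def intro: csubspace_simps)
  define u where "u = scaleC (of_real (1 / norm y)) y"
  have u: "u \<in> S" "norm u = 1"
    using y assms by (auto simp: u_def norm_scaleC norm_divide intro: csubspace_simps)
  have orth: "cinner u (c i) = 0" if "i < m" for i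
    using proj_residual_orth[OF assms(1) that, of x] by (simp add: u_def y_def cinner_scaleC_left)
  have on: "orthonormal (Suc m) (c(m := u))" using assms(1) u orth by (rule_tac orthonormal_snoc)
  have yu: "y = scaleC (of_real (norm y)) u" using y by (simp add: u_def scaleC_scaleC)
  have "x = (\<Sum>i<m. scaleC (cinner x (c i)) (c i)) + scaleC (of_real (norm y)) u"
    by (simp only: yu[symmetric] proj_def[symmetric]) (simp add: y_def)
  also have "\<dots> = (\<Sum>i<Suc m. scaleC (if i < m then cinner x (c i) else of_real (norm y)) ((c(m := u)) i))"
    by simp
  finally have "proj (Suc m) (c(m := u)) x = x"
    using proj_comb[OF on] by metis
  then show thesis using that u on u_def y_def by blast
qed

text \<open>As long as \<open>m < n\<close>, some \<open>b i\<close> lies outside the span of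
  \<open>c\<close>, for otherwise the comparison of dimensions would give \<open>n \<le> m\<close>;
  its residual direction is appended.\<close>

lemma orthonormal_extend:
  assumes "orthonormal n b" "orthonormal m c" "\<And>j. j < m \<Longrightarrow> proj n b (c j) = c j"
  obtains c' where "orthonormal n c'" "\<And>i. i < m \<Longrightarrow> c' i = c i" "proj n c' = proj n b"
proof -
  have "\<exists>c'. orthonormal n c' \<and> (\<forall>i<m. c' i = c i) \<and> proj n c' = proj n b"
    if "n - m = k" "orthonormal m c" "\<And>j. j < m \<Longrightarrow> proj n b (c j) = c j" for k m and c
    using that
  proof (induction k arbitrary: m c)
    case 0
    then have "m = n" using orthonormal_count_le(1)[OF assms(1) 0(2,3)] by simp
    then show ?case using 0 orthonormal_count_le(2)[OF assms(1) 0(2,3)] by auto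
  next
    case (Suc k)
    have mn: "m < n" using Suc by linarith
    have "\<exists>i<n. proj m c (b i) \<noteq> b i"
    proof (rule ccontr)
      assume "\<not> ?thesis"
      then show False using orthonormal_count_le(1)[OF Suc.prems(2) assms(1)] mn by auto
    qed
    then obtain i where i: "i < n" "proj m c (b i) \<noteq> b i" by blast
    define S where "S = {x. proj n b x = x}"
    have S: "csubspace S" by (auto simp: S_def csubspace_def proj_simps)
    have "c j \<in> S" if "j < m" for j using Suc.prems(3)[OF that] by (simp add: S_def)
    moreover have "b i \<in> S" using proj_basis[OF assms(1) i(1)] by (simp add: S_def)
    ultimately obtain u where u: "u \<in> S" "orthonormal (Suc m) (c(m := u))"
      using orthonormal_add_vector[OF Suc.prems(2) S _ _ i(2)] by blast
    have "proj n b ((c(m := u)) j) = (c(m := u)) j" if "j < Suc m" for j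
      using u(1) Suc.prems(3)[of j] that by (auto simp: S_def less_Suc_eq)
    then obtain c' where c': "orthonormal n c'" "\<forall>i<Suc m. c' i = (c(m := u)) i" "proj n c' = proj n b"
      using Suc.IH[OF _ u(2)] Suc.prems(1) by fastforce
    have "\<forall>i<m. c' i = c i" using c'(2) by (metis fun_upd_other less_SucI nat_less_le)
    then show ?case using c' by blast
  qed
  then show thesis using that assms by blast
qed

text \<open>Gram-Schmidt along a list, with the given family kept as the head. A new direction is
  orthogonal to everything in the old span, so the projection of vectors captured earlier does not
  change.\<close>

lemma orthonormal_span_list:
  assumes "orthonormal m c" "csubspace S" "\<And>i. i < m \<Longrightarrow> c i \<in> S" "set xs \<subseteq> S"
  obtains n c' where "m \<le> n" "n \<le> m + length xs" "orthonormal n c'" "\<And>i. i < n \<Longrightarrow> c' i \<in> S"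
    "\<And>i. i < m \<Longrightarrow> c' i = c i" "\<And>x. x \<in> set xs \<Longrightarrow> proj n c' x = x"
proof -
  have "\<exists>n c'. m \<le> n \<and> n \<le> m + length xs \<and> orthonormal n c' \<and> (\<forall>i<n. c' i \<in> S) \<and>
    (\<forall>i<m. c' i = c i) \<and> (\<forall>x\<in>set xs. proj n c' x = x)"
    using assms(4)
  proof (induction xs rule: rev_induct)
    case Nil
    then show ?case using assms by (intro exI[of _ m] exI[of _ c]) auto
  next
    case (snoc x xs)
    then obtain n c' where n: "m \<le> n" "n \<le> m + length xs" "orthonormal n c'" "\<forall>i<n. c' i \<in> S"
      "\<forall>i<m. c' i = c i" "\<forall>x\<in>set xs. proj n c' x = x" by auto
    show ?case
    proof (cases "proj n c' x = x")
      case True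
      then show ?thesis using n by (intro exI[of _ n] exI[of _ c']) auto
    next
      case False
      obtain u where u: "u \<in> S" "orthonormal (Suc n) (c'(n := u))" "proj (Suc n) (c'(n := u)) x = x"
        "\<exists>a. u = scaleC a (x - proj n c' x)"
        using orthonormal_add_vector[OF n(3) assms(2), of x] n(4) False snoc.prems by auto
      have "proj (Suc n) (c'(n := u)) y = y" if "y \<in> set xs" for y
      proof -
        have fy: "proj n c' y = y" using n(6) that by auto
        have "cinner (x - proj n c' x) y = cinner (x - proj n c' x) (proj n c' y)" by (simp add: fy)
        also have "\<dots> = 0"
          using n(3) by (simp add: proj_selfadjoint[symmetric] proj_simps proj_idem)
        finally have "cinner u y = 0" using u(4) by (auto simp: cinner_scaleC_left)
        then have "cinner y u = 0" by (metis cinner_commute complex_cnj_zero)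
        then have "proj (Suc n) (c'(n := u)) y = proj n c' y"
          unfolding proj_def by (simp add: fun_upd_def)
        then show ?thesis using fy by simp
      qed
      moreover have "\<forall>i<Suc n. (c'(n := u)) i \<in> S" "\<forall>i<m. (c'(n := u)) i = c i"
        using n u(1) by (auto simp: less_Suc_eq)
      ultimately show ?thesis using n(1,2) u(2,3)
        by (intro exI[of _ "Suc n"] exI[of _ "c'(n := u)"]) (auto simp del: fun_upd_apply)
    qed
  qed
  then show thesis using that by blast
qed

section \<open>Triangular and diagonal forms\<close>

text \<open>The compression is written as a complex matrix, whose spectrum is non-empty; the
  coordinate vector found there is turned back into an element of the span.\<close>

lemma exists_eigenvector:
  fixes b :: "nat \<Rightarrow> 'a::complex_inner"
  assumes b: "orthonormal (Suc d) b" and T: "clin T"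
  obtains a x where "proj (Suc d) b x = x" "norm x = 1" "proj (Suc d) b (T x) = scaleC a x"
proof -
  let ?n = "Suc d"
  define A where "A = mat ?n ?n (\<lambda>(i, j). cinner (T (b j)) (b i))"
  have A: "A \<in> carrier_mat ?n ?n" by (simp add: A_def)
  then have "spectrum A \<noteq> {}" by (rule spectrum_non_empty) simp
  then obtain a v where v: "v \<in> carrier_vec ?n" "v \<noteq> 0\<^sub>v ?n" "A *\<^sub>v v = a \<cdot>\<^sub>v v"
    using A by (auto simp: spectrum_def eigenvalue_def eigenvector_def)
  define x where "x = (\<Sum>j<?n. scaleC (vec_index v j) (b j))"
  have x: "proj ?n b x = x" unfolding x_def by (rule proj_comb[OF b])
  have "x \<noteq> 0"
  proof
    assume "x = 0"
    then have "vec_index v i = 0" if "i < ?n" for i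
      using cinner_comb_basis[OF b that, of "vec_index v"] by (simp add: x_def)
    then have "v = 0\<^sub>v ?n" using v(1) by (intro eq_vecI) auto
    then show False using v(2) by simp
  qed
  have "cinner (T x) (b i) = a * vec_index v i" if "i < ?n" for i
  proof -
    have "cinner (T x) (b i) = (\<Sum>j<?n. vec_index v j * cinner (T (b j)) (b i))"
      by (simp only: x_def clin_simps[OF T] cinner_sum_left cinner_scaleC_left)
    also have "\<dots> = vec_index (A *\<^sub>v v) i"
      using that v(1) by (simp add: A_def scalar_prod_def lessThan_atLeast0 mult.commute del: sum.lessThan_Suc sum.op_ivl_Suc)
    also have "\<dots> = a * vec_index v i" using v that by simp
    finally show ?thesis .
  qed
  then have "proj ?n b (T x) = (\<Sum>i<?n. scaleC (a * vec_index v i) (b i))"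
    unfolding proj_def by (intro sum.cong) auto
  then have Tx: "proj ?n b (T x) = scaleC a x"
    by (simp only: x_def scaleC_sum_right scaleC_scaleC)
  define y where "y = scaleC (of_real (1 / norm x)) x"
  have "norm y = 1" using \<open>x \<noteq> 0\<close> by (simp add: y_def norm_scaleC norm_divide)
  moreover have "proj ?n b y = y" using x by (simp add: y_def proj_simps)
  moreover have "proj ?n b (T y) = scaleC a y"
    using Tx by (simp add: y_def proj_simps clin_simps[OF T] scaleC_scaleC mult.commute)
  ultimately show thesis using that by blast
qed

lemma proj_Suc_shift: "proj (Suc d) c y = scaleC (cinner y (c 0)) (c 0) + proj d (\<lambda>i. c (Suc i)) y"
  unfolding proj_def by (rule sum.lessThan_Suc_shift)

lemma orthonormal_shift: "orthonormal (Suc d) c \<Longrightarrow> orthonormal d (\<lambda>i. c (Suc i))"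
  by (auto simp: orthonormal_def)

text \<open>\<open>Q\<close> is an arbitrary property of the eigenvalues of the compression, which
  is carried over to the diagonal entries. One eigenvector is split off and the induction runs on
  the compression to its orthogonal complement; the point is that eigenvalues of the smaller
  compression are eigenvalues of the larger one.\<close>

lemma schur_form:
  fixes b :: "nat \<Rightarrow> 'a::complex_inner"
  assumes "orthonormal d b" "clin T"
    and "\<And>a x. proj d b x = x \<Longrightarrow> x \<noteq> 0 \<Longrightarrow> proj d b (T x) = scaleC a x \<Longrightarrow> Q a"
  shows "\<exists>f. orthonormal d f \<and> proj d f = proj d b \<and> (\<forall>i<d. \<forall>j<i. cinner (T (f j)) (f i) = 0) \<and>
    (\<forall>i<d. Q (cinner (T (f i)) (f i)))"
  using assms(1,3)
proof (induction d arbitrary: b)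
  case 0
  then show ?case by (intro exI[of _ b]) auto
next
  case (Suc d)
  obtain a x where x: "proj (Suc d) b x = x" "norm x = 1" "proj (Suc d) b (T x) = scaleC a x"
    using exists_eigenvector[OF Suc.prems(1) assms(2)] .
  have "orthonormal 1 (\<lambda>_. x)" using x(2) by (simp add: orthonormal_def cinner_self)
  then obtain c where c: "orthonormal (Suc d) c" "c 0 = x" "proj (Suc d) c = proj (Suc d) b"
    using orthonormal_extend[OF Suc.prems(1), of 1 "\<lambda>_. x"] x(1) by auto
  define g where "g = (\<lambda>i. c (Suc i))"
  have g: "orthonormal d g" unfolding g_def by (rule orthonormal_shift[OF c(1)])
  have pb: "proj (Suc d) b y = scaleC (cinner y x) x + proj d g y" for y
    unfolding c(3)[symmetric] proj_Suc_shift c(2) g_def ..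
  have gx0: "proj d g x = 0"
    using orthonormalD[OF c(1), of 0] c(2) by (simp add: proj_def g_def)
  have orthx: "cinner y x = 0" if "proj d g y = y" for y
    using that proj_selfadjoint[of d g y x] gx0 by simp
  have Qa: "Q a" using Suc.prems(2)[of x a] x by fastforce
  have Qg: "Q k" if y: "proj d g y = y" "y \<noteq> 0" "proj d g (T y) = scaleC k y" for k y
  proof (cases "k = a")
    case False
    \<comment> \<open>Solves \<open>cinner (T y) x + \<gamma> * a = k * \<gamma>\<close>, so that
      adding \<open>scaleC \<gamma> x\<close> turns the eigenvector \<open>y\<close> of the smaller
      compression into one of the larger compression.\<close>
    define \<gamma> where "\<gamma> = cinner (T y) x / (k - a)"
    define z where "z = y + scaleC \<gamma> x"
    have Ty: "proj (Suc d) b (T y) = scaleC (cinner (T y) x) x + scaleC k y" using pb y(3) by simp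
    have "proj (Suc d) b (T z) = scaleC (cinner (T y) x) x + scaleC k y + scaleC (\<gamma> * a) x"
      by (simp only: z_def clin_simps[OF assms(2)] proj_simps Ty x(3) scaleC_scaleC)
    also have "\<dots> = scaleC (cinner (T y) x + \<gamma> * a) x + scaleC k y" by (simp add: scaleC_add_left)
    also have "cinner (T y) x + \<gamma> * a = k * \<gamma>" using False by (simp add: \<gamma>_def field_simps)
    finally have 1: "proj (Suc d) b (T z) = scaleC k z"
      by (simp add: z_def scaleC_add_right scaleC_scaleC)
    have 2: "proj (Suc d) b z = z"
      unfolding z_def using orthx[OF y(1)] y(1) x(1) pb[of y] by (simp only: proj_simps) simp
    have "z \<noteq> 0"
    proof
      assume "z = 0"
      then have "proj d g z = 0" by (simp add: proj_simps)
      then have "y = 0" unfolding z_def by (simp add: proj_simps gx0 y(1))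
      then show False using y(2) by simp
    qed
    then show ?thesis using Suc.prems(2) 1 2 by blast
  qed (use Qa in simp)
  obtain f where f: "orthonormal d f" "proj d f = proj d g"
    "\<forall>i<d. \<forall>j<i. cinner (T (f j)) (f i) = 0" "\<forall>i<d. Q (cinner (T (f i)) (f i))"
    using Suc.IH[OF g] Qg by metis
  have fx: "cinner (f i) x = 0" if "i < d" for i
    using orthx proj_basis[OF f(1) that] f(2) by metis
  then have xf: "cinner x (f i) = 0" if "i < d" for i
    using that by (metis cinner_commute complex_cnj_zero)
  define h where "h = case_nat x f"
  have h: "h 0 = x" "h (Suc i) = f i" for i by (auto simp: h_def)
  have oh: "orthonormal (Suc d) h"
    unfolding orthonormal_def
  proof (intro allI impI)
    fix i j assume "i < Suc d" "j < Suc d"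
    then show "cinner (h i) (h j) = (if i = j then 1 else 0)"
      using x(2) fx xf orthonormalD[OF f(1)]
      by (cases i; cases j) (auto simp: h cinner_self)
  qed
  have ph: "proj (Suc d) h = proj (Suc d) b"
    by (rule ext) (simp add: proj_Suc_shift[of d h] h pb f(2))
  have Txi: "cinner (T x) y = a * cinner x y" if "proj (Suc d) b y = y" for y
    using proj_selfadjoint[of "Suc d" b "T x" y] that x(3) by (simp add: cinner_scaleC_left)
  have tri: "cinner (T (h j)) (h i) = 0" if "i < Suc d" "j < i" for i j
  proof (cases j)
    case 0
    define i' where "i' = i - 1"
    then have i': "i = Suc i'" "i' < d" using that by auto
    have "proj (Suc d) b (f i') = f i'"
      using proj_basis[OF oh, of i] i' ph by (simp add: h)
    then show ?thesis using 0 i' Txi xf by (simp add: h)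
  next
    case (Suc j')
    define i' where "i' = i - 1"
    then have i': "i = Suc i'" "i' < d" using that by auto
    then show ?thesis using Suc that f(3) by (auto simp: h)
  qed
  have "Q (cinner (T (h i)) (h i))" if "i < Suc d" for i
  proof (cases i)
    case 0
    then show ?thesis using Txi[OF x(1)] x(2) Qa by (simp add: h cinner_self)
  next
    case (Suc i')
    then show ?thesis using that f(4) by (simp add: h)
  qed
  then show ?case using oh ph tri by blast
qed

text \<open>For orthonormal \<open>b\<close>, symmetry and the range condition force
  \<open>X\<close> to vanish on the orthogonal complement of the span, so \<open>X\<close> is in
  effect a Hermitian matrix of size \<open>d\<close>.\<close>

definition herm_op :: "nat \<Rightarrow> (nat \<Rightarrow> 'a::complex_inner) \<Rightarrow> ('a \<Rightarrow> 'a) \<Rightarrow> bool" where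
  "herm_op d b X \<longleftrightarrow> clin X \<and> (\<forall>x y. cinner (X x) y = cinner x (X y)) \<and> (\<forall>x. proj d b (X x) = X x)"

lemma herm_opD:
  assumes "herm_op d b X"
  shows "clin X" "cinner (X x) y = cinner x (X y)" "proj d b (X x) = X x"
  using assms by (auto simp: herm_op_def)

lemma herm_op_real: "herm_op d b X \<Longrightarrow> cinner (X x) x = of_real (Re (cinner (X x) x))"
proof -
  assume "herm_op d b X"
  then have "cnj (cinner (X x) x) = cinner (X x) x"
    using cinner_commute[of x "X x"] by (simp add: herm_op_def)
  then have "cinner (X x) x \<in> \<real>" by (metis Reals_cnj_iff)
  then show ?thesis by (metis of_real_Re)
qed

text \<open>The Schur form of a Hermitian operator is diagonal, because symmetry reflects the zeros
  below the diagonal to those above.\<close>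

lemma herm_eigenbasis:
  assumes b: "orthonormal d b" and X: "herm_op d b X"
  obtains g where "orthonormal d g" "proj d g = proj d b"
    "\<And>i. i < d \<Longrightarrow> X (g i) = scaleC (of_real (Re (cinner (X (g i)) (g i)))) (g i)"
proof -
  obtain f where f: "orthonormal d f" "proj d f = proj d b"
    "\<forall>i<d. \<forall>j<i. cinner (X (f j)) (f i) = 0"
    using schur_form[OF b herm_opD(1)[OF X], of "\<lambda>_. True"] by blast
  have "X (f i) = scaleC (of_real (Re (cinner (X (f i)) (f i)))) (f i)" if i: "i < d" for i
  proof -
    have "cinner (X (f i)) (f k) = 0" if "k < d" "k \<noteq> i" for k
    proof (cases "i < k")
      case False
      then have "cinner (X (f k)) (f i) = 0" using f(3) that i by simp
      then show ?thesis
        using herm_opD(2)[OF X, of "f i" "f k"] by (metis cinner_commute complex_cnj_zero)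
    qed (use f(3) that in simp)
    then have "proj d f (X (f i)) = (\<Sum>k<d. if k = i then scaleC (cinner (X (f i)) (f i)) (f i) else 0)"
      unfolding proj_def by (intro sum.cong) auto
    then have "X (f i) = scaleC (cinner (X (f i)) (f i)) (f i)"
      using i herm_opD(3)[OF X] f(2) by simp
    then show ?thesis using herm_op_real[OF X] by metis
  qed
  then show thesis using that f by blast
qed

section \<open>Traces of powers\<close>

definition tr_on :: "nat \<Rightarrow> (nat \<Rightarrow> 'a::complex_inner) \<Rightarrow> ('a \<Rightarrow> 'a) \<Rightarrow> complex" where
  "tr_on d b X = (\<Sum>i<d. cinner (X (b i)) (b i))"

lemma clin_expand:
  assumes "clin X" "proj d f x = x"
  shows "X x = (\<Sum>j<d. scaleC (cinner x (f j)) (X (f j)))"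
proof -
  have "X x = X (\<Sum>j<d. scaleC (cinner x (f j)) (f j))"
    using assms(2) by (simp add: proj_def)
  then show ?thesis by (simp only: clin_simps[OF assms(1)])
qed

lemma tr_on_basis_independent:
  assumes "orthonormal d b" "orthonormal d f" "proj d f = proj d b" "clin X"
  shows "tr_on d b X = tr_on d f X"
proof -
  have "cinner (X (b i)) (b i) = (\<Sum>j<d. cinner (b i) (f j) * cinner (X (f j)) (b i))" if "i < d" for i
  proof -
    have "X (b i) = (\<Sum>j<d. scaleC (cinner (b i) (f j)) (X (f j)))"
      using proj_basis[OF assms(1) that] assms(3) by (intro clin_expand[OF assms(4)]) simp
    then show ?thesis by (simp add: cinner_sum_left cinner_scaleC_left)
  qed
  then have "tr_on d b X = (\<Sum>i<d. \<Sum>j<d. cinner (b i) (f j) * cinner (X (f j)) (b i))"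
    by (simp add: tr_on_def)
  also have "\<dots> = (\<Sum>j<d. \<Sum>i<d. cinner (X (f j)) (b i) * cinner (b i) (f j))"
    by (subst sum.swap) (simp add: mult.commute)
  also have "\<dots> = (\<Sum>j<d. cinner (X (f j)) (proj d b (f j)))"
    by (simp only: cinner_proj_right)
  also have "\<dots> = tr_on d f X"
    unfolding tr_on_def by (intro sum.cong) (auto simp: assms(3)[symmetric] proj_basis[OF assms(2)])
  finally show ?thesis .
qed

text \<open>For Hermitian \<open>X\<close> and positive \<open>m\<close> this is the Schatten sum of
  order \<open>2 ^ m\<close>, that is, the sum of these powers of the singular values. The order is
  coded by \<open>m\<close> because every induction doubles it.\<close>

definition ptr :: "nat \<Rightarrow> nat \<Rightarrow> (nat \<Rightarrow> 'a::complex_inner) \<Rightarrow> ('a \<Rightarrow> 'a) \<Rightarrow> real" where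
  "ptr m d b X = Re (tr_on d b (X ^^ 2 ^ m))"

lemma clin_comp: "clin X \<Longrightarrow> clin Y \<Longrightarrow> clin (\<lambda>x. X (Y x))"
  by (auto simp: clin_on_def)

lemma clin_funpow: "clin X \<Longrightarrow> clin (X ^^ n)"
  by (induction n) (auto simp: clin_on_def)

lemma herm_op_square: "herm_op d b X \<Longrightarrow> herm_op d b (\<lambda>x. X (X x))"
  by (auto simp: herm_op_def clin_on_def)

lemma herm_op_add: "herm_op d b X \<Longrightarrow> herm_op d b Y \<Longrightarrow> herm_op d b (\<lambda>x. X x + Y x)"
  by (auto simp: herm_op_def clin_on_def cinner_add_left cinner_add_right proj_simps scaleC_add_right)

lemma herm_op_diff: "herm_op d b X \<Longrightarrow> herm_op d b Y \<Longrightarrow> herm_op d b (\<lambda>x. X x - Y x)"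
  by (auto simp: herm_op_def clin_on_def cinner_diff_left cinner_diff_right proj_simps scaleC_diff_right)

lemma herm_op_jordan: "herm_op d b X \<Longrightarrow> herm_op d b Y \<Longrightarrow> herm_op d b (\<lambda>x. X (Y x) + Y (X x))"
  by (auto simp: herm_op_def clin_on_def cinner_add_left cinner_add_right proj_simps scaleC_add_right)

lemma funpow_double: "X ^^ 2 ^ Suc m = (\<lambda>x. X (X x)) ^^ 2 ^ m"
proof -
  have "(X ^^ 2) ^^ (2 ^ m) = X ^^ (2 * 2 ^ m)" by (simp add: funpow_mult)
  moreover have "X ^^ 2 = (\<lambda>x. X (X x))" by (simp add: numeral_2_eq_2 fun_eq_iff)
  ultimately show ?thesis by simp
qed

lemma ptr_Suc: "ptr (Suc m) d b X = ptr m d b (\<lambda>x. X (X x))"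
  unfolding ptr_def funpow_double ..

text \<open>For a unit vector the squared form of \<open>X\<close> is at most the form of its
  square, by Cauchy-Schwarz; induction with the square in place of \<open>X\<close> does the
  rest.\<close>

lemma jensen_herm:
  assumes "herm_op d b X" "norm x = 1"
  shows "(Re (cinner (X x) x)) ^ 2 ^ m \<le> Re (cinner ((X ^^ 2 ^ m) x) x)"
  using assms(1)
proof (induction m arbitrary: X)
  case (Suc m)
  let ?Y = "\<lambda>x. X (X x)"
  have "\<bar>Re (cinner (X x) x)\<bar> \<le> norm (X x)"
    using abs_Re_le_cmod[of "cinner (X x) x"] cauchy_schwarz[of "X x" x] assms(2) by simp
  then have "(Re (cinner (X x) x))\<^sup>2 \<le> (norm (X x))\<^sup>2"
    using abs_le_square_iff[of "Re (cinner (X x) x)" "norm (X x)"] by simp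
  also have "\<dots> = Re (cinner (?Y x) x)"
    using herm_opD(2)[OF Suc.prems, of "X x" x] Re_cinner_self[of "X x"] by simp
  finally have "((Re (cinner (X x) x))\<^sup>2) ^ 2 ^ m \<le> (Re (cinner (?Y x) x)) ^ 2 ^ m"
    by (intro power_mono) auto
  also have "\<dots> \<le> Re (cinner ((?Y ^^ 2 ^ m) x) x)"
    by (rule Suc.IH[OF herm_op_square[OF Suc.prems]])
  finally show ?case unfolding funpow_double by (simp add: power_mult)
qed simp

lemma even_pow2: "even ((2::nat) ^ Suc m)" by simp

lemma herm_power_nonneg:
  assumes "herm_op d b X" "norm x = 1"
  shows "0 \<le> Re (cinner ((X ^^ 2 ^ Suc m) x) x)"
proof -
  have "0 \<le> (Re (cinner (X x) x)) ^ 2 ^ Suc m" by (rule zero_le_even_power[OF even_pow2])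
  then show ?thesis using jensen_herm[OF assms, of "Suc m"] by linarith
qed

text \<open>Peierls' inequality for even powers. The family is completed to a basis of the span, and
  the added terms are non-negative because the exponent is even.\<close>

lemma peierls:
  assumes "orthonormal d b" "herm_op d b X" "orthonormal n g" "\<And>i. i < n \<Longrightarrow> proj d b (g i) = g i"
  shows "(\<Sum>i<n. (Re (cinner (X (g i)) (g i))) ^ 2 ^ Suc m) \<le> ptr (Suc m) d b X"
proof -
  obtain c where c: "orthonormal d c" "\<And>i. i < n \<Longrightarrow> c i = g i" "proj d c = proj d b"
    using orthonormal_extend[OF assms(1,3,4)] by blast
  have nd: "n \<le> d" using orthonormal_count_le(1)[OF assms(1,3,4)] .
  let ?f = "\<lambda>i. Re (cinner ((X ^^ 2 ^ Suc m) (c i)) (c i))"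
  have "(\<Sum>i<n. (Re (cinner (X (g i)) (g i))) ^ 2 ^ Suc m) \<le> (\<Sum>i<n. ?f i)"
    using jensen_herm[OF assms(2) orthonormal_norm[OF assms(3)], of _ "Suc m"] c(2)
    by (intro sum_mono) (auto simp del: power_Suc)
  also have "\<dots> \<le> (\<Sum>i<d. ?f i)"
    using nd herm_power_nonneg[OF assms(2) orthonormal_norm[OF c(1)]]
    by (intro sum_mono2) (auto simp del: power_Suc)
  also have "\<dots> = ptr (Suc m) d b X"
    using tr_on_basis_independent[OF assms(1) c(1,3) clin_funpow[OF herm_opD(1)[OF assms(2)]]]
    by (simp add: ptr_def tr_on_def)
  finally show ?thesis .
qed

lemma ptr_eigen:
  assumes "orthonormal d b" "herm_op d b X" "orthonormal d g" "proj d g = proj d b"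
    "\<And>i. i < d \<Longrightarrow> X (g i) = scaleC (of_real (ev i)) (g i)"
  shows "ptr m d b X = (\<Sum>i<d. ev i ^ 2 ^ m)"
proof -
  have "(X ^^ k) (g i) = scaleC (of_real (ev i ^ k)) (g i)" if "i < d" for i k
    by (induction k) (simp_all add: clin_simps[OF herm_opD(1)[OF assms(2)]] assms(5)[OF that]
        scaleC_scaleC mult.commute)
  then have "tr_on d g (X ^^ 2 ^ m) = (\<Sum>i<d. of_real (ev i ^ 2 ^ m))"
    unfolding tr_on_def
    by (intro sum.cong) (auto simp: cinner_scaleC_left cinner_self orthonormal_norm[OF assms(3)])
  then show ?thesis
    using tr_on_basis_independent[OF assms(1,3,4) clin_funpow[OF herm_opD(1)[OF assms(2)]]]
    by (simp add: ptr_def)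
qed

text \<open>The trace is attained in an eigenbasis of \<open>X\<close>, so a bound for the diagonal
  sums in all bases suffices. Together with \<open>peierls\<close> this is a variational description
  of Schatten sums, from which the inequalities below follow entry by entry.\<close>

lemma ptr_le:
  assumes "orthonormal d b" "herm_op d b X"
    "\<And>g. orthonormal d g \<Longrightarrow> proj d g = proj d b \<Longrightarrow> (\<Sum>i<d. (Re (cinner (X (g i)) (g i))) ^ 2 ^ m) \<le> B"
  shows "ptr m d b X \<le> B"
proof -
  obtain g where g: "orthonormal d g" "proj d g = proj d b"
    "\<And>i. i < d \<Longrightarrow> X (g i) = scaleC (of_real (Re (cinner (X (g i)) (g i)))) (g i)"
    using herm_eigenbasis[OF assms(1,2)] by metis
  show ?thesis using ptr_eigen[OF assms(1,2) g] assms(3)[OF g(1,2)] by simp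
qed

lemma power_add_le:
  fixes x y :: real
  assumes "even n"
  shows "(x + y) ^ n \<le> 2 ^ n * (x ^ n + y ^ n)"
proof -
  let ?m = "max \<bar>x\<bar> \<bar>y\<bar>"
  have "(x + y) ^ n = \<bar>x + y\<bar> ^ n" using assms by (simp add: power_even_abs)
  also have "\<dots> \<le> (2 * ?m) ^ n" by (intro power_mono) auto
  also have "\<dots> = 2 ^ n * ?m ^ n" by (simp add: power_mult_distrib)
  also have "?m ^ n \<le> \<bar>x\<bar> ^ n + \<bar>y\<bar> ^ n" by (auto simp: max_def)
  finally show ?thesis using assms by (simp add: power_even_abs)
qed

lemma ptr_nonneg:
  assumes "orthonormal d b" "herm_op d b X"
  shows "0 \<le> ptr (Suc m) d b X"
  unfolding ptr_def tr_on_def Re_sum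
  by (intro sum_nonneg herm_power_nonneg[OF assms(2)]) (simp add: orthonormal_norm[OF assms(1)])

text \<open>A triangle inequality up to a constant. It is read off from the diagonal entries in one
  basis; sharp constants are irrelevant for the application.\<close>

lemma ptr_add_le:
  assumes b: "orthonormal d b" and X: "herm_op d b X" and Y: "herm_op d b Y"
  shows "ptr (Suc m) d b (\<lambda>x. X x + Y x) \<le> 2 ^ 2 ^ Suc m * (ptr (Suc m) d b X + ptr (Suc m) d b Y)"
proof (rule ptr_le[OF b herm_op_add[OF X Y]])
  fix g assume g: "orthonormal d g" "proj d g = proj d b"
  have fx: "proj d b (g i) = g i" if "i < d" for i using proj_basis[OF g(1) that] g(2) by simp
  let ?x = "\<lambda>i. Re (cinner (X (g i)) (g i))" and ?y = "\<lambda>i. Re (cinner (Y (g i)) (g i))"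
  have "(\<Sum>i<d. (Re (cinner (X (g i) + Y (g i)) (g i))) ^ 2 ^ Suc m)
    \<le> (\<Sum>i<d. 2 ^ 2 ^ Suc m * (?x i ^ 2 ^ Suc m + ?y i ^ 2 ^ Suc m))"
    unfolding cinner_add_left plus_complex.sel by (intro sum_mono power_add_le even_pow2)
  also have "\<dots> = 2 ^ 2 ^ Suc m * ((\<Sum>i<d. ?x i ^ 2 ^ Suc m) + (\<Sum>i<d. ?y i ^ 2 ^ Suc m))"
    by (simp add: sum_distrib_left[symmetric] sum.distrib del: power_Suc)
  also have "\<dots> \<le> 2 ^ 2 ^ Suc m * (ptr (Suc m) d b X + ptr (Suc m) d b Y)"
    by (intro mult_left_mono add_mono peierls b X Y g fx) auto
  finally show "(\<Sum>i<d. (Re (cinner (X (g i) + Y (g i)) (g i))) ^ 2 ^ Suc m)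
    \<le> 2 ^ 2 ^ Suc m * (ptr (Suc m) d b X + ptr (Suc m) d b Y)" .
qed

lemma norm_power_le_trace:
  assumes "herm_op d b X" "norm x = 1"
  shows "norm (X x) ^ 2 ^ m \<le> sqrt (Re (cinner ((X ^^ 2 ^ Suc m) x) x))"
proof (rule real_le_rsqrt)
  have "(norm (X x) ^ 2 ^ m)\<^sup>2 = ((norm (X x))\<^sup>2) ^ 2 ^ m" by (simp add: mult.commute flip: power_mult)
  also have "(norm (X x))\<^sup>2 = Re (cinner (X (X x)) x)"
    using herm_opD(2)[OF assms(1), of "X x" x] Re_cinner_self[of "X x"] by simp
  also have "\<dots> ^ 2 ^ m \<le> Re (cinner ((X ^^ 2 ^ Suc m) x) x)"
    unfolding funpow_double by (rule jensen_herm[OF herm_op_square[OF assms(1)] assms(2)])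
  finally show "(norm (X x) ^ 2 ^ m)\<^sup>2 \<le> Re (cinner ((X ^^ 2 ^ Suc m) x) x)" .
qed

text \<open>A diagonal entry of XY + YX has modulus at most
  \<open>2 * norm (X g) * norm (Y g)\<close>. The powers of these norms are bounded by square roots
  of diagonal entries of doubled order, and Cauchy-Schwarz over the basis separates the two
  factors.\<close>

lemma ptr_jordan_le:
  assumes b: "orthonormal d b" and X: "herm_op d b X" and Y: "herm_op d b Y"
  shows "ptr (Suc m) d b (\<lambda>x. X (Y x) + Y (X x))
    \<le> 2 ^ 2 ^ Suc m * (sqrt (ptr (Suc (Suc m)) d b X) * sqrt (ptr (Suc (Suc m)) d b Y))"
proof (rule ptr_le[OF b herm_op_jordan[OF X Y]])
  fix g assume g: "orthonormal d g" "proj d g = proj d b"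
  let ?p = "2 ^ Suc m :: nat"
  let ?x = "\<lambda>i. sqrt (Re (cinner ((X ^^ 2 ^ Suc (Suc m)) (g i)) (g i)))"
    and ?y = "\<lambda>i. sqrt (Re (cinner ((Y ^^ 2 ^ Suc (Suc m)) (g i)) (g i)))"
  have "(Re (cinner (X (Y (g i)) + Y (X (g i))) (g i))) ^ ?p \<le> 2 ^ ?p * (?x i * ?y i)" if i: "i < d" for i
  proof -
    have n1: "norm (g i) = 1" by (rule orthonormal_norm[OF g(1) i])
    let ?z = "Re (cinner (X (Y (g i)) + Y (X (g i))) (g i))"
    have "cinner (X (Y (g i)) + Y (X (g i))) (g i) = cinner (Y (g i)) (X (g i)) + cinner (X (g i)) (Y (g i))"
      by (simp add: cinner_add_left herm_opD(2)[OF X] herm_opD(2)[OF Y])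
    then have "\<bar>?z\<bar> \<le> cmod (cinner (Y (g i)) (X (g i))) + cmod (cinner (X (g i)) (Y (g i)))"
      using abs_Re_le_cmod norm_triangle_ineq by (metis order_trans)
    also have "\<dots> \<le> 2 * (norm (X (g i)) * norm (Y (g i)))"
      using cauchy_schwarz[of "Y (g i)" "X (g i)"] cauchy_schwarz[of "X (g i)" "Y (g i)"]
      by (simp add: mult.commute)
    finally have "\<bar>?z\<bar> ^ ?p \<le> (2 * (norm (X (g i)) * norm (Y (g i)))) ^ ?p" by (intro power_mono) auto
    also have "\<dots> = 2 ^ ?p * (norm (X (g i)) ^ ?p * norm (Y (g i)) ^ ?p)" by (simp add: power_mult_distrib)
    also have "\<dots> \<le> 2 ^ ?p * (?x i * ?y i)"
      by (intro mult_left_mono mult_mono norm_power_le_trace[OF X n1] norm_power_le_trace[OF Y n1]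
          real_sqrt_ge_zero herm_power_nonneg[OF X n1]) auto
    finally show ?thesis by (simp add: power_even_abs)
  qed
  then have "(\<Sum>i<d. (Re (cinner (X (Y (g i)) + Y (X (g i))) (g i))) ^ ?p)
    \<le> (\<Sum>i<d. 2 ^ ?p * (?x i * ?y i))" by (intro sum_mono) auto
  also have "\<dots> \<le> (\<Sum>i<d. 2 ^ ?p * (\<bar>?x i\<bar> * \<bar>?y i\<bar>))"
    by (intro sum_mono mult_left_mono) (auto simp flip: abs_mult simp del: real_sqrt_abs)
  also have "\<dots> \<le> 2 ^ ?p * (L2_set ?x {..<d} * L2_set ?y {..<d})"
    using L2_set_mult_ineq[of ?x ?y "{..<d}"] by (simp only: sum_distrib_left[symmetric]) simp
  also have "L2_set ?x {..<d} = sqrt (ptr (Suc (Suc m)) d b X)"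
    unfolding L2_set_def ptr_def tr_on_basis_independent[OF b g clin_funpow[OF herm_opD(1)[OF X]]]
    unfolding tr_on_def Re_sum
    by (intro arg_cong[of _ _ sqrt] sum.cong refl real_sqrt_pow2
        herm_power_nonneg[OF X orthonormal_norm[OF g(1)]]) simp
  also have "L2_set ?y {..<d} = sqrt (ptr (Suc (Suc m)) d b Y)"
    unfolding L2_set_def ptr_def tr_on_basis_independent[OF b g clin_funpow[OF herm_opD(1)[OF Y]]]
    unfolding tr_on_def Re_sum
    by (intro arg_cong[of _ _ sqrt] sum.cong refl real_sqrt_pow2
        herm_power_nonneg[OF Y orthonormal_norm[OF g(1)]]) simp
  finally show "(\<Sum>i<d. (Re (cinner (X (Y (g i)) + Y (X (g i))) (g i))) ^ 2 ^ Suc m)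
    \<le> 2 ^ 2 ^ Suc m * (sqrt (ptr (Suc (Suc m)) d b X) * sqrt (ptr (Suc (Suc m)) d b Y))" .
qed

section \<open>Nilpotent operators: the real part against the imaginary part\<close>

definition strictly_triangular :: "nat \<Rightarrow> (nat \<Rightarrow> 'a::complex_inner) \<Rightarrow> ('a \<Rightarrow> 'a) \<Rightarrow> bool" where
  "strictly_triangular d b N \<longleftrightarrow> (\<exists>f. orthonormal d f \<and> proj d f = proj d b \<and>
     (\<forall>i<d. \<forall>j\<le>i. cinner (N (f j)) (f i) = 0))"

lemma strictly_triangular_square:
  assumes "strictly_triangular d b N" "clin N" "\<And>x. proj d b (N x) = N x"
  shows "strictly_triangular d b (\<lambda>x. N (N x))"
proof -
  obtain f where f: "orthonormal d f" "proj d f = proj d b"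
     "\<forall>i<d. \<forall>j\<le>i. cinner (N (f j)) (f i) = 0" using assms(1) by (auto simp: strictly_triangular_def)
  have "cinner (N (N (f j))) (f i) = 0" if "i < d" "j \<le> i" for i j
  proof -
    have "N (N (f j)) = (\<Sum>k<d. scaleC (cinner (N (f j)) (f k)) (N (f k)))"
      using assms(3)[of "f j"] f(2) by (intro clin_expand[OF assms(2)]) simp
    then have "cinner (N (N (f j))) (f i) = (\<Sum>k<d. cinner (N (f j)) (f k) * cinner (N (f k)) (f i))"
      by (simp add: cinner_sum_left cinner_scaleC_left)
    also have "\<dots> = 0"
    proof (rule sum.neutral, rule ballI)
      fix k assume "k \<in> {..<d}"
      then show "cinner (N (f j)) (f k) * cinner (N (f k)) (f i) = 0"
        using f(3) that by (cases "j \<le> k") auto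
    qed
    finally show ?thesis .
  qed
  then show ?thesis using f(1,2) by (auto simp: strictly_triangular_def)
qed

lemma tr_strictly_triangular:
  assumes "strictly_triangular d b N" "clin N" "orthonormal d b"
  shows "tr_on d b N = 0"
proof -
  obtain f where f: "orthonormal d f" "proj d f = proj d b"
     "\<forall>i<d. \<forall>j\<le>i. cinner (N (f j)) (f i) = 0" using assms(1) by (auto simp: strictly_triangular_def)
  then show ?thesis
    using tr_on_basis_independent[OF assms(3) f(1,2) assms(2)] by (simp add: tr_on_def)
qed

text \<open>Resolves the self-referential estimate that arises when the order of a Schatten sum is
  doubled: \<open>x\<close> and \<open>y\<close> stand for the roots of the sums of the real and the
  imaginary part.\<close>

lemma quadratic_bound:
  fixes x y a b :: real
  assumes "x\<^sup>2 \<le> a * (x * y) + b * y\<^sup>2" "0 \<le> a" "0 \<le> b" "0 \<le> x" "0 \<le> y"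
  shows "x\<^sup>2 \<le> (a + b + 1)\<^sup>2 * y\<^sup>2"
proof -
  have "x \<le> (a + b + 1) * y"
  proof (rule ccontr)
    assume "\<not> ?thesis"
    then have gt: "(a + b + 1) * y < x" by simp
    have "1 * y \<le> (a + b + 1) * y" using assms by (intro mult_right_mono) auto
    then have "y < x" using gt by linarith
    then have "b * y * y \<le> b * y * x" using assms by (intro mult_left_mono) auto
    then have "x * x \<le> (a + b) * y * x"
      using assms(1) by (simp add: power2_eq_square algebra_simps)
    then have "x \<le> (a + b) * y" using \<open>y < x\<close> assms by simp
    then show False using gt assms by (simp add: algebra_simps)
  qed
  then have "x\<^sup>2 \<le> ((a + b + 1) * y)\<^sup>2" using assms by (intro power_mono) auto
  then show ?thesis by (simp add: power_mult_distrib)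
qed

text \<open>The real part of a nilpotent operator is controlled by its imaginary part in every Schatten
  norm of order \<open>2 ^ k\<close>: the order doubles because
  \<open>(R + iJ)\<^sup>2 = (R\<^sup>2 - J\<^sup>2) + i (R J + J R)\<close> is again nilpotent.\<close>

lemma triangular_real_part_le:
  "\<exists>C\<ge>0. \<forall>d b. \<forall>R J :: 'a::complex_inner \<Rightarrow> 'a. orthonormal d b \<longrightarrow> herm_op d b R \<longrightarrow> herm_op d b J \<longrightarrow>
     strictly_triangular d b (\<lambda>x. R x + scaleC \<i> (J x)) \<longrightarrow> ptr (Suc m) d b R \<le> C * ptr (Suc m) d b J"
proof (induction m)
  case 0
  show ?case
  proof (intro exI[of _ 1] conjI allI impI)
    fix d b and R J :: "'a \<Rightarrow> 'a"
    assume b: "orthonormal d b" and R: "herm_op d b R" and J: "herm_op d b J"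
      and tri: "strictly_triangular d b (\<lambda>x. R x + scaleC \<i> (J x))"
    let ?N = "\<lambda>x. R x + scaleC \<i> (J x)"
    have N: "clin ?N"
      using herm_opD(1)[OF R] herm_opD(1)[OF J]
      by (auto simp: clin_on_def scaleC_add_right scaleC_scaleC mult.commute)
    have PN: "proj d b (?N x) = ?N x" for x
      by (simp add: proj_simps herm_opD(3)[OF R] herm_opD(3)[OF J])
    \<comment> \<open>Order 2: the square of a nilpotent operator has trace zero, and the real part
      of this trace is the trace of the square of \<open>R\<close> minus that of the square of
      \<open>J\<close>, since the mixed terms are purely imaginary.\<close>
    have "tr_on d b (\<lambda>x. ?N (?N x)) = 0"
      by (rule tr_strictly_triangular[OF strictly_triangular_square[OF tri N PN] clin_comp[OF N N] b])
    moreover have "Re (cinner (?N (?N x)) x) = Re (cinner (R (R x)) x) - Re (cinner (J (J x)) x)" for x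
    proof -
      have "cinner (J (R x)) x + cinner (R (J x)) x = cinner (R x) (J x) + cnj (cinner (R x) (J x))"
        using herm_opD(2)[OF R, of "J x" x] herm_opD(2)[OF J, of "R x" x] cinner_commute[of "J x" "R x"] by simp
      then have "Im (cinner (J (R x)) x) + Im (cinner (R (J x)) x) = 0" by (simp add: complex_eq_iff)
      then show ?thesis
        by (simp add: clin_simps[OF herm_opD(1)[OF R]] clin_simps[OF herm_opD(1)[OF J]]
            cinner_add_left cinner_diff_left cinner_scaleC_left scaleC_add_right scaleC_scaleC)
    qed
    ultimately have "(\<Sum>i<d. Re (cinner (R (R (b i))) (b i))) - (\<Sum>i<d. Re (cinner (J (J (b i))) (b i))) = 0"
      by (simp add: tr_on_def complex_eq_iff sum_subtractf)
    then show "ptr (Suc 0) d b R \<le> 1 * ptr (Suc 0) d b J"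
      by (simp add: ptr_def tr_on_def numeral_2_eq_2)
  qed simp
next
  case (Suc m)
  from Suc.IH obtain C where C: "C \<ge> 0" "\<forall>d b. \<forall>R J :: 'a \<Rightarrow> 'a. orthonormal d b \<longrightarrow> herm_op d b R \<longrightarrow> herm_op d b J \<longrightarrow>
     strictly_triangular d b (\<lambda>x. R x + scaleC \<i> (J x)) \<longrightarrow> ptr (Suc m) d b R \<le> C * ptr (Suc m) d b J"
    by (elim exE conjE)
  define q where "q = (2::real) ^ 2 ^ Suc m"
  have q: "q \<ge> 0" by (simp add: q_def)
  show ?case
  \<comment> \<open>The constant that \<open>quadratic_bound\<close> yields, with \<open>q\<close>
    from the triangle inequality and from \<open>ptr_jordan_le\<close>, and \<open>C\<close> from
    the lower order.\<close>
  proof (intro exI[of _ "(q * (C * q) + q + 1)\<^sup>2"] conjI allI impI)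
    fix d b and R J :: "'a \<Rightarrow> 'a"
    assume b: "orthonormal d b" and R: "herm_op d b R" and J: "herm_op d b J"
      and tri: "strictly_triangular d b (\<lambda>x. R x + scaleC \<i> (J x))"
    let ?N = "\<lambda>x. R x + scaleC \<i> (J x)"
    let ?R = "\<lambda>x. R (R x) - J (J x)" and ?J = "\<lambda>x. R (J x) + J (R x)"
    have N: "clin ?N"
      using herm_opD(1)[OF R] herm_opD(1)[OF J]
      by (auto simp: clin_on_def scaleC_add_right scaleC_scaleC mult.commute)
    have PN: "proj d b (?N x) = ?N x" for x
      by (simp add: proj_simps herm_opD(3)[OF R] herm_opD(3)[OF J])
    have "(\<lambda>x. ?N (?N x)) = (\<lambda>x. ?R x + scaleC \<i> (?J x))"
      by (simp add: fun_eq_iff clin_simps[OF herm_opD(1)[OF R]] clin_simps[OF herm_opD(1)[OF J]]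
          scaleC_add_right scaleC_scaleC algebra_simps)
    then have tri': "strictly_triangular d b (\<lambda>x. ?R x + scaleC \<i> (?J x))"
      using strictly_triangular_square[OF tri N PN] by simp
    note R' = herm_op_diff[OF herm_op_square[OF R] herm_op_square[OF J]]
    note J' = herm_op_jordan[OF R J]
    let ?x = "sqrt (ptr (Suc (Suc m)) d b R)" and ?y = "sqrt (ptr (Suc (Suc m)) d b J)"
    have x2: "?x\<^sup>2 = ptr (Suc (Suc m)) d b R" and y2: "?y\<^sup>2 = ptr (Suc (Suc m)) d b J"
      using ptr_nonneg[OF b R] ptr_nonneg[OF b J] by auto
    \<comment> \<open>The square of \<open>R\<close> is \<open>?R\<close> plus the square of
      \<open>J\<close>. Here \<open>?R\<close> is the real part of the squared nilpotent operator,
      so the induction hypothesis at half the order applies to it.\<close>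
    have "ptr (Suc (Suc m)) d b R = ptr (Suc m) d b (\<lambda>x. ?R x + J (J x))"
      by (simp add: ptr_Suc[of "Suc m"])
    also have "\<dots> \<le> q * (ptr (Suc m) d b ?R + ptr (Suc m) d b (\<lambda>x. J (J x)))"
      unfolding q_def by (rule ptr_add_le[OF b R' herm_op_square[OF J]])
    also have "\<dots> \<le> q * (C * (q * (?x * ?y)) + ?y\<^sup>2)"
    proof (intro mult_left_mono add_mono q)
      have "ptr (Suc m) d b ?R \<le> C * ptr (Suc m) d b ?J" by (rule C(2)[rule_format, OF b R' J' tri'])
      also have "\<dots> \<le> C * (q * (?x * ?y))"
        unfolding q_def by (intro mult_left_mono ptr_jordan_le[OF b R J] C(1))
      finally show "ptr (Suc m) d b ?R \<le> C * (q * (?x * ?y))" .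
      show "ptr (Suc m) d b (\<lambda>x. J (J x)) \<le> ?y\<^sup>2" unfolding y2 by (simp add: ptr_Suc[of "Suc m"])
    qed
    finally have "?x\<^sup>2 \<le> (q * (C * q)) * (?x * ?y) + q * ?y\<^sup>2"
      unfolding x2 by (simp add: algebra_simps)
    then have "?x\<^sup>2 \<le> (q * (C * q) + q + 1)\<^sup>2 * ?y\<^sup>2"
      using q C(1) ptr_nonneg[OF b R] ptr_nonneg[OF b J] by (intro quadratic_bound) auto
    then show "ptr (Suc (Suc m)) d b R \<le> (q * (C * q) + q + 1)\<^sup>2 * ptr (Suc (Suc m)) d b J"
      unfolding x2 y2 .
  qed simp
qed


section \<open>Trace estimate for compressions with small spectrum\<close>

lemma Re_cinner_diagonal:
  assumes "orthonormal d f"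
  shows "cinner (\<Sum>j<d. scaleC (of_real (r j)) (scaleC (cinner x (f j)) (f j))) x
    = of_real (\<Sum>j<d. r j * (cmod (cinner x (f j)))\<^sup>2)"
  by (simp only: cinner_sum_left cinner_scaleC_left cinner_swap_mult of_real_sum of_real_mult)

lemma herm_op_diagonal:
  assumes "orthonormal d f" "proj d f = proj d b"
  shows "herm_op d b (\<lambda>x. \<Sum>j<d. scaleC (of_real (r j)) (scaleC (cinner x (f j)) (f j)))"
  unfolding herm_op_def
proof (intro conjI allI)
  show "clin (\<lambda>x. \<Sum>j<d. scaleC (of_real (r j)) (scaleC (cinner x (f j)) (f j)))"
    by (rule clinI) (simp_all add: cinner_add_left cinner_scaleC_left scaleC_add_left scaleC_add_right
      sum.distrib scaleC_sum_right scaleC_scaleC mult_ac)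
  fix x y
  have "cnj (cinner y z) = cinner z y" for y z :: 'a by (metis cinner_commute)
  then show "cinner (\<Sum>j<d. scaleC (of_real (r j)) (scaleC (cinner x (f j)) (f j))) y
    = cinner x (\<Sum>j<d. scaleC (of_real (r j)) (scaleC (cinner y (f j)) (f j)))"
    by (simp add: cinner_sum_left cinner_sum_right cinner_scaleC_left cinner_scaleC_right mult_ac)
  have "proj d f (\<Sum>j<d. scaleC (of_real (r j) * cinner x (f j)) (f j))
    = (\<Sum>j<d. scaleC (of_real (r j) * cinner x (f j)) (f j))" by (rule proj_comb[OF assms(1)])
  then show "proj d b (\<Sum>j<d. scaleC (of_real (r j)) (scaleC (cinner x (f j)) (f j)))
    = (\<Sum>j<d. scaleC (of_real (r j)) (scaleC (cinner x (f j)) (f j)))"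
    by (simp add: assms(2) scaleC_scaleC)
qed

text \<open>The adjoint of \<open>K\<close> restricted to the span, written out in the basis, so
  that no completeness of the ambient space is required.\<close>

definition adj_on :: "nat \<Rightarrow> (nat \<Rightarrow> 'a::complex_inner) \<Rightarrow> ('a \<Rightarrow> 'a) \<Rightarrow> 'a \<Rightarrow> 'a" where
  "adj_on d b K y = (\<Sum>i<d. scaleC (cinner y (K (b i))) (b i))"

lemma adj_on:
  assumes "orthonormal d b" "clin K"
  shows "clin (adj_on d b K)" "proj d b (adj_on d b K y) = adj_on d b K y"
    "cinner (adj_on d b K y) x = cinner y (K (proj d b x))"
proof -
  show "clin (adj_on d b K)"
    by (rule clinI) (simp_all add: adj_on_def cinner_add_left cinner_scaleC_left scaleC_add_left
      sum.distrib scaleC_sum_right scaleC_scaleC)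
  show "proj d b (adj_on d b K y) = adj_on d b K y" unfolding adj_on_def by (rule proj_comb[OF assms(1)])
  have "cnj (cinner y z) = cinner z y" for y z :: 'a by (metis cinner_commute)
  then show "cinner (adj_on d b K y) x = cinner y (K (proj d b x))"
    unfolding proj_def adj_on_def
    by (simp add: clin_simps[OF assms(2)] cinner_sum_left cinner_sum_right cinner_scaleC_left
        cinner_scaleC_right mult.commute)
qed

text \<open>Subtracting from the compression of H + K the diagonal of its Schur form leaves a
  strictly triangular operator. \<open>H\<close> enters only its real part; its imaginary part
  consists of that of \<open>K\<close> and of the imaginary parts of the diagonal, both governed by
  \<open>K\<close>. So \<open>triangular_real_part_le\<close> bounds the real part by
  \<open>K\<close>, and \<open>peierls\<close> along the vectors \<open>v\<close> recovers the size
  of \<open>H\<close>.\<close>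

lemma quasinilpotent_trace_bound:
  "\<exists>C\<ge>0. \<forall>d n b v \<epsilon> t S. \<forall>H K :: 'a::complex_inner \<Rightarrow> 'a.
     orthonormal d b \<longrightarrow> clin H \<longrightarrow> clin K \<longrightarrow>
     (\<forall>x y. proj d b x = x \<longrightarrow> proj d b y = y \<longrightarrow> cinner (H x) y = cinner x (H y)) \<longrightarrow>
     (\<forall>a x. proj d b x = x \<longrightarrow> x \<noteq> 0 \<longrightarrow> proj d b (H x + K x) = scaleC a x \<longrightarrow> cmod a \<le> \<epsilon>) \<longrightarrow>
     orthonormal n v \<longrightarrow> (\<forall>i<n. proj d b (v i) = v i \<and> t \<le> Re (cinner (H (v i)) (v i))) \<longrightarrow> \<epsilon> \<le> t \<longrightarrow>
     (\<forall>f. orthonormal d f \<longrightarrow> proj d f = proj d b \<longrightarrow> (\<Sum>i<d. norm (K (f i)) ^ 2 ^ Suc m) \<le> S) \<longrightarrow>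
     real n * (t - \<epsilon>) ^ 2 ^ Suc m \<le> C * S"
proof -
  obtain C where C: "C \<ge> 0" "\<forall>d b. \<forall>R J :: 'a \<Rightarrow> 'a. orthonormal d b \<longrightarrow> herm_op d b R \<longrightarrow> herm_op d b J \<longrightarrow>
     strictly_triangular d b (\<lambda>x. R x + scaleC \<i> (J x)) \<longrightarrow> ptr (Suc m) d b R \<le> C * ptr (Suc m) d b J"
    using triangular_real_part_le[where 'a='a, of m] by (elim exE conjE)
  let ?p = "2 ^ Suc m :: nat"
  define q where "q = (2::real) ^ ?p"
  have q0: "q \<ge> 0" by (simp add: q_def)
  show ?thesis
  proof (intro exI[of _ "q * (C * (q * 2) + 1)"] conjI allI impI)
    show "0 \<le> q * (C * (q * 2) + 1)" using q0 C(1) by simp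
    fix d n b v \<epsilon> t S and H K :: "'a \<Rightarrow> 'a"
    assume b: "orthonormal d b" and H: "clin H" and K: "clin K"
      and sym: "\<forall>x y. proj d b x = x \<longrightarrow> proj d b y = y \<longrightarrow> cinner (H x) y = cinner x (H y)"
      and spec: "\<forall>a x. proj d b x = x \<longrightarrow> x \<noteq> 0 \<longrightarrow> proj d b (H x + K x) = scaleC a x \<longrightarrow> cmod a \<le> \<epsilon>"
      and v: "orthonormal n v" and tv: "\<forall>i<n. proj d b (v i) = v i \<and> t \<le> Re (cinner (H (v i)) (v i))"
      and et: "\<epsilon> \<le> t"
      and S: "\<forall>f. orthonormal d f \<longrightarrow> proj d f = proj d b \<longrightarrow> (\<Sum>i<d. norm (K (f i)) ^ ?p) \<le> S"
    let ?P = "proj d b"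
    have cHK: "clin (\<lambda>x. H x + K x)"
      using H K by (auto simp: clin_on_def scaleC_add_right)
    obtain f where f: "orthonormal d f" "proj d f = ?P"
      "\<forall>i<d. \<forall>j<i. cinner (H (f j) + K (f j)) (f i) = 0"
      "\<forall>i<d. cmod (cinner (H (f i) + K (f i)) (f i)) \<le> \<epsilon>"
      using schur_form[OF b cHK, of "\<lambda>a. cmod a \<le> \<epsilon>"] spec by blast
    define \<alpha> where "\<alpha> i = cinner (H (f i) + K (f i)) (f i)" for i
    have Pf: "?P (f i) = f i" if "i < d" for i using proj_basis[OF f(1) that] f(2) by simp
    define HP where "HP x = ?P (H (?P x))" for x
    have HP: "herm_op d b HP"
      unfolding herm_op_def
    proof (intro conjI allI)
      show "clin HP" unfolding HP_def by (rule clinI) (simp_all add: proj_simps clin_simps[OF H])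
      show "cinner (HP x) y = cinner x (HP y)" for x y
        using sym proj_idem[OF b] by (simp add: HP_def proj_selfadjoint[of d b "H (?P x)"]
            proj_selfadjoint[of d b x, symmetric])
      show "?P (HP x) = HP x" for x by (simp add: HP_def proj_idem[OF b])
    qed
    define KP where "KP x = ?P (K (?P x))" for x
    have KP: "clin KP" unfolding KP_def by (rule clinI) (simp_all add: proj_simps clin_simps[OF K])
    have PKP: "?P (KP x) = KP x" "KP (?P x) = KP x" for x by (simp_all add: KP_def proj_idem[OF b])
    define KA where "KA = adj_on d b KP"
    have KA: "clin KA" "?P (KA x) = KA x" "cinner (KA y) x = cinner y (KP x)" for x y
      using adj_on[OF b KP] by (auto simp: KA_def PKP)
    have KA': "cinner x (KA y) = cinner (KP x) y" for x y
      using KA(3)[of y x] by (metis cinner_commute)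
    \<comment> \<open>Real and imaginary part of the compressed \<open>K\<close>, so that
      \<open>KR + \<i> KJ\<close> is this compression.\<close>
    define KR where "KR x = scaleC (1/2) (KP x + KA x)" for x
    define KJ where "KJ x = scaleC (- \<i> / 2) (KP x - KA x)" for x
    have KR: "herm_op d b KR"
      unfolding herm_op_def
    proof (intro conjI allI)
      show "clin KR" unfolding KR_def
        by (rule clinI) (simp_all add: clin_simps[OF KP] clin_simps[OF KA(1)] scaleC_add_right scaleC_scaleC mult.commute)
      show "cinner (KR x) y = cinner x (KR y)" for x y
        by (simp add: KR_def cinner_scaleC_left cinner_scaleC_right cinner_add_left cinner_add_right KA(3) KA')
      show "?P (KR x) = KR x" for x by (simp add: KR_def proj_simps PKP KA)
    qed
    have KJ: "herm_op d b KJ"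
      unfolding herm_op_def
    proof (intro conjI allI)
      show "clin KJ" unfolding KJ_def
        by (rule clinI) (simp_all add: clin_simps[OF KP] clin_simps[OF KA(1)] scaleC_add_right
            scaleC_diff_right scaleC_scaleC mult.commute)
      show "cinner (KJ x) y = cinner x (KJ y)" for x y
        by (simp add: KJ_def cinner_scaleC_left cinner_scaleC_right cinner_diff_left cinner_diff_right KA(3) KA'
            cinner_minus_left cinner_minus_right algebra_simps)
      show "?P (KJ x) = KJ x" for x
        by (simp only: KJ_def proj_simps PKP KA)
    qed
    have KRJ: "KR x + scaleC \<i> (KJ x) = KP x" for x
      by (simp add: KR_def KJ_def scaleC_scaleC scaleC_add_right scaleC_diff_right flip: scaleC_add_left)
    \<comment> \<open>Minus the real and minus the imaginary part of the diagonal of the Schur form,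
      as Hermitian operators diagonal in the basis \<open>f\<close>.\<close>
    define DR where "DR x = (\<Sum>j<d. scaleC (of_real (- Re (\<alpha> j))) (scaleC (cinner x (f j)) (f j)))" for x
    define DJ where "DJ x = (\<Sum>j<d. scaleC (of_real (- Im (\<alpha> j))) (scaleC (cinner x (f j)) (f j)))" for x
    have DR: "herm_op d b DR" and DJ: "herm_op d b DJ"
      unfolding DR_def[abs_def] DJ_def[abs_def] by (rule herm_op_diagonal[OF f(1,2)])+
    define R where "R x = (HP x + KR x) + DR x" for x
    define J where "J x = KJ x + DJ x" for x
    have R: "herm_op d b R" and J: "herm_op d b J"
      unfolding R_def[abs_def] J_def[abs_def] by (intro herm_op_add HP KR KJ DR DJ)+
    have Df: "DR (f j) + scaleC \<i> (DJ (f j)) = - scaleC (\<alpha> j) (f j)" if "j < d" for j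
    proof -
      have *: "(\<Sum>i<d. scaleC (of_real (r i)) (scaleC (cinner (f j) (f i)) (f i))) = scaleC (of_real (r j)) (f j)" for r
      proof -
        have "(\<Sum>i<d. scaleC (of_real (r i)) (scaleC (cinner (f j) (f i)) (f i)))
          = (\<Sum>i<d. if i = j then scaleC (of_real (r j)) (f j) else 0)"
          using that by (intro sum.cong) (auto simp: orthonormalD[OF f(1)])
        then show ?thesis using that by simp
      qed
      have "DR (f j) + scaleC \<i> (DJ (f j)) = scaleC (of_real (- Re (\<alpha> j)) + \<i> * of_real (- Im (\<alpha> j))) (f j)"
        unfolding DR_def DJ_def * by (simp only: scaleC_scaleC scaleC_add_left)
      also have "of_real (- Re (\<alpha> j)) + \<i> * of_real (- Im (\<alpha> j)) = - \<alpha> j" by (simp add: complex_eq_iff)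
      finally show ?thesis by simp
    qed
    have "cinner (R (f j) + scaleC \<i> (J (f j))) (f i) = 0" if "i < d" "j \<le> i" for i j
    proof -
      have j: "j < d" using that by simp
      have "R (f j) + scaleC \<i> (J (f j)) = HP (f j) + (KR (f j) + scaleC \<i> (KJ (f j)))
        + (DR (f j) + scaleC \<i> (DJ (f j)))" by (simp add: R_def J_def scaleC_add_right)
      also have "\<dots> = ?P (H (f j) + K (f j)) - scaleC (\<alpha> j) (f j)"
        unfolding KRJ Df[OF j] by (simp add: HP_def KP_def Pf[OF j] proj_simps)
      finally have "cinner (R (f j) + scaleC \<i> (J (f j))) (f i)
        = cinner (H (f j) + K (f j)) (f i) - \<alpha> j * cinner (f j) (f i)"
        by (simp only: cinner_diff_left cinner_scaleC_left proj_selfadjoint Pf[OF that(1)])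
      then show ?thesis
        using f(3) that orthonormalD[OF f(1) j that(1)] by (cases "j = i") (auto simp: \<alpha>_def)
    qed
    then have tri: "strictly_triangular d b (\<lambda>x. R x + scaleC \<i> (J x))"
      using f(1,2) by (auto simp: strictly_triangular_def)
    have pw: "\<bar>x\<bar> ^ ?p = x ^ ?p" for x :: real by (rule power_even_abs[OF even_pow2])
    \<comment> \<open>An eigenbasis of \<open>KJ\<close> is unrelated to the bases at hand; for this
      reason the hypothesis on \<open>S\<close> speaks of every orthonormal basis of the
      span.\<close>
    have KJ_le: "ptr (Suc m) d b KJ \<le> S"
    proof (rule ptr_le[OF b KJ])
      fix g assume g: "orthonormal d g" "proj d g = proj d b"
      have "(Re (cinner (KJ (g i)) (g i))) ^ ?p \<le> norm (K (g i)) ^ ?p" if i: "i < d" for i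
      proof -
        have gi: "?P (g i) = g i" using proj_basis[OF g(1) i] g(2) by simp
        have *: "cinner (KP (g i)) (g i) = cinner (K (g i)) (g i)"
          by (simp add: KP_def gi proj_selfadjoint)
        have "cinner (KA (g i)) (g i) = cnj (cinner (K (g i)) (g i))"
          using KA'[of "g i" "g i"] * cinner_commute[of "KA (g i)" "g i"] by simp
        then have "Re (cinner (KJ (g i)) (g i)) = Im (cinner (K (g i)) (g i))"
          using * by (simp add: KJ_def cinner_scaleC_left cinner_diff_left)
        then have "\<bar>Re (cinner (KJ (g i)) (g i))\<bar> \<le> norm (K (g i))"
          using abs_Im_le_cmod[of "cinner (K (g i)) (g i)"] cauchy_schwarz[of "K (g i)" "g i"]
            orthonormal_norm[OF g(1) i] by simp
        then have "\<bar>Re (cinner (KJ (g i)) (g i))\<bar> ^ ?p \<le> norm (K (g i)) ^ ?p" by (intro power_mono) auto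
        then show ?thesis unfolding pw .
      qed
      then have "(\<Sum>i<d. (Re (cinner (KJ (g i)) (g i))) ^ ?p) \<le> (\<Sum>i<d. norm (K (g i)) ^ ?p)"
        by (intro sum_mono) auto
      also have "\<dots> \<le> S" using S g by blast
      finally show "(\<Sum>i<d. (Re (cinner (KJ (g i)) (g i))) ^ ?p) \<le> S" .
    qed
    \<comment> \<open>The diagonal entries of \<open>H\<close> are real, so the imaginary part of an
      entry of the Schur diagonal comes from \<open>K\<close> alone.\<close>
    have diag_le: "\<bar>Im (\<alpha> i)\<bar> \<le> norm (K (f i))" if i: "i < d" for i
    proof -
      have "cinner (H (f i)) (f i) = cinner (HP (f i)) (f i)"
        by (simp add: HP_def Pf[OF i] proj_selfadjoint)
      then have "Im (cinner (H (f i)) (f i)) = 0" using herm_op_real[OF HP] by (metis Im_complex_of_real)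
      then have "Im (\<alpha> i) = Im (cinner (K (f i)) (f i))" by (simp add: \<alpha>_def cinner_add_left)
      then show ?thesis
        using abs_Im_le_cmod[of "cinner (K (f i)) (f i)"] cauchy_schwarz[of "K (f i)" "f i"]
            orthonormal_norm[OF f(1) i] by simp
    qed
    have DJ_le: "ptr (Suc m) d b DJ \<le> S"
    proof -
      have "DJ (f i) = scaleC (of_real (- Im (\<alpha> i))) (f i)" if "i < d" for i
      proof -
        have "DJ (f i) = (\<Sum>j<d. if j = i then scaleC (of_real (- Im (\<alpha> i))) (f i) else 0)"
          unfolding DJ_def using that by (intro sum.cong) (auto simp: orthonormalD[OF f(1)])
        then show ?thesis using that by simp
      qed
      then have "ptr (Suc m) d b DJ = (\<Sum>i<d. (- Im (\<alpha> i)) ^ ?p)"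
        by (rule ptr_eigen[OF b DJ f(1,2)])
      also have "\<dots> \<le> (\<Sum>i<d. norm (K (f i)) ^ ?p)"
      proof (rule sum_mono)
        fix i assume "i \<in> {..<d}"
        then have "\<bar>- Im (\<alpha> i)\<bar> ^ ?p \<le> norm (K (f i)) ^ ?p"
          using diag_le by (intro power_mono) auto
        then show "(- Im (\<alpha> i)) ^ ?p \<le> norm (K (f i)) ^ ?p" unfolding pw .
      qed
      also have "\<dots> \<le> S" using S f by blast
      finally show ?thesis .
    qed
    have J_le: "ptr (Suc m) d b J \<le> q * (S + S)"
      unfolding J_def[abs_def] q_def
      by (rule order_trans[OF ptr_add_le[OF b KJ DJ]]) (intro mult_left_mono add_mono KJ_le DJ_le, simp)
    have R_le: "ptr (Suc m) d b R \<le> C * (q * (S + S))"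
      using C(2)[rule_format, OF b R J tri] mult_left_mono[OF J_le C(1)] by linarith
    obtain w where w: "orthonormal d w" "\<And>i. i < n \<Longrightarrow> w i = v i" "proj d w = ?P"
      using orthonormal_extend[OF b v] tv by blast
    have nd: "n \<le> d" using orthonormal_count_le(1)[OF b v] tv by blast
    let ?r = "\<lambda>i. Re (cinner (R (v i)) (v i))"
    have "(t - \<epsilon>) ^ ?p \<le> q * ((?r i) ^ ?p + norm (K (v i)) ^ ?p)" if i: "i < n" for i
    proof -
      have Pv: "?P (v i) = v i" using tv i by blast
      have nv: "norm (v i) = 1" by (rule orthonormal_norm[OF v i])
      have "cinner (HP (v i)) (v i) = cinner (H (v i)) (v i)"
        by (simp add: HP_def Pv proj_selfadjoint)
      moreover have "Re (cinner (KR (v i)) (v i)) = Re (cinner (K (v i)) (v i))"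
      proof -
        have *: "cinner (KP (v i)) (v i) = cinner (K (v i)) (v i)"
          by (simp add: KP_def Pv proj_selfadjoint)
        have "cinner (KA (v i)) (v i) = cnj (cinner (K (v i)) (v i))"
          using KA'[of "v i" "v i"] * cinner_commute[of "KA (v i)" "v i"] by simp
        then show ?thesis using * by (simp add: KR_def cinner_scaleC_left cinner_add_left)
      qed
      \<comment> \<open>The diagonal entries have modulus at most \<open>\<epsilon>\<close>, so the
        form of \<open>DR\<close> at a unit vector of the span is an average of numbers that are at
        least \<open>- \<epsilon>\<close>.\<close>
      moreover have "- \<epsilon> \<le> Re (cinner (DR (v i)) (v i))"
      proof -
        have w1: "(\<Sum>j<d. (cmod (cinner (v i) (f j)))\<^sup>2) = 1"
          using norm_proj_sq[OF f(1), of "v i"] Pv nv f(2) by simp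
        have "- \<epsilon> = (\<Sum>j<d. - \<epsilon> * (cmod (cinner (v i) (f j)))\<^sup>2)"
          by (simp only: sum_distrib_left[symmetric] w1 mult_1_right)
        also have "\<dots> \<le> (\<Sum>j<d. - Re (\<alpha> j) * (cmod (cinner (v i) (f j)))\<^sup>2)"
        proof (intro sum_mono mult_right_mono)
          fix j assume "j \<in> {..<d}"
          then have "cmod (\<alpha> j) \<le> \<epsilon>" using f(4) by (auto simp: \<alpha>_def)
          then show "- \<epsilon> \<le> - Re (\<alpha> j)" using complex_Re_le_cmod[of "\<alpha> j"] by linarith
        qed simp
        finally show ?thesis
          unfolding DR_def Re_cinner_diagonal[OF f(1)] by simp
      qed
      ultimately have "t - \<epsilon> \<le> ?r i + - Re (cinner (K (v i)) (v i))"
        using tv i by (force simp: R_def cinner_add_left)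
      then have "(t - \<epsilon>) ^ ?p \<le> (?r i + - Re (cinner (K (v i)) (v i))) ^ ?p"
        using et by (intro power_mono) auto
      also have "\<dots> \<le> q * (?r i ^ ?p + (- Re (cinner (K (v i)) (v i))) ^ ?p)"
        unfolding q_def by (rule power_add_le[OF even_pow2])
      also have "(- Re (cinner (K (v i)) (v i))) ^ ?p \<le> norm (K (v i)) ^ ?p"
      proof -
        have "\<bar>- Re (cinner (K (v i)) (v i))\<bar> ^ ?p \<le> norm (K (v i)) ^ ?p"
          using abs_Re_le_cmod[of "cinner (K (v i)) (v i)"] cauchy_schwarz[of "K (v i)" "v i"] nv
          by (intro power_mono) auto
        then show ?thesis unfolding pw .
      qed
      finally show ?thesis using q0 by (simp add: mult_left_mono)
    qed
    then have "(\<Sum>i<n. (t - \<epsilon>) ^ ?p) \<le> (\<Sum>i<n. q * ((?r i) ^ ?p + norm (K (v i)) ^ ?p))"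
      by (intro sum_mono) auto
    also have "\<dots> = q * ((\<Sum>i<n. ?r i ^ ?p) + (\<Sum>i<n. norm (K (v i)) ^ ?p))"
      by (simp only: sum_distrib_left[symmetric] sum.distrib)
    also have "\<dots> \<le> q * (C * (q * (S + S)) + S)"
    proof (intro mult_left_mono add_mono q0)
      show "(\<Sum>i<n. ?r i ^ ?p) \<le> C * (q * (S + S))"
        by (rule order_trans[OF peierls[OF b R v] R_le]) (use tv in blast)
      have "(\<Sum>i<n. norm (K (v i)) ^ ?p) = (\<Sum>i<n. norm (K (w i)) ^ ?p)"
        using w(2) by simp
      also have "\<dots> \<le> (\<Sum>i<d. norm (K (w i)) ^ ?p)" using nd by (intro sum_mono2) auto
      also have "\<dots> \<le> S" using S w by blast
      finally show "(\<Sum>i<n. norm (K (v i)) ^ ?p) \<le> S" .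
    qed
    finally show "real n * (t - \<epsilon>) ^ ?p \<le> q * (C * (q * 2) + 1) * S"
      by (simp add: algebra_simps)
  qed
qed

section \<open>Determinants of finite-dimensional compressions\<close>

text \<open>Separate bases for arguments and values: a change of basis is then the matrix of the
  identity, and a triangular shape can be produced by choosing only the basis of the values.\<close>

definition dmat :: "nat \<Rightarrow> (nat \<Rightarrow> 'a::complex_inner) \<Rightarrow> (nat \<Rightarrow> 'a) \<Rightarrow> ('a \<Rightarrow> 'a) \<Rightarrow> complex mat" where
  "dmat d b c X = mat d d (\<lambda>(i, j). cinner (X (b j)) (c i))"

lemma dmat_carrier [simp]: "dmat d b c X \<in> carrier_mat d d"
  by (simp add: dmat_def)

lemma dmat_comp:
  assumes "clin X" "\<And>j. j < d \<Longrightarrow> proj d c (Y (b j)) = Y (b j)"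
  shows "dmat d b e (\<lambda>x. X (Y x)) = dmat d c e X * dmat d b c Y"
proof (rule eq_matI)
  fix i j assume ij: "i < dim_row (dmat d c e X * dmat d b c Y)" "j < dim_col (dmat d c e X * dmat d b c Y)"
  then have ij: "i < d" "j < d" by (auto simp: dmat_def)
  have "X (Y (b j)) = (\<Sum>k<d. scaleC (cinner (Y (b j)) (c k)) (X (c k)))"
    by (rule clin_expand[OF assms(1) assms(2)[OF ij(2)]])
  then show "dmat d b e (\<lambda>x. X (Y x)) $$ (i, j) = (dmat d c e X * dmat d b c Y) $$ (i, j)"
    using ij by (simp add: dmat_def scalar_prod_def cinner_sum_left cinner_scaleC_left
        lessThan_atLeast0 mult.commute)
qed (auto simp: dmat_def)

lemma dmat_id: "orthonormal d b \<Longrightarrow> dmat d b b (\<lambda>x. x) = 1\<^sub>m d"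
  by (rule eq_matI) (auto simp: dmat_def orthonormalD)

lemma det_dmat_comp:
  assumes "clin X" "\<And>j. j < d \<Longrightarrow> proj d c (Y (b j)) = Y (b j)"
  shows "det (dmat d b e (\<lambda>x. X (Y x))) = det (dmat d c e X) * det (dmat d b c Y)"
  using dmat_comp[of X d c Y b e, OF assms] by (simp add: det_mult[of _ d])

lemma clin_id: "clin (\<lambda>x. x)" by (simp add: clin_on_def)

lemma det_basis_change:
  assumes "orthonormal d b" "orthonormal d f" "proj d f = proj d b"
  shows "det (dmat d b f (\<lambda>x. x)) * det (dmat d f b (\<lambda>x. x)) = 1"
proof -
  have "det (dmat d f f (\<lambda>x. x)) = det (dmat d b f (\<lambda>x. x)) * det (dmat d f b (\<lambda>x. x))"
    using proj_basis[OF assms(2)] assms(3) by (intro det_dmat_comp[OF clin_id]) simp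
  then show ?thesis by (simp add: dmat_id[OF assms(2)])
qed

lemma det_dmat_basis_independent:
  assumes "orthonormal d b" "orthonormal d f" "proj d f = proj d b" "clin X"
    "\<And>x. proj d b x = x \<Longrightarrow> proj d b (X x) = X x"
  shows "det (dmat d b b X) = det (dmat d f f X)"
proof -
  have "det (dmat d b b X) = det (dmat d f b X) * det (dmat d b f (\<lambda>x. x))"
    using proj_basis[OF assms(1)] assms(3) by (intro det_dmat_comp[OF assms(4)]) simp
  also have "det (dmat d f b X) = det (dmat d f b (\<lambda>x. x)) * det (dmat d f f X)"
    using assms(5) proj_basis[OF assms(2)] assms(3) by (intro det_dmat_comp[OF clin_id]) simp
  finally show ?thesis using det_basis_change[OF assms(1-3)] by (simp add: mult.commute)
qed

text \<open>The matrix is unitary: the reverse change of basis is its conjugate transpose.\<close>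

lemma cmod_det_basis_change:
  assumes "orthonormal d b" "orthonormal d f" "proj d f = proj d b"
  shows "cmod (det (dmat d b f (\<lambda>x. x))) = 1"
proof -
  interpret cnj: comm_ring_hom cnj by unfold_locales auto
  have "dmat d f b (\<lambda>x. x) = map_mat cnj (transpose_mat (dmat d b f (\<lambda>x. x)))"
    by (rule eq_matI) (auto simp: dmat_def intro: cinner_commute)
  then have "det (dmat d f b (\<lambda>x. x)) = cnj (det (dmat d b f (\<lambda>x. x)))"
    using cnj.hom_det det_transpose[OF dmat_carrier] by metis
  then have "(cmod (det (dmat d b f (\<lambda>x. x))))\<^sup>2 = 1"
    using det_basis_change[OF assms] by (metis complex_norm_square of_real_1 of_real_eq_iff)
  then show ?thesis by (metis norm_ge_zero one_power2 power2_eq_iff_nonneg zero_le_one)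
qed

section \<open>Triangular determinants and Hadamard's inequality\<close>

lemma det_dmat_triangular:
  assumes "\<And>i j. i < d \<Longrightarrow> j < i \<Longrightarrow> cinner (X (b j)) (c i) = 0"
  shows "det (dmat d b c X) = (\<Prod>j<d. cinner (X (b j)) (c j))"
proof -
  have "upper_triangular (dmat d b c X)"
    using assms by (auto simp: dmat_def)
  then have "det (dmat d b c X) = prod_list (diag_mat (dmat d b c X))"
    by (rule det_upper_triangular[OF _ dmat_carrier])
  also have "\<dots> = (\<Prod>j<d. cinner (X (b j)) (c j))"
    by (simp add: prod_list_diag_prod dmat_def lessThan_atLeast0)
  finally show ?thesis .
qed

text \<open>Gram-Schmidt as in a QR decomposition. If \<open>x k\<close> already lies in the span of
  the first \<open>k\<close> vectors, the basis found so far is kept as it is.\<close>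

lemma adapted_basis:
  assumes b: "orthonormal d b" and x: "\<And>j. j < d \<Longrightarrow> proj d b (x j) = x j"
  obtains c where "orthonormal d c" "proj d c = proj d b" "\<And>j. j < d \<Longrightarrow> proj (Suc j) c (x j) = x j"
proof -
  have "\<exists>c. orthonormal d c \<and> proj d c = proj d b \<and> (\<forall>j<k. proj (Suc j) c (x j) = x j)" if "k \<le> d" for k
    using that
  proof (induction k)
    case 0
    then show ?case using b by auto
  next
    case (Suc k)
    then obtain c where c: "orthonormal d c" "proj d c = proj d b" "\<forall>j<k. proj (Suc j) c (x j) = x j"
      by auto
    have ck: "orthonormal k c" using c(1) Suc.prems by (auto intro: orthonormal_mono)
    show ?case
    proof (cases "proj k c (x k) = x k")
      case True
      have "orthonormal (Suc k) c" using c(1) Suc.prems by (auto intro: orthonormal_mono)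
      then have "cinner (x k) (c k) = 0"
        using True cinner_proj_left[of k c "x k" "c k"] by (simp add: orthonormalD)
      then have "proj (Suc k) c (x k) = x k" using True by (simp add: proj_def)
      then show ?thesis using c by (auto simp: less_Suc_eq)
    next
      case False
      define S where "S = {y. proj d b y = y}"
      have S: "csubspace S" unfolding S_def csubspace_def by (simp add: proj_simps)
      have "c i \<in> S" if "i < k" for i
        using proj_basis[OF c(1), of i] c(2) that Suc.prems by (simp add: S_def)
      moreover have "x k \<in> S" using x Suc.prems by (simp add: S_def)
      ultimately obtain u where u: "u \<in> S" "orthonormal (Suc k) (c(k := u))" "proj (Suc k) (c(k := u)) (x k) = x k"
        using orthonormal_add_vector[OF ck S _ _ False] by blast
      have "proj d b ((c(k := u)) j) = (c(k := u)) j" if "j < Suc k" for j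
        using u(1) proj_basis[OF c(1), of j] c(2) that Suc.prems by (auto simp: S_def less_Suc_eq)
      then obtain c' where c': "orthonormal d c'" "\<And>i. i < Suc k \<Longrightarrow> c' i = (c(k := u)) i" "proj d c' = proj d b"
        using orthonormal_extend[OF b u(2)] by blast
      have "proj (Suc j) c' (x j) = x j" if "j < Suc k" for j
      proof (cases "j = k")
        case True
        have "proj (Suc k) c' (x k) = proj (Suc k) (c(k := u)) (x k)"
          unfolding proj_def using c'(2) by (intro sum.cong) auto
        then show ?thesis using u(3) True by simp
      next
        case False
        have "proj (Suc j) c' (x j) = proj (Suc j) c (x j)"
          unfolding proj_def using c'(2) that False by (intro sum.cong) auto
        then show ?thesis using c(3) that False by simp
      qed
      then show ?thesis using c' by blast
    qed
  qed
  from this[OF order_refl] show thesis using that by blast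
qed

text \<open>In a basis of values adapted to the columns the matrix is triangular, with diagonal
  entries at most the norms of the columns; the change of basis has determinant of modulus
  1.\<close>

lemma hadamard_inequality:
  assumes b: "orthonormal d b" and X: "\<And>j. j < d \<Longrightarrow> proj d b (X (b j)) = X (b j)"
  shows "cmod (det (dmat d b b X)) \<le> (\<Prod>j<d. norm (X (b j)))"
proof -
  obtain c where c: "orthonormal d c" "proj d c = proj d b" "\<And>j. j < d \<Longrightarrow> proj (Suc j) c (X (b j)) = X (b j)"
    using adapted_basis[OF b, of "\<lambda>j. X (b j)"] X by blast
  have "det (dmat d b b X) = det (dmat d c b (\<lambda>x. x)) * det (dmat d b c X)"
    using X c(2) by (intro det_dmat_comp[OF clin_id]) simp
  then have "cmod (det (dmat d b b X)) = cmod (det (dmat d b c X))"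
    using cmod_det_basis_change[OF c(1) b c(2)[symmetric]] by (simp add: norm_mult)
  also have "det (dmat d b c X) = (\<Prod>j<d. cinner (X (b j)) (c j))"
  proof (rule det_dmat_triangular)
    fix i j assume ij: "i < d" "j < i"
    then have "cinner (X (b j)) (c i) = (\<Sum>k<Suc j. cinner (X (b j)) (c k) * cinner (c k) (c i))"
      using c(3)[of j] cinner_proj_left[of "Suc j" c "X (b j)" "c i"] by simp
    also have "\<dots> = 0" using ij orthonormalD[OF c(1)] by (intro sum.neutral) auto
    finally show "cinner (X (b j)) (c i) = 0" .
  qed
  also have "cmod \<dots> \<le> (\<Prod>j<d. norm (X (b j)))"
    unfolding prod_norm[symmetric]
  proof (rule prod_mono, intro conjI)
    fix j assume "j \<in> {..<d}"
    then show "cmod (cinner (X (b j)) (c j)) \<le> norm (X (b j))"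
      using cauchy_schwarz[of "X (b j)" "c j"] orthonormal_norm[OF c(1)] by simp
  qed simp
  finally show ?thesis .
qed

text \<open>On the span, 1 - z (H + K) factors as 1 - z H times 1 - z (1 - z H)^(-1) K, with
  \<open>H\<close> and \<open>K\<close> compressed. The first determinant is explicit in the
  eigenvalues \<open>h\<close>. The second is at most the product of its column norms, and the
  resolvent of the Hermitian factor has norm at most 1 / c. Hadamard's inequality keeps the estimate
  in terms of \<open>norm (K (b j))\<close> for the prescribed basis \<open>b\<close>. The numbers
  \<open>\<alpha> j\<close> are the Schur diagonal of the compression of H + K.\<close>

lemma det_perturbation:
  fixes H K :: "'a::complex_inner \<Rightarrow> 'a"
  assumes b: "orthonormal d b" and H: "clin H" and K: "clin K"
    and sym: "\<And>x y. proj d b x = x \<Longrightarrow> proj d b y = y \<Longrightarrow> cinner (H x) y = cinner x (H y)"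
    and spec: "\<And>a x. proj d b x = x \<Longrightarrow> x \<noteq> 0 \<Longrightarrow> proj d b (H x + K x) = scaleC a x \<Longrightarrow> Q a"
  obtains \<alpha> h g where "\<And>j. j < d \<Longrightarrow> Q (\<alpha> j)" "orthonormal d g" "proj d g = proj d b"
    "\<And>k. k < d \<Longrightarrow> proj d b (H (g k)) = scaleC (of_real (h k)) (g k)"
    "\<And>z c. 0 < c \<Longrightarrow> (\<And>k. k < d \<Longrightarrow> c \<le> cmod (1 - z * of_real (h k))) \<Longrightarrow>
      (\<Prod>j<d. cmod (1 - z * \<alpha> j)) \<le> (\<Prod>k<d. cmod (1 - z * of_real (h k))) * (\<Prod>j<d. 1 + cmod z / c * norm (K (b j)))"
proof -
  let ?P = "proj d b"
  define A where "A x = ?P (H x + K x)" for x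
  have A: "clin A" unfolding A_def
    by (rule clinI) (simp_all add: clin_simps[OF H] clin_simps[OF K] proj_simps scaleC_add_right)
  have specA: "Q a" if "?P x = x" "x \<noteq> 0" "?P (A x) = scaleC a x" for a x
    using spec[OF that(1,2)] that(3) by (simp add: A_def proj_idem[OF b])
  obtain f where f: "orthonormal d f" "proj d f = ?P"
      "\<forall>i<d. \<forall>j<i. cinner (A (f j)) (f i) = 0" "\<forall>i<d. Q (cinner (A (f i)) (f i))"
    using schur_form[OF b A, of Q] specA by blast
  define \<alpha> where "\<alpha> i = cinner (A (f i)) (f i)" for i
  define HP where "HP x = ?P (H (?P x))" for x
  have HP: "herm_op d b HP"
    unfolding herm_op_def
  proof (intro conjI allI)
    show "clin HP" unfolding HP_def by (rule clinI) (simp_all add: proj_simps clin_simps[OF H])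
    show "cinner (HP x) y = cinner x (HP y)" for x y
      using sym proj_idem[OF b] by (simp add: HP_def proj_selfadjoint[of d b "H (?P x)"]
          proj_selfadjoint[of d b x, symmetric])
    show "?P (HP x) = HP x" for x by (simp add: HP_def proj_idem[OF b])
  qed
  obtain g where g: "orthonormal d g" "proj d g = ?P"
    "\<And>i. i < d \<Longrightarrow> HP (g i) = scaleC (of_real (Re (cinner (HP (g i)) (g i)))) (g i)"
    using herm_eigenbasis[OF b HP] by metis
  define h where "h i = Re (cinner (HP (g i)) (g i))" for i
  have Pg: "?P (g i) = g i" if "i < d" for i using proj_basis[OF g(1) that] g(2) by simp
  have HPg: "HP (g i) = scaleC (of_real (h i)) (g i)" if "i < d" for i using g(3)[OF that] by (simp add: h_def)
  have Hg: "?P (H (g i)) = scaleC (of_real (h i)) (g i)" if "i < d" for i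
    using HPg[OF that] by (simp add: HP_def Pg[OF that])
  have main: "(\<Prod>j<d. cmod (1 - z * \<alpha> j)) \<le> (\<Prod>k<d. cmod (1 - z * of_real (h k))) * (\<Prod>j<d. 1 + cmod z / c * norm (K (b j)))"
    if c: "0 < c" "\<And>k. k < d \<Longrightarrow> c \<le> cmod (1 - z * of_real (h k))" for z c
  proof -
    define Y where "Y x = x - scaleC z (HP x)" for x
    have Y: "clin Y" unfolding Y_def
      by (rule clinI) (simp_all add: clin_simps[OF herm_opD(1)[OF HP]] scaleC_add_right scaleC_diff_right
          scaleC_scaleC mult.commute)
    \<comment> \<open>The resolvent of the compressed \<open>H\<close> on the span, extended by zero
      to the orthogonal complement.\<close>
    define B where "B x = (\<Sum>k<d. scaleC (cinner x (g k) / (1 - z * of_real (h k))) (g k))" for x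
    define X where "X x = x - scaleC z (A x)" for x
    have X: "clin X" unfolding X_def
      by (rule clinI) (simp_all add: clin_simps[OF A] scaleC_add_right scaleC_diff_right scaleC_scaleC mult.commute)
    have PX: "?P (X x) = X x" if "?P x = x" for x
      using that by (simp add: X_def A_def proj_simps proj_idem[OF b])
    have PB: "?P (B x) = B x" for x
      unfolding B_def g(2)[symmetric] by (rule proj_comb[OF g(1)])
    have nz: "1 - z * of_real (h k) \<noteq> 0" if "k < d" for k using c(2)[OF that] c(1) by auto
    have YB: "Y (B x) = ?P x" for x
    proof -
      have Yg: "Y (g k) = scaleC (1 - z * of_real (h k)) (g k)" if "k < d" for k
        by (simp add: Y_def HPg[OF that] scaleC_scaleC scaleC_diff_left)
      have "Y (B x) = (\<Sum>k<d. scaleC (cinner x (g k) / (1 - z * of_real (h k))) (Y (g k)))"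
        by (simp only: B_def clin_simps[OF Y])
      also have "\<dots> = (\<Sum>k<d. scaleC (cinner x (g k)) (g k))"
        using nz by (intro sum.cong) (auto simp: Yg scaleC_scaleC)
      finally show ?thesis by (simp only: proj_def[symmetric] g(2))
    qed
    have nB: "norm (B x) \<le> norm x / c" for x
    proof -
      have "(norm (B x))\<^sup>2 = (\<Sum>k<d. (cmod (cinner (B x) (g k)))\<^sup>2)"
        using norm_proj_sq[OF g(1), of "B x"] PB g(2) by simp
      also have "\<dots> \<le> (\<Sum>k<d. (cmod (cinner x (g k)))\<^sup>2 / c\<^sup>2)"
      proof (rule sum_mono)
        fix k assume "k \<in> {..<d}"
        then have k: "k < d" by simp
        have "cmod (cinner (B x) (g k)) = cmod (cinner x (g k)) / cmod (1 - z * of_real (h k))"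
          unfolding B_def cinner_comb_basis[OF g(1) k] by (simp add: norm_divide)
        also have "\<dots> \<le> cmod (cinner x (g k)) / c"
          using c(1) c(2)[OF k] nz[OF k] by (intro divide_left_mono mult_pos_pos) auto
        finally have "(cmod (cinner (B x) (g k)))\<^sup>2 \<le> (cmod (cinner x (g k)) / c)\<^sup>2" by (intro power_mono) auto
        then show "(cmod (cinner (B x) (g k)))\<^sup>2 \<le> (cmod (cinner x (g k)))\<^sup>2 / c\<^sup>2" by (simp add: power_divide)
      qed
      also have "\<dots> \<le> (norm x)\<^sup>2 / c\<^sup>2"
        using bessel[OF g(1), of x] by (simp add: divide_right_mono flip: sum_divide_distrib)
      finally have "(norm (B x))\<^sup>2 \<le> (norm x / c)\<^sup>2" by (simp add: power_divide)
      then show ?thesis by (rule power2_le_imp_le) (use c(1) in simp)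
    qed
    \<comment> \<open>The second factor; on the span \<open>Y\<close> composed with \<open>Z\<close>
      is \<open>X\<close>.\<close>
    define Z where "Z x = x - scaleC z (B (K x))" for x
    have YZ: "Y (Z x) = X x" if "?P x = x" for x
    proof -
      have "Y (Z x) = Y x - scaleC z (?P (K x))" by (simp add: Z_def clin_simps[OF Y] YB)
      then show ?thesis
        using that by (simp add: X_def A_def Y_def HP_def proj_simps scaleC_add_right)
    qed
    have Pb: "?P (b j) = b j" if "j < d" for j by (rule proj_basis[OF b that])
    have "dmat d b b (\<lambda>x. Y (Z x)) = dmat d b b X"
      by (rule eq_matI) (auto simp: dmat_def YZ Pb)
    then have "det (dmat d b b X) = det (dmat d b b Y) * det (dmat d b b Z)"
      using det_dmat_comp[OF Y, of d b Z b b] by (simp add: Z_def proj_simps Pb PB)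
    moreover have "det (dmat d b b X) = (\<Prod>j<d. 1 - z * \<alpha> j)"
    proof -
      have "det (dmat d b b X) = det (dmat d f f X)"
        by (rule det_dmat_basis_independent[OF b f(1,2) X PX])
      also have "\<dots> = (\<Prod>j<d. cinner (X (f j)) (f j))"
        using f(3) orthonormalD[OF f(1)]
        by (intro det_dmat_triangular) (simp add: X_def cinner_diff_left cinner_scaleC_left)
      also have "\<dots> = (\<Prod>j<d. 1 - z * \<alpha> j)"
        using orthonormalD[OF f(1)]
        by (intro prod.cong) (auto simp: X_def \<alpha>_def cinner_diff_left cinner_scaleC_left)
      finally show ?thesis .
    qed
    moreover have "det (dmat d b b Y) = (\<Prod>k<d. 1 - z * of_real (h k))"
    proof -
      have "det (dmat d b b Y) = det (dmat d g g Y)"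
        by (rule det_dmat_basis_independent[OF b g(1,2) Y])
          (simp add: Y_def proj_simps herm_opD(3)[OF HP])
      also have "\<dots> = (\<Prod>j<d. cinner (Y (g j)) (g j))"
        using orthonormalD[OF g(1)]
        by (intro det_dmat_triangular) (simp add: Y_def HPg cinner_diff_left cinner_scaleC_left)
      also have "\<dots> = (\<Prod>k<d. 1 - z * of_real (h k))"
        using orthonormalD[OF g(1)]
        by (intro prod.cong) (auto simp: Y_def HPg cinner_diff_left cinner_scaleC_left)
      finally show ?thesis .
    qed
    moreover have "cmod (det (dmat d b b Z)) \<le> (\<Prod>j<d. 1 + cmod z / c * norm (K (b j)))"
    proof -
      have "cmod (det (dmat d b b Z)) \<le> (\<Prod>j<d. norm (Z (b j)))"
        by (rule hadamard_inequality[OF b]) (simp add: Z_def proj_simps Pb PB)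
      also have "\<dots> \<le> (\<Prod>j<d. 1 + cmod z / c * norm (K (b j)))"
      proof (rule prod_mono, intro conjI)
        fix j assume "j \<in> {..<d}"
        then have j: "j < d" by simp
        have "norm (Z (b j)) \<le> norm (b j) + norm (scaleC z (B (K (b j))))"
          unfolding Z_def by (rule norm_triangle_ineq4)
        also have "\<dots> \<le> 1 + cmod z * (norm (K (b j)) / c)"
          using mult_left_mono[OF nB[of "K (b j)"] norm_ge_zero[of z]]
          by (simp add: orthonormal_norm[OF b j] norm_scaleC)
        finally show "norm (Z (b j)) \<le> 1 + cmod z / c * norm (K (b j))" by simp
      qed simp
      finally show ?thesis .
    qed
    ultimately have "cmod (\<Prod>j<d. 1 - z * \<alpha> j) \<le> cmod (\<Prod>k<d. 1 - z * of_real (h k)) * (\<Prod>j<d. 1 + cmod z / c * norm (K (b j)))"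
      by (simp add: norm_mult mult_left_mono)
    then show ?thesis by (simp only: prod_norm)
  qed
  show thesis
    by (rule that[of \<alpha> g h]) (use f(4) \<alpha>_def g(1,2) Hg main in auto)
qed

text \<open>Each \<open>v i\<close> is an eigenvector of the compression as well, with eigenvalue at
  least \<open>t\<close>, hence orthogonal to every \<open>g k\<close> with \<open>h k < t\<close>.
  All its mass lies on the remaining \<open>g k\<close>, and by Bessel's inequality each of these
  can carry mass at most 1 from the family \<open>v\<close>.\<close>

lemma eigenvector_count_le:
  assumes b: "orthonormal d b" and H: "clin H"
    and sym: "\<And>x y. proj d b x = x \<Longrightarrow> proj d b y = y \<Longrightarrow> cinner (H x) y = cinner x (H y)"
    and g: "orthonormal d g" "proj d g = proj d b"
    and h: "\<And>k. k < d \<Longrightarrow> proj d b (H (g k)) = scaleC (of_real (h k)) (g k)"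
    and v: "orthonormal n v" "\<And>i. i < n \<Longrightarrow> proj d b (v i) = v i"
    and \<mu>: "\<And>i. i < n \<Longrightarrow> H (v i) = scaleC (of_real (\<mu> i)) (v i)" "\<And>i. i < n \<Longrightarrow> t \<le> \<mu> i"
  shows "n \<le> card {k. k < d \<and> t \<le> h k}"
proof -
  have Pg: "proj d b (g i) = g i" if "i < d" for i using proj_basis[OF g(1) that] g(2) by simp
  have orth: "cinner (v i) (g k) = 0" if "i < n" "k < d" "\<not> t \<le> h k" for i k
  proof -
    have "of_real (\<mu> i) * cinner (v i) (g k) = cinner (H (v i)) (g k)"
      using \<mu>(1) that by (simp add: cinner_scaleC_left)
    also have "\<dots> = cinner (v i) (proj d b (H (g k)))"
      using sym[of "v i" "g k"] v(2) Pg that by (simp flip: proj_selfadjoint)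
    also have "\<dots> = of_real (h k) * cinner (v i) (g k)" using h that by (simp add: cinner_scaleC_right)
    finally show ?thesis using \<mu>(2)[of i] that by auto
  qed
  let ?K = "{k. k < d \<and> t \<le> h k}"
  have one: "(\<Sum>k\<in>?K. (cmod (cinner (v i) (g k)))\<^sup>2) = 1" if "i < n" for i
  proof -
    have "(\<Sum>k\<in>?K. (cmod (cinner (v i) (g k)))\<^sup>2) = (\<Sum>k<d. (cmod (cinner (v i) (g k)))\<^sup>2)"
      using orth that by (intro sum.mono_neutral_left) auto
    also have "\<dots> = (norm (proj d g (v i)))\<^sup>2" by (rule norm_proj_sq[OF g(1), symmetric])
    finally show ?thesis using v(2)[OF that] g(2) orthonormal_norm[OF v(1) that] by simp
  qed
  have sw: "cmod (cinner x y) = cmod (cinner y x)" for x y :: 'a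
    by (metis cinner_commute complex_mod_cnj)
  have "real n = (\<Sum>i<n. \<Sum>k\<in>?K. (cmod (cinner (v i) (g k)))\<^sup>2)" by (simp add: one)
  also have "\<dots> = (\<Sum>k\<in>?K. \<Sum>i<n. (cmod (cinner (g k) (v i)))\<^sup>2)"
    by (subst sum.swap) (simp add: sw)
  also have "\<dots> \<le> (\<Sum>k\<in>?K. 1)"
  proof (rule sum_mono)
    fix k assume "k \<in> ?K"
    then show "(\<Sum>i<n. (cmod (cinner (g k) (v i)))\<^sup>2) \<le> 1"
      using bessel[OF v(1), of "g k"] orthonormal_norm[OF g(1)] by simp
  qed
  finally show ?thesis by simp
qed

section \<open>A measure on the slit disc\<close>

text \<open>The integrands below need not be continuous, or even bounded, at the left endpoint,
  which is a null set.\<close>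

lemma integrable_dominated_at_0:
  fixes f g :: "real \<Rightarrow> real"
  assumes "continuous_on {0<..b} f" "\<And>x. x \<in> {0<..b} \<Longrightarrow> \<bar>f x\<bar> \<le> g x" "g integrable_on {0..b}"
  shows "f integrable_on {0..b}"
proof -
  have n1: "negligible {x \<in> {0..b} - {0<..b}. h x \<noteq> 0}" for h :: "real \<Rightarrow> real"
    by (rule negligible_subset[of "{0}"]) auto
  have n2: "negligible {x \<in> {0<..b} - {0..b}. h x \<noteq> 0}" for h :: "real \<Rightarrow> real"
    by (rule negligible_subset[of "{}"]) auto
  have "g integrable_on {0<..b}" using integrable_spike_set[OF assms(3) n1 n2] .
  moreover have "f \<in> borel_measurable (lebesgue_on {0<..b})"
    by (rule continuous_imp_measurable_on_sets_lebesgue[OF assms(1)]) simp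
  ultimately have "f integrable_on {0<..b}"
    using assms(2) by (intro measurable_bounded_by_integrable_imp_integrable[of f _ g]) auto
  then show ?thesis using integrable_spike_set[OF _ n2 n1] by blast
qed

lemma abs_ln_le:
  fixes y :: real
  assumes "0 < m" "m \<le> 1" "m \<le> y"
  shows "\<bar>ln y\<bar> \<le> \<bar>y - 1\<bar> / m"
proof (cases "1 \<le> y")
  case True
  have "ln y \<le> y - 1" using True by (intro ln_le_minus_one) simp
  also have "\<dots> \<le> (y - 1) / m" using mult_left_mono[of m 1 "y - 1"] assms True by (simp add: pos_le_divide_eq)
  finally show ?thesis using True by simp
next
  case False
  have y: "0 < y" using assms by linarith
  have "ln (1 / y) \<le> 1 / y - 1" using y by (intro ln_le_minus_one) simp
  then have "- ln y \<le> (1 - y) / y" using y by (simp add: ln_div field_simps)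
  also have "\<dots> \<le> (1 - y) / m" using assms y False by (intro divide_left_mono) auto
  finally show ?thesis using False y by (simp add: ln_le_zero_iff abs_if)
qed

lemma cmod_one_minus_cis: "(cmod (1 - of_real h * cis s))\<^sup>2 = 1 - 2 * h * cos s + h\<^sup>2"
proof -
  have "(cmod (1 - of_real h * cis s))\<^sup>2 = (1 - h * cos s)\<^sup>2 + (h * sin s)\<^sup>2"
    by (simp add: cmod_power2)
  then show ?thesis by (simp add: power_mult_distrib sin_squared_eq power2_diff algebra_simps)
qed

text \<open>The right-hand side is (1 + h)^2 sin^2 (s/2) + (1 - h)^2 cos^2 (s/2). Hence the point 1
  has distance at least |sin (s/2)| from the whole ray with argument s, uniformly in
  \<open>h\<close>.\<close>

lemma quadratic_cos_lower:
  fixes h s :: real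
  assumes "0 \<le> h"
  shows "(1 - cos s) / 2 \<le> 1 - 2 * h * cos s + h\<^sup>2"
proof -
  have c: "0 \<le> (1 - cos s) / 2" by simp
  have *: "0 \<le> 1 + x" if "- 1 \<le> x" for x :: real using that by linarith
  have "0 \<le> 1 + cos s" by (rule *[OF cos_ge_minus_one])
  then have c': "0 \<le> (1 + cos s) / 2" by (intro divide_nonneg_nonneg) auto
  have "0 \<le> (1 - cos s) / 2 * (2 * h + h\<^sup>2) + (1 + cos s) / 2 * (1 - h)\<^sup>2"
    using assms by (intro add_nonneg_nonneg mult_nonneg_nonneg c c') auto
  also have "\<dots> = 1 - 2 * h * cos s + h\<^sup>2 - (1 - cos s) / 2"
    by (simp add: power2_eq_square field_simps)
  finally show ?thesis by simp
qed

text \<open>Adding the value at the conjugate point accounts for the lower half of the disc: the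
  measure then lives on the upper half only, and the expansion involves only real parts of powers of
  \<open>z\<close>.\<close>

definition Lg :: "complex \<Rightarrow> complex \<Rightarrow> real" where
  "Lg \<beta> z = ln (cmod (1 - \<beta> * z)) + ln (cmod (1 - \<beta> * cnj z))"

lemma Lg_of_real: "Lg (of_real h) (of_real x * cis s) = ln (1 - 2 * (h * x) * cos s + (h * x)\<^sup>2)"
  if "1 - 2 * (h * x) * cos s + (h * x)\<^sup>2 > 0"
proof -
  have 1: "(cmod (1 - of_real h * (of_real x * cis s)))\<^sup>2 = 1 - 2 * (h * x) * cos s + (h * x)\<^sup>2"
    using cmod_one_minus_cis[of "h * x" s] by (simp add: mult.assoc)
  have 2: "cmod (1 - of_real h * cnj (of_real x * cis s)) = cmod (1 - of_real h * (of_real x * cis s))"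
    using complex_mod_cnj[of "1 - of_real h * (of_real x * cis s)"] by simp
  have "0 < cmod (1 - of_real h * (of_real x * cis s))"
    using 1 that by (metis norm_ge_zero order_le_less zero_power2 less_irrefl)
  then show ?thesis
    unfolding Lg_def 2 1[symmetric] by (simp add: ln_realpow)
qed

lemma Lg_series:
  assumes "cmod \<beta> < 1" "cmod z \<le> 1"
  shows "(\<lambda>n. - (2 / real (Suc n)) * Re (\<beta> ^ Suc n) * Re (z ^ Suc n)) sums Lg \<beta> z"
proof -
  have *: "(\<lambda>n. - (Re ((\<beta> * z) ^ Suc n) / real (Suc n))) sums ln (cmod (1 - \<beta> * z))" if "cmod z \<le> 1" for z
  proof -
    have "cmod (\<beta> * z) \<le> cmod \<beta> * 1" unfolding norm_mult using that by (intro mult_left_mono) auto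
    then have lt: "cmod (- (\<beta> * z)) < 1" using assms(1) by simp
    have "(\<lambda>n. - ((- (- (\<beta> * z))) ^ n) / of_nat n) sums ln (1 + - (\<beta> * z))"
      by (rule Ln_series'[OF lt])
    then have "(\<lambda>n. Re (- ((\<beta> * z) ^ n) / of_nat n)) sums Re (Ln (1 - \<beta> * z))"
      using bounded_linear.sums[OF bounded_linear_Re] by fastforce
    moreover have "1 - \<beta> * z \<noteq> 0" using lt by auto
    ultimately have "(\<lambda>n. Re (- ((\<beta> * z) ^ n) / of_nat n)) sums ln (cmod (1 - \<beta> * z))" by simp
    then have "(\<lambda>n. Re (- ((\<beta> * z) ^ Suc n) / of_nat (Suc n))) sums ln (cmod (1 - \<beta> * z))"
      by (subst sums_Suc_iff) simp
    moreover have "Re (- ((\<beta> * z) ^ Suc n) / of_nat (Suc n)) = - (Re ((\<beta> * z) ^ Suc n) / real (Suc n))" for n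
      using Re_divide_of_nat[of "- ((\<beta> * z) ^ Suc n)" "Suc n"] by simp
    ultimately show ?thesis by simp
  qed
  have "(\<lambda>n. - (Re ((\<beta> * z) ^ Suc n) / real (Suc n)) + - (Re ((\<beta> * cnj z) ^ Suc n) / real (Suc n)))
    sums Lg \<beta> z"
    unfolding Lg_def using assms(2) by (intro sums_add *) auto
  moreover have "- (Re ((\<beta> * z) ^ Suc n) / real (Suc n)) + - (Re ((\<beta> * cnj z) ^ Suc n) / real (Suc n))
    = - (2 / real (Suc n)) * Re (\<beta> ^ Suc n) * Re (z ^ Suc n)" for n
  proof -
    have "Re ((\<beta> * z) ^ Suc n) + Re ((\<beta> * cnj z) ^ Suc n) = Re (\<beta> ^ Suc n * (z ^ Suc n + cnj (z ^ Suc n)))"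
      by (simp only: power_mult_distrib distrib_left complex_cnj_power plus_complex.sel)
    also have "z ^ Suc n + cnj (z ^ Suc n) = of_real (2 * Re (z ^ Suc n))" by (rule complex_add_cnj)
    also have "Re (\<beta> ^ Suc n * of_real (2 * Re (z ^ Suc n))) = 2 * Re (\<beta> ^ Suc n) * Re (z ^ Suc n)"
      by (simp only: Re_complex_of_real Im_complex_of_real times_complex.sel)
    finally have "Re ((\<beta> * z) ^ Suc n) + Re ((\<beta> * cnj z) ^ Suc n) = 2 * Re (\<beta> ^ Suc n) * Re (z ^ Suc n)" .
    moreover have "x + y = 2 * a * b \<Longrightarrow> - (x / r) + - (y / r) = - (2 / r) * a * b" for x y a b r :: real
      by (metis add_divide_distrib minus_add_distrib mult.commute mult_minus_left times_divide_eq_left times_divide_eq_right)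
    ultimately show ?thesis by blast
  qed
  ultimately show ?thesis by (simp only:)
qed

text \<open>The factor \<open>cmod z\<close> matters: the ray density is not integrable at the
  origin, but its product with the modulus is, which permits dominated convergence there.\<close>

lemma Lg_partial_sum_le:
  assumes "cmod \<beta> < 1" "cmod z \<le> 1"
  shows "\<bar>\<Sum>n<N. - (2 / real (Suc n)) * Re (\<beta> ^ Suc n) * Re (z ^ Suc n)\<bar> \<le> 2 / (1 - cmod \<beta>) * cmod z"
proof -
  have "\<bar>\<Sum>n<N. - (2 / real (Suc n)) * Re (\<beta> ^ Suc n) * Re (z ^ Suc n)\<bar>
    \<le> (\<Sum>n<N. 2 * cmod \<beta> ^ n * cmod z)"
  proof (rule order_trans[OF sum_abs sum_mono])
    fix n
    have "\<bar>Re (\<beta> ^ Suc n)\<bar> \<le> cmod \<beta> ^ n"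
      using abs_Re_le_cmod[of "\<beta> ^ Suc n"] assms(1) power_decreasing[of n "Suc n" "cmod \<beta>"]
      by (simp add: norm_power norm_mult)
    moreover have "\<bar>Re (z ^ Suc n)\<bar> \<le> cmod z"
      using abs_Re_le_cmod[of "z ^ Suc n"] assms(2) power_decreasing[of 1 "Suc n" "cmod z"]
      by (simp add: norm_power norm_mult)
    moreover have "\<bar>2 / real (Suc n)\<bar> \<le> 2" by (simp add: field_simps)
    ultimately have "\<bar>2 / real (Suc n)\<bar> * \<bar>Re (\<beta> ^ Suc n)\<bar> * \<bar>Re (z ^ Suc n)\<bar> \<le> 2 * cmod \<beta> ^ n * cmod z"
      by (intro mult_mono) auto
    then show "\<bar>- (2 / real (Suc n)) * Re (\<beta> ^ Suc n) * Re (z ^ Suc n)\<bar> \<le> 2 * cmod \<beta> ^ n * cmod z"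
      by (simp only: abs_mult abs_minus_cancel)
  qed
  also have "\<dots> = 2 * cmod z * (\<Sum>n<N. cmod \<beta> ^ n)" by (simp add: sum_distrib_left mult_ac)
  also have "(\<Sum>n<N. cmod \<beta> ^ n) \<le> 1 / (1 - cmod \<beta>)"
    using assms(1) sum_le_suminf[of "\<lambda>n. cmod \<beta> ^ n" "{..<N}"] by (simp add: suminf_geometric)
  then have "2 * cmod z * (\<Sum>n<N. cmod \<beta> ^ n) \<le> 2 * cmod z * (1 / (1 - cmod \<beta>))"
    by (intro mult_left_mono) auto
  finally show ?thesis by (simp only: times_divide_eq_right times_divide_eq_left mult_1_right mult.commute mult.left_commute)
qed

text \<open>The measure of the determinant argument, on the upper half of the closed disc: density \<open>\<kappa> g\<close> on the unit
  circle and \<open>M w\<close> on the ray with argument \<open>s1\<close>. Here \<open>w x\<close> is the derivative, up to sign and a constant,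
  of \<open>cosh (\<kappa> ln x)\<close>, whose moments \<open>\<kappa> / (n\<^sup>2 - \<kappa>\<^sup>2)\<close> are those of a piecewise trigonometric density \<open>g\<close> of
  frequency \<open>\<kappa>\<close> with a corner at \<open>s1\<close>. The bound on \<open>s1\<close> makes \<open>c1\<close> and hence \<open>g\<close> positive, and it can be
  met only for \<open>\<kappa> > 1/2\<close>.\<close>

locale slit =
  fixes \<kappa> s1 :: real
  assumes kappa: "1/2 < \<kappa>" "\<kappa> < 1" and s1: "0 < s1" "s1 < pi - pi / (2 * \<kappa>)"
begin

definition "c1 = - cos (\<kappa> * (pi - s1))"
definition "c2 = cos (\<kappa> * s1)"
definition "M = \<kappa> * sin (\<kappa> * pi)"
text \<open>\<open>min\<close> and \<open>max\<close> merge the two branches, spelled out in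
  \<open>g_le\<close> and \<open>g_ge\<close>, into one expression whose continuity is
  evident.\<close>

definition "g s = c1 - c1 * cos (\<kappa> * min s s1) + c2 * (cos (\<kappa> * (pi - max s s1)) + c1)"
definition "w x = (x powr (- \<kappa> - 1) - x powr (\<kappa> - 1)) / 2"
text \<open>The square of sin (s1/2), hence a lower bound for the squared modulus of 1 - X cis s1
  for all X \<ge> 0.\<close>

definition "m1 = (1 - cos s1) / 2"
text \<open>The logarithm of the modulus of 1 - X cis s1.\<close>

definition "\<l> X = ln (1 - 2 * X * cos s1 + X\<^sup>2) / 2"

section \<open>Sign and size of the density on the circle\<close>

lemma s1_range: "s1 < pi / 2" "s1 < pi" "pi / 2 < \<kappa> * (pi - s1)" "\<kappa> * (pi - s1) < pi" "\<kappa> * s1 < pi / 2" "0 < \<kappa> * s1"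
proof -
  have "pi / 2 * (2 * \<kappa>) < pi / 2 * 2" using kappa by (intro mult_strict_left_mono) auto
  then have "pi / 2 < pi / (2 * \<kappa>)" using kappa by (simp add: field_simps)
  then show 1: "s1 < pi / 2" using s1 by linarith
  then show "s1 < pi" using pi_gt_zero by linarith
  have "\<kappa> * s1 < \<kappa> * (pi - pi / (2 * \<kappa>))" using s1 kappa by (intro mult_strict_left_mono) auto
  also have "\<dots> = \<kappa> * pi - pi / 2" using kappa by (simp add: field_simps)
  finally have 2: "\<kappa> * s1 < \<kappa> * pi - pi / 2" .
  then show "pi / 2 < \<kappa> * (pi - s1)" by (simp add: algebra_simps)
  have "\<kappa> * pi < 1 * pi" using kappa by (intro mult_strict_right_mono) auto
  then show "\<kappa> * s1 < pi / 2" using 2 by linarith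
  show 3: "0 < \<kappa> * s1" using kappa s1 by simp
  show "\<kappa> * (pi - s1) < pi" using 3 \<open>\<kappa> * pi < 1 * pi\<close> by (simp only: right_diff_distrib)
qed

lemma constants_pos: "0 < c1" "c1 \<le> 1" "0 < c2" "c2 \<le> 1" "0 < M" "0 < m1" "m1 \<le> 1"
proof -
  have "cos (\<kappa> * (pi - s1)) = - sin (\<kappa> * (pi - s1) - pi / 2)" by (simp add: sin_diff)
  moreover have "0 < sin (\<kappa> * (pi - s1) - pi / 2)"
    using s1_range by (intro sin_gt_zero) auto
  ultimately show "0 < c1" by (simp add: c1_def)
  show "c1 \<le> 1" using cos_ge_minus_one[of "\<kappa> * (pi - s1)"] by (simp add: c1_def)
  show "0 < c2" unfolding c2_def using s1_range by (intro cos_gt_zero) auto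
  show "c2 \<le> 1" by (simp add: c2_def)
  have "0 < sin (\<kappa> * pi)" using kappa by (intro sin_gt_zero) auto
  then show "0 < M" using kappa by (simp add: M_def)
  have "cos s1 < cos 0" using s1 s1_range by (intro cos_monotone_0_pi) auto
  then show "0 < m1" by (simp add: m1_def)
  show "m1 \<le> 1" using cos_ge_minus_one[of s1] by (simp add: m1_def)
qed

lemma g_le: "s \<le> s1 \<Longrightarrow> g s = c1 * (1 - cos (\<kappa> * s))"
  by (simp add: g_def c1_def algebra_simps)

lemma g_ge: "s1 \<le> s \<Longrightarrow> g s = c1 + c2 * cos (\<kappa> * (pi - s))"
  by (simp add: g_def c2_def[symmetric] algebra_simps)

lemma g_cont: "continuous_on A g"
  unfolding g_def by (intro continuous_intros)

lemma g_nonneg: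
  assumes "0 \<le> s" "s \<le> pi"
  shows "0 \<le> g s"
proof (cases "s \<le> s1")
  case True
  then show ?thesis using constants_pos by (simp add: g_le)
next
  case False
  have "cos (\<kappa> * (pi - s1)) \<le> cos (\<kappa> * (pi - s))"
    using False assms s1_range kappa by (intro cos_monotone_0_pi_le mult_left_mono) auto
  then have "- c1 \<le> cos (\<kappa> * (pi - s))" by (simp add: c1_def)
  then have "c2 * (- c1) \<le> c2 * cos (\<kappa> * (pi - s))" using constants_pos by (intro mult_left_mono) auto
  moreover have "c2 * c1 \<le> 1 * c1" using constants_pos by (intro mult_right_mono) auto
  ultimately show ?thesis using False by (simp add: g_ge)
qed

definition "Kg = 2 / (1 - cos s1)"

text \<open>Up to \<open>s1\<close> this is \<open>1 - cos (\<kappa> * s) \<le> 1 - cos s\<close>,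
  as \<open>\<kappa> < 1\<close>; beyond \<open>s1\<close> the density is at most 2, which the
  constant \<open>Kg\<close> absorbs. The second-order zero at 0 tames every singularity that the
  integrands have at the point 1.\<close>

lemma g_upper:
  assumes "0 \<le> s" "s \<le> pi"
  shows "g s \<le> Kg * (1 - cos s)"
proof (cases "s \<le> s1")
  case True
  have "cos s \<le> cos (\<kappa> * s)"
    using assms kappa by (intro cos_monotone_0_pi_le) (auto intro: mult_left_le_one_le)
  then have 1: "g s \<le> 1 * (1 - cos s)"
    unfolding g_le[OF True] using constants_pos by (intro mult_mono) auto
  moreover have "0 < 1 - cos s1" using constants_pos(6) by (simp add: m1_def)
  moreover have "1 - cos s1 \<le> 2" using cos_ge_minus_one[of s1] by linarith
  ultimately have "1 \<le> Kg" unfolding Kg_def by (subst pos_le_divide_eq) auto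
  then have "1 * (1 - cos s) \<le> Kg * (1 - cos s)" by (intro mult_right_mono) auto
  with 1 show ?thesis by linarith
next
  case False
  have "cos s \<le> cos s1" using False assms s1 by (intro cos_monotone_0_pi_le) auto
  then have "2 \<le> Kg * (1 - cos s)"
    using constants_pos(6) by (simp add: Kg_def m1_def field_simps)
  moreover have "c2 * cos (\<kappa> * (pi - s)) \<le> c2 * 1"
    using constants_pos by (intro mult_left_mono) auto
  then have "c2 * cos (\<kappa> * (pi - s)) \<le> 1" using constants_pos(4) by (rule_tac order_trans) auto
  then have "c1 + c2 * cos (\<kappa> * (pi - s)) \<le> 1 + 1" by (rule add_mono[OF constants_pos(2)])
  then have "g s \<le> 2" using False by (simp add: g_ge)
  ultimately show ?thesis by (rule_tac order_trans)
qed

section \<open>Moments of the two densities\<close>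

lemma circle_integrable:
  "continuous_on {0..pi} f \<Longrightarrow> (\<lambda>s. g s * f s :: real) integrable_on {0..pi}"
  by (intro integrable_continuous_interval continuous_intros g_cont)

text \<open>Both branches have elementary primitives, which vanish at 0 and at pi respectively, so
  the whole moment is the jump between the primitives at the corner \<open>s1\<close>.\<close>

lemma circle_moment:
  assumes n: "1 \<le> n"
  shows "((\<lambda>s. g s * cos (real n * s)) has_integral - M * cos (real n * s1) / ((real n)\<^sup>2 - \<kappa>\<^sup>2)) {0..pi}"
proof -
  let ?n = "real n"
  define D where "D = ?n\<^sup>2 - \<kappa>\<^sup>2"
  have "\<kappa>\<^sup>2 < ?n\<^sup>2" using n kappa by (intro power_strict_mono) auto
  then have D: "D \<noteq> 0" by (simp add: D_def)
  \<comment> \<open>The reciprocals are named, with their defining equations, so that the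
    verification of the derivatives stays polynomial.\<close>
  define iD where "iD = 1 / D"
  define k where "k = 1 / ?n"
  have kn: "k * ?n = 1" and iDD: "iD * D = 1" using n D by (auto simp: k_def iD_def)
  define F1 where "F1 s = c1 * (sin (?n * s) * k
    - (?n * sin (?n * s) * cos (\<kappa> * s) - \<kappa> * cos (?n * s) * sin (\<kappa> * s)) * iD)" for s
  define F2 where "F2 s = c1 * (sin (?n * s) * k)
    + c2 * ((?n * sin (?n * s) * cos (\<kappa> * (pi - s)) + \<kappa> * cos (?n * s) * sin (\<kappa> * (pi - s))) * iD)" for s
  have d1: "(F1 has_real_derivative c1 * (1 - cos (\<kappa> * s)) * cos (?n * s)) (at s within A)" for s A
  proof -
    have "(F1 has_real_derivative c1 * (cos (?n * s) * ?n * k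
      - (?n\<^sup>2 * cos (?n * s) * cos (\<kappa> * s) - \<kappa>\<^sup>2 * cos (?n * s) * cos (\<kappa> * s)) * iD)) (at s within A)"
      unfolding F1_def by (rule derivative_eq_intros refl)+ (simp add: power2_eq_square algebra_simps)
    moreover have "c1 * (cos (?n * s) * ?n * k
      - (?n\<^sup>2 * cos (?n * s) * cos (\<kappa> * s) - \<kappa>\<^sup>2 * cos (?n * s) * cos (\<kappa> * s)) * iD)
      = c1 * (cos (?n * s) * (k * ?n) - (iD * D) * (cos (?n * s) * cos (\<kappa> * s)))"
      by (simp add: D_def algebra_simps)
    moreover have "c1 * (cos (?n * s) * (k * ?n) - (iD * D) * (cos (?n * s) * cos (\<kappa> * s)))
      = c1 * (1 - cos (\<kappa> * s)) * cos (?n * s)"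
      by (simp only: kn iDD) (simp add: algebra_simps)
    ultimately show ?thesis by (simp only:)
  qed
  have d2: "(F2 has_real_derivative (c1 + c2 * cos (\<kappa> * (pi - s))) * cos (?n * s)) (at s within A)" for s A
  proof -
    have "(F2 has_real_derivative c1 * (cos (?n * s) * ?n * k)
      + c2 * ((?n\<^sup>2 * cos (?n * s) * cos (\<kappa> * (pi - s)) - \<kappa>\<^sup>2 * cos (?n * s) * cos (\<kappa> * (pi - s))) * iD)) (at s within A)"
      unfolding F2_def by (rule derivative_eq_intros refl)+ (simp add: power2_eq_square algebra_simps)
    moreover have "c1 * (cos (?n * s) * ?n * k)
      + c2 * ((?n\<^sup>2 * cos (?n * s) * cos (\<kappa> * (pi - s)) - \<kappa>\<^sup>2 * cos (?n * s) * cos (\<kappa> * (pi - s))) * iD)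
      = c1 * (cos (?n * s) * (k * ?n)) + c2 * (iD * D) * (cos (?n * s) * cos (\<kappa> * (pi - s)))"
      by (simp add: D_def algebra_simps)
    moreover have "c1 * (cos (?n * s) * (k * ?n)) + c2 * (iD * D) * (cos (?n * s) * cos (\<kappa> * (pi - s)))
      = (c1 + c2 * cos (\<kappa> * (pi - s))) * cos (?n * s)"
      by (simp only: kn iDD) (simp add: algebra_simps)
    ultimately show ?thesis by (simp only:)
  qed
  have "((\<lambda>s. c1 * (1 - cos (\<kappa> * s)) * cos (?n * s)) has_integral F1 s1 - F1 0) {0..s1}"
    using s1 d1 by (intro fundamental_theorem_of_calculus) (auto simp: has_real_derivative_iff_has_vector_derivative[symmetric])
  then have i1: "((\<lambda>s. g s * cos (?n * s)) has_integral F1 s1 - F1 0) {0..s1}"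
    by (rule has_integral_eq[rotated]) (simp add: g_le)
  have "((\<lambda>s. (c1 + c2 * cos (\<kappa> * (pi - s))) * cos (?n * s)) has_integral F2 pi - F2 s1) {s1..pi}"
    using s1_range d2 by (intro fundamental_theorem_of_calculus) (auto simp: has_real_derivative_iff_has_vector_derivative[symmetric])
  then have i2: "((\<lambda>s. g s * cos (?n * s)) has_integral F2 pi - F2 s1) {s1..pi}"
    by (rule has_integral_eq[rotated]) (simp add: g_ge)
  have "((\<lambda>s. g s * cos (?n * s)) has_integral (F1 s1 - F1 0) + (F2 pi - F2 s1)) {0..pi}"
    using s1 s1_range by (intro has_integral_combine[OF _ _ i1 i2]) auto
  moreover have "F1 0 = 0" "F2 pi = 0" by (simp_all add: F1_def F2_def)
  \<comment> \<open>The terms with \<open>sin (?n * s1)\<close> cancel because the branches meet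
    continuously, and the addition theorem combines the rest into
    \<open>sin (\<kappa> * pi)\<close>, whence \<open>M\<close>.\<close>
  moreover have "F1 s1 - F2 s1 = - M * cos (?n * s1) / D"
  proof -
    have "sin (\<kappa> * pi) = sin (\<kappa> * s1 + \<kappa> * (pi - s1))" by (simp add: algebra_simps)
    then have *: "sin (\<kappa> * pi) = sin (\<kappa> * s1) * (- c1) + c2 * sin (\<kappa> * (pi - s1))"
      by (simp only: sin_add c1_def c2_def minus_minus)
    have "F1 s1 - F2 s1 = - (c1 * (?n * sin (?n * s1) * c2 - \<kappa> * cos (?n * s1) * sin (\<kappa> * s1))
      + c2 * (?n * sin (?n * s1) * (- c1) + \<kappa> * cos (?n * s1) * sin (\<kappa> * (pi - s1)))) * iD"
      unfolding F1_def F2_def by (simp add: c2_def c1_def algebra_simps)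
    also have "c1 * (?n * sin (?n * s1) * c2 - \<kappa> * cos (?n * s1) * sin (\<kappa> * s1))
      + c2 * (?n * sin (?n * s1) * (- c1) + \<kappa> * cos (?n * s1) * sin (\<kappa> * (pi - s1)))
      = \<kappa> * cos (?n * s1) * (sin (\<kappa> * s1) * (- c1) + c2 * sin (\<kappa> * (pi - s1)))"
      by (simp add: algebra_simps)
    also have "- (\<kappa> * cos (?n * s1) * (sin (\<kappa> * s1) * (- c1) + c2 * sin (\<kappa> * (pi - s1)))) * iD
      = - M * cos (?n * s1) / D"
      unfolding *[symmetric] M_def iD_def by simp
    finally show ?thesis .
  qed
  ultimately show ?thesis by (simp add: D_def)
qed

text \<open>The formula of \<open>circle_moment\<close> read at n = 0, plus the mass
  \<open>pi * c1\<close> of the constant part of \<open>g\<close>, which the moments of positive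
  order do not see.\<close>

lemma circle_mass: "(g has_integral pi * c1 + M / \<kappa>\<^sup>2) {0..pi}"
proof -
  define F1 where "F1 s = c1 * (s - sin (\<kappa> * s) / \<kappa>)" for s
  define F2 where "F2 s = c1 * s - c2 * (sin (\<kappa> * (pi - s)) / \<kappa>)" for s
  have k: "\<kappa> \<noteq> 0" using kappa by simp
  have d1: "(F1 has_real_derivative c1 * (1 - cos (\<kappa> * s))) (at s within A)" for s A
    unfolding F1_def using k by (auto intro!: derivative_eq_intros)
  have d2: "(F2 has_real_derivative c1 + c2 * cos (\<kappa> * (pi - s))) (at s within A)" for s A
    unfolding F2_def using k by (auto intro!: derivative_eq_intros)
  have "((\<lambda>s. c1 * (1 - cos (\<kappa> * s))) has_integral F1 s1 - F1 0) {0..s1}"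
    using s1 d1 by (intro fundamental_theorem_of_calculus) (auto simp: has_real_derivative_iff_has_vector_derivative[symmetric])
  then have i1: "(g has_integral F1 s1 - F1 0) {0..s1}"
    by (rule has_integral_eq[rotated]) (simp add: g_le)
  have "((\<lambda>s. c1 + c2 * cos (\<kappa> * (pi - s))) has_integral F2 pi - F2 s1) {s1..pi}"
    using s1_range d2 by (intro fundamental_theorem_of_calculus) (auto simp: has_real_derivative_iff_has_vector_derivative[symmetric])
  then have i2: "(g has_integral F2 pi - F2 s1) {s1..pi}"
    by (rule has_integral_eq[rotated]) (simp add: g_ge)
  have "(g has_integral (F1 s1 - F1 0) + (F2 pi - F2 s1)) {0..pi}"
    using s1 s1_range by (intro has_integral_combine[OF _ _ i1 i2]) auto
  moreover have "(F1 s1 - F1 0) + (F2 pi - F2 s1) = pi * c1 + M / \<kappa>\<^sup>2"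
  proof -
    have "sin (\<kappa> * pi) = sin (\<kappa> * s1 + \<kappa> * (pi - s1))" by (simp add: algebra_simps)
    then have *: "sin (\<kappa> * pi) = sin (\<kappa> * s1) * (- c1) + c2 * sin (\<kappa> * (pi - s1))"
      by (simp only: sin_add c1_def c2_def minus_minus)
    show ?thesis unfolding M_def * F1_def F2_def using k
      by (simp add: field_simps power2_eq_square)
  qed
  ultimately show ?thesis by simp
qed

lemma w_nonneg: "0 \<le> x \<Longrightarrow> x \<le> 1 \<Longrightarrow> 0 \<le> w x"
proof -
  assume x: "0 \<le> x" "x \<le> 1"
  have "x powr (\<kappa> - 1) \<le> x powr (- \<kappa> - 1)"
    using x kappa by (cases "x = 0") (auto intro!: powr_mono')
  then show ?thesis by (simp add: w_def)
qed

lemma w_moment: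
  assumes p: "\<kappa> < p"
  shows "((\<lambda>x. w x * x powr p) has_integral \<kappa> / (p\<^sup>2 - \<kappa>\<^sup>2)) {0..1}"
proof -
  have "\<kappa>\<^sup>2 < p\<^sup>2" using p kappa by (intro power_strict_mono) auto
  have "((\<lambda>x. x powr (p - \<kappa> - 1)) has_integral 1 powr (p - \<kappa> - 1 + 1) / (p - \<kappa> - 1 + 1)) {0..1}"
    using p by (intro has_integral_powr_from_0) auto
  moreover have "((\<lambda>x. x powr (p + \<kappa> - 1)) has_integral 1 powr (p + \<kappa> - 1 + 1) / (p + \<kappa> - 1 + 1)) {0..1}"
    using p kappa by (intro has_integral_powr_from_0) auto
  ultimately have "((\<lambda>x. x powr (p - \<kappa> - 1) - x powr (p + \<kappa> - 1)) has_integral 1 / (p - \<kappa>) - 1 / (p + \<kappa>)) {0..1}"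
    by (auto intro: has_integral_diff)
  then have "((\<lambda>x. (x powr (p - \<kappa> - 1) - x powr (p + \<kappa> - 1)) * (1 / 2)) has_integral (1 / (p - \<kappa>) - 1 / (p + \<kappa>)) * (1 / 2)) {0..1}"
    by (rule has_integral_mult_left)
  moreover have "(1 / (p - \<kappa>) - 1 / (p + \<kappa>)) * (1 / 2) = \<kappa> / (p\<^sup>2 - \<kappa>\<^sup>2)"
  proof -
    have "p\<^sup>2 - \<kappa>\<^sup>2 = (p - \<kappa>) * (p + \<kappa>)" by (simp add: power2_eq_square algebra_simps)
    then show ?thesis using p kappa by (simp add: field_simps)
  qed
  moreover have "(x powr (p - \<kappa> - 1) - x powr (p + \<kappa> - 1)) * (1 / 2) = w x * x powr p" for x
    by (simp add: w_def algebra_simps flip: powr_add)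
  ultimately show ?thesis by (simp only:)
qed

lemma w_moment_nat:
  assumes n: "1 \<le> n"
  shows "((\<lambda>x. w x * x ^ n) has_integral \<kappa> / ((real n)\<^sup>2 - \<kappa>\<^sup>2)) {0..1}"
proof -
  have "\<kappa> < real n" using n kappa by linarith
  from w_moment[OF this] show ?thesis
    by (rule has_integral_eq[rotated]) (use n in \<open>auto simp: powr_realpow' w_def\<close>)
qed

section \<open>The measure as a positive functional\<close>

definition circ :: "(complex \<Rightarrow> real) \<Rightarrow> real" where
  "circ f = integral {0..pi} (\<lambda>s. g s * f (cis s))"

definition ray :: "(complex \<Rightarrow> real) \<Rightarrow> real" where
  "ray f = integral {0..1} (\<lambda>x. w x * f (of_real x * cis s1))"

definition adm :: "(complex \<Rightarrow> real) \<Rightarrow> bool" where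
  "adm f \<longleftrightarrow> (\<lambda>s. g s * f (cis s)) integrable_on {0..pi} \<and> (\<lambda>x. w x * f (of_real x * cis s1)) integrable_on {0..1}"

text \<open>The factors balance the moments of order n: the circle gives - M cos (n s1) / (n^2 -
  \<kappa>^2), the ray \<kappa> cos (n s1) / (n^2 - \<kappa>^2).\<close>

definition "Lam f = \<kappa> * circ f + M * ray f"

lemma moment_zero:
  assumes "1 \<le> n"
  shows "adm (\<lambda>z. Re (z ^ n))" "Lam (\<lambda>z. Re (z ^ n)) = 0"
proof -
  have c: "Re (cis s ^ n) = cos (real n * s)" for s by (simp add: Complex.DeMoivre)
  have r: "w x * Re ((of_real x * cis s1) ^ n) = (w x * x ^ n) * cos (real n * s1)" for x
    by (simp add: power_mult_distrib Complex.DeMoivre flip: of_real_power)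
  have 1: "((\<lambda>s. g s * Re (cis s ^ n)) has_integral - M * cos (real n * s1) / ((real n)\<^sup>2 - \<kappa>\<^sup>2)) {0..pi}"
    unfolding c by (rule circle_moment[OF assms])
  have 2: "((\<lambda>x. w x * Re ((of_real x * cis s1) ^ n)) has_integral \<kappa> / ((real n)\<^sup>2 - \<kappa>\<^sup>2) * cos (real n * s1)) {0..1}"
    unfolding r by (rule has_integral_mult_left[OF w_moment_nat[OF assms]])
  show "adm (\<lambda>z. Re (z ^ n))" unfolding adm_def using 1 2 by (auto simp: integrable_on_def)
  show "Lam (\<lambda>z. Re (z ^ n)) = 0"
    unfolding Lam_def circ_def ray_def integral_unique[OF 1] integral_unique[OF 2] by simp
qed

lemma Lam_add: "adm f \<Longrightarrow> adm h \<Longrightarrow> adm (\<lambda>z. f z + h z)" "adm f \<Longrightarrow> adm h \<Longrightarrow> Lam (\<lambda>z. f z + h z) = Lam f + Lam h"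
  by (auto simp: adm_def Lam_def circ_def ray_def distrib_left integral_add integrable_add)

lemma Lam_cmult: "adm f \<Longrightarrow> adm (\<lambda>z. c * f z)" "Lam (\<lambda>z. c * f z) = c * Lam f"
proof -
  have *: "g s * (c * f z) = c * (g s * f z)" "w s * (c * f z) = c * (w s * f z)" for s z by auto
  show "adm f \<Longrightarrow> adm (\<lambda>z. c * f z)"
    unfolding adm_def * using integrable_on_mult_right by blast
  show "Lam (\<lambda>z. c * f z) = c * Lam f"
    unfolding Lam_def circ_def ray_def * integral_mult_right by (simp add: algebra_simps)
qed

lemma Lam_zero: "adm (\<lambda>z. 0)" "Lam (\<lambda>z. 0) = 0"
  by (simp_all add: adm_def Lam_def circ_def ray_def integrable_0)

lemma Lam_sum:
  assumes "finite A" "\<And>i. i \<in> A \<Longrightarrow> adm (f i)"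
  shows "adm (\<lambda>z. \<Sum>i\<in>A. f i z)" "Lam (\<lambda>z. \<Sum>i\<in>A. f i z) = (\<Sum>i\<in>A. Lam (f i))"
proof -
  have "adm (\<lambda>z. \<Sum>i\<in>A. f i z) \<and> Lam (\<lambda>z. \<Sum>i\<in>A. f i z) = (\<Sum>i\<in>A. Lam (f i))"
    using assms by (induction A rule: finite_induct) (auto simp: Lam_zero Lam_add)
  then show "adm (\<lambda>z. \<Sum>i\<in>A. f i z)" "Lam (\<lambda>z. \<Sum>i\<in>A. f i z) = (\<Sum>i\<in>A. Lam (f i))" by auto
qed

lemma Lam_mono:
  assumes "adm f" "adm h" "\<And>s. 0 < s \<Longrightarrow> s \<le> pi \<Longrightarrow> f (cis s) \<le> h (cis s)"
    "\<And>x. 0 < x \<Longrightarrow> x \<le> 1 \<Longrightarrow> f (of_real x * cis s1) \<le> h (of_real x * cis s1)"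
  shows "Lam f \<le> Lam h"
proof -
  have "circ f \<le> circ h"
    unfolding circ_def
  proof (rule integral_le)
    fix s assume s: "s \<in> {0..pi}"
    \<comment> \<open>The comparison is not assumed at the point 1, but there \<open>g\<close>
      vanishes.\<close>
    show "g s * f (cis s) \<le> g s * h (cis s)"
      using assms(3) g_nonneg[of s] s s1 by (cases "s = 0") (auto simp: g_le intro!: mult_left_mono)
  qed (use assms in \<open>auto simp: adm_def\<close>)
  moreover have "ray f \<le> ray h"
    unfolding ray_def
  proof (rule integral_le)
    fix x :: real assume x: "x \<in> {0..1}"
    \<comment> \<open>At the origin \<open>w\<close> has the value 0, since \<open>powr\<close> with
      base 0 is 0.\<close>
    show "w x * f (of_real x * cis s1) \<le> w x * h (of_real x * cis s1)"
      using assms(4) w_nonneg[of x] x by (cases "x = 0") (auto simp: w_def[of 0] intro!: mult_left_mono)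
  qed (use assms in \<open>auto simp: adm_def\<close>)
  ultimately show ?thesis
    unfolding Lam_def using constants_pos kappa by (intro add_mono mult_left_mono) auto
qed

text \<open>All moments of the measure vanish, hence so does the integral of every function holomorphic
  near the closed disc and vanishing at the origin.\<close>

lemma Lam_Lg_small:
  assumes \<beta>: "cmod \<beta> < 1"
  shows "adm (Lg \<beta>)" "Lam (Lg \<beta>) = 0"
proof -
  define S where "S N z = (\<Sum>n<N. (- (2 / real (Suc n)) * Re (\<beta> ^ Suc n)) * Re (z ^ Suc n))" for N z
  have S: "adm (S N)" "Lam (S N) = 0" for N
  proof -
    have "adm (\<lambda>z. (- (2 / real (Suc n)) * Re (\<beta> ^ Suc n)) * Re (z ^ Suc n))" for n
      by (intro Lam_cmult moment_zero) simp
    moreover have "Lam (\<lambda>z. (- (2 / real (Suc n)) * Re (\<beta> ^ Suc n)) * Re (z ^ Suc n)) = 0" for n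
      by (subst Lam_cmult(2), subst moment_zero(2)) auto
    ultimately show "adm (S N)" "Lam (S N) = 0"
      unfolding S_def[abs_def] by (auto simp only: Lam_sum finite_lessThan sum.neutral_const)
  qed
  have conv: "(\<lambda>N. S N z) \<longlonglongrightarrow> Lg \<beta> z" if "cmod z \<le> 1" for z
    using Lg_series[OF \<beta> that] by (simp add: sums_def S_def)
  let ?C = "2 / (1 - cmod \<beta>)"
  have bnd: "\<bar>S N z\<bar> \<le> ?C * cmod z" if "cmod z \<le> 1" for N z
    unfolding S_def using Lg_partial_sum_le[OF \<beta> that, of N] by simp
  have C0: "0 \<le> ?C" using \<beta> by simp
  note dc1 = dominated_convergence[where f = "\<lambda>N s. g s * S N (cis s)" and g = "\<lambda>s. g s * Lg \<beta> (cis s)"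
      and S = "{0..pi}" and h = "\<lambda>s. g s * ?C"]
  have 1: "(\<lambda>s. g s * Lg \<beta> (cis s)) integrable_on {0..pi}" "(\<lambda>N. circ (S N)) \<longlonglongrightarrow> circ (Lg \<beta>)"
  proof -
    have a: "(\<lambda>s. g s * S N (cis s)) integrable_on {0..pi}" for N using S by (simp add: adm_def)
    have b: "(\<lambda>s. g s * ?C) integrable_on {0..pi}" by (rule circle_integrable) auto
    have c: "norm (g s * S N (cis s)) \<le> g s * ?C" if "s \<in> {0..pi}" for s N
      using bnd[of "cis s" N] g_nonneg[of s] that mult_left_mono[OF bnd[of "cis s" N], of "g s"] by (simp add: abs_mult)
    have d: "(\<lambda>N. g s * S N (cis s)) \<longlonglongrightarrow> g s * Lg \<beta> (cis s)" for s
      by (intro tendsto_intros conv) simp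
    show "(\<lambda>s. g s * Lg \<beta> (cis s)) integrable_on {0..pi}" "(\<lambda>N. circ (S N)) \<longlonglongrightarrow> circ (Lg \<beta>)"
      unfolding circ_def using dc1[OF a b c d] by auto
  qed
  note dc2 = dominated_convergence[where f = "\<lambda>N x. w x * S N (of_real x * cis s1)"
      and g = "\<lambda>x. w x * Lg \<beta> (of_real x * cis s1)" and S = "{0..1}" and h = "\<lambda>x. (w x * x ^ 1) * ?C"]
  have 2: "(\<lambda>x. w x * Lg \<beta> (of_real x * cis s1)) integrable_on {0..1}" "(\<lambda>N. ray (S N)) \<longlonglongrightarrow> ray (Lg \<beta>)"
  proof -
    have a: "(\<lambda>x. w x * S N (of_real x * cis s1)) integrable_on {0..1}" for N using S by (simp add: adm_def)
    have "(\<lambda>x. w x * x ^ 1) integrable_on {0..1}" using w_moment_nat[of 1] by (auto simp: integrable_on_def)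
    then have b: "(\<lambda>x. (w x * x ^ 1) * ?C) integrable_on {0..1}" using integrable_on_mult_left by blast
    have c: "norm (w x * S N (of_real x * cis s1)) \<le> (w x * x ^ 1) * ?C" if "x \<in> {0..1}" for x N
      using mult_left_mono[OF bnd[of "of_real x * cis s1" N] w_nonneg[of x]] that w_nonneg[of x]
      by (simp add: abs_mult norm_mult mult_ac)
    have d: "(\<lambda>N. w x * S N (of_real x * cis s1)) \<longlonglongrightarrow> w x * Lg \<beta> (of_real x * cis s1)" if "x \<in> {0..1}" for x
      using that by (intro tendsto_intros conv) (simp add: norm_mult)
    show "(\<lambda>x. w x * Lg \<beta> (of_real x * cis s1)) integrable_on {0..1}" "(\<lambda>N. ray (S N)) \<longlonglongrightarrow> ray (Lg \<beta>)"
      unfolding ray_def using dc2[OF a b c d] by auto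
  qed
  show "adm (Lg \<beta>)" using 1 2 by (simp add: adm_def)
  have "(\<lambda>N. Lam (S N)) \<longlonglongrightarrow> Lam (Lg \<beta>)" unfolding Lam_def using 1 2 by (intro tendsto_intros)
  then show "Lam (Lg \<beta>) = 0" unfolding S(2) using LIMSEQ_unique tendsto_const by blast
qed

section \<open>The potential of the measure on the positive axis\<close>

lemma denominator_pos:
  assumes "0 \<le> h" "0 < s" "s \<le> pi"
  shows "0 < 1 - 2 * h * cos s + h\<^sup>2"
proof -
  have "cos s < cos 0" using assms by (intro cos_monotone_0_pi) auto
  then show ?thesis using quadratic_cos_lower[OF assms(1), of s] by simp
qed

lemma denominator_pos_0:
  fixes h s :: real
  assumes "0 \<le> h" "h \<noteq> 1" "0 \<le> s" "s \<le> pi"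
  shows "0 < 1 - 2 * h * cos s + h\<^sup>2"
proof (cases "s = 0")
  case True
  have "1 - 2 * h + h\<^sup>2 = (1 - h)\<^sup>2" by (simp add: power2_diff)
  then show ?thesis using True assms by simp
qed (use denominator_pos assms in auto)

text \<open>The modulus of 1 - X cis s1 differs from 1 by at most \<open>X\<close> and is at least
  \<open>m1\<close>. Linear decay at 0 makes \<open>\<l>\<close> integrable against X powr
  (-\<kappa> - 1).\<close>

lemma l_bound:
  assumes "0 \<le> X"
  shows "\<bar>\<l> X\<bar> \<le> X / m1"
proof -
  have pos: "m1 \<le> 1 - 2 * X * cos s1 + X\<^sup>2"
    using quadratic_cos_lower[OF assms, of s1] by (simp add: m1_def)
  let ?y = "sqrt (1 - 2 * X * cos s1 + X\<^sup>2)"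
  have y: "?y\<^sup>2 = 1 - 2 * X * cos s1 + X\<^sup>2" using pos constants_pos by simp
  have ypos: "0 < ?y" using pos constants_pos by simp
  have ly: "\<l> X = ln ?y" using pos constants_pos by (simp add: \<l>_def ln_sqrt)
  have "m1 * m1 \<le> m1 * 1" using constants_pos by (intro mult_left_mono) auto
  then have "m1\<^sup>2 \<le> ?y\<^sup>2" using y pos by (simp add: power2_eq_square)
  then have "m1 \<le> ?y" by (rule power2_le_imp_le) (use ypos in simp)
  then have "\<bar>\<l> X\<bar> \<le> \<bar>?y - 1\<bar> / m1" unfolding ly by (intro abs_ln_le constants_pos)
  also have "\<bar>?y - 1\<bar> \<le> X"
  proof -
    have "1 - 2 * X * c + X\<^sup>2 \<le> (1 + X)\<^sup>2" if "X * (- 1) \<le> X * c" for c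
      using that by (simp add: power2_sum)
    then have "?y\<^sup>2 \<le> (1 + X)\<^sup>2" unfolding y using mult_left_mono[OF cos_ge_minus_one assms] by blast
    moreover have "(1 - X)\<^sup>2 \<le> 1 - 2 * X * c + X\<^sup>2" if "X * c \<le> X * 1" for c
      using that by (simp add: power2_diff)
    then have "(1 - X)\<^sup>2 \<le> ?y\<^sup>2" unfolding y using mult_left_mono[OF cos_le_one assms] by blast
    ultimately have "?y \<le> 1 + X" "\<bar>1 - X\<bar> \<le> ?y"
      using assms ypos abs_le_square_iff[of "1 - X" ?y] by (auto intro: power2_le_imp_le)
    then show ?thesis by linarith
  qed
  then have "\<bar>?y - 1\<bar> / m1 \<le> X / m1" using constants_pos by (intro divide_right_mono) auto
  finally show ?thesis .
qed

lemma l_cont: "continuous_on {0..} \<l>"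
  unfolding \<l>_def using denominator_pos[OF _ s1(1)] s1_range
  by (intro continuous_intros) (auto simp: less_imp_neq[symmetric])

text \<open>Truncated Mellin integrals of \<open>\<l>\<close>. The substitution X = h x expresses
  the ray integral of \<open>Lg (of_real h)\<close> through \<open>U h\<close> and
  \<open>V h\<close>; the resulting combination is \<open>r h\<close>.\<close>

definition "U T = integral {0..T} (\<lambda>X. X powr (- \<kappa> - 1) * \<l> X)"
definition "V T = integral {0..T} (\<lambda>X. X powr (\<kappa> - 1) * \<l> X)"

lemma UV_integrable:
  assumes p: "- 2 < p" and T: "0 \<le> T"
  shows "(\<lambda>X. X powr p * \<l> X) integrable_on {0..T}"
proof (rule integrable_dominated_at_0)
  show "continuous_on {0<..T} (\<lambda>X. X powr p * \<l> X)"
    by (intro continuous_intros continuous_on_subset[OF l_cont]) auto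
  show "\<bar>X powr p * \<l> X\<bar> \<le> X powr (p + 1) * (1 / m1)" if "X \<in> {0<..T}" for X
    using mult_left_mono[OF l_bound[of X], of "X powr p"] that by (simp add: abs_mult powr_add)
  have "(\<lambda>X. X powr (p + 1)) integrable_on {0..T}"
    using has_integral_powr_from_0[of "p + 1" T] p T by (auto simp: integrable_on_def)
  then show "(\<lambda>X. X powr (p + 1) * (1 / m1)) integrable_on {0..T}"
    using integrable_on_mult_left by blast
qed

lemma UV_deriv:
  assumes p: "- 2 < p" and T: "0 < T"
  shows "((\<lambda>T. integral {0..T} (\<lambda>X. X powr p * \<l> X)) has_real_derivative T powr p * \<l> T) (at T)"
proof -
  have "((\<lambda>u. integral {0..u} (\<lambda>X. X powr p * \<l> X)) has_vector_derivative T powr p * \<l> T)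
    (at T within ({0..T + 1} - {}))"
  proof (rule integral_has_vector_derivative_continuous_at)
    show "(\<lambda>X. X powr p * \<l> X) integrable_on {0..T + 1}" using p T by (intro UV_integrable) auto
    have "continuous_on {0<..} (\<lambda>X. X powr p * \<l> X)"
      by (intro continuous_intros continuous_on_subset[OF l_cont]) auto
    then have "continuous (at T) (\<lambda>X. X powr p * \<l> X)"
      using T by (simp add: continuous_on_eq_continuous_at)
    then show "continuous (at T within {0..T + 1} - {}) (\<lambda>X. X powr p * \<l> X)"
      by (rule continuous_at_imp_continuous_within)
  qed (use T in auto)
  then show ?thesis
    using T at_within_interior[of T "{0..T + 1}"]
    by (simp add: has_real_derivative_iff_has_vector_derivative)
qed

definition "r h = h powr \<kappa> * U h - h powr (- \<kappa>) * V h"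

lemma ray_Lg:
  assumes h: "0 < h"
  shows "((\<lambda>x. w x * Lg (of_real h) (of_real x * cis s1)) has_integral r h) {0..1}"
proof -
  have st: "((\<lambda>x. x powr p * \<l> (h * x)) has_integral h powr (- p - 1) * I) {0..1}"
    if "((\<lambda>X. X powr p * \<l> X) has_integral I) {0..h}" for p I
  proof -
    have im: "(\<lambda>x. x / h) ` {0..h} = {0..1}"
      using h by (auto simp: image_def field_simps zero_le_mult_iff intro!: bexI[of _ "h * _"])
    have "((\<lambda>x. (h * x) powr p * \<l> (h * x)) has_integral (1 / \<bar>h\<bar>) *\<^sub>R I) {0..1}"
      using has_integral_stretch_real[OF that, of h] h unfolding im by simp
    then have "((\<lambda>x. h powr (- p) * ((h * x) powr p * \<l> (h * x))) has_integral h powr (- p) * ((1 / \<bar>h\<bar>) *\<^sub>R I)) {0..1}"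
      by (rule has_integral_mult_right)
    moreover have "h powr (- p) * ((1 / \<bar>h\<bar>) *\<^sub>R I) = h powr (- p - 1) * I"
      using h by (simp add: powr_diff field_simps)
    moreover have "h powr (- p) * ((h * x) powr p * \<l> (h * x)) = x powr p * \<l> (h * x)" if "x \<in> {0..1}" for x
      using that h by (simp add: powr_mult powr_minus)
    ultimately show ?thesis by (metis (no_types, lifting) has_integral_cong)
  qed
  have u: "((\<lambda>x. x powr (- \<kappa> - 1) * \<l> (h * x)) has_integral h powr \<kappa> * U h) {0..1}"
    using st[of "- \<kappa> - 1" "U h"] UV_integrable[of "- \<kappa> - 1" h] h kappa by (simp add: U_def integrable_integral)
  have v: "((\<lambda>x. x powr (\<kappa> - 1) * \<l> (h * x)) has_integral h powr (- \<kappa>) * V h) {0..1}"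
    using st[of "\<kappa> - 1" "V h"] UV_integrable[of "\<kappa> - 1" h] h kappa by (simp add: V_def integrable_integral)
  have "((\<lambda>x. x powr (- \<kappa> - 1) * \<l> (h * x) - x powr (\<kappa> - 1) * \<l> (h * x)) has_integral r h) {0..1}"
    unfolding r_def by (rule has_integral_diff[OF u v])
  then show ?thesis
  proof (rule has_integral_eq[rotated])
    fix x :: real assume x: "x \<in> {0..1}"
    have "Lg (of_real h) (of_real x * cis s1) = 2 * \<l> (h * x)"
      unfolding \<l>_def using x h s1 s1_range by (subst Lg_of_real) (auto intro!: denominator_pos)
    then show "x powr (- \<kappa> - 1) * \<l> (h * x) - x powr (\<kappa> - 1) * \<l> (h * x) = w x * Lg (of_real h) (of_real x * cis s1)"
      by (simp add: w_def algebra_simps)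
  qed
qed

lemma circle_Lg:
  assumes h: "0 < h" "h \<noteq> 1"
  shows "(\<lambda>s. g s * ln (1 - 2 * h * cos s + h\<^sup>2)) integrable_on {0..pi}"
    "circ (Lg (of_real h)) = integral {0..pi} (\<lambda>s. g s * ln (1 - 2 * h * cos s + h\<^sup>2))"
    "(\<lambda>s. g s * Lg (of_real h) (cis s)) integrable_on {0..pi}"
proof -
  have pos: "0 < 1 - 2 * h * cos s + h\<^sup>2" if "s \<in> {0..pi}" for s
    using denominator_pos_0[of h s] h that by auto
  show 1: "(\<lambda>s. g s * ln (1 - 2 * h * cos s + h\<^sup>2)) integrable_on {0..pi}"
    using pos by (intro circle_integrable continuous_intros) (auto simp: less_imp_neq[symmetric])
  have eq: "g s * Lg (of_real h) (cis s) = g s * ln (1 - 2 * h * cos s + h\<^sup>2)" if "s \<in> {0..pi}" for s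
    using Lg_of_real[of h 1 s] pos[OF that] by simp
  show "circ (Lg (of_real h)) = integral {0..pi} (\<lambda>s. g s * ln (1 - 2 * h * cos s + h\<^sup>2))"
    unfolding circ_def using eq by (intro integral_cong) auto
  show "(\<lambda>s. g s * Lg (of_real h) (cis s)) integrable_on {0..pi}"
    using 1 eq by (metis (no_types, lifting) integrable_eq)
qed

lemma adm_Lg_real: "0 < h \<Longrightarrow> h \<noteq> 1 \<Longrightarrow> adm (Lg (of_real h))"
  unfolding adm_def using circle_Lg(3)[of h] ray_Lg[of h] by (auto simp: integrable_on_def)

lemma Lam_Lg_real: "0 < h \<Longrightarrow> Lam (Lg (of_real h)) = \<kappa> * circ (Lg (of_real h)) + M * r h"
  unfolding Lam_def ray_def using integral_unique[OF ray_Lg] by simp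

text \<open>The modulus of 1 - h cis s is h times that of 1 - (1/h) cis s, so the two integrands
  differ by 2 ln h times \<open>g\<close>. This is the odd part of the circle potential as a
  function of ln h.\<close>

lemma circle_inversion:
  assumes h: "0 < h" "h \<noteq> 1"
  shows "circ (Lg (of_real h)) - circ (Lg (of_real (1 / h))) = 2 * ln h * (pi * c1 + M / \<kappa>\<^sup>2)"
proof -
  have h': "0 < 1 / h" "1 / h \<noteq> 1" using h by auto
  have "circ (Lg (of_real h)) - circ (Lg (of_real (1 / h)))
    = integral {0..pi} (\<lambda>s. g s * ln (1 - 2 * h * cos s + h\<^sup>2) - g s * ln (1 - 2 * (1 / h) * cos s + (1 / h)\<^sup>2))"
    unfolding circle_Lg(2)[OF h] circle_Lg(2)[OF h']
    by (rule integral_diff[symmetric]) (intro circle_Lg h h')+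
  also have "\<dots> = integral {0..pi} (\<lambda>s. g s * (2 * ln h))"
  proof (rule integral_cong)
    fix s assume s: "s \<in> {0..pi}"
    have p: "0 < 1 - 2 * (1 / h) * cos s + (1 / h)\<^sup>2" using denominator_pos_0[of "1 / h" s] h' s by auto
    have "1 - 2 * h * cos s + h\<^sup>2 = h\<^sup>2 * (1 - 2 * (1 / h) * cos s + (1 / h)\<^sup>2)"
      using h by (simp add: field_simps power2_eq_square)
    then have "ln (1 - 2 * h * cos s + h\<^sup>2) = 2 * ln h + ln (1 - 2 * (1 / h) * cos s + (1 / h)\<^sup>2)"
      using h p by (simp add: ln_mult ln_realpow)
    then show "g s * ln (1 - 2 * h * cos s + h\<^sup>2) - g s * ln (1 - 2 * (1 / h) * cos s + (1 / h)\<^sup>2) = g s * (2 * ln h)"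
      by (simp add: algebra_simps)
  qed
  also have "\<dots> = 2 * ln h * (pi * c1 + M / \<kappa>\<^sup>2)"
    using integral_unique[OF circle_mass] by simp
  finally show ?thesis .
qed

text \<open>The two logarithms add up to \<open>2 * ln (h + 1 / h - 2 * cos s)\<close>. Its
  increments are at most those of h + 1/h divided by 1 - cos s, and \<open>g_upper\<close> cancels
  this denominator. Since h + 1/h = 2 cosh (ln h), the even part is flat at h = 1.\<close>

lemma circle_even_part:
  assumes h: "1 < h'" "h' < h"
  shows "\<bar>(circ (Lg (of_real h)) + circ (Lg (of_real (1 / h)))) - (circ (Lg (of_real h')) + circ (Lg (of_real (1 / h'))))\<bar>
    \<le> pi * Kg * ((h + 1 / h) - (h' + 1 / h'))"
proof -
  define q where "q h s = ln (1 - 2 * h * cos s + h\<^sup>2)" for h s :: real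
  define E where "E h s = g s * q h s + g s * q (1 / h) s" for h s
  have E: "E h integrable_on {0..pi}" "circ (Lg (of_real h)) + circ (Lg (of_real (1 / h))) = integral {0..pi} (E h)"
    if "1 < h" for h
  proof -
    have *: "0 < h" "h \<noteq> 1" "0 < 1 / h" "1 / h \<noteq> 1" using that by auto
    show "E h integrable_on {0..pi}" unfolding E_def q_def by (intro integrable_add circle_Lg *)
    show "circ (Lg (of_real h)) + circ (Lg (of_real (1 / h))) = integral {0..pi} (E h)"
      unfolding circle_Lg(2)[OF *(1,2)] circle_Lg(2)[OF *(3,4)] E_def q_def
      by (rule integral_add[symmetric]) (intro circle_Lg *)+
  qed
  have h1: "1 < h" using h by simp
  let ?d = "(h + 1 / h) - (h' + 1 / h')"
  have d: "0 \<le> ?d"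
  proof -
    have "?d = (h - h') * (1 - 1 / (h * h'))" using h by (simp add: field_simps)
    moreover have "1 * 1 \<le> h * h'" using h by (intro mult_mono) auto
    ultimately show ?thesis using h by (auto intro!: mult_nonneg_nonneg)
  qed
  have "norm (integral {0..pi} (\<lambda>s. E h s - E h' s)) \<le> integral {0..pi} (\<lambda>s. Kg * ?d)"
  proof (rule integral_norm_bound_integral)
    show "(\<lambda>s. E h s - E h' s) integrable_on {0..pi}" using E h h1 by (intro integrable_diff) auto
    fix s assume s: "s \<in> {0..pi}"
    show "norm (E h s - E h' s) \<le> Kg * ?d"
    proof (cases "s = 0")
      case True
      then show ?thesis using d s1 constants_pos by (simp add: E_def g_le Kg_def m1_def)
    next
      case False
      have cs: "0 < 1 - cos s" using s False cos_monotone_0_pi[of 0 s] by simp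
      have qq: "q h s + q (1 / h) s = 2 * ln (h + 1 / h - 2 * cos s)" "0 < h + 1 / h - 2 * cos s"
        "2 * (1 - cos s) \<le> h + 1 / h - 2 * cos s" if "1 < h" for h
      proof -
        have "0 \<le> (h - 1)\<^sup>2 / h" using that by simp
        also have "(h - 1)\<^sup>2 / h = h + 1 / h - 2" using that by (simp add: power2_eq_square field_simps)
        finally show 3: "2 * (1 - cos s) \<le> h + 1 / h - 2 * cos s" by simp
        show 2: "0 < h + 1 / h - 2 * cos s" by (rule less_le_trans[OF _ 3]) (use cs in simp)
        have a: "1 - 2 * h * cos s + h\<^sup>2 = h * (h + 1 / h - 2 * cos s)"
          "1 - 2 * (1 / h) * cos s + (1 / h)\<^sup>2 = (1 / h) * (h + 1 / h - 2 * cos s)"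
          using that by (simp_all add: power2_eq_square field_simps)
        show "q h s + q (1 / h) s = 2 * ln (h + 1 / h - 2 * cos s)"
          unfolding q_def a using that 2 by (simp add: ln_mult ln_div)
      qed
      let ?A = "h + 1 / h - 2 * cos s" and ?B = "h' + 1 / h' - 2 * cos s"
      have "E h s = g s * (2 * ln (h + 1 / h - 2 * cos s))" if "1 < h" for h
        using qq(1)[OF that] by (simp add: E_def flip: distrib_left)
      then have "E h s - E h' s = g s * (2 * (ln ?A - ln ?B))"
        using h1 h(1) by (simp only: right_diff_distrib)
      also have "ln ?A - ln ?B = ln (1 + ?d / ?B)"
      proof -
        have "1 + ?d / ?B = (?B + ?d) / ?B" using qq(2)[OF h(1)] by (simp only: add_divide_distrib) simp
        also have "?B + ?d = ?A" by simp
        finally have "1 + ?d / ?B = ?A / ?B" .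
        then show ?thesis using ln_divide_pos[OF qq(2)[OF h1] qq(2)[OF h(1)]] by simp
      qed
      finally have e: "E h s - E h' s = g s * (2 * ln (1 + ?d / ?B))" .
      have dB: "0 \<le> ?d / ?B" using d qq(2)[OF h(1)] by simp
      have "ln (1 + ?d / ?B) \<le> ?d / ?B" by (rule ln_add_one_self_le_self[OF dB])
      also have "\<dots> \<le> ?d / (2 * (1 - cos s))"
        using d cs qq(2,3)[OF h(1)] by (intro divide_left_mono) auto
      also have "?d / (2 * (1 - cos s)) = ?d / (1 - cos s) / 2" by simp
      finally have "2 * ln (1 + ?d / ?B) \<le> ?d / (1 - cos s)" by (simp only: le_divide_eq_numeral1 mult.commute)
      then have "g s * (2 * ln (1 + ?d / ?B)) \<le> (Kg * (1 - cos s)) * (?d / (1 - cos s))"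
        using g_upper[of s] g_nonneg[of s] s dB d cs by (intro mult_mono) auto
      also have "\<dots> = Kg * ?d" using cs by simp
      finally have "E h s - E h' s \<le> Kg * ?d" unfolding e .
      moreover have "0 \<le> E h s - E h' s"
        unfolding e using g_nonneg[of s] s dB by (intro mult_nonneg_nonneg) auto
      ultimately show ?thesis by simp
    qed
  qed auto
  then show ?thesis
    unfolding E(2)[OF h1] E(2)[OF h(1)] using integral_diff[OF E(1)[OF h1] E(1)[OF h(1)]]
    by (simp add: mult_ac)
qed

text \<open>The reflection of the radius at the unit circle, now on the ray and in logarithmic
  coordinates.\<close>

lemma l_inversion: "\<l> (exp t) - \<l> (exp (- t)) = t"
proof -
  have p: "0 < 1 - 2 * exp (- t) * cos s1 + (exp (- t))\<^sup>2" using s1 s1_range by (intro denominator_pos) auto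
  have "1 - 2 * exp t * cos s1 + (exp t)\<^sup>2 = (exp t)\<^sup>2 * (1 - 2 * exp (- t) * cos s1 + (exp (- t))\<^sup>2)"
    by (simp add: power2_eq_square algebra_simps flip: exp_add)
  then have "ln (1 - 2 * exp t * cos s1 + (exp t)\<^sup>2) = 2 * t + ln (1 - 2 * exp (- t) * cos s1 + (exp (- t))\<^sup>2)"
    using p by (simp add: ln_mult ln_realpow)
  then show ?thesis by (simp add: \<l>_def add_divide_distrib)
qed

lemma U_deriv: "0 < T \<Longrightarrow> (U has_real_derivative T powr (- \<kappa> - 1) * \<l> T) (at T)"
  and V_deriv: "0 < T \<Longrightarrow> (V has_real_derivative T powr (\<kappa> - 1) * \<l> T) (at T)"
  unfolding U_def[abs_def] V_def[abs_def] using kappa by (auto intro!: UV_deriv)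

text \<open>Gathers the integrals over the unit interval, which have no evident closed form
  separately.\<close>

definition "A0 = 2 * M * (U 1 + V 1 + 1 / \<kappa>\<^sup>2)"

text \<open>The derivative of \<open>U (exp t) + V (exp (- t))\<close> involves \<open>\<l>\<close>
  only through the difference in \<open>l_inversion\<close>, which is \<open>t\<close>; so it is
  \<open>t * exp (- \<kappa> * t)\<close>, and the function is elementary up to an additive
  constant, recorded in \<open>A0\<close>.\<close>

lemma r_odd_part: "M * (r (exp t) - r (exp (- t))) = A0 * sinh (\<kappa> * t) - 2 * M * t / \<kappa>"
proof -
  have k0: "\<kappa> \<noteq> 0" using kappa by simp
  define a where "a t = U (exp t) + V (exp (- t))" for t
  \<comment> \<open>An explicit primitive of \<open>t * exp (- \<kappa> * t)\<close>.\<close>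
  define b where "b t = - (t / \<kappa> + 1 / \<kappa>\<^sup>2) * exp (- \<kappa> * t)" for t
  have "((\<lambda>t. a t - b t) has_real_derivative 0) (at t)" for t
  proof -
    have u: "((\<lambda>t. U (exp t)) has_real_derivative exp t powr (- \<kappa> - 1) * \<l> (exp t) * exp t) (at t)"
      by (rule DERIV_chain2[OF U_deriv]) (auto intro: derivative_eq_intros)
    have v: "((\<lambda>t. V (exp (- t))) has_real_derivative exp (- t) powr (\<kappa> - 1) * \<l> (exp (- t)) * (- exp (- t))) (at t)"
      by (rule DERIV_chain2[OF V_deriv]) (auto intro!: derivative_eq_intros)
    have e1: "exp t powr (- \<kappa> - 1) * exp t = exp (- \<kappa> * t)"
      and e2: "exp (- t) powr (\<kappa> - 1) * exp (- t) = exp (- \<kappa> * t)"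
      unfolding exp_powr_real exp_add[symmetric] by (simp_all add: algebra_simps)
    have "exp t powr (- \<kappa> - 1) * \<l> (exp t) * exp t + exp (- t) powr (\<kappa> - 1) * \<l> (exp (- t)) * (- exp (- t))
      = (exp t powr (- \<kappa> - 1) * exp t) * \<l> (exp t) - (exp (- t) powr (\<kappa> - 1) * exp (- t)) * \<l> (exp (- t))"
      by (simp only: mult_minus_right mult_ac diff_conv_add_uminus)
    also have "\<dots> = exp (- \<kappa> * t) * (\<l> (exp t) - \<l> (exp (- t)))"
      unfolding e1 e2 by (simp only: right_diff_distrib)
    finally have "exp t powr (- \<kappa> - 1) * \<l> (exp t) * exp t + exp (- t) powr (\<kappa> - 1) * \<l> (exp (- t)) * (- exp (- t))
      = exp (- \<kappa> * t) * (\<l> (exp t) - \<l> (exp (- t)))" .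
    then have "(a has_real_derivative exp (- \<kappa> * t) * t) (at t)"
      unfolding a_def[abs_def] using DERIV_add[OF u v] by (simp only: l_inversion)
    moreover have "(b has_real_derivative exp (- \<kappa> * t) * t) (at t)"
    proof -
      have "(b has_real_derivative - (1 / \<kappa>) * exp (- \<kappa> * t) + - (t / \<kappa> + 1 / \<kappa>\<^sup>2) * (exp (- \<kappa> * t) * (- \<kappa>))) (at t)"
        unfolding b_def[abs_def] using k0 by (auto intro!: derivative_eq_intros)
      moreover have "- (1 / \<kappa>) * exp (- \<kappa> * t) + - (t / \<kappa> + 1 / \<kappa>\<^sup>2) * (exp (- \<kappa> * t) * (- \<kappa>)) = exp (- \<kappa> * t) * t"
        using k0 by (simp add: field_simps power2_eq_square)
      ultimately show ?thesis by (simp only:)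
    qed
    ultimately show ?thesis using DERIV_diff by fastforce
  qed
  then have "a t - b t = a 0 - b 0" for t using DERIV_isconst_all by blast
  then have at: "a t = (a 0 - b 0) + b t" for t by (simp add: algebra_simps)
  have ab0: "a 0 - b 0 = U 1 + V 1 + 1 / \<kappa>\<^sup>2" by (simp add: a_def b_def)
  have a: "a t = (U 1 + V 1 + 1 / \<kappa>\<^sup>2) + - (t / \<kappa> + 1 / \<kappa>\<^sup>2) * exp (- \<kappa> * t)" for t
    using at[of t] b_def[of t] unfolding ab0 by simp
  have "r (exp t) - r (exp (- t)) = exp (\<kappa> * t) * a t - exp (- \<kappa> * t) * a (- t)"
    by (simp add: r_def a_def exp_powr_real algebra_simps)
  also have "\<dots> = (U 1 + V 1 + 1 / \<kappa>\<^sup>2) * (exp (\<kappa> * t) - exp (- \<kappa> * t))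
    - (t / \<kappa> + 1 / \<kappa>\<^sup>2) * (exp (\<kappa> * t) * exp (- \<kappa> * t)) + (- t / \<kappa> + 1 / \<kappa>\<^sup>2) * (exp (\<kappa> * t) * exp (- \<kappa> * t))"
    unfolding a by (simp add: algebra_simps)
  also have "exp (\<kappa> * t) * exp (- \<kappa> * t) = 1" by (simp flip: exp_add)
  finally have "r (exp t) - r (exp (- t)) = (U 1 + V 1 + 1 / \<kappa>\<^sup>2) * (exp (\<kappa> * t) - exp (- \<kappa> * t)) - 2 * t / \<kappa>"
    by (simp add: algebra_simps)
  then have "M * (r (exp t) - r (exp (- t))) = M * ((U 1 + V 1 + 1 / \<kappa>\<^sup>2) * (exp (\<kappa> * t) - exp (- \<kappa> * t))) - M * (2 * t / \<kappa>)"
    by (simp only: right_diff_distrib)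
  also have "M * ((U 1 + V 1 + 1 / \<kappa>\<^sup>2) * (exp (\<kappa> * t) - exp (- \<kappa> * t))) = A0 * sinh (\<kappa> * t)"
    by (simp add: A0_def sinh_def)
  finally show ?thesis by simp
qed

text \<open>An even function of \<open>t\<close> that is differentiable at 0 has derivative 0
  there.\<close>

lemma r_even_deriv: "((\<lambda>t. r (exp t) + r (exp (- t))) has_real_derivative 0) (at 0)"
proof -
  have "\<exists>D. (r has_real_derivative D) (at 1)"
    unfolding r_def[abs_def] using U_deriv[of 1] V_deriv[of 1]
    by (intro exI) (rule derivative_eq_intros refl | simp)+
  then obtain D where D: "(r has_real_derivative D) (at 1)" by blast
  have "((\<lambda>t. r (exp t)) has_real_derivative D * 1) (at 0)"
    by (rule DERIV_chain2[where g = exp]) (use D in \<open>auto intro!: derivative_eq_intros\<close>)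
  moreover have "((\<lambda>t. r (exp (- t))) has_real_derivative D * (- 1)) (at 0)"
    by (rule DERIV_chain2[where g = "\<lambda>t. exp (- t)"]) (use D in \<open>auto intro!: derivative_eq_intros\<close>)
  ultimately show ?thesis using DERIV_add by fastforce
qed

text \<open>The functional vanishes on \<open>Lg\<close> at the reciprocal of \<open>exp t\<close>,
  which lies inside the disc. Subtracting this zero gives the odd part in \<open>t\<close>, which is
  explicit up to \<open>A0\<close>; adding it gives the even part, which is flat at t = 0.\<close>

lemma Lam_Lg_exp:
  assumes t: "0 < t"
  shows "Lam (Lg (of_real (exp t))) = 2 * \<kappa> * pi * c1 * t + A0 * sinh (\<kappa> * t)"
    "Lam (Lg (of_real (exp t))) = \<kappa> * (circ (Lg (of_real (exp t))) + circ (Lg (of_real (1 / exp t)))) + M * (r (exp t) + r (exp (- t)))"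
proof -
  have z: "Lam (Lg (of_real (1 / exp t))) = 0"
    using t by (intro Lam_Lg_small) (simp add: norm_divide)
  have L: "Lam (Lg (of_real h)) = \<kappa> * circ (Lg (of_real h)) + M * r h" if "0 < h" for h
    by (rule Lam_Lg_real[OF that])
  have inv: "1 / exp t = exp (- t)" by (simp add: exp_minus field_simps)
  have z': "\<kappa> * circ (Lg (of_real (1 / exp t))) + M * r (exp (- t)) = 0"
    using L[of "1 / exp t"] z by (simp add: inv)
  have "circ (Lg (of_real (exp t))) - circ (Lg (of_real (1 / exp t))) = 2 * t * (pi * c1 + M / \<kappa>\<^sup>2)"
    using circle_inversion[of "exp t"] t by simp
  then have "\<kappa> * circ (Lg (of_real (exp t))) - \<kappa> * circ (Lg (of_real (1 / exp t))) = \<kappa> * (2 * t * (pi * c1 + M / \<kappa>\<^sup>2))"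
    by (simp flip: right_diff_distrib)
  also have "\<dots> = 2 * \<kappa> * pi * c1 * t + 2 * M * t / \<kappa>"
    using kappa by (simp add: field_simps power2_eq_square)
  finally show "Lam (Lg (of_real (exp t))) = 2 * \<kappa> * pi * c1 * t + A0 * sinh (\<kappa> * t)"
    using L[of "exp t"] z' r_odd_part[of t] by (simp add: algebra_simps)
  show "Lam (Lg (of_real (exp t))) = \<kappa> * (circ (Lg (of_real (exp t))) + circ (Lg (of_real (1 / exp t)))) + M * (r (exp t) + r (exp (- t)))"
    using L[of "exp t"] z' by (simp add: algebra_simps)
qed

text \<open>The potential of the measure is continuously differentiable across the unit circle, which
  determines the constant without evaluating the integrals \<open>U 1\<close> and \<open>V 1\<close>.\<close>

lemma A0_eq: "A0 = - 2 * pi * c1"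
proof -
  define P where "P t = 2 * \<kappa> * pi * c1 * t + A0 * sinh (\<kappa> * t)" for t
  define Q where "Q t = r (exp t) + r (exp (- t))" for t
  let ?B = "\<lambda>t. \<kappa> * pi * Kg * (2 * cosh t - 2) + M * \<bar>Q t - Q 0\<bar>"
  have Q: "(Q has_real_derivative 0) (at 0)" unfolding Q_def[abs_def] by (rule r_even_deriv)
  \<comment> \<open>At t = 0 the logarithm has its singularity on the circle, where
    \<open>circle_even_part\<close> does not apply. So increments from a positive \<open>u\<close>
    are estimated, and \<open>u\<close> tends to 0 afterwards.\<close>
  have step: "\<bar>P t - P u\<bar> \<le> \<kappa> * pi * Kg * (2 * cosh t - 2 * cosh u) + M * \<bar>Q t - Q u\<bar>" if "0 < u" "u < t" for t u
  proof -
    let ?C = "\<lambda>t. circ (Lg (of_real (exp t))) + circ (Lg (of_real (1 / exp t)))"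
    have "P t - P u = \<kappa> * (?C t - ?C u) + M * (Q t - Q u)"
      using Lam_Lg_exp[of t] Lam_Lg_exp[of u] that by (simp add: P_def Q_def algebra_simps)
    then have "\<bar>P t - P u\<bar> \<le> \<kappa> * \<bar>?C t - ?C u\<bar> + M * \<bar>Q t - Q u\<bar>"
      using kappa constants_pos by (simp add: abs_mult order_trans[OF abs_triangle_ineq])
    also have "\<bar>?C t - ?C u\<bar> \<le> pi * Kg * ((exp t + 1 / exp t) - (exp u + 1 / exp u))"
      using that by (intro circle_even_part) auto
    also have "(exp t + 1 / exp t) - (exp u + 1 / exp u) = 2 * cosh t - 2 * cosh u"
      by (simp add: cosh_def exp_minus field_simps)
    finally show ?thesis using kappa by (simp add: mult_ac)
  qed
  have bound: "\<bar>P t\<bar> \<le> ?B t" if "0 < t" for t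
  proof -
    have "((\<lambda>u. \<bar>P t - P u\<bar>) \<longlongrightarrow> \<bar>P t - P 0\<bar>) (at_right 0)"
      unfolding P_def by (intro tendsto_intros)
    moreover have "((\<lambda>u. \<kappa> * pi * Kg * (2 * cosh t - 2 * cosh u) + M * \<bar>Q t - Q u\<bar>) \<longlongrightarrow>
       \<kappa> * pi * Kg * (2 * cosh t - 2 * cosh 0) + M * \<bar>Q t - Q 0\<bar>) (at_right 0)"
    proof (intro tendsto_intros)
      have "isCont Q 0" using Q by (rule DERIV_isCont)
      then show "(Q \<longlongrightarrow> Q 0) (at_right 0)"
        unfolding isCont_def by (rule filterlim_mono[OF _ order_refl at_le]) simp
    qed
    moreover have "\<forall>\<^sub>F u in at_right 0. \<bar>P t - P u\<bar> \<le> \<kappa> * pi * Kg * (2 * cosh t - 2 * cosh u) + M * \<bar>Q t - Q u\<bar>"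
      using step that unfolding eventually_at_right_field by (intro exI[of _ t]) auto
    ultimately have "\<bar>P t - P 0\<bar> \<le> \<kappa> * pi * Kg * (2 * cosh t - 2 * cosh 0) + M * \<bar>Q t - Q 0\<bar>"
      using tendsto_le[OF trivial_limit_at_right_real] by blast
    then show ?thesis by (simp add: P_def[of 0])
  qed
  \<comment> \<open>The one-sided derivative of \<open>P\<close> at 0 is found twice: from the
    formula for \<open>P\<close>, and as 0 from \<open>bound\<close>. Equating the two determines
    \<open>A0\<close>.\<close>
  have "(P has_real_derivative 2 * \<kappa> * pi * c1 + A0 * \<kappa>) (at 0)"
    unfolding P_def[abs_def] by (auto intro!: derivative_eq_intros)
  then have dP: "((\<lambda>t. P t / t) \<longlongrightarrow> 2 * \<kappa> * pi * c1 + A0 * \<kappa>) (at_right 0)"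
    unfolding DERIV_def by (auto simp: P_def[of 0] intro: filterlim_mono[OF _ order_refl at_le])
  have "((\<lambda>t. 2 * cosh t - 2) has_real_derivative 0) (at (0::real))" by (auto intro!: derivative_eq_intros)
  then have d1: "((\<lambda>t::real. (2 * cosh t - 2) / t) \<longlongrightarrow> 0) (at_right 0)"
    unfolding DERIV_def by (auto intro: filterlim_mono[OF _ order_refl at_le])
  have d2: "((\<lambda>t. (Q t - Q 0) / t) \<longlongrightarrow> 0) (at_right 0)"
    using Q unfolding DERIV_def by (auto intro: filterlim_mono[OF _ order_refl at_le])
  have "((\<lambda>t. P t / t) \<longlongrightarrow> 0) (at_right 0)"
  proof (rule Lim_null_comparison)
    have "((\<lambda>t. \<kappa> * pi * Kg * ((2 * cosh t - 2) / t) + M * \<bar>(Q t - Q 0) / t\<bar>) \<longlongrightarrow> \<kappa> * pi * Kg * 0 + M * \<bar>0\<bar>) (at_right 0)"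
      by (intro tendsto_intros d1 d2)
    then show "((\<lambda>t. \<kappa> * pi * Kg * ((2 * cosh t - 2) / t) + M * \<bar>(Q t - Q 0) / t\<bar>) \<longlongrightarrow> 0) (at_right 0)" by simp
    show "\<forall>\<^sub>F t in at_right 0. norm (P t / t) \<le> \<kappa> * pi * Kg * ((2 * cosh t - 2) / t) + M * \<bar>(Q t - Q 0) / t\<bar>"
      unfolding eventually_at_right_field
    proof (intro exI[of _ 1] conjI allI impI)
      fix t :: real assume t: "0 < t" "t < 1"
      have "norm (P t / t) \<le> ?B t / t" using bound[OF t(1)] t by (simp add: divide_right_mono)
      also have "\<dots> = \<kappa> * pi * Kg * ((2 * cosh t - 2) / t) + M * \<bar>(Q t - Q 0) / t\<bar>"
        using t by (simp add: add_divide_distrib)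
      finally show "norm (P t / t) \<le> \<kappa> * pi * Kg * ((2 * cosh t - 2) / t) + M * \<bar>(Q t - Q 0) / t\<bar>" .
    qed simp
  qed
  then have "2 * \<kappa> * pi * c1 + A0 * \<kappa> = 0"
    using tendsto_unique[OF trivial_limit_at_right_real dP] by blast
  then have "\<kappa> * (A0 + 2 * pi * c1) = 0" by (simp add: algebra_simps)
  then show ?thesis using kappa by simp
qed

lemma Lam_Lg_gt:
  assumes "0 < t"
  shows "Lam (Lg (of_real (exp t))) = - 2 * pi * c1 * (sinh (\<kappa> * t) - \<kappa> * t)"
  using Lam_Lg_exp(1)[OF assms] by (simp add: A0_eq algebra_simps)

lemma sinh_gap_mono:
  fixes a b :: real
  assumes "0 \<le> a" "a \<le> b"
  shows "sinh a - a \<le> sinh b - b"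
proof (rule DERIV_nonneg_imp_nondecreasing[OF assms(2)])
  fix x assume "a \<le> x" "x \<le> b"
  have "((\<lambda>x. sinh x - x) has_real_derivative cosh x - 1) (at x)" by (auto intro!: derivative_eq_intros)
  then show "\<exists>y. ((\<lambda>x. sinh x - x) has_real_derivative y) (at x) \<and> 0 \<le> y"
    using cosh_real_ge_1[of x] by auto
qed

text \<open>Minus the value of the functional at \<open>Lg (exp 1)\<close>, that is, at t = 1; by
  monotonicity every larger argument gives at most \<open>- gap\<close>.\<close>

definition "gap = 2 * pi * c1 * (sinh \<kappa> - \<kappa>)"

lemma gap_pos: "0 < gap"
proof -
  have "\<kappa> < sinh \<kappa>"
  proof -
    have "\<exists>z. 0 < z \<and> z < \<kappa> \<and> (sinh \<kappa> - \<kappa>) - (sinh 0 - 0) = (\<kappa> - 0) * (cosh z - 1)"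
      using kappa by (intro MVT2) (auto intro!: derivative_eq_intros)
    then obtain z where z: "0 < z" "(sinh \<kappa> - \<kappa>) = \<kappa> * (cosh z - 1)" by auto
    have "1 < cosh z" using z(1) cosh_real_strict_mono[of 0 z] by simp
    then show ?thesis using z kappa by (metis diff_gt_0_iff_gt mult_pos_pos less_trans zero_less_divide_1_iff zero_less_numeral)
  qed
  then show ?thesis using constants_pos by (simp add: gap_def)
qed

lemma Lam_Lg_nonpos:
  assumes "0 \<le> h" "h \<noteq> 1"
  shows "adm (Lg (of_real h))" "Lam (Lg (of_real h)) \<le> 0" "exp 1 \<le> h \<Longrightarrow> Lam (Lg (of_real h)) \<le> - gap"
proof -
  have "adm (Lg (of_real h)) \<and> Lam (Lg (of_real h)) \<le> 0 \<and> (exp 1 \<le> h \<longrightarrow> Lam (Lg (of_real h)) \<le> - gap)"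
  proof (cases "h < 1")
    case True
    have "h < exp 1" using True one_le_exp_iff[of 1] by (smt (verit))
    then show ?thesis using Lam_Lg_small[of "of_real h"] True assms by auto
  next
    case False
    define t where "t = ln h"
    have h: "h = exp t" "0 < t" using False assms by (auto simp: t_def)
    have k: "0 \<le> \<kappa> * t" using h kappa by simp
    have "sinh 0 - 0 \<le> sinh (\<kappa> * t) - \<kappa> * t" by (rule sinh_gap_mono) (use k in auto)
    then have "Lam (Lg (of_real h)) \<le> 0" unfolding h(1) Lam_Lg_gt[OF h(2)] using constants_pos by simp
    moreover have "Lam (Lg (of_real h)) \<le> - gap" if "exp 1 \<le> h"
    proof -
      have "1 \<le> t" using that h by simp
      then have "\<kappa> * 1 \<le> \<kappa> * t" using kappa by (intro mult_left_mono) auto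
      then have "sinh \<kappa> - \<kappa> \<le> sinh (\<kappa> * t) - \<kappa> * t" using kappa by (intro sinh_gap_mono) auto
      then have "2 * pi * c1 * (sinh \<kappa> - \<kappa>) \<le> 2 * pi * c1 * (sinh (\<kappa> * t) - \<kappa> * t)"
        using constants_pos by (intro mult_left_mono) auto
      then show ?thesis unfolding h(1) Lam_Lg_gt[OF h(2)] gap_def by simp
    qed
    ultimately show ?thesis using adm_Lg_real[of h] False assms by auto
  qed
  then show "adm (Lg (of_real h))" "Lam (Lg (of_real h)) \<le> 0" "exp 1 \<le> h \<Longrightarrow> Lam (Lg (of_real h)) \<le> - gap"
    by auto
qed

end

section \<open>Counting eigenvalues\<close>

text \<open>Turns the logarithm of the product in Hadamard's bound into a Schatten sum of order
  \<open>q\<close>.\<close>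

lemma ln_one_plus_le_powr:
  fixes y q :: real
  assumes "0 \<le> y" "0 < q" "q \<le> 1"
  shows "ln (1 + y) \<le> y powr q / q"
proof (cases "y \<le> 1")
  case True
  show ?thesis
  proof (cases "y = 0")
    case False
    have "ln (1 + y) \<le> y powr 1" using ln_add_one_self_le_self[OF assms(1)] assms(1) by simp
    also have "\<dots> \<le> y powr q" using True assms False by (intro powr_mono') auto
    also have "\<dots> \<le> y powr q / q" using mult_left_le_one_le[of "y powr q" q] assms by (simp add: field_simps)
    finally show ?thesis .
  qed (use assms in simp)
next
  case False
  have "ln (1 + y) \<le> ln (2 * y)" using False by (intro ln_mono) auto
  also have "\<dots> = ln 2 + ln y" using False by (simp add: ln_mult)
  also have "ln 2 \<le> (2::real) - 1" by (intro ln_le_minus_one) simp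
  also have "\<dots> \<le> 1 / q" using assms by (simp add: field_simps)
  also have "ln y \<le> (y powr q - 1) / q"
  proof -
    have "ln (y powr q) \<le> y powr q - 1" using False by (intro ln_le_minus_one) simp
    then show ?thesis using assms False by (simp add: ln_powr field_simps)
  qed
  finally show ?thesis using assms by (simp add: field_simps)
qed

context slit
begin

text \<open>The sine of half the argument for nonzero \<open>z\<close> in the upper half-plane: the
  uniform lower bound for the modulus of 1 - h z over h \<ge> 0 given by
  \<open>quadratic_cos_lower\<close>.\<close>

definition "aperture z = sqrt ((1 - Re z / cmod z) / 2)"

definition "majorant q z = (cmod z / aperture z) powr q"

lemma aperture_polar: "0 < x \<Longrightarrow> aperture (of_real x * cis s) = sqrt ((1 - cos s) / 2)"
  by (simp add: aperture_def norm_mult)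

text \<open>On the circle the second-order zero of \<open>g\<close> absorbs the singularity at the
  point 1. On the ray the aperture is constant, and \<open>x powr q\<close> is integrable against
  \<open>w\<close> because \<open>\<kappa> < q\<close>.\<close>

lemma adm_majorant:
  assumes q: "\<kappa> < q" "q < 1"
  shows "adm (majorant q)"
  unfolding adm_def
proof (intro conjI)
  show "(\<lambda>s. g s * majorant q (cis s)) integrable_on {0..pi}"
  proof (rule integrable_dominated_at_0)
    have c: "cos s < 1" if "s \<in> {0<..pi}" for s using that cos_monotone_0_pi[of 0 s] by simp
    have m: "majorant q (cis s) = (1 / sqrt ((1 - cos s) / 2)) powr q" for s
      using aperture_polar[of 1 s] by (simp add: majorant_def)
    show "continuous_on {0<..pi} (\<lambda>s. g s * majorant q (cis s))"
      unfolding m using c by (intro continuous_intros g_cont) (auto simp: less_imp_neq)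
    show "(\<lambda>s. 2 * Kg) integrable_on {0..pi}" by (rule integrable_const_ivl)
    fix s assume s: "s \<in> {0<..pi}"
    let ?y = "2 / (1 - cos s)"
    have "1 - x \<le> 2" if "- 1 \<le> x" for x :: real using that by simp
    then have "1 - cos s \<le> 2" using cos_ge_minus_one by blast
    then have y: "1 \<le> ?y" using c[OF s] by (subst pos_le_divide_eq) auto
    have "1 / sqrt ((1 - cos s) / 2) = ?y powr (1 / 2)"
      using c[OF s] by (simp add: powr_half_sqrt real_sqrt_divide)
    then have "majorant q (cis s) = ?y powr (q / 2)" unfolding m by (simp add: powr_powr)
    also have "\<dots> \<le> ?y powr 1" using y q by (intro powr_mono) auto
    also have "\<dots> = ?y" using y by simp
    finally have "g s * majorant q (cis s) \<le> (Kg * (1 - cos s)) * ?y"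
      using g_upper[of s] g_nonneg[of s] s by (intro mult_mono) (auto simp: majorant_def)
    also have "\<dots> = 2 * Kg" using c[OF s] by simp
    finally show "\<bar>g s * majorant q (cis s)\<bar> \<le> 2 * Kg"
      using g_nonneg[of s] s by (simp add: majorant_def)
  qed
  have "(\<lambda>x. w x * x powr q) integrable_on {0..1}" using w_moment[OF q(1)] by (auto simp: integrable_on_def)
  then have "(\<lambda>x. (w x * x powr q) * (1 / sqrt m1) powr q) integrable_on {0..1}"
    using integrable_on_mult_left by blast
  then show "(\<lambda>x. w x * majorant q (of_real x * cis s1)) integrable_on {0..1}"
  proof (rule integrable_eq)
    fix x :: real assume x: "x \<in> {0..1}"
    show "w x * x powr q * (1 / sqrt m1) powr q = w x * majorant q (of_real x * cis s1)"
    proof (cases "x = 0")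
      case False
      then have "majorant q (of_real x * cis s1) = (x * (1 / sqrt m1)) powr q"
        using x by (simp add: majorant_def aperture_polar norm_mult m1_def)
      also have "\<dots> = x powr q * (1 / sqrt m1) powr q"
        using x constants_pos by (subst powr_mult) auto
      finally show ?thesis by simp
    qed (simp add: w_def)
  qed
qed

text \<open>The determinant inequality at the point \<open>of_real (R * x) * cis s\<close>, with
  \<open>c\<close> the distance bound of \<open>quadratic_cos_lower\<close>, in logarithmic form.
  The bound on \<open>R * cmod (\<alpha> j)\<close> keeps the factors on the left away from
  zero.\<close>

lemma log_perturbation:
  fixes \<alpha> :: "nat \<Rightarrow> complex" and h \<sigma> :: "nat \<Rightarrow> real"
  assumes \<alpha>: "\<And>j. j < d \<Longrightarrow> R * cmod (\<alpha> j) < 1" and h: "\<And>k. k < d \<Longrightarrow> 0 \<le> h k"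
    and \<sigma>: "\<And>j. j < d \<Longrightarrow> 0 \<le> \<sigma> j" and R: "0 < R" and q: "0 < q" "q \<le> 1"
    and pert: "\<And>z c. 0 < c \<Longrightarrow> (\<And>k. k < d \<Longrightarrow> c \<le> cmod (1 - z * of_real (h k))) \<Longrightarrow>
      (\<Prod>j<d. cmod (1 - z * \<alpha> j)) \<le> (\<Prod>k<d. cmod (1 - z * of_real (h k))) * (\<Prod>j<d. 1 + cmod z / c * \<sigma> j)"
    and x: "0 < x" "x \<le> 1" and s: "cos s < 1"
  shows "(\<Sum>j<d. ln (cmod (1 - of_real R * \<alpha> j * (of_real x * cis s))))
    \<le> (\<Sum>k<d. ln (cmod (1 - of_real (R * h k) * (of_real x * cis s))))
      + (R powr q / q * (\<Sum>j<d. \<sigma> j powr q)) * (x / sqrt ((1 - cos s) / 2)) powr q"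
proof -
  let ?c = "sqrt ((1 - cos s) / 2)" and ?z = "of_real (R * x) * cis s"
  have c: "0 < ?c" using s by simp
  have ch: "?c \<le> cmod (1 - ?z * of_real (h k))" if "k < d" for k
  proof -
    have "(1 - cos s) / 2 \<le> 1 - 2 * (R * x * h k) * cos s + (R * x * h k)\<^sup>2"
      using R x h[OF that] by (intro quadratic_cos_lower) simp
    also have "\<dots> = (cmod (1 - of_real (R * x * h k) * cis s))\<^sup>2" by (rule cmod_one_minus_cis[symmetric])
    finally have "?c \<le> cmod (1 - of_real (R * x * h k) * cis s)" by (intro real_le_lsqrt) auto
    then show ?thesis by (simp add: mult_ac)
  qed
  have hp: "0 < cmod (1 - ?z * of_real (h k))" if "k < d" for k using ch[OF that] c by linarith
  have ap: "0 < cmod (1 - ?z * \<alpha> j)" if "j < d" for j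
  proof -
    have "cmod (?z * \<alpha> j) = x * (R * cmod (\<alpha> j))" using R x by (simp add: norm_mult)
    also have "\<dots> \<le> 1 * (R * cmod (\<alpha> j))" using x R by (intro mult_right_mono) auto
    also have "\<dots> < 1" using \<alpha>[OF that] by simp
    finally have "?z * \<alpha> j \<noteq> 1" by auto
    then show ?thesis by simp
  qed
  have sp: "0 < 1 + cmod ?z / ?c * \<sigma> j" if "j < d" for j
    using \<sigma>[OF that] c by (intro add_pos_nonneg mult_nonneg_nonneg) auto
  have zc: "cmod ?z = R * x" using R x by (simp add: norm_mult)
  have "(\<Prod>j<d. cmod (1 - ?z * \<alpha> j)) \<le> (\<Prod>k<d. cmod (1 - ?z * of_real (h k))) * (\<Prod>j<d. 1 + cmod ?z / ?c * \<sigma> j)"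
    by (rule pert[OF c ch])
  then have "ln (\<Prod>j<d. cmod (1 - ?z * \<alpha> j)) \<le> ln ((\<Prod>k<d. cmod (1 - ?z * of_real (h k))) * (\<Prod>j<d. 1 + cmod ?z / ?c * \<sigma> j))"
    using ap hp sp by (intro ln_mono prod_pos) auto
  also have "\<dots> = ln (\<Prod>k<d. cmod (1 - ?z * of_real (h k))) + ln (\<Prod>j<d. 1 + cmod ?z / ?c * \<sigma> j)"
    using hp sp by (intro ln_mult_pos prod_pos) auto
  also have "ln (\<Prod>k<d. cmod (1 - ?z * of_real (h k))) = (\<Sum>k<d. ln (cmod (1 - ?z * of_real (h k))))"
    using hp by (intro ln_prod) auto
  also have "ln (\<Prod>j<d. 1 + cmod ?z / ?c * \<sigma> j) = (\<Sum>j<d. ln (1 + cmod ?z / ?c * \<sigma> j))"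
  proof (rule ln_prod)
    fix j assume "j \<in> {..<d}"
    then have "j < d" by simp
    from less_imp_neq[OF sp[OF this]] show "1 + cmod ?z / ?c * \<sigma> j \<noteq> 0" by (rule not_sym)
  qed simp
  also have "\<dots> \<le> (\<Sum>j<d. (R powr q / q) * (x / ?c) powr q * \<sigma> j powr q)"
  proof (rule sum_mono)
    fix j assume "j \<in> {..<d}"
    then have j: "j < d" by simp
    have nn: "0 \<le> x / ?c" using x c by simp
    have "ln (1 + cmod ?z / ?c * \<sigma> j) \<le> (cmod ?z / ?c * \<sigma> j) powr q / q"
      using \<sigma>[OF j] c q by (intro ln_one_plus_le_powr) auto
    also have "cmod ?z / ?c * \<sigma> j = R * (x / ?c) * \<sigma> j" unfolding zc by simp
    also have "(R * (x / ?c) * \<sigma> j) powr q = R powr q * (x / ?c) powr q * \<sigma> j powr q"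
      using R nn \<sigma>[OF j] by (simp only: powr_mult mult_nonneg_nonneg less_imp_le)
    finally show "ln (1 + cmod ?z / ?c * \<sigma> j) \<le> (R powr q / q) * (x / ?c) powr q * \<sigma> j powr q" unfolding zc by simp
  qed
  also have "\<dots> = (R powr q / q * (\<Sum>j<d. \<sigma> j powr q)) * (x / ?c) powr q"
    by (simp add: sum_distrib_left sum_distrib_right mult_ac)
  also have "ln (\<Prod>j<d. cmod (1 - ?z * \<alpha> j)) = (\<Sum>j<d. ln (cmod (1 - ?z * \<alpha> j)))"
    using ap by (intro ln_prod) auto
  finally show ?thesis by (simp add: mult_ac)
qed

text \<open>After scaling by \<open>R\<close> the numbers \<open>\<alpha> j\<close> lie in the open
  unit disc, where the functional vanishes on \<open>Lg\<close>. Every \<open>R * h k\<close>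
  contributes at most 0, and those with \<open>t \<le> h k\<close> lie beyond \<open>exp 1\<close>
  and contribute at most \<open>- gap\<close>. Positivity of the functional carries the pointwise
  inequality over to these values.\<close>

lemma count_bound:
  fixes \<alpha> :: "nat \<Rightarrow> complex" and h \<sigma> :: "nat \<Rightarrow> real"
  assumes q: "\<kappa> < q" "q < 1" and t: "0 < t"
    and \<alpha>: "\<And>j. j < d \<Longrightarrow> cmod (\<alpha> j) \<le> t / 8" and h: "\<And>k. k < d \<Longrightarrow> 0 \<le> h k"
    and \<sigma>: "\<And>j. j < d \<Longrightarrow> 0 \<le> \<sigma> j"
    and pert: "\<And>z c. 0 < c \<Longrightarrow> (\<And>k. k < d \<Longrightarrow> c \<le> cmod (1 - z * of_real (h k))) \<Longrightarrow>
      (\<Prod>j<d. cmod (1 - z * \<alpha> j)) \<le> (\<Prod>k<d. cmod (1 - z * of_real (h k))) * (\<Prod>j<d. 1 + cmod z / c * \<sigma> j)"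
  shows "real (card {k. k < d \<and> t \<le> h k}) \<le> (2 * 6 powr q * Lam (majorant q) / (q * gap)) * t powr (- q) * (\<Sum>j<d. \<sigma> j powr q)"
proof -
  have q0: "0 < q" "q \<le> 1" using q kappa by auto
  have e3: "exp 1 \<le> (3::real)" by (rule exp_le)
  \<comment> \<open>\<open>R\<close> has to avoid the finitely many numbers \<open>1 / h k\<close>,
    for which the logarithm is singular on the circle. As \<open>exp 1 \<le> 3\<close>, the upper
    end of the interval is at most \<open>6 / t\<close>, which together with \<open>t / 8\<close>
    puts \<open>R * \<alpha> j\<close> inside the unit disc.\<close>
  have "infinite {exp 1 / t..2 * exp 1 / t}"
    using t by (intro infinite_Icc) (simp add: divide_strict_right_mono)
  moreover have "finite ((\<lambda>k. 1 / h k) ` {..<d})" by simp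
  ultimately have "{exp 1 / t..2 * exp 1 / t} - (\<lambda>k. 1 / h k) ` {..<d} \<noteq> {}"
    using Diff_infinite_finite infinite_imp_nonempty by blast
  then obtain R where R: "exp 1 / t \<le> R" "R \<le> 2 * exp 1 / t" "R \<notin> (\<lambda>k. 1 / h k) ` {..<d}"
    by (metis Diff_iff atLeastAtMost_iff ex_in_conv)
  have r0: "0 < R" using R(1) t by (metis divide_pos_pos exp_gt_zero less_le_trans)
  have r6: "R \<le> 6 / t"
  proof -
    have "2 * exp 1 / t \<le> 6 / t" using t e3 by (intro divide_right_mono) auto
    then show ?thesis using R(2) by linarith
  qed
  have rh: "R * h k \<noteq> 1" if "k < d" for k
  proof
    assume "R * h k = 1"
    then have "R = 1 / h k" by (metis eq_divide_eq mult_zero_right zero_neq_one)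
    then show False using R(3) that by auto
  qed
  have ra: "R * cmod (\<alpha> j) < 1" if "j < d" for j
  proof -
    have "R * cmod (\<alpha> j) \<le> 6 / t * (t / 8)" using r6 \<alpha>[OF that] r0 t by (intro mult_mono) auto
    then show ?thesis using t by simp
  qed
  let ?S = "\<Sum>j<d. \<sigma> j powr q"
  \<comment> \<open>The factor 2 arises because \<open>Lg\<close> adds the inequality at a point and
    at its conjugate.\<close>
  define W where "W = 2 * (R powr q / q * ?S)"
  have pt: "(\<Sum>j<d. Lg (of_real R * \<alpha> j) z) \<le> (\<Sum>k<d. Lg (of_real (R * h k)) z) + W * majorant q z"
    if z: "z = of_real x * cis s" and x: "0 < x" "x \<le> 1" and s: "cos s < 1" for z x s
  proof -
    have cz: "cnj z = of_real x * cis (- s)" by (simp add: z cis_cnj)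
    have A: "(\<Sum>j<d. ln (cmod (1 - of_real R * \<alpha> j * (of_real x * cis s))))
      \<le> (\<Sum>k<d. ln (cmod (1 - of_real (R * h k) * (of_real x * cis s))))
        + (R powr q / q * ?S) * (x / sqrt ((1 - cos s) / 2)) powr q" if "cos s < 1" for s
      by (rule log_perturbation) (fact ra h \<sigma> r0 q0 pert x that)+
    have "(\<Sum>j<d. ln (cmod (1 - of_real R * \<alpha> j * z))) \<le> (\<Sum>k<d. ln (cmod (1 - of_real (R * h k) * z)))
      + (R powr q / q * ?S) * (x / sqrt ((1 - cos s) / 2)) powr q"
      unfolding z by (rule A[OF s])
    moreover have "(\<Sum>j<d. ln (cmod (1 - of_real R * \<alpha> j * cnj z))) \<le> (\<Sum>k<d. ln (cmod (1 - of_real (R * h k) * cnj z)))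
      + (R powr q / q * ?S) * (x / sqrt ((1 - cos s) / 2)) powr q"
      unfolding cz using A[of "- s"] s by simp
    moreover have "(x / sqrt ((1 - cos s) / 2)) powr q = majorant q z"
      using x by (simp add: z majorant_def aperture_polar norm_mult)
    ultimately show ?thesis unfolding Lg_def sum.distrib W_def by (simp add: algebra_simps)
  qed
  have adm\<alpha>: "adm (Lg (of_real R * \<alpha> j))" and Lam\<alpha>: "Lam (Lg (of_real R * \<alpha> j)) = 0" if "j < d" for j
    using Lam_Lg_small[of "of_real R * \<alpha> j"] ra[OF that] r0 by (auto simp: norm_mult)
  have rh0: "0 \<le> R * h k" if "k < d" for k using h[OF that] r0 by simp
  note admh = Lam_Lg_nonpos(1)[OF rh0 rh]
  have adm1: "adm (\<lambda>z. \<Sum>j<d. Lg (of_real R * \<alpha> j) z)" using adm\<alpha> by (intro Lam_sum) auto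
  have adm2: "adm (\<lambda>z. \<Sum>k<d. Lg (of_real (R * h k)) z)" using admh by (intro Lam_sum) auto
  have adm3: "adm (\<lambda>z. W * majorant q z)" by (intro Lam_cmult adm_majorant q)
  have "Lam (\<lambda>z. \<Sum>j<d. Lg (of_real R * \<alpha> j) z) \<le> Lam (\<lambda>z. (\<Sum>k<d. Lg (of_real (R * h k)) z) + W * majorant q z)"
  proof (rule Lam_mono[OF adm1 Lam_add(1)[OF adm2 adm3]])
    show "(\<Sum>j<d. Lg (of_real R * \<alpha> j) (cis s)) \<le> (\<Sum>k<d. Lg (of_real (R * h k)) (cis s)) + W * majorant q (cis s)"
      if "0 < s" "s \<le> pi" for s
      using that cos_monotone_0_pi[of 0 s] by (intro pt[of _ 1 s]) auto
    show "(\<Sum>j<d. Lg (of_real R * \<alpha> j) (of_real x * cis s1)) \<le> (\<Sum>k<d. Lg (of_real (R * h k)) (of_real x * cis s1)) + W * majorant q (of_real x * cis s1)"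
      if "0 < x" "x \<le> 1" for x
      using that s1 s1_range cos_monotone_0_pi[of 0 s1] by (intro pt[OF refl]) auto
  qed
  also have "\<dots> = (\<Sum>k<d. Lam (Lg (of_real (R * h k)))) + W * Lam (majorant q)"
  proof -
    have "Lam (\<lambda>z. \<Sum>k<d. Lg (of_real (R * h k)) z) = (\<Sum>k<d. Lam (Lg (of_real (R * h k))))"
      using admh by (intro Lam_sum) auto
    then show ?thesis using Lam_add(2)[OF adm2 adm3] Lam_cmult(2) by simp
  qed
  also have "(\<Sum>k<d. Lam (Lg (of_real (R * h k)))) \<le> (\<Sum>k<d. if t \<le> h k then - gap else 0)"
  proof (rule sum_mono)
    fix k assume "k \<in> {..<d}"
    then have k: "k < d" by simp
    have "exp 1 \<le> R * h k" if "t \<le> h k"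
    proof -
      have "exp 1 / t * t \<le> R * h k" using R(1) that t r0 by (intro mult_mono) auto
      then show ?thesis using t by simp
    qed
    then show "Lam (Lg (of_real (R * h k))) \<le> (if t \<le> h k then - gap else 0)"
      using Lam_Lg_nonpos(2,3)[OF rh0[OF k] rh[OF k]] by auto
  qed
  also have "(\<Sum>k<d. if t \<le> h k then - gap else 0) = - (gap * real (card {k. k < d \<and> t \<le> h k}))"
  proof -
    have "{..<d} \<inter> {k. t \<le> h k} = {k. k < d \<and> t \<le> h k}" by auto
    then show ?thesis by (simp add: sum.If_cases mult.commute)
  qed
  also have "Lam (\<lambda>z. \<Sum>j<d. Lg (of_real R * \<alpha> j) z) = 0"
    using Lam_sum(2)[of "{..<d}" "\<lambda>j. Lg (of_real R * \<alpha> j)"] adm\<alpha> Lam\<alpha> by simp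
  finally have 1: "gap * real (card {k. k < d \<and> t \<le> h k}) \<le> W * Lam (majorant q)" by simp
  have Lp: "0 \<le> Lam (majorant q)"
    using Lam_mono[OF Lam_zero(1) adm_majorant[OF q]] Lam_zero(2) by (simp add: majorant_def)
  have S0: "0 \<le> ?S" by (intro sum_nonneg) simp
  have "R powr q \<le> (6 / t) powr q" using r0 r6 q0 by (intro powr_mono2) auto
  also have "\<dots> = 6 powr q * t powr (- q)" using t by (simp add: powr_divide powr_minus_divide)
  finally have "W \<le> 2 * (6 powr q * t powr (- q) / q * ?S)"
    unfolding W_def using q0 S0 by (intro mult_left_mono mult_right_mono divide_right_mono) auto
  then have "W * Lam (majorant q) \<le> 2 * (6 powr q * t powr (- q) / q * ?S) * Lam (majorant q)"
    by (rule mult_right_mono[OF _ Lp])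
  then have "gap * real (card {k. k < d \<and> t \<le> h k}) \<le> 2 * (6 powr q * t powr (- q) / q * ?S) * Lam (majorant q)"
    by (rule order_trans[OF 1])
  then show ?thesis using gap_pos q0 by (simp add: field_simps)
qed

end

lemma quasinilpotent_count_bound:
  assumes q: "1/2 < q" "q < 1"
  shows "\<exists>C\<ge>0. \<forall>d n b v \<mu> t S. \<forall>H K :: 'a::complex_inner \<Rightarrow> 'a.
     orthonormal d b \<longrightarrow> clin H \<longrightarrow> clin K \<longrightarrow>
     (\<forall>x y. proj d b x = x \<longrightarrow> proj d b y = y \<longrightarrow> cinner (H x) y = cinner x (H y)) \<longrightarrow>
     (\<forall>x. proj d b x = x \<longrightarrow> 0 \<le> Re (cinner (H x) x)) \<longrightarrow>
     (\<forall>a x. proj d b x = x \<longrightarrow> x \<noteq> 0 \<longrightarrow> proj d b (H x + K x) = scaleC a x \<longrightarrow> cmod a \<le> t / 8) \<longrightarrow>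
     0 < t \<longrightarrow> orthonormal n v \<longrightarrow>
     (\<forall>i<n. proj d b (v i) = v i \<and> H (v i) = scaleC (of_real (\<mu> i)) (v i) \<and> t \<le> \<mu> i) \<longrightarrow>
     (\<Sum>j<d. norm (K (b j)) powr q) \<le> S \<longrightarrow>
     real n \<le> C * t powr (- q) * S"
proof -
  \<comment> \<open>Any \<open>\<kappa>\<close> strictly between 1/2 and \<open>q\<close> and any
    admissible angle would do; midpoints are taken.\<close>
  define \<kappa> where "\<kappa> = (1/2 + q) / 2"
  define s1 where "s1 = (pi - pi / (2 * \<kappa>)) / 2"
  have k: "1/2 < \<kappa>" "\<kappa> < 1" "\<kappa> < q" using q by (auto simp: \<kappa>_def)
  have "pi / (2 * \<kappa>) < pi" using k by (simp add: field_simps)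
  then interpret slit \<kappa> s1 using k by unfold_locales (auto simp: s1_def)
  define C where "C = 2 * 6 powr q * Lam (majorant q) / (q * gap)"
  have "0 \<le> Lam (majorant q)"
    using Lam_mono[OF Lam_zero(1) adm_majorant[OF k(3) q(2)]] Lam_zero(2) by (simp add: majorant_def)
  then have C0: "0 \<le> C" using gap_pos q by (simp add: C_def)
  show ?thesis
  proof (intro exI[of _ C] conjI allI impI C0)
    fix d n b v \<mu> t S and H K :: "'a \<Rightarrow> 'a"
    assume b: "orthonormal d b" and H: "clin H" and K: "clin K"
      and sym: "\<forall>x y. proj d b x = x \<longrightarrow> proj d b y = y \<longrightarrow> cinner (H x) y = cinner x (H y)"
      and pos: "\<forall>x. proj d b x = x \<longrightarrow> 0 \<le> Re (cinner (H x) x)"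
      and spec: "\<forall>a x. proj d b x = x \<longrightarrow> x \<noteq> 0 \<longrightarrow> proj d b (H x + K x) = scaleC a x \<longrightarrow> cmod a \<le> t / 8"
      and t: "0 < t" and v: "orthonormal n v"
      and ev: "\<forall>i<n. proj d b (v i) = v i \<and> H (v i) = scaleC (of_real (\<mu> i)) (v i) \<and> t \<le> \<mu> i"
      and S: "(\<Sum>j<d. norm (K (b j)) powr q) \<le> S"
    obtain \<alpha> h g where *: "\<And>j. j < d \<Longrightarrow> cmod (\<alpha> j) \<le> t / 8" "orthonormal d g" "proj d g = proj d b"
      "\<And>k. k < d \<Longrightarrow> proj d b (H (g k)) = scaleC (of_real (h k)) (g k)"
      "\<And>z c. 0 < c \<Longrightarrow> (\<And>k. k < d \<Longrightarrow> c \<le> cmod (1 - z * of_real (h k))) \<Longrightarrow>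
        (\<Prod>j<d. cmod (1 - z * \<alpha> j)) \<le> (\<Prod>k<d. cmod (1 - z * of_real (h k))) * (\<Prod>j<d. 1 + cmod z / c * norm (K (b j)))"
      by (rule det_perturbation[OF b H K, of "\<lambda>a. cmod a \<le> t / 8"]) (use sym spec in blast)+
    have h0: "0 \<le> h k" if "k < d" for k
    proof -
      have gk: "proj d b (g k) = g k" using proj_basis[OF *(2) that] *(3) by simp
      have "cinner (H (g k)) (g k) = cinner (proj d b (H (g k))) (g k)"
        by (simp add: proj_selfadjoint gk)
      also have "\<dots> = of_real (h k)"
        unfolding *(4)[OF that] using orthonormal_norm[OF *(2) that] by (simp add: cinner_scaleC_left cinner_self)
      finally show ?thesis using pos gk by (metis Re_complex_of_real)
    qed
    have "n \<le> card {k. k < d \<and> t \<le> h k}"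
      by (rule eigenvector_count_le[OF b H _ *(2,3,4) v]) (use sym ev in auto)
    then have "real n \<le> real (card {k. k < d \<and> t \<le> h k})" by simp
    also have "\<dots> \<le> C * t powr (- q) * (\<Sum>j<d. norm (K (b j)) powr q)"
      unfolding C_def by (rule count_bound[OF k(3) q(2) t *(1) h0 _ *(5)]) auto
    also have "\<dots> \<le> C * t powr (- q) * S" using S C0 by (intro mult_left_mono) auto
    finally show "real n \<le> C * t powr (- q) * S" .
  qed
qed

section \<open>Operators on a Hilbert space\<close>

lemma tendsto_zero_dominated:
  fixes f :: "nat \<Rightarrow> 'b::real_normed_vector"
  assumes "\<And>n. norm (f n) \<le> g n" "g \<longlonglongrightarrow> 0"
  shows "f \<longlonglongrightarrow> 0"
  by (rule Lim_null_comparison[OF always_eventually]) (use assms in auto)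

lemma limit_eventually_const:
  fixes X :: "nat \<Rightarrow> 'b::t2_space"
  assumes "X \<longlonglongrightarrow> b" "\<forall>\<^sub>F n in sequentially. X n = a"
  shows "b = a"
  using LIMSEQ_unique[OF assms(1) tendsto_eventually[OF assms(2)]] .

text \<open>Zero vectors are allowed, so that finite systems can be continued by zeros.\<close>

definition orthosystem :: "(nat \<Rightarrow> 'a::complex_inner) \<Rightarrow> bool" where
  "orthosystem e \<longleftrightarrow> (\<forall>i j. cinner (e i) (e j) = (if i = j \<and> e i \<noteq> 0 then 1 else 0))"

lemma cinner_comb_orthosystem:
  assumes "orthosystem e"
  shows "cinner (\<Sum>j<n. scaleC (c j * cinner x (e j)) (e j)) (e i) = (if i < n then c i * cinner x (e i) else 0)"
proof -
  have "cinner (\<Sum>j<n. scaleC (c j * cinner x (e j)) (e j)) (e i) = (\<Sum>j<n. if j = i then c i * cinner x (e i) else 0)"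
    unfolding cinner_sum_left cinner_scaleC_left
  proof (rule sum.cong[OF refl])
    fix j
    show "c j * cinner x (e j) * cinner (e j) (e i) = (if j = i then c i * cinner x (e i) else 0)"
      using assms by (cases "e i = 0") (auto simp: orthosystem_def)
  qed
  then show ?thesis by simp
qed

lemma norm_comb_orthosystem:
  assumes "orthosystem e"
  shows "(norm (\<Sum>j\<in>A. scaleC (c j * cinner x (e j)) (e j)))\<^sup>2 = (\<Sum>j\<in>A. (cmod (c j))\<^sup>2 * (cmod (cinner x (e j)))\<^sup>2)"
proof (cases "finite A")
  case True
  let ?y = "\<Sum>j\<in>A. scaleC (c j * cinner x (e j)) (e j)"
  have "cinner ?y ?y = (\<Sum>i\<in>A. cnj (c i * cinner x (e i)) * cinner ?y (e i))"
    by (simp only: cinner_sum_right cinner_scaleC_right)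
  also have "\<dots> = (\<Sum>i\<in>A. cnj (c i * cinner x (e i)) * (c i * cinner x (e i)))"
  proof (rule sum.cong[OF refl])
    fix i assume i: "i \<in> A"
    have "cinner ?y (e i) = (\<Sum>j\<in>A. if j = i then c i * cinner x (e i) else 0)"
      unfolding cinner_sum_left cinner_scaleC_left
    proof (rule sum.cong[OF refl])
      fix j
      show "c j * cinner x (e j) * cinner (e j) (e i) = (if j = i then c i * cinner x (e i) else 0)"
        using assms by (cases "e i = 0") (auto simp: orthosystem_def)
    qed
    then show "cnj (c i * cinner x (e i)) * cinner ?y (e i) = cnj (c i * cinner x (e i)) * (c i * cinner x (e i))"
      using True i by simp
  qed
  also have "\<dots> = of_real (\<Sum>i\<in>A. (cmod (c i * cinner x (e i)))\<^sup>2)"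
    by (simp add: complex_norm_square mult.commute del: complex_cnj_mult of_real_power)
  finally show ?thesis
    unfolding cinner_self of_real_eq_iff by (simp add: norm_mult power_mult_distrib)
qed simp

lemma bessel_orthosystem:
  assumes "orthosystem e"
  shows "(\<Sum>j<n. (cmod (cinner x (e j)))\<^sup>2) \<le> (norm x)\<^sup>2"
proof -
  let ?y = "\<Sum>j<n. scaleC (1 * cinner x (e j)) (e j)"
  have n: "(norm ?y)\<^sup>2 = (\<Sum>j<n. (cmod (cinner x (e j)))\<^sup>2)"
    unfolding norm_comb_orthosystem[OF assms] by simp
  have "cinner x ?y = (\<Sum>j<n. cnj (cinner x (e j)) * cinner x (e j))"
    by (simp add: cinner_sum_right cinner_scaleC_right)
  also have "\<dots> = of_real (\<Sum>j<n. (cmod (cinner x (e j)))\<^sup>2)"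
    by (simp add: complex_norm_square mult.commute del: of_real_power)
  finally have "Re (cinner x ?y) = (norm ?y)\<^sup>2" using n by simp
  then have "0 \<le> (norm x)\<^sup>2 - (norm ?y)\<^sup>2"
    using norm_sq_diff[of x ?y] zero_le_power2[of "norm (x - ?y)"] by simp
  then show ?thesis using n by linarith
qed

locale hilbert_space =
  fixes S :: "'a::complex_inner set"
  assumes subspace: "csubspace S" and complete: "complete S"
begin

lemma closed_space: "closed S"
  using complete by (simp add: complete_imp_closed)

lemmas sub = csubspace_simps[OF subspace]

lemma bounded_opD:
  assumes "bounded_op S T"
  shows "clin_on S T" "x \<in> S \<Longrightarrow> T x \<in> S" "\<exists>M\<ge>0. \<forall>x\<in>S. norm (T x) \<le> M * norm x"
proof -
  show "clin_on S T" "x \<in> S \<Longrightarrow> T x \<in> S" using assms by (auto simp: bounded_op_def clin_on_def)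
  obtain M where M: "\<forall>x\<in>S. norm (T x) \<le> M * norm x" using assms by (auto simp: bounded_op_def)
  have "norm (T x) \<le> \<bar>M\<bar> * norm x" if "x \<in> S" for x
    using M that by (meson abs_ge_self mult_right_mono norm_ge_zero order_trans)
  then show "\<exists>M\<ge>0. \<forall>x\<in>S. norm (T x) \<le> M * norm x" by (intro exI[of _ "\<bar>M\<bar>"]) auto
qed

lemma bounded_op_tendsto:
  assumes "bounded_op S T" "\<And>n. x n \<in> S" "x \<longlonglongrightarrow> l"
  shows "(\<lambda>n. T (x n)) \<longlonglongrightarrow> T l"
proof -
  have l: "l \<in> S" using closed_sequentially[OF closed_space] assms by blast
  obtain M where M: "\<forall>x\<in>S. norm (T x) \<le> M * norm x" using bounded_opD(3)[OF assms(1)] by blast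
  have "(\<lambda>n. M * norm (x n - l)) \<longlonglongrightarrow> M * norm (l - l)" by (intro tendsto_intros assms)
  then have "(\<lambda>n. M * norm (x n - l)) \<longlonglongrightarrow> 0" by simp
  moreover have "norm (T (x n) - T l) \<le> M * norm (x n - l)" for n
    using M sub(4)[OF assms(2)[of n] l] clin_on_simps(2)[OF subspace bounded_opD(1)[OF assms(1)] assms(2)[of n] l] by metis
  ultimately have "(\<lambda>n. T (x n) - T l) \<longlonglongrightarrow> 0"
    by (rule tendsto_zero_dominated[rotated])
  then show ?thesis by (rule LIM_zero_cancel)
qed

definition sequentially_compact :: "('a \<Rightarrow> 'a) \<Rightarrow> bool" where
  "sequentially_compact T \<longleftrightarrow> (\<forall>x. (\<forall>n. x n \<in> S \<and> norm (x n) \<le> 1) \<longrightarrow>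
     (\<exists>r l. strict_mono (r :: nat \<Rightarrow> nat) \<and> l \<in> S \<and> (\<lambda>n. T (x (r n))) \<longlonglongrightarrow> l))"

lemma sequentially_compactD:
  assumes "sequentially_compact T" "\<And>n. x n \<in> S" "\<And>n. norm (x n) \<le> 1"
  obtains r l where "strict_mono (r :: nat \<Rightarrow> nat)" "l \<in> S" "(\<lambda>n. T (x (r n))) \<longlonglongrightarrow> l"
  using assms unfolding sequentially_compact_def by blast

lemma compact_op_sequentially_compact:
  assumes "compact_op S T"
  shows "sequentially_compact T"
  unfolding sequentially_compact_def
proof (intro allI impI)
  fix x :: "nat \<Rightarrow> 'a" assume x: "\<forall>n. x n \<in> S \<and> norm (x n) \<le> 1"
  have "compact (closure (T ` {f \<in> S. norm f \<le> 1}))" using assms by (simp add: compact_op_def)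
  moreover have "\<forall>n. T (x n) \<in> closure (T ` {f \<in> S. norm f \<le> 1})"
    using x closure_subset by (auto intro!: subsetD[OF closure_subset])
  ultimately obtain l r where *: "strict_mono (r :: nat \<Rightarrow> nat)" "((\<lambda>n. T (x n)) \<circ> r) \<longlonglongrightarrow> l"
    unfolding compact_def by (auto dest!: spec[of _ "\<lambda>n. T (x n)"])
  have "T (x n) \<in> S" for n using x assms bounded_opD(2) by (auto simp: compact_op_def)
  then have "l \<in> S" using closed_sequentially[OF closed_space, of "(\<lambda>n. T (x n)) \<circ> r" l] *(2) by auto
  then show "\<exists>r l. strict_mono (r :: nat \<Rightarrow> nat) \<and> l \<in> S \<and> (\<lambda>n. T (x (r n))) \<longlonglongrightarrow> l"
    using * by (auto simp: o_def)
qed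

section \<open>Spectral theorem for compact non-negative operators\<close>

lemma nonneg_opD:
  assumes "nonneg_op S C"
  shows "bounded_op S C" "x \<in> S \<Longrightarrow> y \<in> S \<Longrightarrow> cinner (C x) y = cinner x (C y)"
    "x \<in> S \<Longrightarrow> 0 \<le> Re (cinner (C x) x)" "x \<in> S \<Longrightarrow> C x \<in> S"
  using assms bounded_opD(2) by (auto simp: nonneg_op_def)

text \<open>The form is tested at \<open>x - (1/l) C x\<close>, where it is non-negative. The upper
  bound for the form enters only at the vector \<open>C x\<close>.\<close>

lemma norm_sq_le_form:
  assumes C: "nonneg_op S C" and x: "x \<in> S" and l: "0 < l"
    and le: "Re (cinner (C (C x)) (C x)) \<le> l * (norm (C x))\<^sup>2"
  shows "(norm (C x))\<^sup>2 \<le> l * Re (cinner (C x) x)"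
proof -
  let ?y = "scaleC (of_real (1 / l)) (C x)"
  have Cx: "C x \<in> S" using nonneg_opD(4)[OF C x] .
  have y: "?y \<in> S" using sub(3)[OF Cx] .
  have lin: "C (x - ?y) = C x - scaleC (of_real (1 / l)) (C (C x))"
    using clin_on_simps(2)[OF subspace bounded_opD(1)[OF nonneg_opD(1)[OF C]] x y]
      clin_onD(2)[OF bounded_opD(1)[OF nonneg_opD(1)[OF C]] Cx] by simp
  have "0 \<le> Re (cinner (C (x - ?y)) (x - ?y))" by (rule nonneg_opD(3)[OF C sub(4)[OF x y]])
  also have "cinner (C (x - ?y)) (x - ?y) = cinner (C x) x - of_real (1 / l) * cinner (C x) (C x)
    - of_real (1 / l) * cinner (C (C x)) x + of_real (1 / l) * (of_real (1 / l) * cinner (C (C x)) (C x))"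
    unfolding lin by (simp only: cinner_diff_left cinner_diff_right cinner_scaleC_left cinner_scaleC_right complex_cnj_complex_of_real) (simp add: algebra_simps)
  also have "cinner (C (C x)) x = cinner (C x) (C x)" by (rule nonneg_opD(2)[OF C Cx x])
  finally have "0 \<le> Re (cinner (C x) x) - 2 * ((norm (C x))\<^sup>2 / l) + Re (cinner (C (C x)) (C x)) / l / l"
    by (simp add: Re_cinner_self)
  moreover have "Re (cinner (C (C x)) (C x)) / l / l \<le> (l * (norm (C x))\<^sup>2) / l / l"
    using le l by (intro divide_right_mono) auto
  ultimately have "(norm (C x))\<^sup>2 / l \<le> Re (cinner (C x) x)" using l by simp
  then show ?thesis using l by (simp add: field_simps)
qed

lemma form_zero_imp_zero:
  assumes C: "nonneg_op S C" and x: "x \<in> S" and z: "Re (cinner (C x) x) \<le> 0" "Re (cinner (C (C x)) (C x)) \<le> 0"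
  shows "C x = 0"
proof -
  have "(norm (C x))\<^sup>2 \<le> 1 * Re (cinner (C x) x)"
    by (rule norm_sq_le_form[OF C x]) (use z(2) in \<open>auto intro: order_trans\<close>)
  then show ?thesis using z(1) by (metis dual_order.trans mult_1 norm_eq_zero power2_less_eq_zero_iff)
qed

text \<open>Unit vectors that nearly maximize the form on \<open>N\<close> are approximate
  eigenvectors: \<open>norm_sq_le_form\<close> bounds the squared norm of C x - l x by l (l - (C x,
  x)). Compactness makes a subsequence of \<open>C x\<close> converge, and then the vectors
  themselves, as \<open>l > 0\<close>.\<close>

lemma max_eigenvector:
  assumes C: "nonneg_op S C" and cpt: "sequentially_compact C"
    and N: "csubspace N" "closed N" "N \<subseteq> S" "\<And>x. x \<in> N \<Longrightarrow> C x \<in> N"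
    and ne: "x0 \<in> N" "C x0 \<noteq> 0"
  obtains l e where "0 < l" "e \<in> N" "norm e = 1" "C e = scaleC (of_real l) e"
    "\<And>x. x \<in> N \<Longrightarrow> Re (cinner (C x) x) \<le> l * (norm x)\<^sup>2"
proof -
  note lin = bounded_opD(1)[OF nonneg_opD(1)[OF C]]
  define F where "F = {Re (cinner (C x) x) | x. x \<in> N \<and> norm x = 1}"
  obtain M where M: "M \<ge> 0" "\<forall>x\<in>S. norm (C x) \<le> M * norm x" using bounded_opD(3)[OF nonneg_opD(1)[OF C]] by blast
  have bd: "bdd_above F"
  proof (rule bdd_aboveI)
    fix t assume "t \<in> F"
    then obtain x where x: "x \<in> N" "norm x = 1" "t = Re (cinner (C x) x)" by (auto simp: F_def)
    have "t \<le> norm (C x) * norm x"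
      using x(3) complex_Re_le_cmod cauchy_schwarz order_trans by metis
    also have "\<dots> \<le> M"
      using bspec[OF M(2) subsetD[OF N(3) x(1)]] by (simp add: x(2))
    finally show "t \<le> M" .
  qed
  define l where "l = Sup F"
  have form: "Re (cinner (C x) x) \<le> l * (norm x)\<^sup>2" if x: "x \<in> N" for x
  proof (cases "x = 0")
    case False
    define u where "u = scaleC (of_real (1 / norm x)) x"
    have u: "u \<in> N" "norm u = 1" using csubspace_simps(3)[OF N(1) x] False by (auto simp: u_def norm_scaleC norm_divide)
    then have "Re (cinner (C u) u) \<le> l" unfolding l_def by (intro cSup_upper bd) (auto simp: F_def)
    moreover have "C u = scaleC (of_real (1 / norm x)) (C x)"
      unfolding u_def using clin_onD(2)[OF lin] x N(3) by blast
    then have "Re (cinner (C u) u) = Re (cinner (C x) x) / (norm x)\<^sup>2"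
      by (simp add: u_def cinner_scaleC_left cinner_scaleC_right power2_eq_square)
    ultimately show ?thesis using False by (simp add: field_simps)
  qed (use clin_on_simps(1)[OF subspace lin] in simp)
  have l0: "0 < l"
  proof (rule ccontr)
    assume "\<not> 0 < l"
    then have "l * (norm x)\<^sup>2 \<le> 0" for x by (simp add: mult_nonpos_nonneg)
    then have "Re (cinner (C x) x) \<le> 0" if "x \<in> N" for x using form[OF that] order_trans by blast
    then have "C x0 = 0" using ne(1) N by (intro form_zero_imp_zero[OF C]) auto
    then show False using ne by simp
  qed
  have Fne: "F \<noteq> {}"
  proof -
    have "x0 \<noteq> 0" using ne(2) clin_on_simps(1)[OF subspace lin] by auto
    then have "scaleC (of_real (1 / norm x0)) x0 \<in> N" "norm (scaleC (of_real (1 / norm x0)) x0) = 1"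
      using csubspace_simps(3)[OF N(1) ne(1)] by (auto simp: norm_scaleC norm_divide)
    then show ?thesis by (auto simp: F_def)
  qed
  have "\<exists>x. x \<in> N \<and> norm x = 1 \<and> l - 1 / real (Suc n) < Re (cinner (C x) x)" for n
  proof -
    have "l - 1 / real (Suc n) < Sup F" by (simp add: l_def)
    then obtain t where "t \<in> F" "l - 1 / real (Suc n) < t" using less_cSup_iff[OF Fne bd] by blast
    then show ?thesis by (auto simp: F_def)
  qed
  then obtain x where x: "\<And>n. x n \<in> N" "\<And>n. norm (x n) = 1" "\<And>n. l - 1 / real (Suc n) < Re (cinner (C (x n)) (x n))"
    by metis
  have xS: "x n \<in> S" for n using x(1) N(3) by blast
  define d where "d n = C (x n) - scaleC (of_real l) (x n)" for n
  have dn: "(norm (d n))\<^sup>2 \<le> l * (1 / real (Suc n))" for n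
  proof -
    let ?a = "Re (cinner (C (x n)) (x n))"
    have "(norm (C (x n)))\<^sup>2 \<le> l * ?a"
      using form N x(1) by (intro norm_sq_le_form[OF C xS l0]) auto
    moreover have "(norm (d n))\<^sup>2 = (norm (C (x n)))\<^sup>2 - 2 * (l * ?a) + l\<^sup>2"
      unfolding d_def norm_sq_diff using l0 x(2) by (simp add: norm_scaleC cinner_scaleC_right)
    ultimately have "(norm (d n))\<^sup>2 \<le> l * (l - ?a)" by (simp add: power2_eq_square algebra_simps)
    also have "\<dots> \<le> l * (1 / real (Suc n))" using x(3)[of n] l0 by (intro mult_left_mono) auto
    finally show ?thesis .
  qed
  have d0: "d \<longlonglongrightarrow> 0"
  proof -
    have lz: "(\<lambda>n. l * (1 / real (Suc n))) \<longlonglongrightarrow> l * 0" by (intro tendsto_intros LIMSEQ_Suc[OF lim_1_over_n])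
    have "(\<lambda>n. (norm (d n))\<^sup>2) \<longlonglongrightarrow> 0"
    proof (rule tendsto_zero_dominated[where g = "\<lambda>n. l * (1 / real (Suc n))"])
      show "norm ((norm (d n))\<^sup>2) \<le> l * (1 / real (Suc n))" for n using dn[of n] by simp
    qed (use lz in simp)
    then have "(\<lambda>n. sqrt ((norm (d n))\<^sup>2)) \<longlonglongrightarrow> sqrt 0" by (rule tendsto_real_sqrt)
    then show ?thesis by (simp add: tendsto_norm_zero_iff)
  qed
  have x1: "norm (x n) \<le> 1" for n using x(2) by simp
  obtain r y where r: "strict_mono (r :: nat \<Rightarrow> nat)" "y \<in> S" "(\<lambda>n. C (x (r n))) \<longlonglongrightarrow> y"
    by (rule sequentially_compactD[OF cpt xS x1])
  have dr: "(\<lambda>n. d (r n)) \<longlonglongrightarrow> 0" using LIMSEQ_subseq_LIMSEQ[OF d0 r(1)] by (simp add: o_def)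
  define e where "e = scaleC (of_real (1 / l)) y"
  have "(\<lambda>n. scaleC (of_real (1 / l)) (C (x (r n)) - d (r n))) \<longlonglongrightarrow> scaleC (of_real (1 / l)) (y - 0)"
    by (rule tendsto_scaleC[OF tendsto_const tendsto_diff[OF r(3) dr]])
  moreover have "scaleC (of_real (1 / l)) (C (x n) - d n) = x n" for n
    using l0 by (simp add: d_def scaleC_scaleC flip: of_real_mult)
  ultimately have xe: "(\<lambda>n. x (r n)) \<longlonglongrightarrow> e" by (simp add: e_def)
  have eN: "e \<in> N" using closed_sequentially[OF N(2) _ xe] x(1) by blast
  have "(\<lambda>n. norm (x (r n))) \<longlonglongrightarrow> norm e" by (intro tendsto_norm xe)
  then have ne1: "norm e = 1" using x(2) by (simp add: LIMSEQ_const_iff)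
  have "(\<lambda>n. C (x (r n))) \<longlonglongrightarrow> C e" by (rule bounded_op_tendsto[OF nonneg_opD(1)[OF C] xS xe])
  then have "C e = y" using r(3) LIMSEQ_unique by blast
  then have "C e = scaleC (of_real l) e" using l0 by (simp add: e_def scaleC_scaleC flip: of_real_mult)
  then show thesis using that l0 eN ne1 form by blast
qed

text \<open>Operators of finite rank fit the format through a tail of zero vectors with value 0. The
  \<open>e i\<close> need not be complete; the last clause, that \<open>C\<close> annihilates their
  orthogonal complement, takes the place of completeness.\<close>

definition eigensystem :: "('a \<Rightarrow> 'a) \<Rightarrow> (nat \<Rightarrow> 'a) \<Rightarrow> (nat \<Rightarrow> real) \<Rightarrow> bool" where
  "eigensystem C e ev \<longleftrightarrow> orthosystem e \<and> (\<forall>i. e i \<in> S) \<and> antimono ev \<and> (\<forall>i. 0 \<le> ev i) \<and> ev \<longlonglongrightarrow> 0 \<and>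
     (\<forall>i. e i \<noteq> 0 \<longleftrightarrow> 0 < ev i) \<and> (\<forall>i. C (e i) = scaleC (of_real (ev i)) (e i)) \<and>
     (\<forall>y\<in>S. (\<forall>i. cinner y (e i) = 0) \<longrightarrow> C y = 0)"

lemma eigensystemD:
  assumes "eigensystem C e ev"
  shows "orthosystem e" "e i \<in> S" "antimono ev" "0 \<le> ev i" "ev \<longlonglongrightarrow> 0" "e i \<noteq> 0 \<longleftrightarrow> 0 < ev i"
    "C (e i) = scaleC (of_real (ev i)) (e i)" "y \<in> S \<Longrightarrow> (\<And>i. cinner y (e i) = 0) \<Longrightarrow> C y = 0"
  using assms by (auto simp: eigensystem_def)

text \<open>Each eigenvector maximizes the form on the orthogonal complement of its predecessors.
  This extremal property is kept as the second conclusion, because the tail estimates for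
  \<open>H\<close> and \<open>K\<close> rest on it.\<close>

theorem spectral_theorem:
  assumes C: "nonneg_op S C" and cpt: "sequentially_compact C"
  obtains e ev where "eigensystem C e ev"
    "\<And>n x. x \<in> S \<Longrightarrow> (\<And>i. i < n \<Longrightarrow> cinner x (e i) = 0) \<Longrightarrow> Re (cinner (C x) x) \<le> ev n * (norm x)\<^sup>2"
proof -
  note lin = bounded_opD(1)[OF nonneg_opD(1)[OF C]]
  define N where "N f n = {x \<in> S. \<forall>i<n. cinner x (fst (f i)) = 0}" for f :: "nat \<Rightarrow> 'a \<times> real" and n :: nat
  define P where "P f n p \<longleftrightarrow> fst p \<in> N f n \<and> C (fst p) = scaleC (of_real (snd p)) (fst p) \<and>
    0 \<le> snd p \<and> (\<forall>x\<in>N f n. Re (cinner (C x) x) \<le> snd p * (norm x)\<^sup>2) \<and>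
    (0 < snd p \<longrightarrow> norm (fst p) = 1) \<and> (snd p = 0 \<longrightarrow> fst p = 0)" for f n and p :: "'a \<times> real"
  have subN: "csubspace (N f n)" for f n
    using sub by (auto simp: csubspace_def N_def cinner_add_left cinner_scaleC_left)
  have clN: "closed (N f n)" for f n
  proof -
    have "x \<in> N f n" if s: "\<forall>k. u k \<in> N f n" "u \<longlonglongrightarrow> x" for u x
    proof -
      have "x \<in> S" using s closed_sequentially[OF closed_space, of u x] by (auto simp: N_def)
      moreover have "cinner x (fst (f i)) = 0" if "i < n" for i
      proof -
        have "(\<lambda>k. cinner (u k) (fst (f i))) \<longlonglongrightarrow> cinner x (fst (f i))" by (intro tendsto_cinner s tendsto_const)
        moreover have "cinner (u k) (fst (f i)) = 0" for k using s(1) that by (auto simp: N_def)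
        ultimately show ?thesis by (simp add: LIMSEQ_const_iff)
      qed
      ultimately show ?thesis by (auto simp: N_def)
    qed
    then show ?thesis unfolding closed_sequential_limits by blast
  qed
  have "\<exists>f. \<forall>n. P f n (f n)"
  \<comment> \<open>Pairs of a vector and its eigenvalue are chosen, each depending on all
    predecessors. Once the operator vanishes on the remaining subspace, the pair (0, 0) is
    chosen.\<close>
  proof (rule dependent_wellorder_choice)
    fix p and f g :: "nat \<Rightarrow> 'a \<times> real" and n :: nat
    assume "\<And>y. y < n \<Longrightarrow> f y = g y"
    then show "P f n p = P g n p" by (simp add: P_def N_def)
  next
    fix n :: nat and f :: "nat \<Rightarrow> 'a \<times> real" assume IH: "\<And>y. y < n \<Longrightarrow> P f y (f y)"
    have inv: "C x \<in> N f n" if x: "x \<in> N f n" for x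
    proof -
      have "cinner (C x) (fst (f i)) = 0" if "i < n" for i
      proof -
        have fi: "fst (f i) \<in> S" "C (fst (f i)) = scaleC (of_real (snd (f i))) (fst (f i))"
          using IH[OF that] by (auto simp: P_def N_def)
        have "cinner (C x) (fst (f i)) = cinner x (C (fst (f i)))"
          using nonneg_opD(2)[OF C _ fi(1)] x by (simp add: N_def)
        then show ?thesis using fi(2) x that by (simp add: N_def cinner_scaleC_right)
      qed
      then show ?thesis using nonneg_opD(4)[OF C] x by (auto simp: N_def)
    qed
    have NS: "N f n \<subseteq> S" by (auto simp: N_def)
    show "\<exists>p. P f n p"
    proof (cases "\<exists>x\<in>N f n. C x \<noteq> 0")
      case True
      then obtain x0 where "x0 \<in> N f n" "C x0 \<noteq> 0" by blast
      then obtain l e where "0 < l" "e \<in> N f n" "norm e = 1" "C e = scaleC (of_real l) e"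
        "\<And>x. x \<in> N f n \<Longrightarrow> Re (cinner (C x) x) \<le> l * (norm x)\<^sup>2"
        using max_eigenvector[OF C cpt subN clN NS inv] by metis
      then show ?thesis by (intro exI[of _ "(e, l)"]) (auto simp: P_def)
    next
      case False
      then show ?thesis
        using csubspace_simps(1)[OF subN] clin_on_simps(1)[OF subspace lin]
        by (intro exI[of _ "(0, 0)"]) (auto simp: P_def)
    qed
  qed
  then obtain f where f: "\<And>n. P f n (f n)" by blast
  define e where "e n = fst (f n)" for n
  define ev where "ev n = snd (f n)" for n
  have e: "e n \<in> S" "\<And>i. i < n \<Longrightarrow> cinner (e n) (e i) = 0" "C (e n) = scaleC (of_real (ev n)) (e n)" "0 \<le> ev n"
    "0 < ev n \<Longrightarrow> norm (e n) = 1" "ev n = 0 \<Longrightarrow> e n = 0"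
    "\<And>x. x \<in> S \<Longrightarrow> (\<And>i. i < n \<Longrightarrow> cinner x (e i) = 0) \<Longrightarrow> Re (cinner (C x) x) \<le> ev n * (norm x)\<^sup>2" for n
    using f[of n] by (auto simp: P_def N_def e_def ev_def)
  have ne: "e i \<noteq> 0 \<longleftrightarrow> 0 < ev i" for i
    using e(4,5,6)[of i] by (metis less_eq_real_def less_irrefl norm_zero zero_neq_one)
  have orth: "cinner (e i) (e j) = 0" if "i \<noteq> j" for i j
    using that e(2)[of i j] e(2)[of j i] by (metis cinner_commute complex_cnj_zero linorder_neqE_nat)
  have os: "orthosystem e"
    unfolding orthosystem_def
  proof (intro allI)
    fix i j
    show "cinner (e i) (e j) = (if i = j \<and> e i \<noteq> 0 then 1 else 0)"
      using orth[of i j] e(5)[of i] ne[of i] by (auto simp: cinner_self)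
  qed
  have anti: "antimono ev"
  proof (rule decseq_SucI)
    fix n
    show "ev (Suc n) \<le> ev n"
    proof (cases "0 < ev (Suc n)")
      case True
      have "Re (cinner (C (e (Suc n))) (e (Suc n))) \<le> ev n * (norm (e (Suc n)))\<^sup>2"
        using e(1)[of "Suc n"] e(2) by (intro e(7)) auto
      then show ?thesis using e(3)[of "Suc n"] e(5)[OF True] by (simp add: cinner_scaleC_left cinner_self)
    qed (use e(4)[of n] in linarith)
  qed
  have lim: "ev \<longlonglongrightarrow> 0"
  proof (rule ccontr)
    assume nl: "\<not> ev \<longlonglongrightarrow> 0"
    obtain \<delta> where \<delta>: "0 < \<delta>" "\<And>n. \<delta> \<le> ev n"
    proof -
      obtain \<delta> where "0 < \<delta>" "\<not> (\<forall>\<^sub>F n in sequentially. dist (ev n) 0 < \<delta>)"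
        using nl by (auto simp: tendsto_iff)
      then have "\<exists>m\<ge>n. \<delta> \<le> ev m" for n
        using e(4) unfolding eventually_sequentially by (fastforce simp: not_less)
      then have "\<delta> \<le> ev n" for n using antimonoD[OF anti] by (meson order_trans)
      then show thesis using that \<open>0 < \<delta>\<close> by blast
    qed
    have pos: "0 < ev n" for n using \<delta> by (meson less_le_trans)
    have e1: "norm (e n) \<le> 1" for n using e(5)[OF pos] by simp
    obtain r l where r: "strict_mono (r :: nat \<Rightarrow> nat)" "(\<lambda>n. C (e (r n))) \<longlonglongrightarrow> l"
      by (rule sequentially_compactD[OF cpt e(1) e1])
    have "Cauchy (\<lambda>n. C (e (r n)))" using r(2) by (rule LIMSEQ_imp_Cauchy)
    then obtain m where m: "\<forall>i\<ge>m. \<forall>j\<ge>m. dist (C (e (r i))) (C (e (r j))) < \<delta>" using \<delta>(1) by (auto simp: Cauchy_def)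
    have rn: "r m \<noteq> r (Suc m)" using r(1) by (simp add: strict_mono_eq)
    \<comment> \<open>Images of distinct unit eigenvectors with eigenvalues at least
      \<open>\<delta>\<close> stay at distance at least \<open>\<delta>\<close>, so no subsequence
      of images can converge.\<close>
    have "(norm (C (e (r m)) - C (e (r (Suc m)))))\<^sup>2 = (ev (r m))\<^sup>2 + (ev (r (Suc m)))\<^sup>2"
      unfolding norm_sq_diff e(3) using orth[OF rn] e(5)[OF pos] e(4)
      by (simp add: norm_scaleC cinner_scaleC_left cinner_scaleC_right)
    moreover have "\<delta>\<^sup>2 \<le> (ev (r m))\<^sup>2" using \<delta> by (intro power_mono) auto
    ultimately have "\<delta>\<^sup>2 \<le> (norm (C (e (r m)) - C (e (r (Suc m)))))\<^sup>2"
      using zero_le_power2[of "ev (r (Suc m))"] by linarith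
    then have "\<delta> \<le> dist (C (e (r m))) (C (e (r (Suc m))))" unfolding dist_norm by (rule power2_le_imp_le) simp
    then show False using m by (meson le_SucI not_less order_refl)
  qed
  have kill: "C y = 0" if y: "y \<in> S" "\<forall>i. cinner y (e i) = 0" for y
  proof -
    have le0: "Re (cinner (C z) z) \<le> 0" if z: "z \<in> S" "\<And>i. cinner z (e i) = 0" for z
    proof -
      have "(\<lambda>n. ev n * (norm z)\<^sup>2) \<longlonglongrightarrow> 0 * (norm z)\<^sup>2" by (intro tendsto_intros lim)
      then show ?thesis using e(7)[OF z(1)] z(2) by (intro LIMSEQ_le_const[where X = "\<lambda>n. ev n * (norm z)\<^sup>2"]) auto
    qed
    have "cinner (C y) (e i) = 0" for i
      using nonneg_opD(2)[OF C y(1) e(1)[of i]] e(3)[of i] y(2) by (simp add: cinner_scaleC_right)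
    then show ?thesis using le0 y nonneg_opD(4)[OF C y(1)] by (intro form_zero_imp_zero[OF C y(1)]) auto
  qed
  have "eigensystem C e ev"
    unfolding eigensystem_def using os e(1,3,4) anti lim ne kill by blast
  then show thesis using that e(7) by blast
qed

text \<open>Bessel's inequality makes the partial sums Cauchy for any bounded multipliers
  \<open>c\<close>. It serves both for expanding a vector and for building functions of an
  operator.\<close>

lemma orthosystem_expansion_converges:
  assumes os: "orthosystem e" and eS: "\<And>i. e i \<in> S" and B: "\<And>i. cmod (c i) \<le> B"
  shows "\<exists>y\<in>S. (\<lambda>n. \<Sum>j<n. scaleC (c j * cinner x (e j)) (e j)) \<longlonglongrightarrow> y \<and> norm y \<le> B * norm x"
proof -
  define p where "p n = (\<Sum>j<n. scaleC (c j * cinner x (e j)) (e j))" for n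
  have B0: "0 \<le> B" using B[of 0] norm_ge_zero order_trans by blast
  have pS: "p n \<in> S" for n unfolding p_def by (intro sub(5) sub(3) eS)
  let ?a = "\<lambda>j. (cmod (cinner x (e j)))\<^sup>2"
  have "summable ?a"
    by (rule summableI_nonneg_bounded[of _ "(norm x)\<^sup>2"]) (auto intro: bessel_orthosystem[OF os])
  then have cau: "Cauchy (\<lambda>n. \<Sum>j<n. ?a j)" by (simp add: summable_iff_convergent Cauchy_convergent_iff)
  have diff: "(norm (p n - p m))\<^sup>2 \<le> B\<^sup>2 * ((\<Sum>j<n. ?a j) - (\<Sum>j<m. ?a j))" if "m \<le> n" for m n
  proof -
    have "{..<n} = {..<m} \<union> {m..<n}" using that by auto
    then have split: "(\<Sum>j<n. h j) = (\<Sum>j<m. h j) + (\<Sum>j\<in>{m..<n}. h j)" for h :: "nat \<Rightarrow> 'b::ab_group_add"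
      by (simp add: sum.union_disjoint ivl_disj_int)
    have "p n - p m = (\<Sum>j\<in>{m..<n}. scaleC (c j * cinner x (e j)) (e j))" unfolding p_def split by simp
    then have "(norm (p n - p m))\<^sup>2 = (\<Sum>j\<in>{m..<n}. (cmod (c j))\<^sup>2 * ?a j)"
      by (simp only: norm_comb_orthosystem[OF os])
    also have "\<dots> \<le> (\<Sum>j\<in>{m..<n}. B\<^sup>2 * ?a j)" by (intro sum_mono mult_right_mono power_mono B) auto
    also have "\<dots> = B\<^sup>2 * ((\<Sum>j<n. ?a j) - (\<Sum>j<m. ?a j))" unfolding split by (simp add: sum_distrib_left)
    finally show ?thesis .
  qed
  have "Cauchy p"
  proof (rule metric_CauchyI)
    fix \<epsilon> :: real assume \<epsilon>: "0 < \<epsilon>"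
    have "0 < \<epsilon>\<^sup>2 / (B\<^sup>2 + 1)" using \<epsilon> by (simp add: add_nonneg_pos)
    then obtain M where M: "\<And>m n. m \<ge> M \<Longrightarrow> n \<ge> M \<Longrightarrow> dist (\<Sum>j<m. ?a j) (\<Sum>j<n. ?a j) < \<epsilon>\<^sup>2 / (B\<^sup>2 + 1)"
      using metric_CauchyD[OF cau] by blast
    have key: "dist (p m) (p n) < \<epsilon>" if "m \<ge> M" "n \<ge> M" "m \<le> n" for m n
    proof -
      have "(norm (p n - p m))\<^sup>2 \<le> B\<^sup>2 * ((\<Sum>j<n. ?a j) - (\<Sum>j<m. ?a j))" by (rule diff[OF that(3)])
      also have "\<dots> \<le> B\<^sup>2 * (\<epsilon>\<^sup>2 / (B\<^sup>2 + 1))"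
        using M[OF that(1,2)] by (intro mult_left_mono) (auto simp: dist_real_def)
      also have "\<dots> < (B\<^sup>2 + 1) * (\<epsilon>\<^sup>2 / (B\<^sup>2 + 1))" using \<open>0 < \<epsilon>\<^sup>2 / (B\<^sup>2 + 1)\<close> by (intro mult_strict_right_mono) auto
      also have "\<dots> = \<epsilon>\<^sup>2" by (simp add: add_nonneg_eq_0_iff)
      finally have "norm (p n - p m) < \<epsilon>" by (rule power_less_imp_less_base) (use \<epsilon> in simp)
      then show ?thesis by (simp add: dist_norm norm_minus_commute)
    qed
    show "\<exists>M. \<forall>m\<ge>M. \<forall>n\<ge>M. dist (p m) (p n) < \<epsilon>"
      using key by (metis dist_commute nle_le)
  qed
  then obtain y where y: "y \<in> S" "p \<longlonglongrightarrow> y" using completeE[OF complete, of p] pS by blast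
  have "norm (p n) \<le> B * norm x" for n
  proof (rule power2_le_imp_le)
    have "(norm (p n))\<^sup>2 \<le> B\<^sup>2 * (\<Sum>j<n. ?a j)" using diff[of 0 n] by (simp add: p_def)
    also have "\<dots> \<le> B\<^sup>2 * (norm x)\<^sup>2" by (intro mult_left_mono bessel_orthosystem[OF os]) auto
    finally show "(norm (p n))\<^sup>2 \<le> (B * norm x)\<^sup>2" by (simp add: power_mult_distrib)
  qed (use B0 in simp)
  then have "norm y \<le> B * norm x" using y(2) by (intro LIMSEQ_le_const2[OF tendsto_norm]) auto
  then show ?thesis using y unfolding p_def[abs_def] by blast
qed

text \<open>The difference between \<open>x\<close> and its expansion is orthogonal to every
  \<open>e i\<close>, hence annihilated by \<open>A\<close>; continuity lets \<open>A\<close> act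
  termwise on the expansion.\<close>

lemma diagonal_expansion:
  assumes A: "bounded_op S A" and os: "orthosystem e" and eS: "\<And>i. e i \<in> S"
    and Ae: "\<And>i. A (e i) = scaleC (of_real (a i)) (e i)"
    and kill: "\<And>y. y \<in> S \<Longrightarrow> (\<And>i. cinner y (e i) = 0) \<Longrightarrow> A y = 0" and x: "x \<in> S"
  shows "(\<lambda>n. \<Sum>j<n. scaleC (of_real (a j) * cinner x (e j)) (e j)) \<longlonglongrightarrow> A x"
proof -
  note lin = bounded_opD(1)[OF A]
  obtain y where y: "y \<in> S" "(\<lambda>n. \<Sum>j<n. scaleC (1 * cinner x (e j)) (e j)) \<longlonglongrightarrow> y"
    using orthosystem_expansion_converges[OF os eS, of "\<lambda>_. 1" 1 x] by auto
  have "cinner (x - y) (e i) = 0" for i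
  proof -
    have "(\<lambda>n. cinner (\<Sum>j<n. scaleC (1 * cinner x (e j)) (e j)) (e i)) \<longlonglongrightarrow> cinner y (e i)"
      by (intro tendsto_cinner y tendsto_const)
    moreover have "\<forall>\<^sub>F n in sequentially. cinner (\<Sum>j<n. scaleC (1 * cinner x (e j)) (e j)) (e i) = cinner x (e i)"
      unfolding cinner_comb_orthosystem[OF os] by (rule eventually_sequentiallyI[of "Suc i"]) auto
    ultimately have "cinner y (e i) = cinner x (e i)" by (rule limit_eventually_const)
    then show ?thesis by (simp add: cinner_diff_left)
  qed
  then have "A (x - y) = 0" using kill sub(4)[OF x y(1)] by blast
  then have Axy: "A x = A y" using clin_on_simps(2)[OF subspace lin x y(1)] by simp
  have "(\<lambda>n. A (\<Sum>j<n. scaleC (1 * cinner x (e j)) (e j))) \<longlonglongrightarrow> A y"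
    by (rule bounded_op_tendsto[OF A _ y(2)]) (intro sub(5) sub(3) eS)
  moreover have "A (\<Sum>j<n. scaleC (1 * cinner x (e j)) (e j)) = (\<Sum>j<n. scaleC (of_real (a j) * cinner x (e j)) (e j))" for n
  proof -
    have "A (\<Sum>j<n. scaleC (1 * cinner x (e j)) (e j)) = (\<Sum>j<n. A (scaleC (1 * cinner x (e j)) (e j)))"
      by (intro clin_on_simps(3)[OF subspace lin] sub(3) eS) simp
    also have "\<dots> = (\<Sum>j<n. scaleC (of_real (a j) * cinner x (e j)) (e j))"
      by (intro sum.cong refl) (simp add: clin_onD(2)[OF lin eS] Ae scaleC_scaleC mult.commute)
    finally show ?thesis .
  qed
  ultimately show ?thesis unfolding Axy by simp
qed

text \<open>With s the root of the eigenvalue, z = A e - s e satisfies A z = - s z, and positivity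
  of \<open>A\<close> forces z = 0. So a non-negative root is determined on the eigenvectors, which
  yields its uniqueness.\<close>

lemma sqrt_eigensystem:
  assumes A: "nonneg_op S A" and AB: "\<And>x. x \<in> S \<Longrightarrow> A (A x) = B x" and B: "eigensystem B e ev"
  shows "A (e i) = scaleC (of_real (sqrt (ev i))) (e i)"
    "y \<in> S \<Longrightarrow> (\<And>i. cinner y (e i) = 0) \<Longrightarrow> A y = 0"
proof -
  note lin = bounded_opD(1)[OF nonneg_opD(1)[OF A]]
  have eS: "e i \<in> S" by (rule eigensystemD(2)[OF B])
  show "A (e i) = scaleC (of_real (sqrt (ev i))) (e i)"
  proof (cases "e i = 0")
    case False
    let ?s = "sqrt (ev i)"
    have s: "0 < ?s" using False eigensystemD(6)[OF B] by auto
    define z where "z = A (e i) - scaleC (of_real ?s) (e i)"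
    have Ae: "A (e i) \<in> S" by (rule nonneg_opD(4)[OF A eS])
    have zS: "z \<in> S" unfolding z_def by (intro sub Ae eS)
    have "of_real ?s * of_real ?s = (of_real (ev i) :: complex)"
      using s by (simp flip: of_real_mult add: less_imp_le)
    then have "A z = - scaleC (of_real ?s) z"
      unfolding z_def using clin_on_simps(2)[OF subspace lin Ae sub(3)[OF eS]] clin_onD(2)[OF lin eS] AB[OF eS]
        eigensystemD(7)[OF B] by (simp add: scaleC_diff_right scaleC_scaleC)
    then have "Re (cinner (A z) z) = - (?s * (norm z)\<^sup>2)" by (simp add: cinner_scaleC_left cinner_self)
    then have "?s * (norm z)\<^sup>2 \<le> 0" using nonneg_opD(3)[OF A zS] by simp
    then have "z = 0" using s by (simp add: mult_le_0_iff)
    then show ?thesis by (simp add: z_def)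
  qed (use clin_on_simps(1)[OF subspace lin] in simp)
  show "A y = 0" if y: "y \<in> S" "\<And>i. cinner y (e i) = 0"
  proof -
    have "cinner (A y) (A y) = cinner (A (A y)) y"
      using nonneg_opD(2)[OF A nonneg_opD(4)[OF A y(1)] y(1)] by simp
    then show ?thesis using AB[OF y(1)] eigensystemD(8)[OF B y] by (simp add: cinner_self)
  qed
qed

text \<open>The definite description in \<open>nonneg_sqrt\<close> needs exactly one root. Existence
  comes from the diagonal series with the roots of the eigenvalues, set to 0 off \<open>S\<close>;
  uniqueness from \<open>sqrt_eigensystem\<close> and \<open>diagonal_expansion\<close>.\<close>

lemma nonneg_sqrt_eigensystem:
  assumes B: "eigensystem B e ev" and bB: "bounded_op S B"
  shows "nonneg_op S (nonneg_sqrt S B)" "\<And>x. x \<in> S \<Longrightarrow> nonneg_sqrt S B (nonneg_sqrt S B x) = B x"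
proof -
  define R where "R x = (if x \<in> S then lim (\<lambda>n. \<Sum>j<n. scaleC (of_real (sqrt (ev j)) * cinner x (e j)) (e j)) else 0)" for x
  define p where "p x n = (\<Sum>j<n. scaleC (of_real (sqrt (ev j)) * cinner x (e j)) (e j))" for x n
  note os = eigensystemD(1)[OF B] and eS = eigensystemD(2)[OF B]
  have bnd: "cmod (of_real (sqrt (ev j))) \<le> sqrt (ev 0)" for j
    using eigensystemD(4)[OF B] antimonoD[OF eigensystemD(3)[OF B], of 0 j] by simp
  have R: "R x \<in> S" "p x \<longlonglongrightarrow> R x" "norm (R x) \<le> sqrt (ev 0) * norm x" if "x \<in> S" for x
  proof -
    obtain y where y: "y \<in> S" "p x \<longlonglongrightarrow> y" "norm y \<le> sqrt (ev 0) * norm x"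
      using orthosystem_expansion_converges[OF os eS, of "\<lambda>j. of_real (sqrt (ev j))", OF bnd] unfolding p_def[abs_def] by blast
    have "R x = y" using limI[OF y(2)[unfolded p_def[abs_def]]] that by (simp add: R_def)
    then show "R x \<in> S" "p x \<longlonglongrightarrow> R x" "norm (R x) \<le> sqrt (ev 0) * norm x" using y by auto
  qed
  have linp: "p (x + y) n = p x n + p y n" "p (scaleC c x) n = scaleC c (p x n)" for x y c n
    by (simp_all add: p_def cinner_add_left cinner_scaleC_left distrib_left scaleC_add_left sum.distrib
        scaleC_sum_right scaleC_scaleC mult_ac)
  have bR: "bounded_op S R"
    unfolding bounded_op_def
  proof (intro conjI ballI allI)
    show "R ` S \<subseteq> S" using R by auto
    show "R (x + y) = R x + R y" if "x \<in> S" "y \<in> S" for x y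
    proof (rule LIMSEQ_unique)
      have "p (x + y) = (\<lambda>n. p x n + p y n)" by (simp add: fun_eq_iff linp)
      then show "(\<lambda>n. p x n + p y n) \<longlonglongrightarrow> R (x + y)" using R(2)[OF sub(2)[OF that]] by simp
    qed (intro tendsto_add R that)
    show "R (scaleC c x) = scaleC c (R x)" if "x \<in> S" for c x
    proof (rule LIMSEQ_unique)
      have "p (scaleC c x) = (\<lambda>n. scaleC c (p x n))" by (simp add: fun_eq_iff linp)
      then show "(\<lambda>n. scaleC c (p x n)) \<longlonglongrightarrow> R (scaleC c x)" using R(2)[OF sub(3)[OF that, of c]] by simp
    qed (intro tendsto_scaleC tendsto_const R that)
    show "\<exists>M. \<forall>f\<in>S. norm (R f) \<le> M * norm f" using R(3) by blast
  qed
  have sym: "cinner (R x) y = cinner x (R y)" if "x \<in> S" "y \<in> S" for x y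
  proof -
    have "(\<lambda>n. cinner (p x n) y) \<longlonglongrightarrow> cinner (R x) y" "(\<lambda>n. cinner x (p y n)) \<longlonglongrightarrow> cinner x (R y)"
      by (intro tendsto_cinner R tendsto_const that)+
    moreover have "cinner (p x n) y = cinner x (p y n)" for n
    proof -
      have "cnj (cinner y z) = cinner z y" for y z :: 'a by (metis cinner_commute)
      then show ?thesis by (simp add: p_def cinner_sum_left cinner_sum_right cinner_scaleC_left cinner_scaleC_right mult_ac)
    qed
    ultimately show ?thesis using LIMSEQ_unique by auto
  qed
  have pos: "0 \<le> Re (cinner (R x) x)" if "x \<in> S" for x
  proof (rule LIMSEQ_le_const)
    show "(\<lambda>n. Re (cinner (p x n) x)) \<longlonglongrightarrow> Re (cinner (R x) x)"
      by (intro tendsto_Re tendsto_cinner R tendsto_const that)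
    have "cinner (p x n) x = of_real (\<Sum>j<n. sqrt (ev j) * (cmod (cinner x (e j)))\<^sup>2)" for n
      by (simp only: p_def cinner_sum_left cinner_scaleC_left mult.assoc cinner_swap_mult of_real_sum of_real_mult)
    then show "\<exists>N. \<forall>n\<ge>N. 0 \<le> Re (cinner (p x n) x)"
      using eigensystemD(4)[OF B] by (auto intro!: sum_nonneg mult_nonneg_nonneg)
  qed
  have nR: "nonneg_op S R" unfolding nonneg_op_def using bR sym pos by blast
  have Re: "cinner (R x) (e i) = of_real (sqrt (ev i)) * cinner x (e i)" if "x \<in> S" for x i
  proof -
    have "(\<lambda>n. cinner (p x n) (e i)) \<longlonglongrightarrow> cinner (R x) (e i)" by (intro tendsto_cinner R tendsto_const that)
    moreover have "\<forall>\<^sub>F n in sequentially. cinner (p x n) (e i) = of_real (sqrt (ev i)) * cinner x (e i)"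
      unfolding p_def cinner_comb_orthosystem[OF os] by (rule eventually_sequentiallyI[of "Suc i"]) auto
    ultimately show ?thesis by (rule limit_eventually_const)
  qed
  have RR: "R (R x) = B x" if x: "x \<in> S" for x
  proof -
    have "p (R x) = (\<lambda>n. \<Sum>j<n. scaleC (of_real (ev j) * cinner x (e j)) (e j))"
      unfolding p_def[abs_def] Re[OF x]
    proof (intro ext sum.cong refl)
      fix j
      have "of_real (sqrt (ev j)) * of_real (sqrt (ev j)) = (of_real (ev j) :: complex)"
        using eigensystemD(4)[OF B, of j] by (simp flip: of_real_mult)
      then show "scaleC (of_real (sqrt (ev j)) * (of_real (sqrt (ev j)) * cinner x (e j))) (e j) = scaleC (of_real (ev j) * cinner x (e j)) (e j)"
        by (simp flip: mult.assoc)
    qed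
    then have "p (R x) \<longlonglongrightarrow> B x"
      using diagonal_expansion[OF bB os eS eigensystemD(7)[OF B] eigensystemD(8)[OF B] x] by simp
    then show ?thesis using R(2)[OF R(1)[OF x]] LIMSEQ_unique by blast
  qed
  let ?Q = "\<lambda>A. nonneg_op S A \<and> (\<forall>f\<in>S. A (A f) = B f) \<and> (\<forall>f. f \<notin> S \<longrightarrow> A f = 0)"
  have "?Q (THE A. ?Q A)"
  proof (rule theI[where P = "?Q"])
    show "?Q R" using nR RR by (auto simp: R_def)
    fix A assume A: "?Q A"
    show "A = R"
    proof
      fix x
      show "A x = R x"
      proof (cases "x \<in> S")
        case True
        have AB: "\<And>x. x \<in> S \<Longrightarrow> A (A x) = B x" using A by blast
        have "(\<lambda>n. \<Sum>j<n. scaleC (of_real (sqrt (ev j)) * cinner x (e j)) (e j)) \<longlonglongrightarrow> A x"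
          using A by (intro diagonal_expansion[OF _ os eS _ _ True] sqrt_eigensystem[OF _ AB B] nonneg_opD(1)) auto
        then show ?thesis using R(2)[OF True] LIMSEQ_unique unfolding p_def[abs_def] by blast
      qed (use A in \<open>simp add: R_def\<close>)
    qed
  qed
  then have "?Q (nonneg_sqrt S B)" unfolding nonneg_sqrt_def .
  then show "nonneg_op S (nonneg_sqrt S B)" "\<And>x. x \<in> S \<Longrightarrow> nonneg_sqrt S B (nonneg_sqrt S B x) = B x" by auto
qed

text \<open>The representing vector is the minimizer of \<open>J\<close>. The parallelogram law
  makes a minimizing sequence Cauchy, and the first variation at the minimum gives the
  representation.\<close>

lemma riesz:
  assumes lin: "\<And>x y. x \<in> S \<Longrightarrow> y \<in> S \<Longrightarrow> \<phi> (x + y) = \<phi> x + \<phi> y" "\<And>c x. x \<in> S \<Longrightarrow> \<phi> (scaleC c x) = c * \<phi> x"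
    and bnd: "\<And>x. x \<in> S \<Longrightarrow> cmod (\<phi> x) \<le> M * norm x"
  shows "\<exists>h\<in>S. \<forall>x\<in>S. \<phi> x = cinner x h"
proof -
  define J where "J x = (norm x)\<^sup>2 - 2 * Re (\<phi> x)" for x
  have S0: "0 \<in> S" by (rule sub(1))
  have low: "- M\<^sup>2 \<le> J x" if "x \<in> S" for x
  proof -
    have "Re (\<phi> x) \<le> M * norm x" using bnd[OF that] complex_Re_le_cmod[of "\<phi> x"] by linarith
    moreover have "0 \<le> (norm x - M)\<^sup>2" by simp
    ultimately show ?thesis by (simp add: J_def power2_diff mult.commute)
  qed
  define d where "d = Inf (J ` S)"
  have bb: "bdd_below (J ` S)" by (rule bdd_belowI[of _ "- M\<^sup>2"]) (use low in auto)
  have dle: "d \<le> J x" if "x \<in> S" for x unfolding d_def by (intro cInf_lower bb imageI that)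
  have "\<exists>x\<in>S. J x < d + 1 / real (Suc n)" for n
  proof -
    have "Inf (J ` S) < d + 1 / real (Suc n)" by (simp add: d_def)
    then show ?thesis using cInf_less_iff[of "J ` S", OF _ bb] S0 by auto
  qed
  then obtain x where x: "\<And>n. x n \<in> S" "\<And>n. J (x n) < d + 1 / real (Suc n)" by metis
  have par: "(norm (u - v))\<^sup>2 \<le> 2 * (J u - d) + 2 * (J v - d)" if u: "u \<in> S" and v: "v \<in> S" for u v
  proof -
    define m where "m = scaleC (of_real (1/2)) (u + v)"
    have mS: "m \<in> S" unfolding m_def using sub(3)[OF sub(2)[OF u v]] .
    have "\<phi> m = of_real (1/2) * (\<phi> u + \<phi> v)"
      unfolding m_def using lin(2)[OF sub(2)[OF u v]] lin(1)[OF u v] by simp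
    then have "Re (\<phi> m) = Re (of_real (1/2) * (\<phi> u + \<phi> v))" by (rule arg_cong)
    then have "Re (\<phi> m) = (Re (\<phi> u) + Re (\<phi> v)) / 2" by simp
    moreover have "(norm m)\<^sup>2 = (norm (u + v))\<^sup>2 / 4" by (simp add: m_def norm_scaleC power_divide)
    ultimately have "4 * J m = (norm (u + v))\<^sup>2 - 4 * Re (\<phi> u) - 4 * Re (\<phi> v)" by (simp add: J_def field_simps)
    moreover have "(norm (u - v))\<^sup>2 + (norm (u + v))\<^sup>2 = 2 * (norm u)\<^sup>2 + 2 * (norm v)\<^sup>2"
      by (simp add: norm_sq_add norm_sq_diff)
    moreover have "4 * d \<le> 4 * J m" using dle[OF mS] by simp
    ultimately show ?thesis by (simp add: J_def)
  qed
  have "Cauchy x"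
  proof (rule metric_CauchyI)
    fix \<epsilon> :: real assume \<epsilon>: "0 < \<epsilon>"
    obtain N where N: "1 / real (Suc N) < \<epsilon>\<^sup>2 / 4" using \<epsilon> nat_approx_posE[of "\<epsilon>\<^sup>2 / 4"] by auto
    have "dist (x m) (x n) < \<epsilon>" if "m \<ge> N" "n \<ge> N" for m n
    proof -
      have ar: "a < e" if "a \<le> 2 * p + 2 * q" "p < e / 4" "q < e / 4" for a p q e :: real using that by linarith
      have *: "J (x k) - d < \<epsilon>\<^sup>2 / 4" if "k \<ge> N" for k
      proof -
        have "1 / real (Suc k) \<le> 1 / real (Suc N)" using that by (intro divide_left_mono) auto
        then show ?thesis using x(2)[of k] N by linarith
      qed
      have "(norm (x m - x n))\<^sup>2 < \<epsilon>\<^sup>2" 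
        by (rule ar[OF par[OF x(1)[of m] x(1)[of n]] *[OF that(1)] *[OF that(2)]])
      then have "norm (x m - x n) < \<epsilon>" by (rule power_less_imp_less_base) (use \<epsilon> in simp)
      then show ?thesis by (simp add: dist_norm)
    qed
    then show "\<exists>N. \<forall>m\<ge>N. \<forall>n\<ge>N. dist (x m) (x n) < \<epsilon>" by blast
  qed
  then obtain h where h: "h \<in> S" "x \<longlonglongrightarrow> h" using completeE[OF complete, of x] x(1) by blast
  have Jh: "J h \<le> d"
  proof -
    have dif: "\<phi> (x n) - \<phi> h = \<phi> (x n - h)" for n
      using lin(1)[OF sub(4)[OF x(1)[of n] h(1)] h(1)] by simp
    have nz: "(\<lambda>n. M * norm (x n - h)) \<longlonglongrightarrow> M * norm (h - h)" by (intro tendsto_intros h)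
    have "(\<lambda>n. \<phi> (x n) - \<phi> h) \<longlonglongrightarrow> 0"
    proof (rule tendsto_zero_dominated)
      show "cmod (\<phi> (x n) - \<phi> h) \<le> M * norm (x n - h)" for n
        unfolding dif using bnd[OF sub(4)[OF x(1)[of n] h(1)]] .
    qed (use nz in simp)
    then have "(\<lambda>n. \<phi> (x n)) \<longlonglongrightarrow> \<phi> h" by (rule LIM_zero_cancel)
    then have "(\<lambda>n. J (x n)) \<longlonglongrightarrow> J h" unfolding J_def by (intro tendsto_intros h)
    moreover have "(\<lambda>n. d + 1 / real (Suc n)) \<longlonglongrightarrow> d + 0" by (intro tendsto_intros LIMSEQ_Suc[OF lim_1_over_n])
    ultimately show ?thesis using x(2) by (intro LIMSEQ_le[of _ _ "\<lambda>n. d + 1 / real (Suc n)"]) (auto intro!: exI[of _ 0] less_imp_le)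
  qed
  have "\<phi> y = cinner y h" if y: "y \<in> S" for y
  proof -
    have step: "2 * Re (\<phi> z - cinner z h) \<le> (norm z)\<^sup>2" if z: "z \<in> S" for z
    proof -
      have "J h \<le> J (h + z)" using dle[OF sub(2)[OF h(1) z]] Jh by linarith
      moreover have "Re (cinner h z) = Re (cinner z h)" by (subst cinner_commute) simp
      ultimately show ?thesis using lin(1)[OF h(1) z] by (simp add: J_def norm_sq_add)
    qed
    define a where "a = \<phi> y - cinner y h"
    have le: "2 * t * (cmod a)\<^sup>2 \<le> t\<^sup>2 * ((cmod a)\<^sup>2 * (norm y)\<^sup>2)" for t :: real
    proof -
      let ?c = "of_real t * cnj a"
      have "\<phi> (scaleC ?c y) - cinner (scaleC ?c y) h = of_real t * (a * cnj a)"
        by (simp only: lin(2)[OF y] cinner_scaleC_left right_diff_distrib[symmetric] mult_ac flip: a_def)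
      also have "\<dots> = of_real (t * (cmod a)\<^sup>2)" by (simp only: complex_norm_square of_real_mult)
      finally have "2 * (t * (cmod a)\<^sup>2) \<le> (norm (scaleC ?c y))\<^sup>2"
        using step[OF sub(3)[OF y, of ?c]] by simp
      moreover have "(norm (scaleC ?c y))\<^sup>2 = t\<^sup>2 * ((cmod a)\<^sup>2 * (norm y)\<^sup>2)"
        by (simp only: norm_scaleC norm_mult complex_mod_cnj norm_of_real power_mult_distrib power2_abs mult.assoc)
      ultimately show ?thesis by simp
    qed
    have "(cmod a)\<^sup>2 = 0"
    proof (rule ccontr)
      assume "(cmod a)\<^sup>2 \<noteq> 0"
      then have pos: "0 < (cmod a)\<^sup>2" by (simp add: zero_less_power2)
      \<comment> \<open>Small enough for the quadratic term of the variation to lose against the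
        linear one.\<close>
      define t where "t = 1 / ((norm y)\<^sup>2 + 1)"
      have y1: "0 < (norm y)\<^sup>2 + 1" by (intro add_nonneg_pos) auto
      then have t: "0 < t" "t * (norm y)\<^sup>2 < 1" by (simp_all add: t_def divide_less_eq_1_pos)
      have "(t * (cmod a)\<^sup>2) * 2 \<le> (t * (cmod a)\<^sup>2) * (t * (norm y)\<^sup>2)"
        using le[of t] by (simp add: power2_eq_square mult_ac)
      then have "2 \<le> t * (norm y)\<^sup>2" using t pos by (simp add: mult_le_cancel_left_pos)
      then show False using t by simp
    qed
    then show ?thesis by (simp add: a_def)
  qed
  then show ?thesis using h(1) by blast
qed

lemma adjoint_op:
  assumes T: "bounded_op S T" and g: "g \<in> S"
  shows "adjoint_op S T g \<in> S" "f \<in> S \<Longrightarrow> cinner (T f) g = cinner f (adjoint_op S T g)"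
proof -
  note lin = bounded_opD(1)[OF T]
  obtain M where M: "M \<ge> 0" "\<forall>x\<in>S. norm (T x) \<le> M * norm x" using bounded_opD(3)[OF T] by blast
  have "\<exists>h\<in>S. \<forall>x\<in>S. cinner (T x) g = cinner x h"
  proof (rule riesz)
    show "cmod (cinner (T x) g) \<le> (M * norm g) * norm x" if "x \<in> S" for x
      using order_trans[OF cauchy_schwarz[of "T x" g] mult_right_mono[OF bspec[OF M(2) that] norm_ge_zero[of g]]]
      by (simp add: mult_ac)
  qed (auto simp: clin_onD[OF lin] cinner_add_left cinner_scaleC_left)
  then obtain h where h: "h \<in> S" "\<forall>x\<in>S. cinner (T x) g = cinner x h" by blast
  have "h' = h" if h': "h' \<in> S \<and> (\<forall>f\<in>S. cinner (T f) g = cinner f h')" for h'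
  proof -
    have "h' - h \<in> S" using h' h by (intro sub) auto
    then have "cinner (h' - h) h' = cinner (h' - h) h" using h h' by metis
    then have "cinner (h' - h) (h' - h) = 0" by (simp add: cinner_diff_right)
    then show ?thesis by (simp add: cinner_self)
  qed
  then have "(THE h. h \<in> S \<and> (\<forall>f\<in>S. cinner (T f) g = cinner f h)) = h" using h by (intro the_equality) auto
  then have "adjoint_op S T g = h" using g by (simp add: adjoint_op_def)
  then show "adjoint_op S T g \<in> S" "f \<in> S \<Longrightarrow> cinner (T f) g = cinner f (adjoint_op S T g)" using h by auto
qed

lemma eq_if_cinner_eq:
  assumes "x \<in> S" "y \<in> S" "\<And>f. f \<in> S \<Longrightarrow> cinner f x = cinner f y"
  shows "x = y"
proof -
  have "cinner (x - y) (x - y) = 0" using assms(3)[OF sub(4)[OF assms(1,2)]] by (simp add: cinner_diff_right)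
  then show ?thesis by (simp add: cinner_self)
qed

lemma bounded_adjoint_op:
  assumes T: "bounded_op S T"
  shows "bounded_op S (adjoint_op S T)"
  unfolding bounded_op_def
proof (intro conjI ballI allI)
  note ad = adjoint_op[OF T]
  show "adjoint_op S T ` S \<subseteq> S" using ad by auto
  show "adjoint_op S T (f + g) = adjoint_op S T f + adjoint_op S T g" if "f \<in> S" "g \<in> S" for f g
    using that by (intro eq_if_cinner_eq ad sub) (auto simp: cinner_add_right ad(2)[symmetric] sub)
  show "adjoint_op S T (scaleC c f) = scaleC c (adjoint_op S T f)" if "f \<in> S" for c f
    using that by (intro eq_if_cinner_eq ad sub) (auto simp: cinner_scaleC_right ad(2)[symmetric] sub)
  obtain M where M: "M \<ge> 0" "\<forall>x\<in>S. norm (T x) \<le> M * norm x" using bounded_opD(3)[OF T] by blast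
  have "norm (adjoint_op S T g) \<le> M * norm g" if g: "g \<in> S" for g
  proof (cases "adjoint_op S T g = 0")
    case False
    let ?h = "adjoint_op S T g"
    have "(norm ?h)\<^sup>2 = Re (cinner (T ?h) g)" using ad(2)[OF g ad(1)[OF g]] by (simp add: Re_cinner_self)
    also have "\<dots> \<le> norm (T ?h) * norm g" using complex_Re_le_cmod cauchy_schwarz order_trans by metis
    also have "\<dots> \<le> M * norm ?h * norm g" using M ad(1)[OF g] by (intro mult_right_mono) auto
    finally have "norm ?h * norm ?h \<le> norm ?h * (M * norm g)" by (simp add: power2_eq_square mult_ac)
    then show ?thesis using False by simp
  qed (use M in simp)
  then show "\<exists>M. \<forall>f\<in>S. norm (adjoint_op S T f) \<le> M * norm f" by blast
qed

lemma sequentially_compact_comp: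
  assumes "sequentially_compact T" "bounded_op S R" "\<And>x. x \<in> S \<Longrightarrow> T x \<in> S"
  shows "sequentially_compact (\<lambda>x. R (T x))"
  unfolding sequentially_compact_def
proof (intro allI impI)
  fix x :: "nat \<Rightarrow> 'a" assume x: "\<forall>n. x n \<in> S \<and> norm (x n) \<le> 1"
  then obtain r l where r: "strict_mono (r :: nat \<Rightarrow> nat)" "l \<in> S" "(\<lambda>n. T (x (r n))) \<longlonglongrightarrow> l"
    using assms(1) unfolding sequentially_compact_def by blast
  have "(\<lambda>n. R (T (x (r n)))) \<longlonglongrightarrow> R l" using x assms(3) by (intro bounded_op_tendsto[OF assms(2) _ r(3)]) auto
  then show "\<exists>r l. strict_mono r \<and> l \<in> S \<and> (\<lambda>n. R (T (x (r n)))) \<longlonglongrightarrow> l"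
    using r bounded_opD(2)[OF assms(2) r(2)] by blast
qed

lemma bounded_op_comp:
  assumes "bounded_op S R" "bounded_op S T"
  shows "bounded_op S (\<lambda>x. R (T x))"
  unfolding bounded_op_def
proof (intro conjI ballI allI)
  note R = bounded_opD[OF assms(1)] and T = bounded_opD[OF assms(2)]
  show "(\<lambda>x. R (T x)) ` S \<subseteq> S" using R(2) T(2) by auto
  show "R (T (x + y)) = R (T x) + R (T y)" if "x \<in> S" "y \<in> S" for x y
    using clin_onD(1)[OF T(1) that] clin_onD(1)[OF R(1) T(2)[OF that(1)] T(2)[OF that(2)]] by simp
  show "R (T (scaleC c x)) = scaleC c (R (T x))" if "x \<in> S" for c x
    using clin_onD(2)[OF T(1) that] clin_onD(2)[OF R(1) T(2)[OF that]] by simp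
  obtain M where M: "M \<ge> 0" "\<forall>x\<in>S. norm (R x) \<le> M * norm x" using R(3) by blast
  obtain M' where M': "M' \<ge> 0" "\<forall>x\<in>S. norm (T x) \<le> M' * norm x" using T(3) by blast
  have "norm (R (T x)) \<le> M * M' * norm x" if "x \<in> S" for x
    using order_trans[OF bspec[OF M(2) T(2)[OF that]] mult_left_mono[OF bspec[OF M'(2) that] M(1)]] by (simp add: mult_ac)
  then show "\<exists>M. \<forall>f\<in>S. norm (R (T f)) \<le> M * norm f" by blast
qed

text \<open>Superlevel sets of a non-increasing sequence are initial segments, so their sizes
  determine the sequence. It provides the uniqueness required by the definite description in
  \<open>eigenvalue_sequence\<close>.\<close>

lemma superlevel_determines:
  fixes s s' :: "nat \<Rightarrow> real"
  assumes s: "antimono s" "\<And>n. 0 \<le> s n" "s \<longlonglongrightarrow> 0" and s': "antimono s'" "\<And>n. 0 \<le> s' n"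
    and cnt: "\<And>t. 0 < t \<Longrightarrow> finite {n. s n = t}" "\<And>t. 0 < t \<Longrightarrow> finite {n. s' n = t}"
      "\<And>t. 0 < t \<Longrightarrow> card {n. s n = t} = card {n. s' n = t}"
  shows "s = s'"
proof -
  have fin: "finite {n. t \<le> s n}" if t: "0 < t" for t
  proof -
    obtain N where "\<And>n. n \<ge> N \<Longrightarrow> s n < t"
      using order_tendstoD(2)[OF s(3) t] unfolding eventually_sequentially by blast
    then have "{n. t \<le> s n} \<subseteq> {..<N}" by (auto simp: not_less) (meson leD leI)
    then show ?thesis using finite_subset by blast
  qed
  have init: "\<exists>k. {n. t \<le> u n} = {..<k}" if "antimono u" "finite {n. t \<le> u n}" for t and u :: "nat \<Rightarrow> real"
  proof -
    define k where "k = (LEAST k. \<not> t \<le> u k)"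
    have "\<exists>k. \<not> t \<le> u k" using that(2) infinite_UNIV_nat by (metis (mono_tags, lifting) Collect_cong UNIV_def)
    then have k: "\<not> t \<le> u k" unfolding k_def by (rule LeastI_ex)
    have "t \<le> u n" if "n < k" for n using not_less_Least[of n "\<lambda>k. \<not> t \<le> u k"] that by (auto simp: k_def)
    moreover have "\<not> t \<le> u n" if "k \<le> n" for n using k antimonoD[OF \<open>antimono u\<close> that] by linarith
    ultimately have "{n. t \<le> u n} = {..<k}" by (auto simp: not_less[symmetric])
    then show ?thesis by blast
  qed
  have same: "{n. t \<le> s n} = {n. t \<le> s' n}" if t: "0 < t" for t
  proof -
    define V where "V = s ` {n. t \<le> s n}"
    have V: "finite V" "\<And>v. v \<in> V \<Longrightarrow> 0 < v" using fin[OF t] t by (auto simp: V_def)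
    have e1: "{n. t \<le> s n} = (\<Union>v\<in>V. {n. s n = v})" by (auto simp: V_def)
    \<comment> \<open>A positive value of \<open>s'\<close> has a non-empty level set, hence is also
      a value of \<open>s\<close>. This makes the superlevel set of \<open>s'\<close> finite without
      a limit for \<open>s'\<close>.\<close>
    have e2: "{n. t \<le> s' n} = (\<Union>v\<in>V. {n. s' n = v})"
    proof (intro subset_antisym subsetI)
      fix n assume n: "n \<in> {n. t \<le> s' n}"
      then have pos: "0 < s' n" using t by auto
      have "{k. s' k = s' n} \<noteq> {}" by auto
      then have "card {k. s' k = s' n} \<noteq> 0" using cnt(2)[OF pos] by auto
      then have "card {k. s k = s' n} \<noteq> 0" using cnt(3)[OF pos] by simp
      then have "{k. s k = s' n} \<noteq> {}" by (metis card.empty)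
      then obtain k where "s k = s' n" by auto
      then have "s' n \<in> V" using n unfolding V_def by (intro image_eqI[of _ _ k]) auto
      then show "n \<in> (\<Union>v\<in>V. {n. s' n = v})" by simp
    qed (auto simp: V_def)
    have c: "card (\<Union>v\<in>V. {n. u n = v}) = (\<Sum>v\<in>V. card {n. u n = v})"
      if "\<And>v. v \<in> V \<Longrightarrow> finite {n. u n = v}" for u :: "nat \<Rightarrow> real"
      using V that by (intro card_UN_disjoint) auto
    have f2: "finite {n. t \<le> s' n}" unfolding e2 using V cnt(2) by auto
    have "card {n. t \<le> s n} = card {n. t \<le> s' n}"
      unfolding e1 e2 using V cnt by (simp add: c)
    moreover obtain k where "{n. t \<le> s n} = {..<k}" using init[OF s(1) fin[OF t]] by blast
    moreover obtain k' where "{n. t \<le> s' n} = {..<k'}" using init[OF s'(1) f2] by blast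
    ultimately show ?thesis by simp
  qed
  show ?thesis
  proof
    fix n
    show "s n = s' n"
    proof (rule antisym)
      show "s n \<le> s' n" using same[of "s n"] s(2)[of n] s'(2)[of n] by (cases "s n = 0") force+
      show "s' n \<le> s n" using same[of "s' n"] s(2)[of n] s'(2)[of n] by (cases "s' n = 0") force+
    qed
  qed
qed

text \<open>For t > 0 the \<open>e n\<close> with \<open>s n = t\<close> form a basis of the
  eigenspace: an eigenvector minus its projection onto them is orthogonal to every
  \<open>e i\<close>, so it is annihilated by \<open>A\<close> and at the same time multiplied by
  \<open>t\<close>.\<close>

lemma eigenvalue_sequence_eq:
  assumes A: "nonneg_op S A" and E: "eigensystem A e s"
  shows "eigenvalue_sequence S A = s"
proof -
  note lin = bounded_opD(1)[OF nonneg_opD(1)[OF A]]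
  note os = eigensystemD(1)[OF E] and eS = eigensystemD(2)[OF E]
  have fin: "finite {n. s n = t}" if t: "0 < t" for t
  proof -
    obtain N where N: "\<And>n. n \<ge> N \<Longrightarrow> s n < t"
      using order_tendstoD(2)[OF eigensystemD(5)[OF E] t] unfolding eventually_sequentially by blast
    have "{n. s n = t} \<subseteq> {..<N}"
    proof
      fix n assume "n \<in> {n. s n = t}"
      then show "n \<in> {..<N}" using N[of n] by (cases "n < N") auto
    qed
    then show ?thesis using finite_subset by blast
  qed
  have dim: "card {n. s n = t} = cdim (eigenspace S A (complex_of_real t))" if t: "0 < t" for t
  proof -
    let ?I = "{n. s n = t}" and ?B = "e ` {n. s n = t}" and ?V = "eigenspace S A (complex_of_real t)"
    have ne: "e n \<noteq> 0" if "n \<in> ?I" for n using eigensystemD(6)[OF E, of n] that t by auto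
    have inj: "inj_on e ?I"
    proof (rule inj_onI)
      fix i j assume ij: "i \<in> ?I" "j \<in> ?I" "e i = e j"
      then have "cinner (e i) (e j) \<noteq> 0" using ne[OF ij(1)] by (simp add: cinner_self)
      then show "i = j" using os by (auto simp: orthosystem_def split: if_splits)
    qed
    have "cdim ?V = card ?I"
    proof (rule complex_space.dim_unique[of ?B])
      show "?B \<subseteq> ?V" using eS eigensystemD(7)[OF E] by (auto simp: eigenspace_def)
      show "complex_space.independent ?B"
      proof (rule complex_space.independent_if_scalars_zero)
        show "finite ?B" using fin[OF t] by simp
        fix f x assume z: "(\<Sum>x\<in>?B. scaleC (f x) x) = 0" and x: "x \<in> ?B"
        have "0 = (\<Sum>y\<in>?B. f y * cinner y x)"
          using arg_cong[OF z, of "\<lambda>y. cinner y x"] by (simp add: cinner_sum_left cinner_scaleC_left)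
        also have "\<dots> = (\<Sum>y\<in>?B. if y = x then f x else 0)"
        proof (rule sum.cong[OF refl])
          fix y assume y: "y \<in> ?B"
          obtain i j where ij: "i \<in> ?I" "y = e i" "j \<in> ?I" "x = e j" using x y by blast
          show "f y * cinner y x = (if y = x then f x else 0)"
          proof (cases "i = j")
            case True
            then show ?thesis using os ne[OF ij(1)] unfolding ij orthosystem_def by simp
          next
            case False
            then have "e i \<noteq> e j" using inj_onD[OF inj] ij by blast
            then show ?thesis using os False unfolding ij orthosystem_def by simp
          qed
        qed
        also have "\<dots> = f x" using x fin[OF t] by simp
        finally show "f x = 0" by simp
      qed
      show "?V \<subseteq> complex_space.span ?B"
      proof
        fix x assume "x \<in> ?V"
        then have x: "x \<in> S" "A x = scaleC (of_real t) x" by (auto simp: eigenspace_def)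
        define p where "p = (\<Sum>j\<in>?I. scaleC (cinner x (e j)) (e j))"
        have pS: "p \<in> S" unfolding p_def by (intro sub eS)
        have Ap: "A p = scaleC (of_real t) p"
        proof -
          have "A p = (\<Sum>j\<in>?I. A (scaleC (cinner x (e j)) (e j)))"
            unfolding p_def using fin[OF t] by (intro clin_on_simps(3)[OF subspace lin] sub eS) auto
          also have "\<dots> = (\<Sum>j\<in>?I. scaleC (of_real t) (scaleC (cinner x (e j)) (e j)))"
            by (intro sum.cong refl) (simp add: clin_onD(2)[OF lin eS] eigensystemD(7)[OF E] scaleC_scaleC mult.commute)
          finally show ?thesis by (simp add: p_def scaleC_sum_right)
        qed
        have "cinner (x - p) (e i) = 0" for i
        proof (cases "s i = t")
          case True
          have "cinner p (e i) = (\<Sum>j\<in>?I. if j = i then cinner x (e i) else 0)"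
            unfolding p_def cinner_sum_left cinner_scaleC_left
          proof (rule sum.cong[OF refl])
            fix j
            show "cinner x (e j) * cinner (e j) (e i) = (if j = i then cinner x (e i) else 0)"
              using os by (cases "e i = 0") (auto simp: orthosystem_def)
          qed
          then show ?thesis using True fin[OF t] by (simp add: cinner_diff_left)
        next
          case False
          have xp: "x - p \<in> S" using x pS by (intro sub)
          have "A (x - p) = scaleC (of_real t) (x - p)"
            using clin_on_simps(2)[OF subspace lin x(1) pS] x(2) Ap by (simp add: scaleC_diff_right)
          then have "of_real t * cinner (x - p) (e i) = cinner (A (x - p)) (e i)" by (simp add: cinner_scaleC_left)
          also have "\<dots> = of_real (s i) * cinner (x - p) (e i)"
            using nonneg_opD(2)[OF A xp eS] eigensystemD(7)[OF E] by (simp add: cinner_scaleC_right)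
          finally show ?thesis using False by simp
        qed
        then have "A (x - p) = 0" using x pS by (intro eigensystemD(8)[OF E] sub) auto
        then have "scaleC (of_real t) (x - p) = 0"
          using clin_on_simps(2)[OF subspace lin x(1) pS] x(2) Ap by (simp add: scaleC_diff_right)
        then have "x = p" using t by simp
        also have "p \<in> complex_space.span ?B"
          unfolding p_def by (intro complex_space.span_sum complex_space.span_scale complex_space.span_base) auto
        finally show "x \<in> complex_space.span ?B" .
      qed
      show "card ?B = card ?I" by (rule card_image[OF inj])
    qed
    then show ?thesis by simp
  qed
  show ?thesis
    unfolding eigenvalue_sequence_def
  proof (rule the_equality)
    show "antimono s \<and> (\<forall>n. 0 \<le> s n) \<and> (\<forall>t>0. finite {n. s n = t} \<and> card {n. s n = t} = cdim (eigenspace S A (complex_of_real t)))"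
      using eigensystemD(3,4)[OF E] fin dim by blast
    fix s' :: "nat \<Rightarrow> real"
    assume *: "antimono s' \<and> (\<forall>n. 0 \<le> s' n) \<and> (\<forall>t>0. finite {n. s' n = t} \<and> card {n. s' n = t} = cdim (eigenspace S A (complex_of_real t)))"
    have "s = s'" using * fin dim by (intro superlevel_determines eigensystemD(3,4,5)[OF E]) auto
    then show "s' = s" by simp
  qed
qed

lemma abs_op_eigensystem:
  assumes B: "eigensystem (\<lambda>f. adjoint_op S T (T f)) e ev" and T: "bounded_op S T"
  shows "s_number S T n = sqrt (ev (n - 1))"
proof -
  have bB: "bounded_op S (\<lambda>f. adjoint_op S T (T f))" by (rule bounded_op_comp[OF bounded_adjoint_op[OF T] T])
  note R = nonneg_sqrt_eigensystem[OF B bB]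
  have "eigensystem (abs_op S T) e (\<lambda>i. sqrt (ev i))"
    unfolding eigensystem_def
  proof (intro conjI allI ballI impI)
    show "antimono (\<lambda>i. sqrt (ev i))" using antimonoD[OF eigensystemD(3)[OF B]] by (auto intro!: antimonoI)
    have "(\<lambda>i. sqrt (ev i)) \<longlonglongrightarrow> sqrt 0" by (intro tendsto_real_sqrt eigensystemD[OF B])
    then show "(\<lambda>i. sqrt (ev i)) \<longlonglongrightarrow> 0" by simp
    show "abs_op S T (e i) = scaleC (of_real (sqrt (ev i))) (e i)" for i
      unfolding abs_op_def by (rule sqrt_eigensystem(1)[OF R B])
    show "abs_op S T y = 0" if "y \<in> S" "\<forall>i. cinner y (e i) = 0" for y
      unfolding abs_op_def using that by (intro sqrt_eigensystem(2)[OF R B]) auto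
  qed (use eigensystemD[OF B] in auto)
  then show ?thesis
    unfolding s_number_def using eigenvalue_sequence_eq R(1) by (simp add: abs_op_def)
qed

text \<open>The adjoint of \<open>H\<close> is \<open>H\<close>, so the s-numbers are the roots of
  the squared eigenvalues. The bound for the form improves to a bound for the norm by
  \<open>norm_sq_le_form\<close>, since \<open>H x\<close> is again orthogonal to the first
  \<open>n\<close> eigenvectors.\<close>

lemma compact_nonneg_structure:
  assumes H: "nonneg_op S H" and cpt: "compact_op S H"
  obtains v \<mu> where "eigensystem H v \<mu>" "\<And>n. s_number S H n = \<mu> (n - 1)"
    "\<And>n x. x \<in> S \<Longrightarrow> (\<And>i. i < n \<Longrightarrow> cinner x (v i) = 0) \<Longrightarrow> norm (H x) \<le> \<mu> n * norm x"
proof -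
  have bH: "bounded_op S H" by (rule nonneg_opD(1)[OF H])
  obtain v \<mu> where E: "eigensystem H v \<mu>"
    and le: "\<And>n x. x \<in> S \<Longrightarrow> (\<And>i. i < n \<Longrightarrow> cinner x (v i) = 0) \<Longrightarrow> Re (cinner (H x) x) \<le> \<mu> n * (norm x)\<^sup>2"
    using spectral_theorem[OF H compact_op_sequentially_compact[OF cpt]] by metis
  have ad: "adjoint_op S H g = H g" if "g \<in> S" for g
    using that adjoint_op[OF bH that] nonneg_opD(2,4)[OF H] by (intro eq_if_cinner_eq) auto
  have E2: "eigensystem (\<lambda>f. adjoint_op S H (H f)) v (\<lambda>i. (\<mu> i)\<^sup>2)"
    unfolding eigensystem_def
  proof (intro conjI allI ballI impI)
    show "antimono (\<lambda>i. (\<mu> i)\<^sup>2)"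
      using antimonoD[OF eigensystemD(3)[OF E]] eigensystemD(4)[OF E] by (auto intro!: antimonoI power_mono)
    have "(\<lambda>i. (\<mu> i)\<^sup>2) \<longlonglongrightarrow> 0\<^sup>2" by (intro tendsto_power eigensystemD[OF E])
    then show "(\<lambda>i. (\<mu> i)\<^sup>2) \<longlonglongrightarrow> 0" by simp
    show "v i \<noteq> 0 \<longleftrightarrow> 0 < (\<mu> i)\<^sup>2" for i using eigensystemD(4,6)[OF E, of i] by (auto simp: zero_less_power2)
    show "adjoint_op S H (H (v i)) = scaleC (of_real ((\<mu> i)\<^sup>2)) (v i)" for i
      using ad[OF nonneg_opD(4)[OF H eigensystemD(2)[OF E, of i]]] eigensystemD(7)[OF E, of i]
        clin_onD(2)[OF bounded_opD(1)[OF bH] eigensystemD(2)[OF E, of i]]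
      by (simp add: scaleC_scaleC power2_eq_square)
    show "adjoint_op S H (H y) = 0" if "y \<in> S" "\<forall>i. cinner y (v i) = 0" for y
      using eigensystemD(8)[OF E, of y] that ad[OF sub(1)] clin_on_simps(1)[OF subspace bounded_opD(1)[OF bH]] by simp
  qed (use eigensystemD[OF E] in auto)
  have "s_number S H n = \<mu> (n - 1)" for n
    using abs_op_eigensystem[OF E2 bH] eigensystemD(4)[OF E] by simp
  moreover have "norm (H x) \<le> \<mu> n * norm x" if x: "x \<in> S" "\<And>i. i < n \<Longrightarrow> cinner x (v i) = 0" for n x
  proof -
    have Hx: "H x \<in> S" by (rule nonneg_opD(4)[OF H x(1)])
    have o: "cinner (H x) (v i) = 0" if "i < n" for i
      using nonneg_opD(2)[OF H x(1) eigensystemD(2)[OF E, of i]] eigensystemD(7)[OF E, of i] x(2)[OF that]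
      by (simp add: cinner_scaleC_right)
    have form: "Re (cinner (H x) x) \<le> \<mu> n * (norm x)\<^sup>2" by (rule le) (use x in auto)
    have form': "Re (cinner (H (H x)) (H x)) \<le> \<mu> n * (norm (H x))\<^sup>2" by (rule le) (use Hx o in auto)
    show ?thesis
    proof (cases "0 < \<mu> n")
      case True
      have "(norm (H x))\<^sup>2 \<le> \<mu> n * Re (cinner (H x) x)"
        by (rule norm_sq_le_form[OF H x(1) True form'])
      also have "\<dots> \<le> \<mu> n * (\<mu> n * (norm x)\<^sup>2)" using form True by (intro mult_left_mono) auto
      finally have "(norm (H x))\<^sup>2 \<le> (\<mu> n * norm x)\<^sup>2" by (simp add: power2_eq_square mult_ac)
      then show ?thesis by (rule power2_le_imp_le) (use True in simp)
    next
      case False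
      then have "\<mu> n = 0" using eigensystemD(4)[OF E, of n] by simp
      then show ?thesis using form_zero_imp_zero[OF H x(1)] form form' by simp
    qed
  qed
  ultimately show thesis using that E by blast
qed

text \<open>The \<open>e i\<close> are right singular vectors, that is, eigenvectors of the adjoint
  times \<open>K\<close>. The relation for \<open>cinner (K (e i)) (K x)\<close> expresses the
  orthogonality of their images and takes the place of left singular vectors.\<close>

lemma compact_op_structure:
  assumes cpt: "compact_op S K"
  obtains e \<sigma> where "orthosystem e" "\<And>i. e i \<in> S" "antimono \<sigma>" "\<And>i. 0 \<le> \<sigma> i" "\<sigma> \<longlonglongrightarrow> 0"
    "\<And>i. e i \<noteq> 0 \<longleftrightarrow> 0 < \<sigma> i" "\<And>n. s_number S K n = \<sigma> (n - 1)"
    "\<And>i x. x \<in> S \<Longrightarrow> cinner (K (e i)) (K x) = of_real ((\<sigma> i)\<^sup>2) * cinner (e i) x"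
    "\<And>n x. x \<in> S \<Longrightarrow> (\<And>i. i < n \<Longrightarrow> cinner x (e i) = 0) \<Longrightarrow> norm (K x) \<le> \<sigma> n * norm x"
proof -
  have bK: "bounded_op S K" using cpt by (simp add: compact_op_def)
  note KS = bounded_opD(2)[OF bK]
  let ?C = "\<lambda>f. adjoint_op S K (K f)"
  have form: "cinner (?C f) g = cinner (K f) (K g)" if "f \<in> S" "g \<in> S" for f g
    using adjoint_op(2)[OF bK KS[OF that(1)] that(2)] by (metis cinner_commute)
  have form': "cinner f (?C g) = cinner (K f) (K g)" if "f \<in> S" "g \<in> S" for f g
    using adjoint_op(2)[OF bK KS[OF that(2)] that(1)] by simp
  have C: "nonneg_op S ?C"
    unfolding nonneg_op_def
  proof (intro conjI ballI)
    show "bounded_op S ?C" by (rule bounded_op_comp[OF bounded_adjoint_op[OF bK] bK])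
    show "cinner (?C f) g = cinner f (?C g)" if "f \<in> S" "g \<in> S" for f g using form form' that by simp
    show "0 \<le> Re (cinner (?C f) f)" if "f \<in> S" for f using form[OF that that] by (simp add: Re_cinner_self)
  qed
  have "sequentially_compact ?C"
    by (rule sequentially_compact_comp[OF compact_op_sequentially_compact[OF cpt] bounded_adjoint_op[OF bK] KS])
  then obtain e ev where E: "eigensystem ?C e ev"
    and le: "\<And>n x. x \<in> S \<Longrightarrow> (\<And>i. i < n \<Longrightarrow> cinner x (e i) = 0) \<Longrightarrow> Re (cinner (?C x) x) \<le> ev n * (norm x)\<^sup>2"
    using spectral_theorem[OF C] by metis
  have 1: "antimono (\<lambda>i. sqrt (ev i))" using antimonoD[OF eigensystemD(3)[OF E]] by (auto intro!: antimonoI)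
  have "(\<lambda>i. sqrt (ev i)) \<longlonglongrightarrow> sqrt 0" by (intro tendsto_real_sqrt eigensystemD[OF E])
  then have 2: "(\<lambda>i. sqrt (ev i)) \<longlonglongrightarrow> 0" by simp
  have 3: "cinner (K (e i)) (K x) = of_real ((sqrt (ev i))\<^sup>2) * cinner (e i) x" if "x \<in> S" for i x
    using form[OF eigensystemD(2)[OF E] that] eigensystemD(4,7)[OF E] by (simp add: cinner_scaleC_left)
  have 4: "norm (K x) \<le> sqrt (ev n) * norm x" if x: "x \<in> S" "\<And>i. i < n \<Longrightarrow> cinner x (e i) = 0" for n x
  proof (rule power2_le_imp_le)
    have "(norm (K x))\<^sup>2 = Re (cinner (?C x) x)" using form[OF x(1) x(1)] by (simp add: Re_cinner_self)
    also have "\<dots> \<le> ev n * (norm x)\<^sup>2" by (rule le[OF x])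
    finally show "(norm (K x))\<^sup>2 \<le> (sqrt (ev n) * norm x)\<^sup>2" using eigensystemD(4)[OF E] by (simp add: power_mult_distrib)
  qed (use eigensystemD(4)[OF E] in simp)
  show thesis
    by (rule that[of e "\<lambda>i. sqrt (ev i)"]) (use eigensystemD[OF E] 1 2 3 4 abs_op_eigensystem[OF E bK] in auto)
qed

end

section \<open>Completeness of the space of square-integrable functions\<close>

lemma l2_eq_refl: "square_integrable f \<Longrightarrow> l2_eq f f"
  by (simp add: l2_eq_def)

lemma to_l2_add:
  "square_integrable f \<Longrightarrow> square_integrable g \<Longrightarrow> to_l2 f + to_l2 g = to_l2 (\<lambda>x. f x + g x)"
  by (simp add: plus_l2.abs_eq l2_eq_refl)

lemma to_l2_scaleC: "square_integrable f \<Longrightarrow> scaleC c (to_l2 f) = to_l2 (\<lambda>x. c * f x)"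
  by (simp add: scaleC_l2.abs_eq l2_eq_refl)

lemma square_integrable_diff:
  assumes "square_integrable f" "square_integrable g"
  shows "square_integrable (\<lambda>x. f x - g x)"
  using square_integrable_add[OF assms(1) square_integrable_cmult[OF assms(2), of "-1"]] by simp

lemma to_l2_diff:
  assumes "square_integrable f" "square_integrable g"
  shows "to_l2 f - to_l2 g = to_l2 (\<lambda>x. f x - g x)"
proof -
  have "to_l2 f - to_l2 g = to_l2 f + scaleC (-1) (to_l2 g)" by simp
  also have "\<dots> = to_l2 (\<lambda>x. f x + (-1) * g x)"
    unfolding to_l2_scaleC[OF assms(2)] by (rule to_l2_add[OF assms(1) square_integrable_cmult[OF assms(2)]])
  finally show ?thesis by simp
qed

lemma csubspace_L2_on: "csubspace (L2_on W)"
  unfolding csubspace_def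
proof (intro conjI ballI allI)
  show "0 \<in> L2_on W"
    unfolding L2_on_def zero_l2_def by (intro CollectI exI[of _ "\<lambda>x. 0"]) (simp add: square_integrable_zero)
  show "u + v \<in> L2_on W" if uv: "u \<in> L2_on W" "v \<in> L2_on W" for u v
  proof -
    obtain f g where "u = to_l2 f" "square_integrable f" "\<forall>x. x \<notin> W \<longrightarrow> f x = 0"
      "v = to_l2 g" "square_integrable g" "\<forall>x. x \<notin> W \<longrightarrow> g x = 0"
      using uv unfolding L2_on_def by blast
    then show ?thesis
      unfolding L2_on_def
      by (intro CollectI exI[of _ "\<lambda>x. f x + g x"]) (simp add: to_l2_add square_integrable_add)
  qed
  show "scaleC c u \<in> L2_on W" if u: "u \<in> L2_on W" for c u
  proof -
    obtain f where "u = to_l2 f" "square_integrable f" "\<forall>x. x \<notin> W \<longrightarrow> f x = 0"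
      using u unfolding L2_on_def by blast
    then show ?thesis
      unfolding L2_on_def
      by (intro CollectI exI[of _ "\<lambda>x. c * f x"]) (simp add: to_l2_scaleC square_integrable_cmult)
  qed
qed

lemma norm_to_l2:
  assumes "square_integrable f"
  shows "(norm (to_l2 f))\<^sup>2 = (LINT x|lebesgue. (norm (f x))\<^sup>2)"
proof -
  have "(norm (to_l2 f))\<^sup>2 = Re (LINT x|lebesgue. f x * cnj (f x))"
    using assms by (simp add: Re_cinner_self[symmetric] cinner_l2.abs_eq l2_eq_refl)
  also have "(\<lambda>x. f x * cnj (f x)) = (\<lambda>x. complex_of_real ((norm (f x))\<^sup>2))"
    by (simp only: complex_norm_square)
  finally show ?thesis by (simp only: integral_complex_of_real Re_complex_of_real)
qed

lemma nn_integral_to_l2: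
  assumes "square_integrable f"
  shows "(\<integral>\<^sup>+ x. ennreal ((norm (f x))\<^sup>2) \<partial>lebesgue) = ennreal ((norm (to_l2 f))\<^sup>2)"
  unfolding norm_to_l2[OF assms]
  by (rule nn_integral_eq_integral) (use assms in \<open>auto simp: square_integrable_def\<close>)

lemma square_integrable_if_nn_integral_le:
  fixes f :: "'a::euclidean_space \<Rightarrow> complex"
  assumes "f \<in> borel_measurable lebesgue" "(\<integral>\<^sup>+ x. ennreal ((norm (f x))\<^sup>2) \<partial>lebesgue) \<le> ennreal c"
  shows "square_integrable f"
  unfolding square_integrable_def
proof (intro conjI integrableI_bounded)
  show "(\<integral>\<^sup>+ x. ennreal (norm ((norm (f x))\<^sup>2)) \<partial>lebesgue) < \<infinity>"
    using le_less_trans[OF assms(2) ennreal_less_top] by simp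
qed (use assms(1) in auto)

text \<open>With weights 2^n the squared increments still have summable integrals, as 2^n 4^(-n) is
  summable. Pointwise the weighted squares control the increments themselves, since r \<le> 2^(-n) +
  2^n r^2 for r \<ge> 0.\<close>

lemma AE_convergent_if_fast_Cauchy:
  fixes g :: "nat \<Rightarrow> 'a::euclidean_space \<Rightarrow> complex"
  assumes g: "\<And>n. square_integrable (g n)"
    and fast: "\<And>n. norm (to_l2 (g (Suc n)) - to_l2 (g n)) \<le> (1/2) ^ n"
  shows "AE x in lebesgue. convergent (\<lambda>n. g n x)"
proof -
  define D where "D n x = g (Suc n) x - g n x" for n x
  have D: "square_integrable (D n)" for n unfolding D_def by (intro square_integrable_diff g)
  have nD: "norm (to_l2 (D n)) \<le> (1/2) ^ n" for n
    using fast[of n] unfolding to_l2_diff[OF g g] D_def .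
  have meas: "D n \<in> borel_measurable lebesgue" for n using D by (simp add: square_integrable_def)
  have "(\<integral>\<^sup>+ x. (\<Sum>n. ennreal (2 ^ n * (norm (D n x))\<^sup>2)) \<partial>lebesgue) = (\<Sum>n. \<integral>\<^sup>+ x. ennreal (2 ^ n * (norm (D n x))\<^sup>2) \<partial>lebesgue)"
    using meas by (intro nn_integral_suminf) auto
  also have "\<dots> \<le> (\<Sum>n. ennreal ((1/2) ^ n))"
  proof (rule suminf_le)
    fix n
    have "(\<integral>\<^sup>+ x. ennreal (2 ^ n * (norm (D n x))\<^sup>2) \<partial>lebesgue) = (\<integral>\<^sup>+ x. ennreal (2 ^ n) * ennreal ((norm (D n x))\<^sup>2) \<partial>lebesgue)"
      by (simp add: ennreal_mult)
    also have "\<dots> = ennreal (2 ^ n) * ennreal ((norm (to_l2 (D n)))\<^sup>2)"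
      using meas by (subst nn_integral_cmult) (auto simp: nn_integral_to_l2[OF D])
    also have "\<dots> = ennreal (2 ^ n * (norm (to_l2 (D n)))\<^sup>2)" by (simp add: ennreal_mult)
    also have "\<dots> \<le> ennreal (2 ^ n * ((1/2) ^ n)\<^sup>2)"
      by (intro ennreal_leI mult_left_mono power_mono nD) auto
    also have "(2::real) ^ n * ((1/2) ^ n)\<^sup>2 = (1/2) ^ n"
      by (simp add: power2_eq_square power_mult_distrib[symmetric] flip: mult.assoc)
    finally show "(\<integral>\<^sup>+ x. ennreal (2 ^ n * (norm (D n x))\<^sup>2) \<partial>lebesgue) \<le> ennreal ((1/2) ^ n)" .
  qed auto
  also have "\<dots> = ennreal (\<Sum>n. (1/2) ^ n)" by (intro suminf_ennreal2) auto
  also have "\<dots> < \<infinity>" by simp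
  finally have fin: "(\<integral>\<^sup>+ x. (\<Sum>n. ennreal (2 ^ n * (norm (D n x))\<^sup>2)) \<partial>lebesgue) \<noteq> \<infinity>" by simp
  have "AE x in lebesgue. (\<Sum>n. ennreal (2 ^ n * (norm (D n x))\<^sup>2)) \<noteq> \<infinity>"
    using meas by (intro nn_integral_noteq_infinite fin) auto
  then show ?thesis
  proof eventually_elim
    case (elim x)
    have s1: "summable (\<lambda>n. 2 ^ n * (norm (D n x))\<^sup>2)"
      by (rule summable_suminf_not_top) (use elim in auto)
    have "summable (\<lambda>n. D n x)"
    proof (rule summable_comparison_test)
      show "summable (\<lambda>n. (1/2) ^ n + 2 ^ n * (norm (D n x))\<^sup>2)" by (intro summable_add s1) simp
      have "norm (D n x) \<le> (1/2) ^ n + 2 ^ n * (norm (D n x))\<^sup>2" for n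
      proof -
        let ?s = "norm (D n x)" and ?c = "(2::real) ^ n"
        have c: "0 < ?c" "(1/2) ^ n = 1 / ?c" by (auto simp: power_one_over)
        show ?thesis
        proof (cases "?s \<le> 1 / ?c")
          case True
          then show ?thesis using c by (simp add: add_increasing2)
        next
          case False
          then have "1 * ?s \<le> (?c * ?s) * ?s" using c by (intro mult_right_mono) (auto simp: field_simps)
          then show ?thesis using c by (simp add: power2_eq_square add_increasing mult.assoc)
        qed
      qed
      then show "\<exists>N. \<forall>n\<ge>N. norm (D n x) \<le> (1/2) ^ n + 2 ^ n * (norm (D n x))\<^sup>2" by blast
    qed
    then have "convergent (\<lambda>n. \<Sum>k<n. D k x)" by (simp add: summable_iff_convergent)
    then have "convergent (\<lambda>n. g 0 x + (\<Sum>k<n. D k x))" by (intro convergent_add convergent_const)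
    moreover have "g 0 x + (\<Sum>k<n. D k x) = g n x" for n
      unfolding D_def using sum_lessThan_telescope[of "\<lambda>k. g k x" n] by simp
    ultimately show "convergent (\<lambda>n. g n x)" by simp
  qed
qed

text \<open>Riesz-Fischer: the limit is taken pointwise along a fast subsequence, and Fatou's lemma
  transfers the norm bounds to it. Representatives that vanish off \<open>W\<close> everywhere make
  the limit vanish there too.\<close>

theorem complete_L2_on: "complete (L2_on W)"
proof (rule completeI)
  fix u :: "nat \<Rightarrow> 'a l2" assume uW: "\<forall>n. u n \<in> L2_on W" and Cau: "Cauchy u"
  have "\<exists>N. \<forall>i\<ge>N. \<forall>j\<ge>N. norm (u i - u j) < (1/2) ^ n" for n
    using metric_CauchyD[OF Cau, of "(1/2) ^ n"] by (simp add: dist_norm)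
  then obtain N where N: "\<And>n i j. i \<ge> N n \<Longrightarrow> j \<ge> N n \<Longrightarrow> norm (u i - u j) < (1/2) ^ n" by metis
  \<comment> \<open>Partial sums give a monotone sequence of indices that dominates
    \<open>N\<close>.\<close>
  define r where "r n = sum N {..n}" for n
  have rN: "N n \<le> r n" for n unfolding r_def by (rule member_le_sum) auto
  have rr: "r n \<le> r m" if "n \<le> m" for n m unfolding r_def using that by (intro sum_mono2) auto
  have "\<forall>n. \<exists>f. u (r n) = to_l2 f \<and> square_integrable f \<and> (\<forall>x. x \<notin> W \<longrightarrow> f x = 0)"
    using uW unfolding L2_on_def by blast
  then obtain g where g: "\<And>n. u (r n) = to_l2 (g n)" "\<And>n. square_integrable (g n)" "\<And>n x. x \<notin> W \<Longrightarrow> g n x = 0"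
    by metis
  have close: "norm (to_l2 (g m) - to_l2 (g n)) \<le> (1/2) ^ n" if "n \<le> m" for n m
    unfolding g(1)[symmetric] using N[OF order_trans[OF rN[of n] rr[OF that]] rN[of n]] by simp
  \<comment> \<open>On the null set of divergence the value of \<open>lim\<close> is unspecified but
    harmless; off \<open>W\<close> the sequence is constantly 0, so the limit is 0 there.\<close>
  define G where "G x = lim (\<lambda>n. g n x)" for x
  have meas: "g n \<in> borel_measurable lebesgue" for n using g(2) by (simp add: square_integrable_def)
  have measG: "G \<in> borel_measurable lebesgue"
    unfolding G_def by (intro borel_measurable_lim_metric meas)
  have conv: "AE x in lebesgue. (\<lambda>n. g n x) \<longlonglongrightarrow> G x"
    using AE_convergent_if_fast_Cauchy[OF g(2) close[OF le_SucI[OF order_refl]]]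
    by eventually_elim (simp add: G_def convergent_LIMSEQ_iff)
  have bound: "(\<integral>\<^sup>+ x. ennreal ((norm (G x - g n x))\<^sup>2) \<partial>lebesgue) \<le> ennreal (((1/2) ^ n)\<^sup>2)" for n
  proof -
    have "(\<integral>\<^sup>+ x. ennreal ((norm (G x - g n x))\<^sup>2) \<partial>lebesgue) = (\<integral>\<^sup>+ x. liminf (\<lambda>m. ennreal ((norm (g m x - g n x))\<^sup>2)) \<partial>lebesgue)"
    proof (rule nn_integral_cong_AE)
      show "AE x in lebesgue. ennreal ((norm (G x - g n x))\<^sup>2) = liminf (\<lambda>m. ennreal ((norm (g m x - g n x))\<^sup>2))"
        using conv
      proof eventually_elim
        case (elim x)
        have "(\<lambda>m. ennreal ((norm (g m x - g n x))\<^sup>2)) \<longlonglongrightarrow> ennreal ((norm (G x - g n x))\<^sup>2)"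
          by (intro tendsto_ennrealI tendsto_intros elim)
        then show ?case by (rule lim_imp_Liminf[OF sequentially_bot, symmetric])
      qed
    qed
    also have "\<dots> \<le> liminf (\<lambda>m. \<integral>\<^sup>+ x. ennreal ((norm (g m x - g n x))\<^sup>2) \<partial>lebesgue)"
      using meas by (intro nn_integral_liminf) auto
    also have "\<dots> \<le> ennreal (((1/2) ^ n)\<^sup>2)"
    proof (rule Liminf_le)
      show "\<forall>\<^sub>F m in sequentially. (\<integral>\<^sup>+ x. ennreal ((norm (g m x - g n x))\<^sup>2) \<partial>lebesgue) \<le> ennreal (((1/2) ^ n)\<^sup>2)"
      proof (rule eventually_sequentiallyI)
        fix m assume "n \<le> m"
        then show "(\<integral>\<^sup>+ x. ennreal ((norm (g m x - g n x))\<^sup>2) \<partial>lebesgue) \<le> ennreal (((1/2) ^ n)\<^sup>2)"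
          unfolding nn_integral_to_l2[OF square_integrable_diff[OF g(2) g(2)]] to_l2_diff[OF g(2) g(2), symmetric]
          by (intro ennreal_leI power_mono close) auto
      qed
    qed simp
    finally show ?thesis .
  qed
  have sqd: "square_integrable (\<lambda>x. G x - g n x)" for n
    by (rule square_integrable_if_nn_integral_le[OF _ bound]) (use measG meas in auto)
  have sqG: "square_integrable G" using square_integrable_add[OF sqd[of 0] g(2)[of 0]] by simp
  have dG: "norm (to_l2 G - u (r n)) \<le> (1/2) ^ n" for n
  proof (rule power2_le_imp_le)
    have "ennreal ((norm (to_l2 G - u (r n)))\<^sup>2) \<le> ennreal (((1/2) ^ n)\<^sup>2)"
      using bound[of n] unfolding nn_integral_to_l2[OF sqd] to_l2_diff[OF sqG g(2), symmetric] g(1) .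
    then show "(norm (to_l2 G - u (r n)))\<^sup>2 \<le> ((1/2) ^ n)\<^sup>2" by (simp add: ennreal_le_iff)
  qed simp
  have "u \<longlonglongrightarrow> to_l2 G"
  proof (rule metric_LIMSEQ_I)
    fix \<epsilon> :: real assume \<epsilon>: "0 < \<epsilon>"
    obtain n where n: "(1/2) ^ n < \<epsilon> / 2" using real_arch_pow_inv[of "\<epsilon> / 2" "1/2"] \<epsilon> by auto
    have "dist (u i) (to_l2 G) < \<epsilon>" if "i \<ge> r n" for i
    proof -
      have "norm (u i - u (r n)) < (1/2) ^ n" using rN[of n] that by (intro N) auto
      moreover have "dist (u i) (to_l2 G) \<le> norm (u i - u (r n)) + norm (to_l2 G - u (r n))"
        using dist_triangle[of "u i" "to_l2 G" "u (r n)"] by (simp add: dist_norm norm_minus_commute)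
      ultimately show ?thesis using dG[of n] n by linarith
    qed
    then show "\<exists>m. \<forall>i\<ge>m. dist (u i) (to_l2 G) < \<epsilon>" by blast
  qed
  moreover have "to_l2 G \<in> L2_on W"
  proof -
    have "G x = 0" if "x \<notin> W" for x unfolding G_def using g(3)[OF that] limI[OF tendsto_const] by simp
    then show ?thesis unfolding L2_on_def using sqG by blast
  qed
  ultimately show "\<exists>l\<in>L2_on W. u \<longlonglongrightarrow> l" by blast
qed

lemma hilbert_space_L2_on: "hilbert_space (L2_on W)"
  by unfold_locales (rule csubspace_L2_on complete_L2_on)+

section \<open>Compressions of quasinilpotent operators\<close>

text \<open>Jensen's inequality for the square, which is the non-negativity of a variance, applied
  repeatedly.\<close>

lemma jensen_power:
  fixes \<tau> w :: "'i \<Rightarrow> real"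
  assumes w: "\<And>i. i \<in> I \<Longrightarrow> 0 \<le> w i" "sum w I = 1" and \<tau>: "\<And>i. i \<in> I \<Longrightarrow> 0 \<le> \<tau> i"
  shows "(\<Sum>i\<in>I. w i * \<tau> i) ^ 2 ^ m \<le> (\<Sum>i\<in>I. w i * \<tau> i ^ 2 ^ m)"
proof -
  have sq: "(\<Sum>i\<in>I. w i * y i)\<^sup>2 \<le> (\<Sum>i\<in>I. w i * (y i)\<^sup>2)" for y :: "'i \<Rightarrow> real"
  proof -
    define c where "c = (\<Sum>i\<in>I. w i * y i)"
    have "0 \<le> (\<Sum>i\<in>I. w i * (y i - c)\<^sup>2)" by (intro sum_nonneg mult_nonneg_nonneg w) auto
    also have "\<dots> = (\<Sum>i\<in>I. w i * (y i)\<^sup>2 - 2 * c * (w i * y i) + c\<^sup>2 * w i)"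
      by (intro sum.cong refl) (simp add: power2_eq_square algebra_simps)
    also have "\<dots> = (\<Sum>i\<in>I. w i * (y i)\<^sup>2) - 2 * c * c + c\<^sup>2 * 1"
      by (simp only: sum.distrib sum_subtractf sum_distrib_left[symmetric] w(2) c_def)
    finally show ?thesis by (simp add: c_def power2_eq_square)
  qed
  show ?thesis
  proof (induction m)
    case (Suc m)
    have "(\<Sum>i\<in>I. w i * \<tau> i) ^ 2 ^ Suc m = ((\<Sum>i\<in>I. w i * \<tau> i) ^ 2 ^ m)\<^sup>2"
      by (simp add: power_mult[symmetric] mult.commute)
    also have "\<dots> \<le> (\<Sum>i\<in>I. w i * \<tau> i ^ 2 ^ m)\<^sup>2"
      by (intro power_mono Suc.IH zero_le_power sum_nonneg mult_nonneg_nonneg w \<tau>)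
    also have "\<dots> \<le> (\<Sum>i\<in>I. w i * (\<tau> i ^ 2 ^ m)\<^sup>2)" by (rule sq)
    also have "\<dots> = (\<Sum>i\<in>I. w i * \<tau> i ^ 2 ^ Suc m)" by (simp add: power_mult[symmetric] mult.commute)
    finally show ?case .
  qed simp
qed

context hilbert_space
begin

text \<open>The adjoint minus \<open>cnj z\<close> maps onto \<open>S\<close>, whereas an
  eigenvector of \<open>A\<close> to \<open>z\<close> is orthogonal to its range.\<close>

lemma quasinilpotent_adjoint_no_eigenvalue:
  assumes A: "bounded_op S A" and sp: "op_spectrum S (adjoint_op S A) \<subseteq> {0}"
    and x: "x \<in> S" "A x = scaleC z x" "z \<noteq> 0"
  shows "x = 0"
proof -
  have "cnj z \<notin> op_spectrum S (adjoint_op S A)" using sp x(3) by auto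
  then obtain R where R: "bounded_op S R"
    "\<forall>f\<in>S. R (adjoint_op S A f - scaleC (cnj z) f) = f \<and> adjoint_op S A (R f) - scaleC (cnj z) (R f) = f"
    unfolding op_spectrum_def by blast
  have Rx: "R x \<in> S" by (rule bounded_opD(2)[OF R(1) x(1)])
  have "adjoint_op S A (R x) - scaleC (cnj z) (R x) = x" using R(2) x(1) by blast
  then have "cinner x x = cinner x (adjoint_op S A (R x)) - cinner x (scaleC (cnj z) (R x))" by (metis cinner_diff_right)
  also have "\<dots> = 0" using adjoint_op(2)[OF A Rx x(1)] x(2) by (simp add: cinner_scaleC_left cinner_scaleC_right)
  finally show ?thesis by (simp add: cinner_self)
qed

lemma bounded_op_add:
  assumes "bounded_op S R" "bounded_op S T"
  shows "bounded_op S (\<lambda>x. R x + T x)"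
  unfolding bounded_op_def
proof (intro conjI ballI allI)
  note R = bounded_opD[OF assms(1)] and T = bounded_opD[OF assms(2)]
  show "(\<lambda>x. R x + T x) ` S \<subseteq> S" using R(2) T(2) sub(2) by auto
  show "R (x + y) + T (x + y) = R x + T x + (R y + T y)" if "x \<in> S" "y \<in> S" for x y
    using clin_onD(1)[OF T(1) that] clin_onD(1)[OF R(1) that] by simp
  show "R (scaleC c x) + T (scaleC c x) = scaleC c (R x + T x)" if "x \<in> S" for c x
    using clin_onD(2)[OF T(1) that] clin_onD(2)[OF R(1) that] by (simp add: scaleC_add_right)
  obtain M where M: "M \<ge> 0" "\<forall>x\<in>S. norm (R x) \<le> M * norm x" using R(3) by blast
  obtain M' where M': "M' \<ge> 0" "\<forall>x\<in>S. norm (T x) \<le> M' * norm x" using T(3) by blast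
  have "norm (R x + T x) \<le> (M + M') * norm x" if "x \<in> S" for x
    using norm_triangle_ineq[of "R x" "T x"] bspec[OF M(2) that] bspec[OF M'(2) that] by (simp add: distrib_right)
  then show "\<exists>M. \<forall>f\<in>S. norm (R f + T f) \<le> M * norm f" by blast
qed

lemma sequentially_compact_add:
  assumes "sequentially_compact R" "sequentially_compact T"
  shows "sequentially_compact (\<lambda>x. R x + T x)"
  unfolding sequentially_compact_def
proof (intro allI impI)
  fix x :: "nat \<Rightarrow> 'a" assume x: "\<forall>n. x n \<in> S \<and> norm (x n) \<le> 1"
  obtain r l where r: "strict_mono (r :: nat \<Rightarrow> nat)" "l \<in> S" "(\<lambda>n. R (x (r n))) \<longlonglongrightarrow> l"
    by (rule sequentially_compactD[OF assms(1), of x]) (use x in auto)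
  obtain s m where s: "strict_mono (s :: nat \<Rightarrow> nat)" "m \<in> S" "(\<lambda>n. T (x (r (s n)))) \<longlonglongrightarrow> m"
    by (rule sequentially_compactD[OF assms(2), of "\<lambda>n. x (r n)"]) (use x in auto)
  have "(\<lambda>n. R (x (r (s n)))) \<longlonglongrightarrow> l" using LIMSEQ_subseq_LIMSEQ[OF r(3) s(1)] by (simp add: o_def)
  then have "(\<lambda>n. R (x ((r \<circ> s) n)) + T (x ((r \<circ> s) n))) \<longlonglongrightarrow> l + m"
    unfolding o_def by (rule tendsto_add[OF _ s(3)])
  then show "\<exists>r l. strict_mono r \<and> l \<in> S \<and> (\<lambda>n. R (x (r n)) + T (x (r n))) \<longlonglongrightarrow> l"
    using strict_mono_o[OF r(1) s(1)] sub(2)[OF r(2) s(2)] by blast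
qed

text \<open>If \<open>x\<close> is an eigenvector of the compression, then \<open>A x\<close> is an approximate eigenvector of \<open>A\<close> itself.\<close>

lemma compressed_eigenvalues_small:
  fixes d :: "nat \<Rightarrow> nat" and b :: "nat \<Rightarrow> nat \<Rightarrow> 'a"
  assumes A: "bounded_op S A" and cpt: "sequentially_compact A"
    and noev: "\<And>z x. x \<in> S \<Longrightarrow> A x = scaleC z x \<Longrightarrow> z \<noteq> 0 \<Longrightarrow> x = 0"
    and b: "\<And>n. orthonormal (d n) (b n)" "\<And>n i. i < d n \<Longrightarrow> b n i \<in> S"
    and approx: "\<And>n x. x \<in> S \<Longrightarrow> norm (A (x - proj (d n) (b n) x)) \<le> \<delta> n * norm x" "\<delta> \<longlonglongrightarrow> 0"
    and \<epsilon>: "0 < \<epsilon>"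
  shows "\<exists>N. \<forall>n\<ge>N. \<forall>a x. proj (d n) (b n) x = x \<longrightarrow> x \<noteq> 0 \<longrightarrow> proj (d n) (b n) (A x) = scaleC a x \<longrightarrow> cmod a \<le> \<epsilon>"
proof (rule ccontr)
  assume contra: "\<not> ?thesis"
  have "\<forall>N. \<exists>n a x. N \<le> n \<and> proj (d n) (b n) x = x \<and> x \<noteq> 0 \<and> proj (d n) (b n) (A x) = scaleC a x \<and> \<epsilon> < cmod a"
    using contra by (simp add: not_le)
  then obtain n a x where n: "\<And>k. k \<le> n k" and Qx: "\<And>k. proj (d (n k)) (b (n k)) (x k) = x k" and x0: "\<And>k. x k \<noteq> 0"
    and ev: "\<And>k. proj (d (n k)) (b (n k)) (A (x k)) = scaleC (a k) (x k)" and big: "\<And>k. \<epsilon> < cmod (a k)"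
    by metis
  note lin = bounded_opD(1)[OF A]
  define Q where "Q k = proj (d (n k)) (b (n k))" for k
  have QS: "Q k u \<in> S" for k u unfolding Q_def by (intro proj_in_csubspace subspace b(2))
  have xS: "x k \<in> S" for k using QS[of k "x k"] Qx[of k] by (simp add: Q_def)
  define y where "y k = A (x k)" for k
  have yS: "y k \<in> S" for k unfolding y_def by (rule bounded_opD(2)[OF A xS])
  have Qy: "Q k (y k) = scaleC (a k) (x k)" for k using ev by (simp add: Q_def y_def)
  have a0: "a k \<noteq> 0" for k using big[of k] \<epsilon> by auto
  have y0: "y k \<noteq> 0" for k
  proof
    assume "y k = 0"
    then have "scaleC (a k) (x k) = 0" using Qy[of k] by (simp add: Q_def proj_simps)
    then show False using a0 x0 by (simp add: complex_space.scale_eq_0_iff)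
  qed
  have "A (Q k (y k)) = scaleC (a k) (y k)" for k
    by (subst Qy) (simp only: clin_onD(2)[OF lin xS] y_def)
  then have Ay: "A (y k) - scaleC (a k) (y k) = A (y k - Q k (y k))" for k
    using clin_on_simps(2)[OF subspace lin yS QS, of k k "y k"] by simp
  define w where "w k = scaleC (of_real (1 / norm (y k))) (y k)" for k
  have wS: "w k \<in> S" for k unfolding w_def by (rule sub(3)[OF yS])
  have nw: "norm (w k) = 1" for k using y0[of k] by (simp add: w_def norm_scaleC norm_divide)
  have D: "norm (A (w k) - scaleC (a k) (w k)) \<le> \<delta> (n k)" for k
  proof -
    have "A (w k) - scaleC (a k) (w k) = scaleC (of_real (1 / norm (y k))) (A (y k) - scaleC (a k) (y k))"
      unfolding w_def clin_onD(2)[OF lin yS] by (simp add: scaleC_diff_right scaleC_scaleC mult.commute)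
    also have "norm \<dots> = norm (A (y k - Q k (y k))) / norm (y k)" by (simp add: Ay norm_scaleC norm_divide)
    also have "\<dots> \<le> (\<delta> (n k) * norm (y k)) / norm (y k)"
      unfolding Q_def by (intro divide_right_mono approx(1) yS) simp
    finally show ?thesis using y0[of k] by simp
  qed
  have nlim: "filterlim n at_top sequentially"
    by (rule filterlim_at_top_mono[OF filterlim_ident]) (use n in auto)
  have \<delta>n: "(\<lambda>k. \<delta> (n k)) \<longlonglongrightarrow> 0" by (rule filterlim_compose[OF approx(2) nlim])
  have Dlim: "(\<lambda>k. A (w k) - scaleC (a k) (w k)) \<longlonglongrightarrow> 0" by (rule tendsto_zero_dominated[OF D \<delta>n])
  obtain M where M: "M \<ge> 0" "\<forall>x\<in>S. norm (A x) \<le> M * norm x" using bounded_opD(3)[OF A] by blast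
  have aM: "cmod (a k) \<le> M" for k
  proof -
    have "cmod (a k) * norm (x k) = norm (Q k (y k))" by (simp add: Qy norm_scaleC)
    also have "\<dots> \<le> norm (y k)" unfolding Q_def by (rule norm_proj_le[OF b(1)])
    also have "\<dots> \<le> M * norm (x k)" unfolding y_def using M(2) xS by blast
    finally show ?thesis using x0[of k] by simp
  qed
  obtain r p where r: "strict_mono (r :: nat \<Rightarrow> nat)" "p \<in> S" "(\<lambda>k. A (w (r k))) \<longlonglongrightarrow> p"
    by (rule sequentially_compactD[OF cpt, of w]) (use wS nw in auto)
  have "bounded (range (\<lambda>k. a (r k)))" unfolding bounded_iff using aM by auto
  then obtain z s where s: "strict_mono (s :: nat \<Rightarrow> nat)" "(\<lambda>k. a (r (s k))) \<longlonglongrightarrow> z"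
    using bounded_imp_convergent_subsequence[of "\<lambda>k. a (r k)"] by (auto simp: o_def)
  let ?i = "\<lambda>k. r (s k)"
  have i: "strict_mono ?i" using strict_mono_o[OF r(1) s(1)] by (simp add: o_def)
  have Aw: "(\<lambda>k. A (w (?i k))) \<longlonglongrightarrow> p" using LIMSEQ_subseq_LIMSEQ[OF r(3) s(1)] by (simp add: o_def)
  have "(\<lambda>k. A (w (?i k)) - scaleC (a (?i k)) (w (?i k))) \<longlonglongrightarrow> 0"
    using LIMSEQ_subseq_LIMSEQ[OF Dlim i] by (simp add: o_def)
  then have "(\<lambda>k. A (w (?i k)) - (A (w (?i k)) - scaleC (a (?i k)) (w (?i k)))) \<longlonglongrightarrow> p - 0"
    by (rule tendsto_diff[OF Aw])
  then have aw: "(\<lambda>k. scaleC (a (?i k)) (w (?i k))) \<longlonglongrightarrow> p" by simp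
  \<comment> \<open>The factors \<open>a\<close> stay away from 0, so they can be divided out of the
    convergent products: the unit vectors \<open>w\<close> converge, and their limit is an
    eigenvector that \<open>noev\<close> excludes.\<close>
  have "(\<lambda>k. cmod (a (?i k))) \<longlonglongrightarrow> cmod z" by (intro tendsto_norm s(2))
  then have "\<epsilon> \<le> cmod z" by (rule LIMSEQ_le_const) (use big less_imp_le in blast)
  then have z0: "z \<noteq> 0" using \<epsilon> by auto
  have "(\<lambda>k. scaleC (inverse (a (?i k))) (scaleC (a (?i k)) (w (?i k)))) \<longlonglongrightarrow> scaleC (inverse z) p"
    by (intro tendsto_scaleC tendsto_inverse s(2) aw z0)
  then have wlim: "(\<lambda>k. w (?i k)) \<longlonglongrightarrow> scaleC (inverse z) p" using a0 by (simp add: scaleC_scaleC)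
  define l where "l = scaleC (inverse z) p"
  have lS: "l \<in> S" unfolding l_def by (rule sub(3)[OF r(2)])
  have "(\<lambda>k. A (w (?i k))) \<longlonglongrightarrow> A l" unfolding l_def by (rule bounded_op_tendsto[OF A wS wlim])
  then have "A l = p" using Aw LIMSEQ_unique by blast
  then have "A l = scaleC z l" using z0 by (simp add: l_def scaleC_scaleC)
  then have "l = 0" using noev lS z0 by blast
  moreover have "(\<lambda>k. norm (w (?i k))) \<longlonglongrightarrow> norm l" unfolding l_def by (intro tendsto_norm wlim)
  then have "norm l = 1" unfolding nw using LIMSEQ_unique[OF tendsto_const] by metis
  ultimately show False by simp
qed

text \<open>The nonzero singular vectors among the first \<open>n\<close> come first, then at most
  \<open>n\<close> further vectors that bring the first \<open>n\<close> of the \<open>v i\<close>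
  into the span. In this order \<open>K\<close> is under control on the basis: of norm
  \<open>\<sigma> j\<close> on the head and at most \<open>\<sigma> n\<close> on the tail.\<close>

definition adapted :: "nat \<Rightarrow> (nat \<Rightarrow> 'a) \<Rightarrow> (nat \<Rightarrow> 'a) \<Rightarrow> nat \<Rightarrow> (nat \<Rightarrow> 'a) \<Rightarrow> nat \<Rightarrow> bool" where
  "adapted n e v d b k \<longleftrightarrow> orthonormal d b \<and> (\<forall>i<d. b i \<in> S) \<and> k \<le> n \<and> k \<le> d \<and> d \<le> k + n \<and> (\<forall>i<k. b i = e i) \<and>
     (\<forall>i. k \<le> i \<and> i < n \<longrightarrow> e i = 0) \<and> (\<forall>i<n. proj d b (e i) = e i \<and> proj d b (v i) = v i)"

lemma adaptedD:
  assumes "adapted n e v d b k"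
  shows "orthonormal d b" "i < d \<Longrightarrow> b i \<in> S" "k \<le> n" "k \<le> d" "d \<le> k + n" "i < k \<Longrightarrow> b i = e i"
    "k \<le> i \<Longrightarrow> i < n \<Longrightarrow> e i = 0" "i < n \<Longrightarrow> proj d b (e i) = e i" "i < n \<Longrightarrow> proj d b (v i) = v i"
  using assms by (auto simp: adapted_def)

lemma adapted_exists:
  assumes e: "orthosystem e" "\<And>i. e i \<in> S" and \<sigma>: "antimono \<sigma>" "\<And>i. e i \<noteq> 0 \<longleftrightarrow> 0 < \<sigma> i" and v: "\<And>i. v i \<in> S"
  shows "\<exists>d b k. adapted n e v d b k"
proof -
  obtain k where k: "k \<le> n" "\<And>i. i < k \<Longrightarrow> e i \<noteq> 0" "\<And>i. k \<le> i \<Longrightarrow> i < n \<Longrightarrow> e i = 0"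
  proof (cases "\<forall>i<n. e i \<noteq> 0")
    case True
    then show ?thesis using that[of n] by auto
  next
    case False
    \<comment> \<open>The zeros of \<open>e\<close> form a tail, because \<open>\<sigma>\<close> is
      non-increasing and vanishes exactly where \<open>e\<close> does.\<close>
    define k where "k = (LEAST i. e i = 0)"
    have ek: "e k = 0" and kn: "k \<le> n"
      using False LeastI_ex[of "\<lambda>i. e i = 0"] Least_le[of "\<lambda>i. e i = 0"] by (auto simp: k_def intro: order_trans less_imp_le)
    have "e i \<noteq> 0" if "i < k" for i using not_less_Least[of i "\<lambda>i. e i = 0"] that by (simp add: k_def)
    moreover have "e i = 0" if "k \<le> i" for i
      using antimonoD[OF \<sigma>(1) that] \<sigma>(2)[of k] \<sigma>(2)[of i] ek by auto
    ultimately show ?thesis using that[of k] kn by blast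
  qed
  have on: "orthonormal k e" using e(1) k(2) by (auto simp: orthonormal_def orthosystem_def)
  obtain d b where b: "k \<le> d" "d \<le> k + length (map v [0..<n])" "orthonormal d b" "\<And>i. i < d \<Longrightarrow> b i \<in> S"
    "\<And>i. i < k \<Longrightarrow> b i = e i" "\<And>x. x \<in> set (map v [0..<n]) \<Longrightarrow> proj d b x = x"
    by (rule orthonormal_span_list[OF on subspace e(2), of "map v [0..<n]"]) (use v in auto)
  have "proj d b (e i) = e i" if "i < n" for i
  proof (cases "i < k")
    case True
    then show ?thesis using proj_basis[OF b(3), of i] b(1,5) by simp
  next
    case False
    then show ?thesis using k(3)[of i] that by (simp add: proj_simps)
  qed
  then have "adapted n e v d b k" unfolding adapted_def using b k by auto
  then show ?thesis by blast
qed

end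

text \<open>There are at most \<open>n\<close> tail terms, all equal to \<open>h n\<close>, and by
  monotonicity \<open>n\<close> copies of \<open>h n\<close> are dominated by the first
  \<open>n\<close> terms.\<close>

lemma sum_head_tail_le:
  fixes h :: "nat \<Rightarrow> real"
  assumes h: "antimono h" "\<And>j. 0 \<le> h j" "summable h" and k: "k \<le> n" "k \<le> d" "d \<le> k + n"
  shows "(\<Sum>j<d. if j < k then h j else h n) \<le> 2 * (\<Sum>j. h j)"
proof -
  have "(\<Sum>j<d. if j < k then h j else h n) = (\<Sum>j=0..<k. if j < k then h j else h n) + (\<Sum>j=k..<d. if j < k then h j else h n)"
    unfolding lessThan_atLeast0 by (rule sum.atLeastLessThan_concat[symmetric]) (use k in auto)
  also have "\<dots> = (\<Sum>j<k. h j) + real (d - k) * h n" by (simp add: lessThan_atLeast0)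
  also have "real (d - k) * h n \<le> real n * h n" using k by (intro mult_right_mono h) auto
  also have "real n * h n = (\<Sum>j<n. h n)" by simp
  also have "\<dots> \<le> (\<Sum>j<n. h j)" using antimonoD[OF h(1)] by (intro sum_mono) auto
  also have "(\<Sum>j<n. h j) \<le> (\<Sum>j. h j)" by (intro sum_le_suminf h) auto
  also have "(\<Sum>j<k. h j) \<le> (\<Sum>j. h j)" by (intro sum_le_suminf h) auto
  finally show ?thesis by simp
qed

lemma (in hilbert_space) adapted_range:
  assumes "adapted n e v d b k" "proj d b x = x"
  shows "x \<in> S"
proof -
  have "proj d b x \<in> S" by (intro proj_in_csubspace subspace adaptedD(2)[OF assms(1)])
  then show ?thesis using assms(2) by simp
qed

section \<open>Schatten sums of a compact operator over bases of a compression\<close>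

locale singular_system = hilbert_space S for S :: "'a::complex_inner set" +
  fixes K :: "'a \<Rightarrow> 'a" and e :: "nat \<Rightarrow> 'a" and \<sigma> :: "nat \<Rightarrow> real"
  assumes K: "bounded_op S K" and os: "orthosystem e" and eS: "\<And>i. e i \<in> S"
    and \<sigma>_anti: "antimono \<sigma>" and \<sigma>_nonneg: "\<And>i. 0 \<le> \<sigma> i" and \<sigma>_lim: "\<sigma> \<longlonglongrightarrow> 0"
    and e_iff: "\<And>i. e i \<noteq> 0 \<longleftrightarrow> 0 < \<sigma> i"
    and K_e: "\<And>i x. x \<in> S \<Longrightarrow> cinner (K (e i)) (K x) = of_real ((\<sigma> i)\<^sup>2) * cinner (e i) x"
    and K_tail: "\<And>n x. x \<in> S \<Longrightarrow> (\<And>i. i < n \<Longrightarrow> cinner x (e i) = 0) \<Longrightarrow> norm (K x) \<le> \<sigma> n * norm x"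
begin

lemmas K_lin = bounded_opD(1)[OF K]

lemma adapted_tail_orth:
  assumes ad: "adapted n e v d b k" and "k \<le> j" "j < d" "i < n"
  shows "cinner (b j) (e i) = 0"
proof (cases "i < k")
  case True
  then show ?thesis using adaptedD(6)[OF ad True] orthonormalD[OF adaptedD(1)[OF ad], of j i] assms by simp
next
  case False
  then show ?thesis using adaptedD(7)[OF ad, of i] assms by simp
qed

lemma norm_K_e: "norm (K (e i)) = \<sigma> i * norm (e i)"
proof (rule power2_eq_imp_eq)
  show "(norm (K (e i)))\<^sup>2 = (\<sigma> i * norm (e i))\<^sup>2"
    unfolding Re_cinner_self[symmetric] K_e[OF eS] by (simp add: cinner_self power_mult_distrib flip: of_real_power of_real_mult)
qed (use \<sigma>_nonneg in auto)

lemma norm_K_adapted: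
  assumes ad: "adapted n e v d b k" and j: "j < d"
  shows "norm (K (b j)) \<le> (if j < k then \<sigma> j else \<sigma> n)"
proof (cases "j < k")
  case True
  then show ?thesis using norm_K_e[of j] adaptedD(6)[OF ad True] orthonormal_norm[OF adaptedD(1)[OF ad] j] by simp
next
  case False
  then have "norm (K (b j)) \<le> \<sigma> n * norm (b j)"
    using adapted_tail_orth[OF ad _ j] by (intro K_tail adaptedD(2)[OF ad j]) auto
  then show ?thesis using False orthonormal_norm[OF adaptedD(1)[OF ad] j] by simp
qed

text \<open>For exponents below 2 the sum over an arbitrary orthonormal basis is not controlled by
  the singular values, since spreading a singular vector over many basis vectors increases it. For
  this reason an adapted basis begins with singular vectors.\<close>

lemma schatten_sum_adapted:
  assumes ad: "adapted n e v d b k" and q: "0 < q" and sm: "summable (\<lambda>j. \<sigma> j powr q)"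
  shows "(\<Sum>j<d. norm (K (b j)) powr q) \<le> 2 * (\<Sum>j. \<sigma> j powr q)"
proof -
  have "(\<Sum>j<d. norm (K (b j)) powr q) \<le> (\<Sum>j<d. if j < k then \<sigma> j powr q else \<sigma> n powr q)"
  proof (rule sum_mono)
    fix j assume "j \<in> {..<d}"
    then have "norm (K (b j)) powr q \<le> (if j < k then \<sigma> j else \<sigma> n) powr q"
      using q by (intro powr_mono2 norm_K_adapted[OF ad]) auto
    then show "norm (K (b j)) powr q \<le> (if j < k then \<sigma> j powr q else \<sigma> n powr q)" by (cases "j < k") auto
  qed
  also have "\<dots> \<le> 2 * (\<Sum>j. \<sigma> j powr q)"
    using antimonoD[OF \<sigma>_anti] \<sigma>_nonneg q adaptedD(3-5)[OF ad]
    by (intro sum_head_tail_le sm) (auto intro!: antimonoI powr_mono2)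
  finally show ?thesis .
qed

text \<open>\<open>x\<close> is split along the first \<open>k\<close> singular vectors. The images
  of the two parts are orthogonal by \<open>K_e\<close>, and the second part is orthogonal to the
  first \<open>n\<close> singular vectors, so \<open>K_tail\<close> applies.\<close>

lemma norm_K_sq_le:
  assumes ad: "adapted n e v d b k" and x: "x \<in> S"
  shows "(norm (K x))\<^sup>2 \<le> (\<Sum>j<k. (\<sigma> j)\<^sup>2 * (cmod (cinner x (b j)))\<^sup>2) + (\<sigma> n)\<^sup>2 * (norm (x - proj k b x))\<^sup>2"
proof -
  have on: "orthonormal k b" by (rule orthonormal_mono[OF adaptedD(1,4)[OF ad]])
  define y where "y = proj k b x"
  define z where "z = x - y"
  have bS: "b j \<in> S" if "j < k" for j using that adaptedD(2,4)[OF ad] by simp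
  have yS: "y \<in> S" unfolding y_def by (intro proj_in_csubspace subspace bS)
  have zS: "z \<in> S" unfolding z_def by (intro sub x yS)
  have Ky: "K y = (\<Sum>j<k. scaleC (cinner x (b j)) (K (b j)))"
    unfolding y_def proj_def using clin_on_simps(3)[OF subspace K_lin, of "{..<k}" "\<lambda>j. scaleC (cinner x (b j)) (b j)"]
    by (simp add: sub(3) bS clin_onD(2)[OF K_lin])
  have ip: "cinner (K y) (K u) = (\<Sum>j<k. of_real ((\<sigma> j)\<^sup>2) * (cinner x (b j) * cinner (b j) u))" if "u \<in> S" for u
    unfolding Ky cinner_sum_left cinner_scaleC_left
  proof (rule sum.cong[OF refl])
    fix j assume "j \<in> {..<k}"
    then have "cinner (K (b j)) (K u) = of_real ((\<sigma> j)\<^sup>2) * cinner (b j) u" using adaptedD(6)[OF ad] K_e[OF that] by simp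
    then show "cinner x (b j) * cinner (K (b j)) (K u) = of_real ((\<sigma> j)\<^sup>2) * (cinner x (b j) * cinner (b j) u)" by simp
  qed
  have "cinner (b j) z = 0" if "j < k" for j
    using proj_residual_orth[OF on that, of x] by (simp add: z_def y_def) (metis cinner_commute complex_cnj_zero)
  then have 1: "cinner (K y) (K z) = 0" unfolding ip[OF zS] by simp
  have "cinner (b j) y = cinner (b j) x" if "j < k" for j
    using cinner_proj_basis[OF on that, of x] unfolding y_def by (metis cinner_commute)
  then have "cinner (K y) (K y) = of_real (\<Sum>j<k. (\<sigma> j)\<^sup>2 * (cmod (cinner x (b j)))\<^sup>2)"
    unfolding ip[OF yS] by (simp add: cinner_swap_mult)
  then have 2: "(norm (K y))\<^sup>2 = (\<Sum>j<k. (\<sigma> j)\<^sup>2 * (cmod (cinner x (b j)))\<^sup>2)"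
    unfolding Re_cinner_self[symmetric] by (simp only: Re_complex_of_real)
  have "norm (K z) \<le> \<sigma> n * norm z"
  proof (rule K_tail[OF zS])
    fix i assume i: "i < n"
    show "cinner z (e i) = 0"
    proof (cases "i < k")
      case True
      then show ?thesis using proj_residual_orth[OF on True, of x] adaptedD(6)[OF ad True] by (simp add: z_def y_def)
    next
      case False
      then show ?thesis using adaptedD(7)[OF ad, of i] i by simp
    qed
  qed
  then have 3: "(norm (K z))\<^sup>2 \<le> (\<sigma> n)\<^sup>2 * (norm z)\<^sup>2" unfolding power_mult_distrib[symmetric] by (rule power_mono) simp
  have "x = y + z" by (simp add: z_def)
  then have "K x = K y + K z" using clin_onD(1)[OF K_lin yS zS] by simp
  then have "(norm (K x))\<^sup>2 = (norm (K y))\<^sup>2 + (norm (K z))\<^sup>2" by (simp add: norm_sq_add 1)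
  then show ?thesis using 2 3 by (simp add: z_def y_def)
qed

text \<open>From order 2 on every basis is admissible: the squared norm of \<open>K (f i)\<close> is
  at most a weighted mean of the squared values on the adapted basis, Jensen's inequality raises it
  to the power \<open>2 ^ m\<close>, and the weights are doubly stochastic.\<close>

lemma schatten_sum_basis:
  assumes ad: "adapted n e v d b k" and sm: "summable (\<lambda>j. \<sigma> j ^ 2 ^ Suc m)"
    and f: "orthonormal d f" "proj d f = proj d b"
  shows "(\<Sum>i<d. norm (K (f i)) ^ 2 ^ Suc m) \<le> 2 * (\<Sum>j. \<sigma> j ^ 2 ^ Suc m)"
proof -
  note b = adaptedD(1)[OF ad]
  define \<tau> where "\<tau> j = (if j < k then \<sigma> j else \<sigma> n)\<^sup>2" for j
  have pw: "x ^ 2 ^ Suc m = (x\<^sup>2) ^ 2 ^ m" for x :: real by (simp add: power_mult[symmetric])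
  have \<tau>pw: "\<tau> j ^ 2 ^ m = (if j < k then \<sigma> j ^ 2 ^ Suc m else \<sigma> n ^ 2 ^ Suc m)" for j
    unfolding \<tau>_def pw[symmetric] by simp
  have one: "norm (K (f i)) ^ 2 ^ Suc m \<le> (\<Sum>j<d. (cmod (cinner (f i) (b j)))\<^sup>2 * \<tau> j ^ 2 ^ m)" if i: "i < d" for i
  proof -
    define wt where "wt j = (cmod (cinner (f i) (b j)))\<^sup>2" for j
    have fx: "proj d b (f i) = f i" using proj_basis[OF f(1) i] f(2) by simp
    have fS: "f i \<in> S" by (rule adapted_range[OF ad fx])
    have w1: "(\<Sum>j<d. wt j) = 1"
      using norm_proj_sq[OF b, of "f i"] orthonormal_norm[OF f(1) i] by (simp add: fx wt_def)
    have split: "(\<Sum>j<d. g j) = (\<Sum>j<k. g j) + (\<Sum>j=k..<d. g j)" for g :: "nat \<Rightarrow> real"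
      unfolding lessThan_atLeast0 by (rule sum.atLeastLessThan_concat[symmetric]) (use adaptedD(4)[OF ad] in auto)
    have on: "orthonormal k b" by (rule orthonormal_mono[OF b adaptedD(4)[OF ad]])
    have tail: "(norm (f i - proj k b (f i)))\<^sup>2 = (\<Sum>j=k..<d. wt j)"
      using proj_pythagoras[OF on, of "f i"] norm_proj_sq[OF on, of "f i"] w1 split[of wt] orthonormal_norm[OF f(1) i]
      by (simp add: wt_def)
    have "(norm (K (f i)))\<^sup>2 \<le> (\<Sum>j<k. (\<sigma> j)\<^sup>2 * wt j) + (\<sigma> n)\<^sup>2 * (\<Sum>j=k..<d. wt j)"
      using norm_K_sq_le[OF ad fS] unfolding tail wt_def .
    also have "\<dots> = (\<Sum>j<d. wt j * \<tau> j)"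
      unfolding split by (simp add: \<tau>_def sum_distrib_right mult.commute)
    finally have "((norm (K (f i)))\<^sup>2) ^ 2 ^ m \<le> (\<Sum>j<d. wt j * \<tau> j) ^ 2 ^ m" by (rule power_mono) simp
    also have "\<dots> \<le> (\<Sum>j<d. wt j * \<tau> j ^ 2 ^ m)"
      by (rule jensen_power) (use w1 in \<open>auto simp: wt_def \<tau>_def\<close>)
    finally show ?thesis unfolding pw wt_def .
  qed
  have col: "(\<Sum>i<d. (cmod (cinner (f i) (b j)))\<^sup>2) = 1" if j: "j < d" for j
  proof -
    have "cmod (cinner (f i) (b j)) = cmod (cinner (b j) (f i))" for i by (metis cinner_commute complex_mod_cnj)
    then have "(\<Sum>i<d. (cmod (cinner (f i) (b j)))\<^sup>2) = (norm (proj d f (b j)))\<^sup>2"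
      using norm_proj_sq[OF f(1), of "b j"] by simp
    then show ?thesis using proj_basis[OF b j] orthonormal_norm[OF b j] f(2) by simp
  qed
  have "(\<Sum>i<d. norm (K (f i)) ^ 2 ^ Suc m) \<le> (\<Sum>i<d. \<Sum>j<d. (cmod (cinner (f i) (b j)))\<^sup>2 * \<tau> j ^ 2 ^ m)"
    by (intro sum_mono one) auto
  also have "\<dots> = (\<Sum>j<d. \<Sum>i<d. (cmod (cinner (f i) (b j)))\<^sup>2 * \<tau> j ^ 2 ^ m)" by (rule sum.swap)
  also have "\<dots> = (\<Sum>j<d. if j < k then \<sigma> j ^ 2 ^ Suc m else \<sigma> n ^ 2 ^ Suc m)"
    unfolding \<tau>pw[symmetric] sum_distrib_right[symmetric] by (intro sum.cong refl) (simp add: col)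
  also have "\<dots> \<le> 2 * (\<Sum>j. \<sigma> j ^ 2 ^ Suc m)"
    using antimonoD[OF \<sigma>_anti] \<sigma>_nonneg adaptedD(3-5)[OF ad]
    by (intro sum_head_tail_le sm) (auto intro!: antimonoI power_mono simp del: power_Suc)
  finally show ?thesis .
qed

end

section \<open>From compressions to the compact operators\<close>

locale quasinilpotent_sum = singular_system +
  fixes H :: "'a \<Rightarrow> 'a" and v :: "nat \<Rightarrow> 'a" and \<mu> :: "nat \<Rightarrow> real"
  assumes H: "nonneg_op S H" and H_cpt: "sequentially_compact H" and K_cpt: "sequentially_compact K"
    and E: "eigensystem H v \<mu>"
    and H_tail: "\<And>n x. x \<in> S \<Longrightarrow> (\<And>i. i < n \<Longrightarrow> cinner x (v i) = 0) \<Longrightarrow> norm (H x) \<le> \<mu> n * norm x"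
    and no_eigenvalue: "\<And>z x. x \<in> S \<Longrightarrow> H x + K x = scaleC z x \<Longrightarrow> z \<noteq> 0 \<Longrightarrow> x = 0"
begin

lemmas H_lin = bounded_opD(1)[OF nonneg_opD(1)[OF H]]

text \<open>A vector orthogonal to the span is orthogonal to the first N of both systems, so H + K
  shrinks it by the factor \<open>\<mu> N + \<sigma> N\<close>, which tends to 0. This is the
  approximation required by \<open>compressed_eigenvalues_small\<close>.\<close>

lemma compression_exists:
  assumes \<epsilon>: "0 < \<epsilon>"
  shows "\<exists>N\<ge>n. \<exists>d b k. adapted N e v d b k \<and>
    (\<forall>a x. proj d b x = x \<longrightarrow> x \<noteq> 0 \<longrightarrow> proj d b (H x + K x) = scaleC a x \<longrightarrow> cmod a \<le> \<epsilon>)"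
proof -
  note vS = eigensystemD(2)[OF E]
  have "\<forall>N. \<exists>d b k. adapted N e v d b k" by (intro allI adapted_exists[OF os eS \<sigma>_anti e_iff] vS)
  then obtain d b k where ad: "\<And>N. adapted N e v (d N) (b N) (k N)" by metis
  let ?A = "\<lambda>x. H x + K x"
  have A: "bounded_op S ?A" by (rule bounded_op_add[OF nonneg_opD(1)[OF H] K])
  have "\<exists>N0. \<forall>N\<ge>N0. \<forall>a x. proj (d N) (b N) x = x \<longrightarrow> x \<noteq> 0 \<longrightarrow> proj (d N) (b N) (?A x) = scaleC a x \<longrightarrow> cmod a \<le> \<epsilon>"
  proof (rule compressed_eigenvalues_small[OF A sequentially_compact_add[OF H_cpt K_cpt] no_eigenvalue adaptedD(1)[OF ad] adaptedD(2)[OF ad] _ _ \<epsilon>])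
    fix N x assume x: "x \<in> S"
    let ?Q = "proj (d N) (b N)"
    note on = adaptedD(1)[OF ad[of N]]
    define z where "z = x - ?Q x"
    have zS: "z \<in> S" unfolding z_def by (intro sub x proj_in_csubspace subspace adaptedD(2)[OF ad])
    have Qz: "?Q z = 0" by (simp add: z_def proj_simps proj_idem[OF on])
    have orth: "cinner z u = 0" if "?Q u = u" for u
      using proj_selfadjoint[of "d N" "b N" z u] that Qz by simp
    have nz: "norm z \<le> norm x" 
    proof (rule power2_le_imp_le)
      show "(norm z)\<^sup>2 \<le> (norm x)\<^sup>2" using proj_pythagoras[OF on, of x] by (simp add: z_def)
    qed simp
    have "norm (H z + K z) \<le> norm (H z) + norm (K z)" by (rule norm_triangle_ineq)
    also have "\<dots> \<le> \<mu> N * norm z + \<sigma> N * norm z"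
      by (intro add_mono H_tail K_tail zS orth adaptedD(8,9)[OF ad])
    also have "\<dots> = (\<mu> N + \<sigma> N) * norm z" by (simp add: distrib_right)
    also have "\<dots> \<le> (\<mu> N + \<sigma> N) * norm x"
      using eigensystemD(4)[OF E, of N] \<sigma>_nonneg[of N] nz by (intro mult_left_mono) auto
    finally show "norm (H (x - ?Q x) + K (x - ?Q x)) \<le> (\<mu> N + \<sigma> N) * norm x" by (simp add: z_def)
  next
    show "(\<lambda>N. \<mu> N + \<sigma> N) \<longlonglongrightarrow> 0" using tendsto_add[OF eigensystemD(5)[OF E] \<sigma>_lim] by simp
  qed
  then obtain N0 where N0: "\<And>N a x. N \<ge> N0 \<Longrightarrow> proj (d N) (b N) x = x \<Longrightarrow> x \<noteq> 0 \<Longrightarrow> proj (d N) (b N) (?A x) = scaleC a x \<Longrightarrow> cmod a \<le> \<epsilon>"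
    by blast
  show ?thesis
    by (intro exI[of _ "max n N0"] conjI exI[of _ "d (max n N0)"] exI[of _ "b (max n N0)"] exI[of _ "k (max n N0)"] ad)
      (use N0[of "max n N0"] in auto)
qed

lemma clin_compose_proj:
  assumes "clin_on S T" "\<And>i. i < d \<Longrightarrow> b i \<in> S"
  shows "clin (\<lambda>x. T (proj d b x))"
proof -
  have pS: "proj d b x \<in> S" for x by (intro proj_in_csubspace subspace assms(2))
  show ?thesis by (rule clinI) (simp_all add: proj_simps clin_onD[OF assms(1)] pS)
qed

lemma orthonormal_eigenvectors:
  assumes "0 < \<mu> n"
  shows "orthonormal (Suc n) v"
proof -
  have "v i \<noteq> 0" if "i < Suc n" for i
    using antimonoD[OF eigensystemD(3)[OF E], of i n] eigensystemD(6)[OF E, of i] assms that by simp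
  then show ?thesis using eigensystemD(1)[OF E] by (auto simp: orthonormal_def orthosystem_def)
qed

text \<open>The threshold is the eigenvalue \<open>\<mu> n\<close> itself, above which there are at
  least n + 1 eigenvectors inside a sufficiently large compression. The bound does not depend on the
  dimension of that compression.\<close>

lemma count_bound:
  assumes q: "1/2 < q" "q < 1" and sm: "summable (\<lambda>j. \<sigma> j powr q)"
  shows "\<exists>C. \<forall>n. 0 < \<mu> n \<longrightarrow> real (Suc n) * \<mu> n powr q \<le> C"
proof -
  obtain C where C: "C \<ge> 0" "\<forall>d n b v \<mu> t S. \<forall>H K :: 'a \<Rightarrow> 'a.
     orthonormal d b \<longrightarrow> clin H \<longrightarrow> clin K \<longrightarrow>
     (\<forall>x y. proj d b x = x \<longrightarrow> proj d b y = y \<longrightarrow> cinner (H x) y = cinner x (H y)) \<longrightarrow>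
     (\<forall>x. proj d b x = x \<longrightarrow> 0 \<le> Re (cinner (H x) x)) \<longrightarrow>
     (\<forall>a x. proj d b x = x \<longrightarrow> x \<noteq> 0 \<longrightarrow> proj d b (H x + K x) = scaleC a x \<longrightarrow> cmod a \<le> t / 8) \<longrightarrow>
     0 < t \<longrightarrow> orthonormal n v \<longrightarrow>
     (\<forall>i<n. proj d b (v i) = v i \<and> H (v i) = scaleC (of_real (\<mu> i)) (v i) \<and> t \<le> \<mu> i) \<longrightarrow>
     (\<Sum>j<d. norm (K (b j)) powr q) \<le> S \<longrightarrow>
     real n \<le> C * t powr (- q) * S"
    using quasinilpotent_count_bound[where 'a = 'a, OF q] by (elim exE conjE)
  have "real (Suc n) * \<mu> n powr q \<le> C * (2 * (\<Sum>j. \<sigma> j powr q))" if \<mu>: "0 < \<mu> n" for n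
  proof -
    obtain N d b k where N: "Suc n \<le> N" and ad: "adapted N e v d b k"
      and small: "\<forall>a x. proj d b x = x \<longrightarrow> x \<noteq> 0 \<longrightarrow> proj d b (H x + K x) = scaleC a x \<longrightarrow> cmod a \<le> \<mu> n / 8"
      using compression_exists[of "\<mu> n / 8" "Suc n"] \<mu> by auto
    note on = adaptedD(1)[OF ad] and bS = adaptedD(2)[OF ad]
    note inS = adapted_range[OF ad]
    have pv: "proj d b (v i) = v i" if "i < Suc n" for i using adaptedD(9)[OF ad, of i] that N by simp
    have "real (Suc n) \<le> C * \<mu> n powr (- q) * (2 * (\<Sum>j. \<sigma> j powr q))"
    proof (rule C(2)[rule_format, OF on clin_compose_proj[OF H_lin bS] clin_compose_proj[OF K_lin bS]])
      show "cinner (H (proj d b x)) y = cinner x (H (proj d b y))" if "proj d b x = x" "proj d b y = y" for x y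
        using nonneg_opD(2)[OF H inS[OF that(1)] inS[OF that(2)]] that by simp
      show "0 \<le> Re (cinner (H (proj d b x)) x)" if "proj d b x = x" for x
        using nonneg_opD(3)[OF H inS[OF that]] that by simp
      show "cmod a \<le> \<mu> n / 8" if "proj d b x = x" "x \<noteq> 0" "proj d b (H (proj d b x) + K (proj d b x)) = scaleC a x" for a x
        using small that by simp
      show "0 < \<mu> n" by fact
      show "orthonormal (Suc n) v" by (rule orthonormal_eigenvectors[OF \<mu>])
      show "proj d b (v i) = v i \<and> H (proj d b (v i)) = scaleC (of_real (\<mu> i)) (v i) \<and> \<mu> n \<le> \<mu> i" if "i < Suc n" for i
        using pv[OF that] eigensystemD(7)[OF E, of i] antimonoD[OF eigensystemD(3)[OF E], of i n] that by simp
      have "(\<Sum>j<d. norm (K (proj d b (b j))) powr q) = (\<Sum>j<d. norm (K (b j)) powr q)"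
        by (intro sum.cong refl) (simp add: proj_basis[OF on])
      then show "(\<Sum>j<d. norm (K (proj d b (b j))) powr q) \<le> 2 * (\<Sum>j. \<sigma> j powr q)"
        using schatten_sum_adapted[OF ad _ sm] q by simp
    qed
    then have "real (Suc n) * \<mu> n powr q \<le> C * \<mu> n powr (- q) * (2 * (\<Sum>j. \<sigma> j powr q)) * \<mu> n powr q"
      by (rule mult_right_mono) simp
    also have "\<dots> = C * (2 * (\<Sum>j. \<sigma> j powr q)) * (\<mu> n powr (- q) * \<mu> n powr q)" by (simp only: mult_ac)
    also have "\<mu> n powr (- q) * \<mu> n powr q = 1" using \<mu> by (simp add: powr_add[symmetric])
    finally show ?thesis by simp
  qed
  then show ?thesis by blast
qed

lemma trace_bound:
  assumes sm: "summable (\<lambda>j. \<sigma> j ^ 2 ^ Suc m)"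
  shows "\<exists>C. \<forall>n. 0 < \<mu> n \<longrightarrow> real (Suc n) * \<mu> n ^ 2 ^ Suc m \<le> C"
proof -
  obtain C where C: "C \<ge> 0" "\<forall>d n b v \<epsilon> t S. \<forall>H K :: 'a \<Rightarrow> 'a.
     orthonormal d b \<longrightarrow> clin H \<longrightarrow> clin K \<longrightarrow>
     (\<forall>x y. proj d b x = x \<longrightarrow> proj d b y = y \<longrightarrow> cinner (H x) y = cinner x (H y)) \<longrightarrow>
     (\<forall>a x. proj d b x = x \<longrightarrow> x \<noteq> 0 \<longrightarrow> proj d b (H x + K x) = scaleC a x \<longrightarrow> cmod a \<le> \<epsilon>) \<longrightarrow>
     orthonormal n v \<longrightarrow> (\<forall>i<n. proj d b (v i) = v i \<and> t \<le> Re (cinner (H (v i)) (v i))) \<longrightarrow> \<epsilon> \<le> t \<longrightarrow>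
     (\<forall>f. orthonormal d f \<longrightarrow> proj d f = proj d b \<longrightarrow> (\<Sum>i<d. norm (K (f i)) ^ 2 ^ Suc m) \<le> S) \<longrightarrow>
     real n * (t - \<epsilon>) ^ 2 ^ Suc m \<le> C * S"
    using quasinilpotent_trace_bound[where 'a = 'a, of m] by (elim exE conjE)
  define B where "B = C * (2 * (\<Sum>j. \<sigma> j ^ 2 ^ Suc m))"
  have eps: "real (Suc n) * (\<mu> n - \<epsilon>) ^ 2 ^ Suc m \<le> B" if \<mu>: "0 < \<mu> n" and \<epsilon>: "0 < \<epsilon>" "\<epsilon> \<le> \<mu> n" for n \<epsilon>
  proof -
    obtain N d b k where N: "Suc n \<le> N" and ad: "adapted N e v d b k"
      and small: "\<forall>a x. proj d b x = x \<longrightarrow> x \<noteq> 0 \<longrightarrow> proj d b (H x + K x) = scaleC a x \<longrightarrow> cmod a \<le> \<epsilon>"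
      using compression_exists[OF \<epsilon>(1), of "Suc n"] by auto
    note on = adaptedD(1)[OF ad] and bS = adaptedD(2)[OF ad]
    note inS = adapted_range[OF ad]
    have pv: "proj d b (v i) = v i" if "i < Suc n" for i using adaptedD(9)[OF ad, of i] that N by simp
    show ?thesis
      unfolding B_def
    proof (rule C(2)[rule_format, OF on clin_compose_proj[OF H_lin bS] clin_compose_proj[OF K_lin bS]])
      show "cinner (H (proj d b x)) y = cinner x (H (proj d b y))" if "proj d b x = x" "proj d b y = y" for x y
        using nonneg_opD(2)[OF H inS[OF that(1)] inS[OF that(2)]] that by simp
      show "cmod a \<le> \<epsilon>" if "proj d b x = x" "x \<noteq> 0" "proj d b (H (proj d b x) + K (proj d b x)) = scaleC a x" for a x
        using small that by simp
      show "\<epsilon> \<le> \<mu> n" by fact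
      show ov: "orthonormal (Suc n) v" by (rule orthonormal_eigenvectors[OF \<mu>])
      show "proj d b (v i) = v i \<and> \<mu> n \<le> Re (cinner (H (proj d b (v i))) (v i))" if "i < Suc n" for i
        using pv[OF that] eigensystemD(7)[OF E, of i] antimonoD[OF eigensystemD(3)[OF E], of i n] that
          orthonormal_norm[OF ov that] by (simp add: cinner_scaleC_left cinner_self)
      show "(\<Sum>i<d. norm (K (proj d b (f i))) ^ 2 ^ Suc m) \<le> 2 * (\<Sum>j. \<sigma> j ^ 2 ^ Suc m)"
        if f: "orthonormal d f" "proj d f = proj d b" for f
      proof -
        have "(\<Sum>i<d. norm (K (proj d b (f i))) ^ 2 ^ Suc m) = (\<Sum>i<d. norm (K (f i)) ^ 2 ^ Suc m)"
          by (intro sum.cong refl) (simp add: proj_basis[OF f(1)] flip: f(2))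
        then show ?thesis using schatten_sum_basis[OF ad sm f] by simp
      qed
    qed
  qed
  have "real (Suc n) * \<mu> n ^ 2 ^ Suc m \<le> B" if \<mu>: "0 < \<mu> n" for n
  proof (rule LIMSEQ_le_const2)
    have "(\<lambda>k. 1 / real (Suc k)) \<longlonglongrightarrow> 0" by (rule LIMSEQ_Suc[OF lim_1_over_n])
    then have "(\<lambda>k. real (Suc n) * (\<mu> n - \<mu> n * (1 / real (Suc k))) ^ 2 ^ Suc m) \<longlonglongrightarrow> real (Suc n) * (\<mu> n - \<mu> n * 0) ^ 2 ^ Suc m"
      by (intro tendsto_intros)
    then show "(\<lambda>k. real (Suc n) * (\<mu> n - \<mu> n * (1 / real (Suc k))) ^ 2 ^ Suc m) \<longlonglongrightarrow> real (Suc n) * \<mu> n ^ 2 ^ Suc m" by simp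
    show "\<exists>N. \<forall>k\<ge>N. real (Suc n) * (\<mu> n - \<mu> n * (1 / real (Suc k))) ^ 2 ^ Suc m \<le> B"
    proof (intro exI allI impI eps[OF \<mu>])
      fix k
      show "0 < \<mu> n * (1 / real (Suc k))" using \<mu> by simp
      have "\<mu> n * (1 / real (Suc k)) \<le> \<mu> n * 1" using \<mu> by (intro mult_left_mono) auto
      then show "\<mu> n * (1 / real (Suc k)) \<le> \<mu> n" by simp
    qed
  qed
  then show ?thesis by blast
qed

end

section \<open>Asymptotics of s-numbers\<close>

lemma (in hilbert_space) singular_bounds:
  assumes H: "nonneg_op S H" and cH: "compact_op S H" and cK: "compact_op S K"
    and noev: "\<And>z x. x \<in> S \<Longrightarrow> H x + K x = scaleC z x \<Longrightarrow> z \<noteq> 0 \<Longrightarrow> x = 0"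
  shows "1/2 < q \<Longrightarrow> q < 1 \<Longrightarrow> K \<in> schatten_class q S \<Longrightarrow>
      \<exists>C. \<forall>n>0. 0 < s_number S H n \<longrightarrow> real n * s_number S H n powr q \<le> C"
    and "0 < q \<Longrightarrow> K \<in> schatten_class q S \<Longrightarrow>
      \<exists>p>0. \<exists>C. \<forall>n>0. 0 < s_number S H n \<longrightarrow> real n * s_number S H n powr p \<le> C"
proof -
  obtain v \<mu> where E: "eigensystem H v \<mu>" and sH: "\<And>n. s_number S H n = \<mu> (n - 1)"
    and Ht: "\<And>n x. x \<in> S \<Longrightarrow> (\<And>i. i < n \<Longrightarrow> cinner x (v i) = 0) \<Longrightarrow> norm (H x) \<le> \<mu> n * norm x"
    using compact_nonneg_structure[OF H cH] by metis
  obtain e \<sigma> where e: "orthosystem e" "\<And>i. e i \<in> S" "antimono \<sigma>" "\<And>i. 0 \<le> \<sigma> i" "\<sigma> \<longlonglongrightarrow> 0"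
    "\<And>i. e i \<noteq> 0 \<longleftrightarrow> 0 < \<sigma> i" and sK: "\<And>n. s_number S K n = \<sigma> (n - 1)"
    and ke: "\<And>i x. x \<in> S \<Longrightarrow> cinner (K (e i)) (K x) = of_real ((\<sigma> i)\<^sup>2) * cinner (e i) x"
    "\<And>n x. x \<in> S \<Longrightarrow> (\<And>i. i < n \<Longrightarrow> cinner x (e i) = 0) \<Longrightarrow> norm (K x) \<le> \<sigma> n * norm x"
    using compact_op_structure[OF cK] by metis
  have sm: "summable (\<lambda>j. \<sigma> j powr q)" if "K \<in> schatten_class q S" for q
  proof -
    have "summable (\<lambda>j. s_number S K (Suc j) powr q)" using that unfolding schatten_class_def by blast
    moreover have "s_number S K (Suc j) = \<sigma> j" for j using sK[of "Suc j"] unfolding diff_Suc_1 .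
    ultimately show ?thesis by (simp only:)
  qed
  have bK: "bounded_op S K" using cK by (simp add: compact_op_def)
  interpret quasinilpotent_sum S K e \<sigma> H v \<mu>
  proof unfold_locales
    show "bounded_op S K" by (rule bK)
    show "orthosystem e" by (rule e(1))
    show "e i \<in> S" for i by (rule e(2))
    show "antimono \<sigma>" by (rule e(3))
    show "0 \<le> \<sigma> i" for i by (rule e(4))
    show "\<sigma> \<longlonglongrightarrow> 0" by (rule e(5))
    show "e i \<noteq> 0 \<longleftrightarrow> 0 < \<sigma> i" for i by (rule e(6))
    show "cinner (K (e i)) (K x) = of_real ((\<sigma> i)\<^sup>2) * cinner (e i) x" if "x \<in> S" for i x by (rule ke(1)[OF that])
    show "norm (K x) \<le> \<sigma> n * norm x" if "x \<in> S" "\<And>i. i < n \<Longrightarrow> cinner x (e i) = 0" for n x by (rule ke(2)[OF that])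
    show "nonneg_op S H" by (rule H)
    show "sequentially_compact H" "sequentially_compact K" by (rule compact_op_sequentially_compact cH cK)+
    show "eigensystem H v \<mu>" by (rule E)
    show "norm (H x) \<le> \<mu> n * norm x" if "x \<in> S" "\<And>i. i < n \<Longrightarrow> cinner x (v i) = 0" for n x by (rule Ht[OF that])
    show "x = 0" if "x \<in> S" "H x + K x = scaleC z x" "z \<noteq> 0" for z x by (rule noev[OF that])
  qed
  \<comment> \<open>s-numbers are indexed from 1, the eigenvalues \<open>\<mu>\<close> from
    0.\<close>
  have idx: "\<exists>C. \<forall>n>0. 0 < s_number S H n \<longrightarrow> real n * f (s_number S H n) \<le> C"
    if C: "\<exists>C. \<forall>n. 0 < \<mu> n \<longrightarrow> real (Suc n) * f (\<mu> n) \<le> C" for f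
  proof -
    obtain C where C: "\<And>n. 0 < \<mu> n \<Longrightarrow> real (Suc n) * f (\<mu> n) \<le> C" using C by blast
    have "real n * f (s_number S H n) \<le> C" if "0 < n" "0 < s_number S H n" for n
      using C[of "n - 1"] that sH[of n] by simp
    then show ?thesis by blast
  qed
  show "\<exists>C. \<forall>n>0. 0 < s_number S H n \<longrightarrow> real n * s_number S H n powr q \<le> C"
    if q: "1/2 < q" "q < 1" and Kq: "K \<in> schatten_class q S"
  proof (rule idx[of "\<lambda>t. t powr q"])
    have "summable (\<lambda>j. \<sigma> j powr q)" by (rule sm[OF Kq])
    then show "\<exists>C. \<forall>n. 0 < \<mu> n \<longrightarrow> real (Suc n) * \<mu> n powr q \<le> C" by (rule count_bound[OF q])
  qed
  show "\<exists>p>0. \<exists>C. \<forall>n>0. 0 < s_number S H n \<longrightarrow> real n * s_number S H n powr p \<le> C"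
    if q: "0 < q" and Kq: "K \<in> schatten_class q S"
  proof -
    \<comment> \<open>A power of two at least \<open>q\<close>; Schatten classes grow with the
      order, because the singular values are eventually below 1.\<close>
    obtain m where "q < 2 ^ m" using real_arch_pow[of 2 q] by auto
    then have m: "q \<le> 2 ^ Suc m" by (rule order_trans[OF less_imp_le]) simp
    define p where "p = (2::nat) ^ Suc m"
    have p: "q \<le> real p" "0 < p" using m by (simp_all add: p_def)
    have "summable (\<lambda>j. \<sigma> j ^ p)"
    proof (rule summable_comparison_test_ev[OF _ sm[OF Kq]])
      have "\<forall>\<^sub>F j in sequentially. \<sigma> j < 1" by (rule order_tendstoD(2)[OF e(5)]) simp
      then show "\<forall>\<^sub>F j in sequentially. norm (\<sigma> j ^ p) \<le> \<sigma> j powr q"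
      proof eventually_elim
        case (elim j)
        show "norm (\<sigma> j ^ p) \<le> \<sigma> j powr q"
        proof (cases "\<sigma> j = 0")
          case False
          then have pos: "0 < \<sigma> j" using e(4)[of j] by simp
          have "\<sigma> j powr real p \<le> \<sigma> j powr q" using elim pos p(1) by (intro powr_mono') auto
          then show ?thesis using pos by (simp add: powr_realpow)
        qed (use p in \<open>simp add: zero_power\<close>)
      qed
    qed
    then have tb: "\<exists>C. \<forall>n. 0 < \<mu> n \<longrightarrow> real (Suc n) * \<mu> n ^ p \<le> C" unfolding p_def by (rule trace_bound)
    then obtain C where "\<forall>n>0. 0 < s_number S H n \<longrightarrow> real n * s_number S H n ^ p \<le> C"
      using idx[of "\<lambda>t. t ^ p", OF tb] by blast
    then show ?thesis using p(2) by (intro exI[of _ "real p"] conjI exI[of _ C]) (auto simp: powr_realpow)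
  qed
qed

text \<open>Inserting the lower bound gives c powr q * n powr (1 - \<beta> q) \<le> C for all large
  n, with a positive exponent.\<close>

lemma power_lower_bound_contradiction:
  fixes s :: "nat \<Rightarrow> real"
  assumes bound: "\<And>n. 0 < n \<Longrightarrow> 0 < s n \<Longrightarrow> real n * s n powr q \<le> C"
    and low: "\<forall>\<^sub>F n in sequentially. c * real n powr (-\<beta>) \<le> s n"
    and c: "0 < c" and q: "0 < q" and \<beta>: "\<beta> * q < 1"
  shows False
proof -
  define \<gamma> where "\<gamma> = 1 - \<beta> * q"
  have \<gamma>: "0 < \<gamma>" using \<beta> by (simp add: \<gamma>_def)
  have "\<forall>\<^sub>F n in sequentially. c powr q * real n powr \<gamma> \<le> C"
    using low eventually_gt_at_top[of 0]
  proof eventually_elim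
    case (elim n)
    have pos: "0 < c * real n powr (-\<beta>)" using c elim(2) by simp
    have "real n * (c * real n powr (-\<beta>)) powr q \<le> real n * s n powr q"
      using pos elim q by (intro mult_left_mono powr_mono2) auto
    also have "\<dots> \<le> C" using elim pos by (intro bound) auto
    also have "real n * (c * real n powr (-\<beta>)) powr q = c powr q * (real n * real n powr (- \<beta> * q))"
      using c elim(2) by (simp add: powr_mult powr_powr)
    also have "real n * real n powr (- \<beta> * q) = real n powr \<gamma>"
      using elim(2) powr_add[of "real n" 1 "- \<beta> * q"] by (simp add: \<gamma>_def)
    finally show ?case .
  qed
  moreover have "filterlim (\<lambda>n. c powr q * real n powr \<gamma>) at_top sequentially"
    using c \<gamma> by real_asymp
  then have "\<forall>\<^sub>F n in sequentially. C < c powr q * real n powr \<gamma>" by (simp add: filterlim_at_top_dense)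
  ultimately have "\<forall>\<^sub>F n in sequentially. False" by eventually_elim linarith
  then show False by simp
qed

text \<open>The function ln (l x) + \<eta> ln x has derivative (x l'(x) / l x + \<eta>) / x, which
  is eventually positive; so l x * x powr \<eta> is eventually non-decreasing.\<close>

lemma slowly_varying_lower_bound:
  assumes l: "slowly_varying l" and \<eta>: "0 < \<eta>"
  obtains c where "0 < c" "\<forall>\<^sub>F x in at_top. c * x powr (-\<eta>) \<le> l x"
proof -
  obtain b l' where b: "0 < b" and pos: "\<And>x. b \<le> x \<Longrightarrow> 0 < l x"
    and der: "\<And>x. b \<le> x \<Longrightarrow> (l has_real_derivative l' x) (at x within {b..})"
    and lim: "((\<lambda>x. x * l' x / l x) \<longlongrightarrow> 0) at_top"
    using l unfolding slowly_varying_def by blast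
  have "\<forall>\<^sub>F x in at_top. - \<eta> < x * l' x / l x" by (rule order_tendstoD(1)[OF lim]) (use \<eta> in simp)
  then obtain x1 where x1: "\<And>x. x1 \<le> x \<Longrightarrow> - \<eta> < x * l' x / l x" unfolding eventually_at_top_linorder by blast
  \<comment> \<open>Starting at \<open>b + 1\<close> keeps away from the endpoint \<open>b\<close>,
    where the derivative is only one-sided.\<close>
  define x0 where "x0 = max x1 (b + 1)"
  have x0: "x1 \<le> x0" "b < x0" "0 < x0" using b by (auto simp: x0_def)
  have mono: "ln (l x0) + \<eta> * ln x0 \<le> ln (l x) + \<eta> * ln x" if x: "x0 \<le> x" for x
  proof (rule DERIV_nonneg_imp_nondecreasing[OF x])
    fix y assume y: "x0 \<le> y" "y \<le> x"
    have yb: "b < y" "0 < y" using x0 y by auto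
    have ly: "0 < l y" using pos yb by simp
    have "(l has_real_derivative l' y) (at y within {b<..})"
      by (rule DERIV_subset[OF der]) (use yb in auto)
    then have "(l has_real_derivative l' y) (at y)" using yb by (simp add: at_within_open[OF _ open_greaterThan])
    then have "((\<lambda>x. ln (l x) + \<eta> * ln x) has_real_derivative l' y / l y + \<eta> / y) (at y)"
      using ly yb by (auto intro!: derivative_eq_intros simp: divide_inverse)
    moreover have "0 \<le> (y * l' y / l y + \<eta>) / y" using x1[of y] x0 y yb by (intro divide_nonneg_pos) auto
    then have "0 \<le> l' y / l y + \<eta> / y" using yb by (simp add: add_divide_distrib)
    ultimately show "\<exists>d. ((\<lambda>x. ln (l x) + \<eta> * ln x) has_real_derivative d) (at y) \<and> 0 \<le> d" by blast
  qed
  define c where "c = l x0 * x0 powr \<eta>"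
  have "c * x powr (-\<eta>) \<le> l x" if x: "x0 \<le> x" for x
  proof -
    have lx: "0 < l x" "0 < l x0" "0 < x" using pos x x0 by auto
    have "ln c \<le> ln (l x * x powr \<eta>)"
      using mono[OF x] lx x0 by (simp add: c_def ln_mult ln_powr)
    then have "c \<le> l x * x powr \<eta>" using lx x0 by (simp add: c_def)
    then have "c * x powr (-\<eta>) \<le> l x * x powr \<eta> * x powr (-\<eta>)" by (rule mult_right_mono) simp
    also have "\<dots> = l x" using lx by (simp add: mult.assoc flip: powr_add)
    finally show ?thesis .
  qed
  then have "\<forall>\<^sub>F x in at_top. c * x powr (-\<eta>) \<le> l x" unfolding eventually_at_top_linorder by blast
  moreover have "0 < c" using pos x0 by (simp add: c_def)
  ultimately show ?thesis using that by blast
qed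

theorem corollary3p5:
  fixes \<Omega> :: "(real ^ 'm) set"
    and L L\<^sub>K :: "((real ^ 'm) l2 \<times> (real ^ 'm) l2) set"
    and K :: "(real ^ 'm) l2 \<Rightarrow> (real ^ 'm) l2"
  assumes domain: "bounded_smooth_domain \<Omega>"
    and L: "well_defined_restriction (L2_on \<Omega>) (maximal_laplace \<Omega>) L"
    and L_nonneg: "nonneg_op (L2_on \<Omega>) (inverse_op L)"
    and L_compact: "compact_op (L2_on \<Omega>) (inverse_op L)"
    and K_bounded: "bounded_op (L2_on \<Omega>) K"
    and K_range: "K ` L2_on \<Omega> \<subseteq> op_kernel (maximal_laplace \<Omega>)"
    and L\<^sub>K: "well_defined_restriction (L2_on \<Omega>) (maximal_laplace \<Omega>) L\<^sub>K"
    and L\<^sub>K_inverse: "\<forall>f\<in>L2_on \<Omega>. inverse_op L\<^sub>K f = inverse_op L f + K f"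
    and conditions:
      "(filterlim (\<lambda>n. (real n)\<^sup>2 * s_number (L2_on \<Omega>) (inverse_op L) n) at_top sequentially \<and>
        (\<exists>\<alpha> a. 0 < \<alpha> \<and> \<alpha> < 2 \<and> 0 < a \<and>
           (\<lambda>n. real n powr \<alpha> * s_number (L2_on \<Omega>) (inverse_op L) n) \<longlonglongrightarrow> a \<and>
           (\<forall>q. 0 < q \<and> q \<le> 1 / \<alpha> \<longrightarrow> K \<in> schatten_class q (L2_on \<Omega>))))
       \<or>
       (\<exists>l a. slowly_varying l \<and> 0 < a \<and>
           (\<lambda>n. 1 / l (real n) * s_number (L2_on \<Omega>) (inverse_op L) n) \<longlonglongrightarrow> a \<and>
           (\<exists>q>0. K \<in> schatten_class q (L2_on \<Omega>)))"
  shows "\<not> volterra_op (L2_on \<Omega>) (adjoint_op (L2_on \<Omega>) (inverse_op L\<^sub>K))"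
proof
  assume volterra: "volterra_op (L2_on \<Omega>) (adjoint_op (L2_on \<Omega>) (inverse_op L\<^sub>K))"
  let ?S = "L2_on \<Omega>" and ?H = "inverse_op L"
  let ?s = "s_number ?S ?H"
  interpret hilbert_space ?S by (rule hilbert_space_L2_on)
  have "bounded_op ?S (\<lambda>f. ?H f + K f)" by (rule bounded_op_add[OF nonneg_opD(1)[OF L_nonneg] K_bounded])
  then have bLK: "bounded_op ?S (inverse_op L\<^sub>K)"
    using L\<^sub>K_inverse sub(2,3) unfolding bounded_op_def by (simp add: image_subset_iff)
  \<comment> \<open>The Volterra assumption concerns the adjoint; it is passed to H + K as the
    absence of nonzero eigenvalues, the only form in which it is used.\<close>
  have noev: "x = 0" if "x \<in> ?S" "?H x + K x = scaleC z x" "z \<noteq> 0" for x z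
    by (rule quasinilpotent_adjoint_no_eigenvalue[OF bLK _ that(1) _ that(3)])
      (use volterra L\<^sub>K_inverse that in \<open>auto simp: volterra_op_def\<close>)
  from conditions show False
  proof (elim disjE conjE exE)
    fix \<alpha> a
    assume \<alpha>: "0 < \<alpha>" "\<alpha> < 2" and a: "0 < a" and lim: "(\<lambda>n. real n powr \<alpha> * ?s n) \<longlonglongrightarrow> a"
      and Kq: "\<forall>q. 0 < q \<and> q \<le> 1 / \<alpha> \<longrightarrow> K \<in> schatten_class q ?S"
    \<comment> \<open>The midpoint between 1/2 and the smaller of 1 and 1 / \<alpha>. The interval
      is non-empty as \<alpha> < 2; \<open>q < 1 / \<alpha>\<close> puts \<open>K\<close> into the
      class of order \<open>q\<close> and makes \<alpha> q < 1.\<close>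
    define q where "q = (1/2 + min 1 (1 / \<alpha>)) / 2"
    have "1/2 < 1 / \<alpha>" using \<alpha> by (simp add: field_simps)
    then have q: "1/2 < q" "q < 1" "q < 1 / \<alpha>" by (auto simp: q_def min_def)
    have Kq: "K \<in> schatten_class q ?S" using Kq q by simp
    then have cK: "compact_op ?S K" by (simp add: schatten_class_def)
    obtain C where C: "\<forall>n>0. 0 < ?s n \<longrightarrow> real n * ?s n powr q \<le> C"
      using singular_bounds(1)[OF L_nonneg L_compact cK _ q(1,2) Kq] noev by blast
    have "\<forall>\<^sub>F n in sequentially. a / 2 < real n powr \<alpha> * ?s n" by (rule order_tendstoD(1)[OF lim]) (use a in simp)
    then have low: "\<forall>\<^sub>F n in sequentially. a / 2 * real n powr (-\<alpha>) \<le> ?s n"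
      using eventually_gt_at_top[of 0]
    proof eventually_elim
      case (elim n)
      have "a / 2 * real n powr (-\<alpha>) \<le> real n powr \<alpha> * ?s n * real n powr (-\<alpha>)"
        using elim(1) by (intro mult_right_mono) auto
      also have "\<dots> = ?s n * (real n powr \<alpha> * real n powr (-\<alpha>))" by (simp only: mult_ac)
      also have "real n powr \<alpha> * real n powr (-\<alpha>) = 1" using elim(2) by (simp flip: powr_add)
      finally show ?case by simp
    qed
    show False
      by (rule power_lower_bound_contradiction[where q = q and C = C, OF _ low])
        (use C a q \<alpha> in \<open>auto simp: field_simps\<close>)
  next
    fix l a q
    assume l: "slowly_varying l" and a: "0 < a" and lim: "(\<lambda>n. 1 / l (real n) * ?s n) \<longlonglongrightarrow> a"
      and q: "0 < q" and Kq: "K \<in> schatten_class q ?S"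
    have cK: "compact_op ?S K" using Kq by (simp add: schatten_class_def)
    obtain p C where p: "0 < p" and C: "\<forall>n>0. 0 < ?s n \<longrightarrow> real n * ?s n powr p \<le> C"
      using singular_bounds(2)[OF L_nonneg L_compact cK _ q Kq] noev by blast
    \<comment> \<open>With this exponent of decay the product with \<open>p\<close> is 1/2, below
      the critical value 1.\<close>
    have "0 < 1 / (2 * p)" using p by simp
    then obtain c where c: "0 < c" "\<forall>\<^sub>F x in at_top. c * x powr (- (1 / (2 * p))) \<le> l x"
      by (rule slowly_varying_lower_bound[OF l])
    have lc: "\<forall>\<^sub>F n in sequentially. c * real n powr (- (1 / (2 * p))) \<le> l (real n)"
      using eventually_compose_filterlim[OF c(2) filterlim_real_sequentially] .
    have "\<forall>\<^sub>F n in sequentially. a / 2 < 1 / l (real n) * ?s n" by (rule order_tendstoD(1)[OF lim]) (use a in simp)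
    then have low: "\<forall>\<^sub>F n in sequentially. a / 2 * c * real n powr (- (1 / (2 * p))) \<le> ?s n"
      using lc eventually_gt_at_top[of 0]
    proof eventually_elim
      case (elim n)
      have "0 < c * real n powr (- (1 / (2 * p)))" using c(1) elim(3) by simp
      then have lpos: "0 < l (real n)" using elim(2) by linarith
      have "a / 2 * (c * real n powr (- (1 / (2 * p)))) \<le> a / 2 * l (real n)"
        using a by (intro mult_left_mono elim(2)) simp
      also have "\<dots> \<le> 1 / l (real n) * ?s n * l (real n)" using elim(1) lpos by (intro mult_right_mono) auto
      also have "\<dots> = ?s n" using lpos by simp
      finally show ?case by (simp only: mult.assoc)
    qed
    show False
      by (rule power_lower_bound_contradiction[where q = p and C = C, OF _ low])
        (use C a c(1) p in auto)
  qed
qed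

end
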